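(* There exist constants $c_p>0$ (depending only on $p$, entering the definition of $r_{p,k}$) and $c_k>0$ (depending only on $k$) such that the following holds. Let $(\mu^{(1)},\mu^{(2)})$ be a pair of probability measures on $\mathbb{R}^d$ satisfying the spiked transport model with a spike of dimension $k$. For any $p\in[1,2]$, if $\mu^{(1)}$ and $\mu^{(2)}$ satisfy the $T_p(\sigma^2)$ transport inequality, then the estimator $\hat W_{p,k}=\tilde W_{p,k}(\mu^{(1)}_n,\mu^{(2)}_n)$ satisfies $$\mathbb{E}\,\bigl|\hat W_{p,k}-W_p(\mu^{(1)},\mu^{(2)})\bigr|\;\le\; c_k\cdot\sigma\Bigl(r_{p,k}(n)+\sqrt{\tfrac{d\log n}{n}}\Bigr).$$
   Context: $W_p$ is the $p$-Wasserstein distance on $\mathbb{R}^d$ (or $\mathbb{R}^k$) for the Euclidean norm. Spiked transport model: $(\mu^{(1)},\mu^{(2)})$ satisfies it with spike $\mathcal U$ if $\mathcal{U}\subseteq\mathbb{R}^d$ is a linear subspace of dimension $k$, $X^{(1)},X^{(2)}$ are random variables taking values in $\mathcal U$ (with arbitrary distributions), $Z$ is a random variable independent of $(X^{(1)},X^{(2)})$ taking values in the orthogonal complement $\mathcal U^\perp$, and $\mu^{(i)}=\mathrm{Law}(X^{(i)}+Z)$ for $i=1,2$. $T_p(\sigma^2)$ (with $\sigma>0$): a probability measure $\mu$ on $\mathbb{R}^d$ with finite $p$-th moment satisfies $T_p(\sigma^2)$ if $W_p(\nu,\mu)\le\sqrt{2\sigma^2 D(\nu\|\mu)}$ for all probability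 measures $\nu$ on $\mathbb{R}^d$ with finite $p$-th moment, where $D$ is the Kullback–Leibler divergence. $\mathcal V_k(\mathbb{R}^d)$ is the set of $k\times d$ real matrices with orthonormal rows. For a measure $\mu$ on $\mathbb{R}^d$ and $U\in\mathcal V_k(\mathbb{R}^d)$, $\mu_U$ is the law of $UY$ with $Y\sim\mu$. Define $\tilde W_{p,k}(\mu,\nu)=\sup_{U\in\mathcal V_k(\mathbb{R}^d)}W_p(\mu_U,\nu_U)$. $\mu^{(i)}_n=\frac1n\sum_{j=1}^n\delta_{X_j^{(i)}}$ is the empirical measure of $n$ i.i.d. samples $X_j^{(i)}$ from $\mu^{(i)}$. Rate: $r_{p,k}(n)=c_p\sqrt k\cdot n^{-1/(2p)}$ if $k<2p$; $r_{p,k}(n)=c_p\sqrt k\cdot n^{-1/(2p)}(\log n)^{1/p}$ if $k=2p$; $r_{p,k}(n)=c_p\sqrt k\cdot n^{-1/k}$ if $k>2p$.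
   Formalization: The sample size is taken to be n ≥ 2: for n = 1 one has log n = 0 and the stated bound fails (the right side is 0 if k = 2p and does not grow with d otherwise, while for Gaussian measures the left side is positive and grows like σ√d). *)

theory Defs
  imports "HOL-Probability.Probability" "HOL-Library.Function_Algebras"
begin

text \<open>
  Dimensions have to be quantified over inside formulas (constants must be uniform in \<open>d\<close>), so
  \<open>\<real>\<^sup>d\<close> is the set of sequences that vanish from index \<open>d\<close> on.  With the pointwise vector space
  structure below, the library notions \<^const>\<open>subspace\<close> and \<^const>\<open>dim\<close> apply to its subsets.
\<close>

type_synonym rvec = "nat \<Rightarrow> real"

instantiation "fun" :: (type, real_vector) real_vector
begin

definition scaleR_fun :: "real \<Rightarrow> ('a \<Rightarrow> 'b) \<Rightarrow> 'a \<Rightarrow> 'b"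
  where "scaleR_fun c f = (\<lambda>x. c *\<^sub>R f x)"

instance
  by standard (auto simp: scaleR_fun_def fun_eq_iff algebra_simps)

end

definition Rn :: "nat \<Rightarrow> rvec set"
  where "Rn d = {x. \<forall>i\<ge>d. x i = 0}"

text \<open>
  The Borel sigma-algebra of the type \<^typ>\<open>rvec\<close> is the one of the product topology; its trace on
  \<^term>\<open>Rn d\<close> is the usual Borel sigma-algebra of \<open>\<real>\<^sup>d\<close>.
\<close>

definition borel_Rn :: "nat \<Rightarrow> rvec measure"
  where "borel_Rn d = restrict_space borel (Rn d)"

definition inner_Rn :: "nat \<Rightarrow> rvec \<Rightarrow> rvec \<Rightarrow> real"
  where "inner_Rn d x y = (\<Sum>i<d. x i * y i)"

definition norm_Rn :: "nat \<Rightarrow> rvec \<Rightarrow> real"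
  where "norm_Rn d x = L2_set x {..<d}"

definition orth_compl :: "nat \<Rightarrow> rvec set \<Rightarrow> rvec set"
  where "orth_compl d U = {z \<in> Rn d. \<forall>u\<in>U. inner_Rn d u z = 0}"

definition prob_Rn :: "nat \<Rightarrow> rvec measure \<Rightarrow> bool"
  where "prob_Rn d \<mu> \<longleftrightarrow> prob_space \<mu> \<and> sets \<mu> = sets (borel_Rn d)"

definition finite_moment :: "nat \<Rightarrow> real \<Rightarrow> rvec measure \<Rightarrow> bool"
  where "finite_moment d p \<mu> \<longleftrightarrow> (\<integral>\<^sup>+ x. ennreal (norm_Rn d x powr p) \<partial>\<mu>) < \<infinity>"

definition couplings :: "'a measure \<Rightarrow> 'b measure \<Rightarrow> ('a \<times> 'b) measure set"
  where "couplings \<mu> \<nu> =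
    {\<gamma>. sets \<gamma> = sets (\<mu> \<Otimes>\<^sub>M \<nu>) \<and> distr \<gamma> \<mu> fst = \<mu> \<and> distr \<gamma> \<nu> snd = \<nu>}"

text \<open>
  The value is meaningful only when the infimum is finite, for instance for probability measures
  with finite \<open>p\<close>-th moment (\<^const>\<open>enn2real\<close> sends \<open>\<infinity>\<close> to \<open>0\<close>).
\<close>

definition wasserstein :: "nat \<Rightarrow> real \<Rightarrow> rvec measure \<Rightarrow> rvec measure \<Rightarrow> real"
  where "wasserstein d p \<mu> \<nu> =
    enn2real (INF \<gamma>\<in>couplings \<mu> \<nu>. \<integral>\<^sup>+ (x, y). ennreal (norm_Rn d (x - y) powr p) \<partial>\<gamma>) powr (1 / p)"

text \<open>
  The relative entropy \<open>D(\<nu>\<parallel>\<mu>)\<close> with natural logarithm.  The library's \<^const>\<open>KL_divergence\<close> takes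
  the reference measure first and is real-valued.  The negative part of the integrand is always
  integrable, so non-integrability means that the divergence is infinite.
\<close>

definition KL_div :: "'a measure \<Rightarrow> 'a measure \<Rightarrow> ereal"
  where "KL_div \<nu> \<mu> =
    (if absolutely_continuous \<mu> \<nu> \<and> integrable \<nu> (entropy_density (exp 1) \<mu> \<nu>)
     then ereal (KL_divergence (exp 1) \<mu> \<nu>) else \<infinity>)"

text \<open>
  Here \<open>s\<close> plays the role of \<open>\<sigma>\<^sup>2\<close>.  For infinite divergence the inequality is vacuous.
\<close>

definition transport_inequality :: "nat \<Rightarrow> real \<Rightarrow> real \<Rightarrow> rvec measure \<Rightarrow> bool"
  where "transport_inequality d p s \<mu> \<longleftrightarrow>
    prob_Rn d \<mu> \<and> finite_moment d p \<mu> \<and>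
    (\<forall>\<nu>. prob_Rn d \<nu> \<and> finite_moment d p \<nu> \<and> KL_div \<nu> \<mu> < \<infinity> \<longrightarrow>
       wasserstein d p \<nu> \<mu> \<le> sqrt (2 * s * real_of_ereal (KL_div \<nu> \<mu>)))"

text \<open>
  A concrete type of elementary outcomes.  A probability space over it can carry any countable
  family of random vectors with any prescribed joint law (take the coordinate maps).  A type
  variable would make existentially quantified constants depend on the type.
\<close>

type_synonym outcome = "nat \<Rightarrow> rvec"

text \<open>
  The library's \<open>indep_var\<close> needs both variables to have values in the same type, so independence of
  \<open>(X1, X2)\<close> and \<open>Z\<close> is stated for the generated sigma-algebras.
\<close>

definition spiked_transport_model ::
    "nat \<Rightarrow> rvec set \<Rightarrow> rvec measure \<Rightarrow> rvec measure \<Rightarrow> bool"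
  where "spiked_transport_model d U \<mu>1 \<mu>2 \<longleftrightarrow>
    U \<subseteq> Rn d \<and> subspace U \<and>
    (\<exists>(M :: outcome measure) X1 X2 Z.
       prob_space M \<and>
       X1 \<in> M \<rightarrow>\<^sub>M borel_Rn d \<and> X2 \<in> M \<rightarrow>\<^sub>M borel_Rn d \<and> Z \<in> M \<rightarrow>\<^sub>M borel_Rn d \<and>
       (\<forall>\<omega>\<in>space M. X1 \<omega> \<in> U \<and> X2 \<omega> \<in> U \<and> Z \<omega> \<in> orth_compl d U) \<and>
       prob_space.indep_set M
         (sets (vimage_algebra (space M) (\<lambda>\<omega>. (X1 \<omega>, X2 \<omega>)) (borel_Rn d \<Otimes>\<^sub>M borel_Rn d)))
         (sets (vimage_algebra (space M) Z (borel_Rn d))) \<and>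
       \<mu>1 = distr M (borel_Rn d) (\<lambda>\<omega>. X1 \<omega> + Z \<omega>) \<and>
       \<mu>2 = distr M (borel_Rn d) (\<lambda>\<omega>. X2 \<omega> + Z \<omega>))"

text \<open>
  Matrices of size \<open>k \<times> d\<close> are doubly indexed families that vanish outside the index range.
\<close>

definition stiefel :: "nat \<Rightarrow> nat \<Rightarrow> (nat \<Rightarrow> nat \<Rightarrow> real) set"
  where "stiefel k d =
    {U. (\<forall>i j. \<not> (i < k \<and> j < d) \<longrightarrow> U i j = 0) \<and>
        (\<forall>i<k. \<forall>l<k. inner_Rn d (U i) (U l) = (if i = l then 1 else 0))}"

definition mat_vec :: "nat \<Rightarrow> nat \<Rightarrow> (nat \<Rightarrow> nat \<Rightarrow> real) \<Rightarrow> rvec \<Rightarrow> rvec"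
  where "mat_vec k d U x = (\<lambda>i. if i < k then \<Sum>j<d. U i j * x j else 0)"

definition proj_measure ::
    "nat \<Rightarrow> nat \<Rightarrow> (nat \<Rightarrow> nat \<Rightarrow> real) \<Rightarrow> rvec measure \<Rightarrow> rvec measure"
  where "proj_measure k d U \<mu> = distr \<mu> (borel_Rn k) (mat_vec k d U)"

lemma measurable_mat_vec: "mat_vec k d U \<in> borel_Rn d \<rightarrow>\<^sub>M borel_Rn k"
proof -
  have "mat_vec k d U \<in> borel_measurable borel"
    by (rule measurable_coordinatewise_then_product) (simp add: mat_vec_def)
  then show ?thesis
    by (auto simp: borel_Rn_def Rn_def mat_vec_def
        intro!: measurable_restrict_space2 measurable_restrict_space1)
qed

text \<open>
  The supremum is taken in the reals; for probability measures with finite \<open>p\<close>-th moment the set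
  is bounded by \<open>W\<^sub>p(\<mu>, \<nu>)\<close>, and it is nonempty whenever \<open>k \<le> d\<close>.
\<close>

definition proj_wasserstein ::
    "nat \<Rightarrow> real \<Rightarrow> nat \<Rightarrow> rvec measure \<Rightarrow> rvec measure \<Rightarrow> real"
  where "proj_wasserstein d p k \<mu> \<nu> =
    (SUP U\<in>stiefel k d. wasserstein k p (proj_measure k d U \<mu>) (proj_measure k d U \<nu>))"

definition iid_sample ::
    "nat \<Rightarrow> outcome measure \<Rightarrow> nat \<Rightarrow> (nat \<Rightarrow> outcome \<Rightarrow> rvec) \<Rightarrow> rvec measure \<Rightarrow> bool"
  where "iid_sample d M n X \<mu> \<longleftrightarrow>
    prob_space.indep_vars M (\<lambda>_. borel_Rn d) X {..<n} \<and>
    (\<forall>j<n. distr M (borel_Rn d) (X j) = \<mu>)"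

definition empirical :: "nat \<Rightarrow> nat \<Rightarrow> (nat \<Rightarrow> rvec) \<Rightarrow> rvec measure"
  where "empirical d n x = distr (uniform_count_measure {..<n}) (borel_Rn d) x"

lemma space_borel_Rn: "space (borel_Rn d) = Rn d"
  by (simp add: borel_Rn_def space_restrict_space)

text \<open>
  The following lemma shows that \<^const>\<open>empirical\<close> is \<open>(1/n) \<Sum>\<^sub>j \<delta>\<^bsub>x\<^sub>j\<^esub>\<close>.
\<close>

lemma emeasure_empirical:
  assumes "\<And>j. j < n \<Longrightarrow> x j \<in> Rn d" and A: "A \<in> sets (borel_Rn d)"
  shows "emeasure (empirical d n x) A = ennreal ((\<Sum>j<n. indicator A (x j)) / real n)"
proof -
  have x: "x \<in> uniform_count_measure {..<n} \<rightarrow>\<^sub>M borel_Rn d"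
    by (rule measurableI)
      (use assms(1) in \<open>auto simp: space_borel_Rn space_uniform_count_measure sets_uniform_count_measure\<close>)
  have "(\<Sum>j<n. indicator A (x j)) = (\<Sum>j<n. if j \<in> x -` A then 1 else (0::real))"
    by (intro sum.cong) auto
  also have "\<dots> = real (card (x -` A \<inter> {..<n}))"
    by (subst sum.inter_restrict [symmetric]) (auto simp: Int_commute)
  finally show ?thesis
    using x A by (simp add: empirical_def emeasure_distr emeasure_uniform_count_measure
        space_uniform_count_measure)
qed

definition rate :: "real \<Rightarrow> real \<Rightarrow> nat \<Rightarrow> nat \<Rightarrow> real"
  where "rate c p k n =
    (if real k < 2 * p then c * sqrt (real k) * real n powr (- 1 / (2 * p))
     else if real k = 2 * p
       then c * sqrt (real k) * real n powr (- 1 / (2 * p)) * ln (real n) powr (1 / p)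
     else c * sqrt (real k) * real n powr (- 1 / real k))"

end

theory Submission
  imports Defs
begin

text \<open>
  If the rows of \<open>V\<close> form an orthonormal basis of the spike, then the component \<open>Z\<close> is invisible after
  projection and can be added back to any coupling of the projected measures, so
  \<open>W\<^sub>p(\<mu>\<^sub>1, \<mu>\<^sub>2)\<close> equals the projected distance.  By the triangle inequality the error is at most the sum of
  \<open>sup\<^sub>U W\<^sub>p(\<mu>\<^sub>U, (\<mu>\<^sub>n)\<^sub>U)\<close> over the two samples.  For fixed \<open>U\<close> the expectation is bounded by a greedy
  multiscale coupling along dyadic cubes, which gives the rate.  The inequality \<open>T\<^sub>p(\<sigma>\<^sup>2)\<close> implies the
  dual bound \<open>log \<integral> e\<^sup>g d\<mu> \<le> \<integral> h d\<mu> + const\<close> for \<open>g(x) - h(y) \<le> s |x - y|\<^sup>p / (2\<sigma>\<^sup>2)\<close>, which tensorizes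
  and shows that \<open>W\<^sub>p(\<mu>\<^sub>U, (\<mu>\<^sub>n)\<^sub>U)\<close> is sub-Gaussian with variance proxy \<open>\<sigma>\<^sup>2 / n\<close>.  A net of the
  Stiefel manifold with \<open>(C \<surd>n)\<^bsup>kd\<^esup>\<close> points then costs \<open>\<sigma> \<surd>(d log n / n)\<close>.
\<close>

section \<open>Vectors and the Wasserstein distance\<close>

text \<open>Gluing couplings normally rests on disintegration. Here every triangle inequality that
  occurs contains an empirical measure, and a coupling with one finitely supported marginal has a
  density with respect to the product measure, so Fubini is enough. Chains of triangle inequalities
  are arranged with this in view. The transport inequality bounds W_p^2 while couplings control
  W_p^p. Two Young inequalities bridge the exponents 1, p and 2; they are tangent at the same point,
  so their errors add up to the same \<open>\<theta>^2 \<sigma>^2 / (2 n)\<close> for every p in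
  [1, 2]. The supremum over the uncountable Stiefel set is not integrated: an explicit integrable
  majorant dominates it pointwise. Only the error itself needs measurability, which comes from
  Lipschitz dependence on the sample. For fixed p the constant of the rate has to be uniform in k,
  but it may degenerate as p approaches k / 2, where a geometric series stops converging; what grows
  with k goes into c_k. Since n \<ge> 2, log n is bounded below, and errors of order sqrt (d / n)
  are absorbed in the second term.\<close>

lemma norm_Rn_nonneg [simp]: "0 \<le> norm_Rn d x"
  by (simp add: norm_Rn_def)

lemma norm_Rn_zero [simp]: "norm_Rn d 0 = 0"
  by (simp add: norm_Rn_def L2_set_def)

lemma norm_Rn_uminus [simp]: "norm_Rn d (- x) = norm_Rn d x"
  by (simp add: norm_Rn_def L2_set_def)

lemma norm_Rn_triangle: "norm_Rn d (x + y) \<le> norm_Rn d x + norm_Rn d y"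
  using L2_set_triangle_ineq[of x y "{..<d}"] by (simp add: norm_Rn_def plus_fun_def)

lemma norm_Rn_minus_commute: "norm_Rn d (x - y) = norm_Rn d (y - x)"
  by (simp add: norm_Rn_def L2_set_def power2_commute)

lemma norm_Rn_diff_triangle: "norm_Rn d (x - z) \<le> norm_Rn d (x - y) + norm_Rn d (y - z)"
  using norm_Rn_triangle[of d "x - y" "y - z"] by simp

lemma norm_Rn_diff_le: "norm_Rn d (x - y) \<le> norm_Rn d x + norm_Rn d y"
  using norm_Rn_diff_triangle[of d x y 0] by simp

lemma norm_Rn_sq: "(norm_Rn d x)\<^sup>2 = (\<Sum>i<d. (x i)\<^sup>2)"
  by (simp add: norm_Rn_def L2_set_def sum_nonneg)

lemma norm_Rn_le_sum: "norm_Rn d x \<le> (\<Sum>i<d. \<bar>x i\<bar>)"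
  by (simp add: norm_Rn_def L2_set_le_sum_abs)

lemma inner_Rn_Cauchy_Schwarz: "\<bar>inner_Rn d x y\<bar> \<le> norm_Rn d x * norm_Rn d y"
proof -
  have "\<bar>inner_Rn d x y\<bar> \<le> (\<Sum>i<d. \<bar>x i\<bar> * \<bar>y i\<bar>)"
    unfolding inner_Rn_def by (rule order_trans[OF sum_abs]) (simp add: abs_mult)
  also have "\<dots> \<le> norm_Rn d x * norm_Rn d y"
    unfolding norm_Rn_def by (rule L2_set_mult_ineq)
  finally show ?thesis .
qed

lemma inner_Rn_self: "inner_Rn d x x = (norm_Rn d x)\<^sup>2"
  unfolding norm_Rn_sq by (simp add: inner_Rn_def power2_eq_square)

lemma Rn_diff: "x \<in> Rn d \<Longrightarrow> y \<in> Rn d \<Longrightarrow> x - y \<in> Rn d"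
  and Rn_add: "x \<in> Rn d \<Longrightarrow> y \<in> Rn d \<Longrightarrow> x + y \<in> Rn d"
  and Rn_scaleR: "x \<in> Rn d \<Longrightarrow> c *\<^sub>R x \<in> Rn d"
  and Rn_zero: "0 \<in> Rn d"
  by (auto simp: Rn_def scaleR_fun_def)

lemma measurable_Rn_coord: "f \<in> M \<rightarrow>\<^sub>M borel_Rn d \<Longrightarrow> (\<lambda>\<omega>. f \<omega> i) \<in> borel_measurable M"
proof -
  assume f: "f \<in> M \<rightarrow>\<^sub>M borel_Rn d"
  have "(\<lambda>x::rvec. x i) \<in> borel_measurable borel" by simp
  then have "(\<lambda>x::rvec. x i) \<in> borel_measurable (borel_Rn d)"
    unfolding borel_Rn_def by (rule measurable_restrict_space1)
  from measurable_compose[OF f this] show ?thesis .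
qed

lemma measurable_borel_RnI:
  assumes "\<And>i. i < k \<Longrightarrow> (\<lambda>\<omega>. f \<omega> i) \<in> borel_measurable M" "\<And>\<omega>. \<omega> \<in> space M \<Longrightarrow> f \<omega> \<in> Rn k"
  shows "f \<in> M \<rightarrow>\<^sub>M borel_Rn k"
proof -
  have "(\<lambda>\<omega>. f \<omega> i) \<in> borel_measurable M" for i
  proof (cases "i < k")
    case False
    then have "f \<omega> i = 0" if "\<omega> \<in> space M" for \<omega> using assms(2)[OF that] by (simp add: Rn_def)
    then show ?thesis by (simp cong: measurable_cong)
  qed (use assms in auto)
  then have "f \<in> borel_measurable M" by (rule measurable_coordinatewise_then_product)
  then show ?thesis using assms(2) by (auto simp: borel_Rn_def intro!: measurable_restrict_space2)
qed

lemma measurable_Rn_add [measurable (raw)]: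
  "f \<in> M \<rightarrow>\<^sub>M borel_Rn d \<Longrightarrow> g \<in> M \<rightarrow>\<^sub>M borel_Rn d \<Longrightarrow> (\<lambda>\<omega>. f \<omega> + g \<omega>) \<in> M \<rightarrow>\<^sub>M borel_Rn d"
  using measurable_Rn_coord[of f M d] measurable_Rn_coord[of g M d]
  by (intro measurable_borel_RnI)
    (auto intro!: borel_measurable_add Rn_add dest: measurable_space simp: space_borel_Rn)

lemma measurable_Rn_diff [measurable (raw)]:
  "f \<in> M \<rightarrow>\<^sub>M borel_Rn d \<Longrightarrow> g \<in> M \<rightarrow>\<^sub>M borel_Rn d \<Longrightarrow> (\<lambda>\<omega>. f \<omega> - g \<omega>) \<in> M \<rightarrow>\<^sub>M borel_Rn d"
  using measurable_Rn_coord[of f M d] measurable_Rn_coord[of g M d]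
  by (intro measurable_borel_RnI)
    (auto intro!: borel_measurable_diff Rn_diff dest: measurable_space simp: space_borel_Rn)

lemma measurable_Rn_scaleR [measurable (raw)]:
  "f \<in> M \<rightarrow>\<^sub>M borel_Rn d \<Longrightarrow> (\<lambda>\<omega>. c *\<^sub>R f \<omega>) \<in> M \<rightarrow>\<^sub>M borel_Rn d"
  using measurable_Rn_coord[of f M d]
  by (intro measurable_borel_RnI)
    (auto intro!: borel_measurable_times Rn_scaleR dest: measurable_space
      simp: space_borel_Rn scaleR_fun_def Rn_def)

lemma measurable_norm_Rn [measurable (raw)]:
  "f \<in> M \<rightarrow>\<^sub>M borel_Rn d \<Longrightarrow> (\<lambda>\<omega>. norm_Rn d (f \<omega>)) \<in> borel_measurable M"
  using measurable_Rn_coord[of f M d] unfolding norm_Rn_def L2_set_def by simp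

lemma measurable_inner_Rn:
  "f \<in> M \<rightarrow>\<^sub>M borel_Rn d \<Longrightarrow> (\<lambda>\<omega>. inner_Rn d u (f \<omega>)) \<in> borel_measurable M"
  using measurable_Rn_coord[of f M d] unfolding inner_Rn_def by simp

lemma prob_RnD: "prob_Rn d \<mu> \<Longrightarrow> prob_space \<mu>" "prob_Rn d \<mu> \<Longrightarrow> sets \<mu> = sets (borel_Rn d)"
  "prob_Rn d \<mu> \<Longrightarrow> space \<mu> = Rn d"
  by (auto simp: prob_Rn_def space_borel_Rn[symmetric] dest: sets_eq_imp_space_eq)

lemma prob_Rn_distr: "prob_space A \<Longrightarrow> f \<in> A \<rightarrow>\<^sub>M borel_Rn d \<Longrightarrow> prob_Rn d (distr A (borel_Rn d) f)"
  by (simp add: prob_Rn_def prob_space.prob_space_distr)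

lemma singleton_sets_Rn: "x \<in> Rn d \<Longrightarrow> {x} \<in> sets (borel_Rn d)"
proof -
  assume "x \<in> Rn d"
  have "{x} \<in> sets borel" by (rule borel_closed) simp
  then have "Rn d \<inter> {x} \<in> sets (borel_Rn d)"
    by (auto simp: borel_Rn_def sets_restrict_space)
  then show ?thesis using \<open>x \<in> Rn d\<close> by simp
qed

section \<open>Transport cost with values in [0, \<infinity>], couplings and finiteness\<close>

definition wcost :: "nat \<Rightarrow> real \<Rightarrow> rvec measure \<Rightarrow> rvec measure \<Rightarrow> ennreal"
  where "wcost d p \<mu> \<nu> =
    (INF \<gamma>\<in>couplings \<mu> \<nu>. \<integral>\<^sup>+ z. ennreal (norm_Rn d (fst z - snd z) powr p) \<partial>\<gamma>)"

lemma wasserstein_wcost: "wasserstein d p \<mu> \<nu> = enn2real (wcost d p \<mu> \<nu>) powr (1 / p)"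
  by (simp add: wasserstein_def wcost_def split_beta')

lemma wasserstein_nonneg [simp]: "0 \<le> wasserstein d p \<mu> \<nu>"
  by (simp add: wasserstein_wcost)

lemma wasserstein_dim_0: "wasserstein 0 p \<mu> \<nu> = 0"
proof -
  have [simp]: "norm_Rn 0 x = 0" for x by (simp add: norm_Rn_def)
  \<comment> \<open>Arbitrary measures may have no coupling; the infimum is then \<infinity>, which
    \<open>enn2real\<close> also sends to 0.\<close>
  have "wcost 0 p \<mu> \<nu> = 0 \<or> wcost 0 p \<mu> \<nu> = \<infinity>"
    by (cases "couplings \<mu> \<nu> = {}") (auto simp: wcost_def image_constant_conv)
  then show ?thesis by (auto simp: wasserstein_wcost)
qed

lemma coupling_distr:
  assumes f: "f \<in> A \<rightarrow>\<^sub>M \<mu>" and g: "g \<in> A \<rightarrow>\<^sub>M \<nu>"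
    and "distr A \<mu> f = \<mu>" "distr A \<nu> g = \<nu>"
  shows "distr A (\<mu> \<Otimes>\<^sub>M \<nu>) (\<lambda>\<omega>. (f \<omega>, g \<omega>)) \<in> couplings \<mu> \<nu>"
  using assms by (simp add: couplings_def distr_distr comp_def)

text \<open>Random vectors f and g on any space A serve as a coupling. Later estimates choose A
  freely: a coupling, a glued triple, the set of sample indices, or a product with the space that
  carries the noise.\<close>

lemma wcost_le:
  assumes f: "f \<in> A \<rightarrow>\<^sub>M borel_Rn d" and g: "g \<in> A \<rightarrow>\<^sub>M borel_Rn d"
    and \<mu>: "distr A (borel_Rn d) f = \<mu>" and \<nu>: "distr A (borel_Rn d) g = \<nu>"
  shows "wcost d p \<mu> \<nu> \<le> (\<integral>\<^sup>+ \<omega>. ennreal (norm_Rn d (f \<omega> - g \<omega>) powr p) \<partial>A)"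
proof -
  have [measurable_cong]: "sets \<mu> = sets (borel_Rn d)" "sets \<nu> = sets (borel_Rn d)"
    using \<mu> \<nu> by auto
  have f': "f \<in> A \<rightarrow>\<^sub>M \<mu>" and g': "g \<in> A \<rightarrow>\<^sub>M \<nu>" using f g by (auto cong: measurable_cong_sets)
  let ?\<gamma> = "distr A (\<mu> \<Otimes>\<^sub>M \<nu>) (\<lambda>\<omega>. (f \<omega>, g \<omega>))"
  have "?\<gamma> \<in> couplings \<mu> \<nu>"
    using \<mu> \<nu> by (intro coupling_distr f' g') (auto cong: distr_cong)
  then have "wcost d p \<mu> \<nu> \<le> (\<integral>\<^sup>+ z. ennreal (norm_Rn d (fst z - snd z) powr p) \<partial>?\<gamma>)"
    unfolding wcost_def by (rule INF_lower)
  also have "\<dots> = (\<integral>\<^sup>+ \<omega>. ennreal (norm_Rn d (f \<omega> - g \<omega>) powr p) \<partial>A)"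
    using f' g' by (subst nn_integral_distr) auto
  finally show ?thesis .
qed

lemma couplings_borel_Rn:
  assumes "\<gamma> \<in> couplings \<mu> \<nu>" "sets \<mu> = sets (borel_Rn d)" "sets \<nu> = sets (borel_Rn d)"
  shows "sets \<gamma> = sets (borel_Rn d \<Otimes>\<^sub>M borel_Rn d)"
    "fst \<in> \<gamma> \<rightarrow>\<^sub>M borel_Rn d" "snd \<in> \<gamma> \<rightarrow>\<^sub>M borel_Rn d"
    "distr \<gamma> (borel_Rn d) fst = \<mu>" "distr \<gamma> (borel_Rn d) snd = \<nu>"
proof -
  show s: "sets \<gamma> = sets (borel_Rn d \<Otimes>\<^sub>M borel_Rn d)"
    using assms by (simp add: couplings_def cong: sets_pair_measure_cong)
  show "fst \<in> \<gamma> \<rightarrow>\<^sub>M borel_Rn d" "snd \<in> \<gamma> \<rightarrow>\<^sub>M borel_Rn d"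
    by (simp_all add: measurable_cong_sets[OF s refl])
  have "distr \<gamma> (borel_Rn d) fst = distr \<gamma> \<mu> fst" "distr \<gamma> (borel_Rn d) snd = distr \<gamma> \<nu> snd"
    using assms by (auto intro!: distr_cong)
  then show "distr \<gamma> (borel_Rn d) fst = \<mu>" "distr \<gamma> (borel_Rn d) snd = \<nu>"
    using assms by (auto simp: couplings_def)
qed

lemma coupling_prob_space:
  assumes "\<gamma> \<in> couplings \<mu> \<nu>" "prob_space \<mu>" shows "prob_space \<gamma>"
proof -
  have "fst \<in> \<gamma> \<rightarrow>\<^sub>M \<mu>" using assms by (simp add: couplings_def cong: measurable_cong_sets)
  moreover have "distr \<gamma> \<mu> fst = \<mu>" using assms by (simp add: couplings_def)
  ultimately show ?thesis using assms(2) by (metis prob_space_distrD)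
qed

lemma wasserstein_leI:
  assumes "f \<in> A \<rightarrow>\<^sub>M borel_Rn d" "g \<in> A \<rightarrow>\<^sub>M borel_Rn d"
    and "distr A (borel_Rn d) f = \<mu>" "distr A (borel_Rn d) g = \<nu>"
    and "(\<integral>\<^sup>+ \<omega>. ennreal (norm_Rn d (f \<omega> - g \<omega>) powr p) \<partial>A) \<le> ennreal (a powr p)" "0 \<le> a" "1 \<le> p"
  shows "wasserstein d p \<mu> \<nu> \<le> a"
proof -
  have "wcost d p \<mu> \<nu> \<le> ennreal (a powr p)"
    using wcost_le[OF assms(1-4)] assms(5) by (rule order_trans)
  then have "enn2real (wcost d p \<mu> \<nu>) \<le> a powr p" by (simp add: enn2real_leI)
  then have "wasserstein d p \<mu> \<nu> \<le> (a powr p) powr (1 / p)"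
    unfolding wasserstein_wcost using assms by (intro powr_mono2) auto
  then show ?thesis using assms by (simp add: powr_powr)
qed

lemma wasserstein_powr: "1 \<le> p \<Longrightarrow> wasserstein d p \<mu> \<nu> powr p = enn2real (wcost d p \<mu> \<nu>)"
  by (simp add: wasserstein_wcost powr_powr)

text \<open>Finiteness of the cost excludes the default value: at infinite cost
  \<open>wasserstein\<close> is 0, hence below every positive a, although no coupling is
  cheap.\<close>

lemma wasserstein_lessE:
  assumes "wcost d p \<mu> \<nu> < \<infinity>" "wasserstein d p \<mu> \<nu> < a" "1 \<le> p"
  obtains \<gamma> where "\<gamma> \<in> couplings \<mu> \<nu>"
    "(\<integral>\<^sup>+ z. ennreal (norm_Rn d (fst z - snd z) powr p) \<partial>\<gamma>) < ennreal (a powr p)"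
proof -
  have "enn2real (wcost d p \<mu> \<nu>) < a powr p"
    unfolding wasserstein_powr[OF assms(3), symmetric] using assms by (intro powr_less_mono2) auto
  then have "wcost d p \<mu> \<nu> < ennreal (a powr p)"
    using assms(1) by (metis enn2real_nonneg ennreal_enn2real ennreal_less_iff infinity_ennreal_def)
  then show ?thesis unfolding wcost_def INF_less_iff using that by auto
qed

lemma nn_integral_powr_add_finite:
  assumes [measurable]: "f \<in> borel_measurable M" "g \<in> borel_measurable M"
    and "\<And>x. 0 \<le> f x" "\<And>x. 0 \<le> g x" "1 \<le> (p::real)"
    and "(\<integral>\<^sup>+ x. ennreal (f x powr p) \<partial>M) < \<infinity>" "(\<integral>\<^sup>+ x. ennreal (g x powr p) \<partial>M) < \<infinity>"
  shows "(\<integral>\<^sup>+ x. ennreal ((f x + g x) powr p) \<partial>M) < \<infinity>"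
proof -
  have le: "(a + b) powr p \<le> 2 powr p * (a powr p + b powr p)" if "0 \<le> a" "0 \<le> b" for a b :: real
  proof -
    have "(a + b) powr p \<le> (2 * max a b) powr p" using that assms by (intro powr_mono2) auto
    also have "\<dots> = 2 powr p * max a b powr p" using that by (simp add: powr_mult)
    also have "\<dots> \<le> 2 powr p * (a powr p + b powr p)" by (intro mult_left_mono) (auto simp: max_def)
    finally show ?thesis .
  qed
  have "(\<integral>\<^sup>+ x. ennreal ((f x + g x) powr p) \<partial>M)
      \<le> (\<integral>\<^sup>+ x. ennreal (2 powr p) * (ennreal (f x powr p) + ennreal (g x powr p)) \<partial>M)"
    using le assms(3,4) by (intro nn_integral_mono) (simp add: ennreal_plus[symmetric] ennreal_mult[symmetric] del: ennreal_plus)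
  also have "\<dots> = ennreal (2 powr p) * ((\<integral>\<^sup>+ x. ennreal (f x powr p) \<partial>M) + (\<integral>\<^sup>+ x. ennreal (g x powr p) \<partial>M))"
    by (simp add: nn_integral_cmult nn_integral_add)
  also have "\<dots> < \<infinity>" using assms(6,7) by (simp add: ennreal_mult_less_top)
  finally show ?thesis .
qed

text \<open>The independent coupling already has finite cost, because |x - y| \<le> |x| +
  |y|.\<close>

lemma wcost_finite:
  assumes "prob_Rn d \<mu>" "prob_Rn d \<nu>" "finite_moment d p \<mu>" "finite_moment d p \<nu>" "1 \<le> p"
  shows "wcost d p \<mu> \<nu> < \<infinity>"
proof -
  interpret \<mu>: prob_space \<mu> using assms(1) by (rule prob_RnD)
  interpret \<nu>: prob_space \<nu> using assms(2) by (rule prob_RnD)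
  interpret P: pair_prob_space \<mu> \<nu> ..
  have [measurable_cong]: "sets \<mu> = sets (borel_Rn d)" "sets \<nu> = sets (borel_Rn d)"
    using assms by (auto dest: prob_RnD)
  have m: "fst \<in> \<mu> \<Otimes>\<^sub>M \<nu> \<rightarrow>\<^sub>M borel_Rn d" "snd \<in> \<mu> \<Otimes>\<^sub>M \<nu> \<rightarrow>\<^sub>M borel_Rn d" by measurable
  have 1: "distr (\<mu> \<Otimes>\<^sub>M \<nu>) (borel_Rn d) fst = \<mu>"
    using \<nu>.distr_pair_fst[of \<mu>] assms(1) by (metis distr_cong prob_RnD(2))
  have 2: "distr (\<mu> \<Otimes>\<^sub>M \<nu>) (borel_Rn d) snd = \<nu>"
  proof (rule measure_eqI)
    fix B assume "B \<in> sets (distr (\<mu> \<Otimes>\<^sub>M \<nu>) (borel_Rn d) snd)"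
    then have B[measurable]: "B \<in> sets \<nu>" using assms(2) by (simp add: prob_RnD)
    then have B'[measurable]: "B \<in> sets (borel_Rn d)" using assms(2) by (simp add: prob_RnD)
    have "emeasure (distr (\<mu> \<Otimes>\<^sub>M \<nu>) (borel_Rn d) snd) B = emeasure (\<mu> \<Otimes>\<^sub>M \<nu>) (snd -` B \<inter> space (\<mu> \<Otimes>\<^sub>M \<nu>))"
      by (subst emeasure_distr) measurable
    also have "snd -` B \<inter> space (\<mu> \<Otimes>\<^sub>M \<nu>) = space \<mu> \<times> B"
      using sets.sets_into_space[OF B] by (auto simp: space_pair_measure)
    finally show "emeasure (distr (\<mu> \<Otimes>\<^sub>M \<nu>) (borel_Rn d) snd) B = emeasure \<nu> B"
      by (simp add: \<nu>.emeasure_pair_measure_Times \<mu>.emeasure_space_1)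
  qed (use assms in \<open>simp add: prob_RnD\<close>)
  have fin1: "(\<integral>\<^sup>+ z. ennreal (norm_Rn d (fst z) powr p) \<partial>(\<mu> \<Otimes>\<^sub>M \<nu>)) < \<infinity>"
    using assms(3) nn_integral_distr[OF m(1), of "\<lambda>x. ennreal (norm_Rn d x powr p)"]
    by (simp add: finite_moment_def 1)
  have fin2: "(\<integral>\<^sup>+ z. ennreal (norm_Rn d (snd z) powr p) \<partial>(\<mu> \<Otimes>\<^sub>M \<nu>)) < \<infinity>"
    using assms(4) nn_integral_distr[OF m(2), of "\<lambda>x. ennreal (norm_Rn d x powr p)"]
    by (simp add: finite_moment_def 2)
  have "wcost d p \<mu> \<nu> \<le> (\<integral>\<^sup>+ z. ennreal (norm_Rn d (fst z - snd z) powr p) \<partial>(\<mu> \<Otimes>\<^sub>M \<nu>))"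
    by (rule wcost_le[OF m 1 2])
  also have "\<dots> \<le> (\<integral>\<^sup>+ z. ennreal ((norm_Rn d (fst z) + norm_Rn d (snd z)) powr p) \<partial>(\<mu> \<Otimes>\<^sub>M \<nu>))"
    using assms(5) by (intro nn_integral_mono ennreal_leI powr_mono2 norm_Rn_diff_le) auto
  also have "\<dots> < \<infinity>"
    using m by (intro nn_integral_powr_add_finite fin1 fin2 assms measurable_norm_Rn norm_Rn_nonneg)
  finally show ?thesis .
qed

lemma wasserstein_sym:
  assumes "sets \<mu> = sets (borel_Rn d)" "sets \<nu> = sets (borel_Rn d)"
  shows "wasserstein d p \<mu> \<nu> = wasserstein d p \<nu> \<mu>"
proof -
  have "wcost d p \<mu> \<nu> \<le> wcost d p \<nu> \<mu>"
    if s: "sets \<mu> = sets (borel_Rn d)" "sets \<nu> = sets (borel_Rn d)" for \<mu> \<nu>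
  proof -
    have "wcost d p \<mu> \<nu> \<le> (\<integral>\<^sup>+ z. ennreal (norm_Rn d (fst z - snd z) powr p) \<partial>\<gamma>)"
      if g: "\<gamma> \<in> couplings \<nu> \<mu>" for \<gamma>
      using wcost_le[OF couplings_borel_Rn(3,2,5,4)[OF g s(2,1)], of p]
      by (simp add: norm_Rn_minus_commute)
    then show ?thesis unfolding wcost_def[of d p \<nu> \<mu>] by (intro INF_greatest) auto
  qed
  from this[OF assms] this[OF assms(2,1)] show ?thesis by (simp add: wasserstein_wcost)
qed

lemma finite_moment_distr:
  assumes f: "f \<in> A \<rightarrow>\<^sub>M borel_Rn d"
  shows "finite_moment d p (distr A (borel_Rn d) f) \<longleftrightarrow> (\<integral>\<^sup>+ x. ennreal (norm_Rn d (f x) powr p) \<partial>A) < \<infinity>"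
  unfolding finite_moment_def by (subst nn_integral_distr[OF f]) measurable

text \<open>A nearly optimal coupling is pushed through f in both coordinates.\<close>

lemma wasserstein_distr_lipschitz:
  assumes f[measurable]: "f \<in> borel_Rn d \<rightarrow>\<^sub>M borel_Rn k"
    and lip: "\<And>x y. x \<in> Rn d \<Longrightarrow> y \<in> Rn d \<Longrightarrow> norm_Rn k (f x - f y) \<le> L * norm_Rn d (x - y)" and L: "0 \<le> L"
    and prob: "prob_Rn d \<mu>" "prob_Rn d \<nu>" and fin: "wcost d p \<mu> \<nu> < \<infinity>" and p: "1 \<le> p"
  shows "wasserstein k p (distr \<mu> (borel_Rn k) f) (distr \<nu> (borel_Rn k) f) \<le> L * wasserstein d p \<mu> \<nu>"
proof (rule field_le_epsilon)
  fix e :: real assume e: "0 < e"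
  \<comment> \<open>Dividing the slack by L + 1 instead of L covers L = 0.\<close>
  define a where "a = wasserstein d p \<mu> \<nu> + e / (L + 1)"
  have "wasserstein d p \<mu> \<nu> < a" using e L by (simp add: a_def)
  from wasserstein_lessE[OF fin this p] obtain \<gamma> where g: "\<gamma> \<in> couplings \<mu> \<nu>"
    and c: "(\<integral>\<^sup>+ z. ennreal (norm_Rn d (fst z - snd z) powr p) \<partial>\<gamma>) < ennreal (a powr p)" .
  note G = couplings_borel_Rn[OF g prob_RnD(2)[OF prob(1)] prob_RnD(2)[OF prob(2)]]
  have a0: "0 \<le> a" using e L by (simp add: a_def)
  have "wasserstein k p (distr \<mu> (borel_Rn k) f) (distr \<nu> (borel_Rn k) f) \<le> L * a"
  proof (rule wasserstein_leI)
    show "(\<lambda>z. f (fst z)) \<in> \<gamma> \<rightarrow>\<^sub>M borel_Rn k" "(\<lambda>z. f (snd z)) \<in> \<gamma> \<rightarrow>\<^sub>M borel_Rn k"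
      using G(2,3) f by (auto intro: measurable_compose)
    show "distr \<gamma> (borel_Rn k) (\<lambda>z. f (fst z)) = distr \<mu> (borel_Rn k) f"
      unfolding G(4)[symmetric] using G(2) f by (simp add: distr_distr comp_def)
    show "distr \<gamma> (borel_Rn k) (\<lambda>z. f (snd z)) = distr \<nu> (borel_Rn k) f"
      unfolding G(5)[symmetric] using G(3) f by (simp add: distr_distr comp_def)
    have "(\<integral>\<^sup>+ z. ennreal (norm_Rn k (f (fst z) - f (snd z)) powr p) \<partial>\<gamma>)
      \<le> (\<integral>\<^sup>+ z. ennreal (L powr p) * ennreal (norm_Rn d (fst z - snd z) powr p) \<partial>\<gamma>)"
    proof (rule nn_integral_mono)
      fix z assume "z \<in> space \<gamma>"
      then have "fst z \<in> Rn d" "snd z \<in> Rn d" using G(2,3) by (auto dest: measurable_space simp: space_borel_Rn)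
      then have "norm_Rn k (f (fst z) - f (snd z)) powr p \<le> (L * norm_Rn d (fst z - snd z)) powr p"
        using p by (intro powr_mono2 lip) auto
      then show "ennreal (norm_Rn k (f (fst z) - f (snd z)) powr p) \<le> ennreal (L powr p) * ennreal (norm_Rn d (fst z - snd z) powr p)"
        using L by (simp add: ennreal_mult[symmetric] powr_mult ennreal_leI)
    qed
    also have "\<dots> = ennreal (L powr p) * (\<integral>\<^sup>+ z. ennreal (norm_Rn d (fst z - snd z) powr p) \<partial>\<gamma>)"
      using measurable_norm_Rn[OF measurable_Rn_diff[OF G(2,3)]] by (intro nn_integral_cmult) simp
    also have "\<dots> \<le> ennreal (L powr p) * ennreal (a powr p)" using c by (intro mult_left_mono) auto
    also have "\<dots> = ennreal ((L * a) powr p)" using L a0 by (simp add: ennreal_mult[symmetric] powr_mult)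
    finally show "(\<integral>\<^sup>+ z. ennreal (norm_Rn k (f (fst z) - f (snd z)) powr p) \<partial>\<gamma>) \<le> ennreal ((L * a) powr p)" .
  qed (use L a0 p in auto)
  also have "L * a \<le> L * wasserstein d p \<mu> \<nu> + e"
    using L e by (simp add: a_def distrib_left divide_simps) (simp add: algebra_simps)?
  finally show "wasserstein k p (distr \<mu> (borel_Rn k) f) (distr \<nu> (borel_Rn k) f) \<le> L * wasserstein d p \<mu> \<nu> + e" .
qed

section \<open>Minkowski's inequality, gluing and the triangle inequality\<close>

lemma powr_convex_split:
  assumes "0 < \<theta>" "\<theta> < 1" "0 \<le> x" "0 \<le> y" "1 \<le> (p::real)"
  shows "(x + y) powr p \<le> \<theta> powr (1 - p) * x powr p + (1 - \<theta>) powr (1 - p) * y powr p"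
proof -
  have th: "t * (z / t) powr p = t powr (1 - p) * z powr p" if "0 < t" "0 \<le> z" for t z :: real
    using that by (simp add: powr_divide powr_diff)
  have scale: "(t * z) powr p \<le> t * z powr p" if "0 < t" "t < 1" "0 \<le> z" for t z :: real
  proof -
    have "t powr p \<le> t powr 1" using that assms(5) by (intro powr_mono') auto
    then show ?thesis using that by (simp add: powr_mult mult_right_mono)
  qed
  have conv: "(\<theta> * a + (1 - \<theta>) * b) powr p \<le> \<theta> * a powr p + (1 - \<theta>) * b powr p" if "0 \<le> a" "0 \<le> b" for a b
  \<comment> \<open>At a zero argument the claim follows from t^p \<le> t for t in (0, 1).\<close>
  proof (cases "a = 0 \<or> b = 0")
    case True
    then show ?thesis using scale[of \<theta> a] scale[of "1 - \<theta>" b] assms that by auto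
  next
    case False
    then show ?thesis using convex_onD[OF powr_convex[OF assms(5)], of "1 - \<theta>" a b] assms that by simp
  qed
  \<comment> \<open>x + y is the convex combination of x / \<theta> and y / (1 - \<theta>) with
    weights \<theta> and 1 - \<theta>.\<close>
  have "(\<theta> * (x / \<theta>) + (1 - \<theta>) * (y / (1 - \<theta>))) powr p
      \<le> \<theta> * (x / \<theta>) powr p + (1 - \<theta>) * (y / (1 - \<theta>)) powr p"
    using assms by (intro conv) auto
  then show ?thesis using assms by (simp add: th)
qed

text \<open>With \<theta> = a / (a + b) the convex split loses nothing: the two bounds recombine to
  exactly (a + b)^p. This avoids duality of L^p norms and works with bounds a, b in place of the
  norms themselves.\<close>

lemma nn_integral_Minkowski:
  assumes [measurable]: "f \<in> borel_measurable M" "g \<in> borel_measurable M"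
    and nn: "\<And>x. 0 \<le> f x" "\<And>x. 0 \<le> g x" and p: "1 \<le> (p::real)" and ab: "0 < a" "0 < b"
    and f: "(\<integral>\<^sup>+ x. ennreal (f x powr p) \<partial>M) \<le> ennreal (a powr p)"
    and g: "(\<integral>\<^sup>+ x. ennreal (g x powr p) \<partial>M) \<le> ennreal (b powr p)"
  shows "(\<integral>\<^sup>+ x. ennreal ((f x + g x) powr p) \<partial>M) \<le> ennreal ((a + b) powr p)"
proof -
  define \<theta> where "\<theta> = a / (a + b)"
  have \<theta>: "0 < \<theta>" "\<theta> < 1" "1 - \<theta> = b / (a + b)" using ab by (auto simp: \<theta>_def field_simps)
  have "(\<integral>\<^sup>+ x. ennreal ((f x + g x) powr p) \<partial>M)
    \<le> (\<integral>\<^sup>+ x. ennreal (\<theta> powr (1 - p)) * ennreal (f x powr p) + ennreal ((1 - \<theta>) powr (1 - p)) * ennreal (g x powr p) \<partial>M)"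
  proof (rule nn_integral_mono)
    fix x
    show "ennreal ((f x + g x) powr p)
       \<le> ennreal (\<theta> powr (1 - p)) * ennreal (f x powr p) + ennreal ((1 - \<theta>) powr (1 - p)) * ennreal (g x powr p)"
      using ennreal_leI[OF powr_convex_split[OF \<theta>(1,2) nn(1)[of x] nn(2)[of x] p]]
      by (simp add: ennreal_mult)
  qed
  also have "\<dots> = ennreal (\<theta> powr (1 - p)) * (\<integral>\<^sup>+ x. ennreal (f x powr p) \<partial>M)
       + ennreal ((1 - \<theta>) powr (1 - p)) * (\<integral>\<^sup>+ x. ennreal (g x powr p) \<partial>M)"
    by (simp add: nn_integral_add nn_integral_cmult)
  also have "\<dots> \<le> ennreal (\<theta> powr (1 - p)) * ennreal (a powr p) + ennreal ((1 - \<theta>) powr (1 - p)) * ennreal (b powr p)"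
    using f g by (intro add_mono mult_left_mono) auto
  also have "\<dots> = ennreal (\<theta> powr (1 - p) * a powr p + (1 - \<theta>) powr (1 - p) * b powr p)"
    by (simp add: ennreal_mult)
  also have "\<theta> powr (1 - p) * a powr p + (1 - \<theta>) powr (1 - p) * b powr p = (a + b) powr p"
  proof -
    have "(c / (a + b)) powr (1 - p) * c powr p = c / (a + b) * (a + b) powr p" if "0 < c" for c
      using that ab by (simp add: powr_divide powr_diff)
    then have "\<theta> powr (1 - p) * a powr p + (1 - \<theta>) powr (1 - p) * b powr p
      = a / (a + b) * (a + b) powr p + b / (a + b) * (a + b) powr p"
      using ab unfolding \<theta>(3) by (simp add: \<theta>_def)
    also have "\<dots> = (a + b) powr p"
      using ab by (simp flip: distrib_right add_divide_distrib)
    finally show ?thesis .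
  qed
  finally show ?thesis .
qed

text \<open>If \<open>\<gamma>\<^sub>1\<^sub>2\<close> has a density \<open>f\<close> with respect to \<open>\<mu>\<^sub>1 \<Otimes> \<mu>\<^sub>2\<close>, then \<open>f(x, y) \<mu>\<^sub>1(dx) \<gamma>\<^sub>2\<^sub>3(dy, dz)\<close> glues
  the two couplings, and no disintegration theorem is needed.\<close>

lemma glue_couplings:
  assumes S: "sets \<mu>1 = sets N" "sets \<mu>2 = sets N" "sets \<mu>3 = sets N"
    and prob: "prob_space \<mu>1" "prob_space \<mu>2" "prob_space \<mu>3"
    and g12: "sets \<gamma>12 = sets (N \<Otimes>\<^sub>M N)" "distr \<gamma>12 N snd = \<mu>2"
    and g23: "sets \<gamma>23 = sets (N \<Otimes>\<^sub>M N)" "distr \<gamma>23 N fst = \<mu>2"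
    and ac: "absolutely_continuous (\<mu>1 \<Otimes>\<^sub>M \<mu>2) \<gamma>12"
  shows "\<exists>A. sets A = sets (N \<Otimes>\<^sub>M (N \<Otimes>\<^sub>M N)) \<and>
    distr A (N \<Otimes>\<^sub>M N) (\<lambda>(x, y, z). (x, y)) = \<gamma>12 \<and> distr A (N \<Otimes>\<^sub>M N) snd = \<gamma>23"
proof -
  note [measurable_cong] = S g12(1) g23(1)
  interpret \<mu>1: prob_space \<mu>1 by fact
  interpret \<mu>2: prob_space \<mu>2 by fact
  interpret P: pair_prob_space \<mu>1 \<mu>2 ..
  have mfst: "fst \<in> \<gamma>23 \<rightarrow>\<^sub>M N" by measurable
  have "prob_space (distr \<gamma>23 N fst)" using g23 prob by simp
  then interpret \<gamma>23: prob_space \<gamma>23 using mfst by (rule prob_space_distrD[rotated])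
  interpret Q: pair_prob_space \<mu>1 \<gamma>23 ..
  have s12: "sets (\<mu>1 \<Otimes>\<^sub>M \<mu>2) = sets (N \<Otimes>\<^sub>M N)" using S by (intro sets_pair_measure_cong) auto
  define f where "f = RN_deriv (\<mu>1 \<Otimes>\<^sub>M \<mu>2) \<gamma>12"
  have \<gamma>12: "\<gamma>12 = density (\<mu>1 \<Otimes>\<^sub>M \<mu>2) f"
    unfolding f_def using P.density_RN_deriv[OF ac] g12 s12 by simp
  have "f \<in> borel_measurable (\<mu>1 \<Otimes>\<^sub>M \<mu>2)" by (simp add: f_def)
  then have f[measurable]: "f \<in> borel_measurable (N \<Otimes>\<^sub>M N)" using measurable_cong_sets[OF s12 refl] by blast
  define A where "A = density (\<mu>1 \<Otimes>\<^sub>M \<gamma>23) (\<lambda>(x, y, z). f (x, y))"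
  have sA[measurable_cong]: "sets A = sets (N \<Otimes>\<^sub>M (N \<Otimes>\<^sub>M N))"
    unfolding A_def sets_density using S g23 by (intro sets_pair_measure_cong) auto
  have 1: "distr A (N \<Otimes>\<^sub>M N) (\<lambda>(x, y, z). (x, y)) = \<gamma>12"
  proof (rule measure_eqI)
    fix C assume "C \<in> sets (distr A (N \<Otimes>\<^sub>M N) (\<lambda>(x, y, z). (x, y)))"
    then have C[measurable]: "C \<in> sets (N \<Otimes>\<^sub>M N)" by simp
    have "emeasure (distr A (N \<Otimes>\<^sub>M N) (\<lambda>(x, y, z). (x, y))) C
      = (\<integral>\<^sup>+ w. indicator C w \<partial>distr A (N \<Otimes>\<^sub>M N) (\<lambda>(x, y, z). (x, y)))" by simp
    also have "\<dots> = (\<integral>\<^sup>+ (x, y, z). indicator C (x, y) \<partial>A)"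
      by (subst nn_integral_distr) (auto simp: split_beta')
    also have "\<dots> = (\<integral>\<^sup>+ (x, y, z). f (x, y) * indicator C (x, y) \<partial>(\<mu>1 \<Otimes>\<^sub>M \<gamma>23))"
      unfolding A_def by (subst nn_integral_density) (auto simp: split_beta')
    also have "\<dots> = (\<integral>\<^sup>+ x. \<integral>\<^sup>+ w. f (x, fst w) * indicator C (x, fst w) \<partial>\<gamma>23 \<partial>\<mu>1)"
      by (subst \<gamma>23.nn_integral_fst[symmetric]) (auto simp: split_beta')
    \<comment> \<open>The integrand sees only the first component of w, and that component has law
      \<open>\<mu>2\<close> under \<open>\<gamma>23\<close>.\<close>
    also have "\<dots> = (\<integral>\<^sup>+ x. \<integral>\<^sup>+ y. f (x, y) * indicator C (x, y) \<partial>\<mu>2 \<partial>\<mu>1)"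
    proof (rule nn_integral_cong)
      fix x assume "x \<in> space \<mu>1"
      then have [measurable]: "x \<in> space N" using S sets_eq_imp_space_eq by blast
      show "(\<integral>\<^sup>+ w. f (x, fst w) * indicator C (x, fst w) \<partial>\<gamma>23) = (\<integral>\<^sup>+ y. f (x, y) * indicator C (x, y) \<partial>\<mu>2)"
        unfolding g23(2)[symmetric] by (subst nn_integral_distr) auto
    qed
    also have "\<dots> = (\<integral>\<^sup>+ w. f w * indicator C w \<partial>(\<mu>1 \<Otimes>\<^sub>M \<mu>2))"
      by (subst \<mu>2.nn_integral_fst[symmetric]) auto
    also have "\<dots> = emeasure \<gamma>12 C"
      unfolding \<gamma>12 by (subst emeasure_density) auto
    finally show "emeasure (distr A (N \<Otimes>\<^sub>M N) (\<lambda>(x, y, z). (x, y))) C = emeasure \<gamma>12 C" .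
  qed (simp add: g12)
  \<comment> \<open>The second marginal of \<open>\<gamma>12\<close> is \<open>\<mu>2\<close>, so
    the density integrates to 1 over x for almost every y. This makes the projection of A to the
    last two coordinates equal to \<open>\<gamma>23\<close>.\<close>
  have int1: "AE y in \<mu>2. (\<integral>\<^sup>+ x. f (x, y) \<partial>\<mu>1) = 1"
  proof -
    let ?h = "\<lambda>y. \<integral>\<^sup>+ x. f (x, y) \<partial>\<mu>1"
    have [measurable]: "?h \<in> borel_measurable \<mu>2" by measurable
    have "density \<mu>2 ?h = density \<mu>2 (\<lambda>_. 1)"
    proof (rule measure_eqI)
      fix B assume "B \<in> sets (density \<mu>2 ?h)"
      then have B[measurable]: "B \<in> sets \<mu>2" "B \<in> sets N" using S by auto
      have "emeasure (density \<mu>2 ?h) B = (\<integral>\<^sup>+ y. \<integral>\<^sup>+ x. f (x, y) * indicator B y \<partial>\<mu>1 \<partial>\<mu>2)"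
      proof (subst emeasure_density, goal_cases)
        case 3
        show ?case
        proof (intro nn_integral_cong nn_integral_multc[symmetric])
          fix y assume "y \<in> space \<mu>2"
          then have [measurable]: "y \<in> space N" using S sets_eq_imp_space_eq by blast
          show "(\<lambda>x. f (x, y)) \<in> borel_measurable \<mu>1" by measurable
        qed
      qed auto
      also have "\<dots> = (\<integral>\<^sup>+ w. f w * indicator B (snd w) \<partial>(\<mu>1 \<Otimes>\<^sub>M \<mu>2))"
        by (subst P.nn_integral_snd[symmetric]) (auto simp: split_beta')
      also have "\<dots> = (\<integral>\<^sup>+ w. indicator B (snd w) \<partial>\<gamma>12)"
        unfolding \<gamma>12 by (subst nn_integral_density) auto
      also have "\<dots> = (\<integral>\<^sup>+ y. indicator B y \<partial>distr \<gamma>12 N snd)"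
        by (subst nn_integral_distr) auto
      finally show "emeasure (density \<mu>2 ?h) B = emeasure (density \<mu>2 (\<lambda>_. 1)) B"
        using g12 by (simp add: density_1)
    qed simp
    then show ?thesis by (subst (asm) \<mu>2.density_unique_iff) auto
  qed
  have 2: "distr A (N \<Otimes>\<^sub>M N) snd = \<gamma>23"
  proof (rule measure_eqI)
    fix C assume "C \<in> sets (distr A (N \<Otimes>\<^sub>M N) snd)"
    then have C[measurable]: "C \<in> sets (N \<Otimes>\<^sub>M N)" by simp
    have "emeasure (distr A (N \<Otimes>\<^sub>M N) snd) C = (\<integral>\<^sup>+ w. indicator C w \<partial>distr A (N \<Otimes>\<^sub>M N) snd)" by simp
    also have "\<dots> = (\<integral>\<^sup>+ w. indicator C (snd w) \<partial>A)"
      by (subst nn_integral_distr) auto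
    also have "\<dots> = (\<integral>\<^sup>+ (x, w). f (x, fst w) * indicator C w \<partial>(\<mu>1 \<Otimes>\<^sub>M \<gamma>23))"
      unfolding A_def by (subst nn_integral_density) (auto simp: split_beta')
    also have "\<dots> = (\<integral>\<^sup>+ w. \<integral>\<^sup>+ x. f (x, fst w) * indicator C w \<partial>\<mu>1 \<partial>\<gamma>23)"
      by (subst Q.nn_integral_snd[symmetric]) (auto simp: split_beta')
    also have "\<dots> = (\<integral>\<^sup>+ w. (\<integral>\<^sup>+ x. f (x, fst w) \<partial>\<mu>1) * indicator C w \<partial>\<gamma>23)"
    proof (intro nn_integral_cong nn_integral_multc)
      fix w assume "w \<in> space \<gamma>23"
      then have [measurable]: "fst w \<in> space N" using mfst by (rule measurable_space[rotated])
      show "(\<lambda>x. f (x, fst w)) \<in> borel_measurable \<mu>1" by measurable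
    qed
    also have "\<dots> = (\<integral>\<^sup>+ w. indicator C w \<partial>\<gamma>23)"
    proof (rule nn_integral_cong_AE)
      have "AE w in \<gamma>23. (\<integral>\<^sup>+ x. f (x, fst w) \<partial>\<mu>1) = 1"
        using int1 unfolding g23(2)[symmetric] by (subst (asm) AE_distr_iff) auto
      then show "AE w in \<gamma>23. (\<integral>\<^sup>+ x. f (x, fst w) \<partial>\<mu>1) * indicator C w = indicator C w" by eventually_elim simp
    qed
    finally show "emeasure (distr A (N \<Otimes>\<^sub>M N) snd) C = emeasure \<gamma>23 C" by simp
  qed (simp add: g23)
  show ?thesis using sA 1 2 by blast
qed

text \<open>Every coupling is required to have a density because the nearly optimal one is not known
  beforehand. Once glued, the two costs are added by Minkowski on the space of triples.\<close>

lemma wasserstein_triangle_ac: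
  assumes prob: "prob_Rn d \<mu>1" "prob_Rn d \<mu>2" "prob_Rn d \<mu>3" and p: "1 \<le> p"
    and fin: "wcost d p \<mu>1 \<mu>2 < \<infinity>" "wcost d p \<mu>2 \<mu>3 < \<infinity>"
    and ac: "\<And>\<gamma>. \<gamma> \<in> couplings \<mu>1 \<mu>2 \<Longrightarrow> absolutely_continuous (\<mu>1 \<Otimes>\<^sub>M \<mu>2) \<gamma>"
  shows "wasserstein d p \<mu>1 \<mu>3 \<le> wasserstein d p \<mu>1 \<mu>2 + wasserstein d p \<mu>2 \<mu>3"
proof (rule field_le_epsilon)
  fix e :: real assume e: "0 < e"
  define a where "a = wasserstein d p \<mu>1 \<mu>2 + e / 2"
  define b where "b = wasserstein d p \<mu>2 \<mu>3 + e / 2"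
  have ab: "0 < a" "0 < b" using e by (auto simp: a_def b_def add_nonneg_pos)
  have "wasserstein d p \<mu>1 \<mu>2 < a" "wasserstein d p \<mu>2 \<mu>3 < b" using e by (auto simp: a_def b_def)
  then obtain \<gamma>12 \<gamma>23 where g: "\<gamma>12 \<in> couplings \<mu>1 \<mu>2" "\<gamma>23 \<in> couplings \<mu>2 \<mu>3"
    and c: "(\<integral>\<^sup>+ z. ennreal (norm_Rn d (fst z - snd z) powr p) \<partial>\<gamma>12) < ennreal (a powr p)"
      "(\<integral>\<^sup>+ z. ennreal (norm_Rn d (fst z - snd z) powr p) \<partial>\<gamma>23) < ennreal (b powr p)"
    by (elim wasserstein_lessE[OF fin(1) _ p] wasserstein_lessE[OF fin(2) _ p]) blast
  let ?N = "borel_Rn d"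
  note S = prob[THEN prob_RnD(2)]
  note G = couplings_borel_Rn[OF g(1) S(1,2)] and H = couplings_borel_Rn[OF g(2) S(2,3)]
  obtain A where A: "sets A = sets (?N \<Otimes>\<^sub>M (?N \<Otimes>\<^sub>M ?N))"
    "distr A (?N \<Otimes>\<^sub>M ?N) (\<lambda>(x, y, z). (x, y)) = \<gamma>12" "distr A (?N \<Otimes>\<^sub>M ?N) snd = \<gamma>23"
    using glue_couplings[OF S prob[THEN prob_RnD(1)] G(1,5) H(1,4) ac[OF g(1)]] by blast
  note [measurable_cong] = A(1)
  have m12: "(\<lambda>(x, y, z). (x, y)) \<in> A \<rightarrow>\<^sub>M ?N \<Otimes>\<^sub>M ?N" and m23: "snd \<in> A \<rightarrow>\<^sub>M ?N \<Otimes>\<^sub>M ?N" by measurable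
  have m[measurable]: "fst \<in> A \<rightarrow>\<^sub>M ?N" "(\<lambda>w. fst (snd w)) \<in> A \<rightarrow>\<^sub>M ?N" "(\<lambda>w. snd (snd w)) \<in> A \<rightarrow>\<^sub>M ?N" by measurable
  have c1: "(\<integral>\<^sup>+ w. ennreal (norm_Rn d (fst w - fst (snd w)) powr p) \<partial>A) \<le> ennreal (a powr p)"
    using c(1) unfolding A(2)[symmetric] by (subst (asm) nn_integral_distr[OF m12]) (auto simp: split_beta')
  have c2: "(\<integral>\<^sup>+ w. ennreal (norm_Rn d (fst (snd w) - snd (snd w)) powr p) \<partial>A) \<le> ennreal (b powr p)"
    using c(2) unfolding A(3)[symmetric] by (subst (asm) nn_integral_distr[OF m23]) auto
  have "wasserstein d p \<mu>1 \<mu>3 \<le> a + b"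
  proof (rule wasserstein_leI)
    show "distr A ?N fst = \<mu>1"
      unfolding G(4)[symmetric] A(2)[symmetric] using m12 by (subst distr_distr) (auto simp: comp_def split_beta')
    show "distr A ?N (\<lambda>w. snd (snd w)) = \<mu>3"
      unfolding H(5)[symmetric] A(3)[symmetric] using m23 by (subst distr_distr) (auto simp: comp_def)
    have "(\<integral>\<^sup>+ w. ennreal (norm_Rn d (fst w - snd (snd w)) powr p) \<partial>A)
      \<le> (\<integral>\<^sup>+ w. ennreal ((norm_Rn d (fst w - fst (snd w)) + norm_Rn d (fst (snd w) - snd (snd w))) powr p) \<partial>A)"
      using p by (intro nn_integral_mono ennreal_leI powr_mono2 norm_Rn_diff_triangle) auto
    also have "\<dots> \<le> ennreal ((a + b) powr p)"
      using ab p c1 c2 m by (intro nn_integral_Minkowski measurable_norm_Rn measurable_Rn_diff) auto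
    finally show "(\<integral>\<^sup>+ w. ennreal (norm_Rn d (fst w - snd (snd w)) powr p) \<partial>A) \<le> ennreal ((a + b) powr p)" .
  qed (use ab p m in auto)
  then show "wasserstein d p \<mu>1 \<mu>3 \<le> wasserstein d p \<mu>1 \<mu>2 + wasserstein d p \<mu>2 \<mu>3 + e"
    by (simp add: a_def b_def)
qed

section \<open>Empirical measures and their couplings\<close>

lemma measurable_empirical_points:
  assumes "\<And>j. j < n \<Longrightarrow> x j \<in> Rn d"
  shows "x \<in> uniform_count_measure {..<n} \<rightarrow>\<^sub>M borel_Rn d"
  by (rule measurableI)
    (use assms in \<open>auto simp: space_borel_Rn space_uniform_count_measure sets_uniform_count_measure\<close>)

lemma prob_Rn_empirical:
  assumes "\<And>j. j < n \<Longrightarrow> x j \<in> Rn d" "0 < n"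
  shows "prob_Rn d (empirical d n x)"
  unfolding empirical_def
  using assms by (intro prob_Rn_distr measurable_empirical_points prob_space_uniform_count_measure) auto

lemma nn_integral_uniform_count:
  assumes "0 < n" "\<And>j. j < n \<Longrightarrow> 0 \<le> f j"
  shows "(\<integral>\<^sup>+ j. ennreal (f j) \<partial>uniform_count_measure {..<n}) = ennreal ((\<Sum>j<n. f j) / real n)"
proof -
  have "(\<integral>\<^sup>+ j. ennreal (f j) \<partial>uniform_count_measure {..<n}) = (\<Sum>j<n. ennreal (1 / real n) * ennreal (f j))"
    unfolding uniform_count_measure_def by (subst nn_integral_point_measure_finite) auto
  also have "\<dots> = (\<Sum>j<n. ennreal (f j / real n))"
    using assms by (intro sum.cong) (auto simp: ennreal_mult[symmetric])
  also have "\<dots> = ennreal (\<Sum>j<n. f j / real n)" using assms by (intro sum_ennreal) auto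
  finally show ?thesis by (simp add: sum_divide_distrib)
qed

lemma finite_moment_empirical:
  assumes "\<And>j. j < n \<Longrightarrow> x j \<in> Rn d" "0 < n"
  shows "finite_moment d p (empirical d n x)"
  using assms unfolding empirical_def
  by (subst finite_moment_distr[OF measurable_empirical_points])
    (auto simp: nn_integral_uniform_count)

lemma AE_empirical:
  assumes "\<And>j. j < n \<Longrightarrow> x j \<in> Rn d" "0 < n"
  shows "AE y in empirical d n x. y \<in> x ` {..<n}"
proof -
  have "(\<Union>j<n. {x j}) \<in> sets (borel_Rn d)" using assms by (intro sets.finite_UN singleton_sets_Rn) auto
  then have [measurable]: "x ` {..<n} \<in> sets (borel_Rn d)" by (simp add: UNION_singleton_eq_range)
  have eq: "{y \<in> space (borel_Rn d). y \<in> x ` {..<n}} = x ` {..<n}"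
    using assms by (auto simp: space_borel_Rn)
  show ?thesis unfolding empirical_def
    by (subst AE_distr_iff[OF measurable_empirical_points[OF assms(1)]])
      (auto intro!: AE_I2 simp: space_uniform_count_measure eq)
qed

lemma emeasure_empirical_point:
  assumes "\<And>j. j < n \<Longrightarrow> x j \<in> Rn d" "j < n"
  shows "emeasure (empirical d n x) {x j} > 0"
proof -
  have "(1::real) \<le> (\<Sum>i<n. indicator {x j} (x i))"
    using member_le_sum[of j "{..<n}" "\<lambda>i. indicator {x j} (x i) :: real"] assms by auto
  then have "(0::real) < (\<Sum>i<n. indicator {x j} (x i)) / real n" using assms by (intro divide_pos_pos) auto
  then show ?thesis using assms by (subst emeasure_empirical) (auto intro!: singleton_sets_Rn)
qed

text \<open>The coupling lives on the finitely many lines over the sample points. A null set of the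
  product has a \<nu>-null section over each atom, and the second marginal turns these finitely many
  null sections into a null set of the coupling.\<close>

lemma coupling_empirical_ac:
  assumes x: "\<And>j. j < n \<Longrightarrow> x j \<in> Rn d" "0 < n" and \<nu>: "prob_Rn d \<nu>"
    and g: "\<gamma> \<in> couplings (empirical d n x) \<nu>"
  shows "absolutely_continuous (empirical d n x \<Otimes>\<^sub>M \<nu>) \<gamma>"
  unfolding absolutely_continuous_def
proof
  let ?\<mu> = "empirical d n x"
  have p\<mu>: "prob_Rn d (empirical d n x)" by (rule prob_Rn_empirical) (use x in auto)
  note S = prob_RnD(2)[OF p\<mu>] prob_RnD(2)[OF \<nu>]
  note G = couplings_borel_Rn[OF g S]
  interpret \<nu>: prob_space \<nu> using \<nu> by (rule prob_RnD)
  have sP: "sets (?\<mu> \<Otimes>\<^sub>M \<nu>) = sets (borel_Rn d \<Otimes>\<^sub>M borel_Rn d)"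
    using S by (intro sets_pair_measure_cong) auto
  fix C assume C: "C \<in> null_sets (?\<mu> \<Otimes>\<^sub>M \<nu>)"
  then have Cs: "C \<in> sets (?\<mu> \<Otimes>\<^sub>M \<nu>)" and C0: "emeasure (?\<mu> \<Otimes>\<^sub>M \<nu>) C = 0" by auto
  have Cx: "Pair a -` C \<in> sets \<nu>" for a using Cs by (rule sets_Pair1)
  have "AE a in ?\<mu>. emeasure \<nu> (Pair a -` C) = 0"
    using C0 by (subst (asm) \<nu>.emeasure_pair_measure_alt[OF Cs], subst (asm) nn_integral_0_iff_AE)
      (auto intro!: \<nu>.measurable_emeasure_Pair[OF Cs])
  \<comment> \<open>Each sample point is an atom of positive mass, so an almost sure statement about
    sections holds at every sample point.\<close>
  then have null: "emeasure \<nu> (Pair (x j) -` C) = 0" if "j < n" for j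
  proof -
    have "{a \<in> space ?\<mu>. emeasure \<nu> (Pair a -` C) \<noteq> 0} \<in> null_sets ?\<mu>"
      using \<open>AE a in ?\<mu>. emeasure \<nu> (Pair a -` C) = 0\<close> \<nu>.measurable_emeasure_Pair[OF Cs]
      by (subst (asm) AE_iff_null) auto
    moreover have "{x j} \<in> sets ?\<mu>" using S x that by (simp add: singleton_sets_Rn)
    ultimately have "emeasure ?\<mu> {x j} = 0" if "emeasure \<nu> (Pair (x j) -` C) \<noteq> 0"
      using that x \<open>j < n\<close> prob_RnD(3)[OF p\<mu>] by (auto intro: emeasure_eq_0 simp: null_sets_def)
    then show ?thesis using emeasure_empirical_point[of n x d j] x that
      by (cases "emeasure \<nu> (Pair (x j) -` C) = 0") auto
  qed
  have 1: "AE z in \<gamma>. fst z \<in> x ` {..<n}"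
  proof (rule AE_distrD[OF G(2)])
    show "AE y in distr \<gamma> (borel_Rn d) fst. y \<in> x ` {..<n}"
      unfolding G(4) by (rule AE_empirical) (use x in auto)
  qed
  have "AE y in \<nu>. y \<notin> Pair (x j) -` C" if "j < n" for j
    using null[OF that] Cx by (intro AE_not_in) auto
  then have "AE y in distr \<gamma> (borel_Rn d) snd. \<forall>j\<in>{..<n}. y \<notin> Pair (x j) -` C"
    unfolding G(5) by (intro AE_finite_allI) auto
  then have "AE z in \<gamma>. \<forall>j\<in>{..<n}. snd z \<notin> Pair (x j) -` C"
    by (rule AE_distrD[OF G(3)])
  with 1 have "AE z in \<gamma>. z \<notin> C"
  proof eventually_elim
    case (elim z)
    then show ?case by (cases z) auto
  qed
  moreover have "C \<in> sets \<gamma>" using Cs G(1) sP by simp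
  ultimately show "C \<in> null_sets \<gamma>" by (simp add: AE_iff_null_sets)
qed

lemma couplings_swap:
  assumes g: "\<gamma> \<in> couplings \<mu> \<nu>" shows "distr \<gamma> (\<nu> \<Otimes>\<^sub>M \<mu>) (\<lambda>z. (snd z, fst z)) \<in> couplings \<nu> \<mu>"
proof (rule coupling_distr)
  have [measurable_cong]: "sets \<gamma> = sets (\<mu> \<Otimes>\<^sub>M \<nu>)" using g by (simp add: couplings_def)
  show "snd \<in> \<gamma> \<rightarrow>\<^sub>M \<nu>" "fst \<in> \<gamma> \<rightarrow>\<^sub>M \<mu>" by measurable
qed (use g in \<open>auto simp: couplings_def\<close>)

text \<open>Gluing needs a density for couplings of the first two measures. If the empirical measure
  is the middle one, swapping the coordinates gives it; if it is the last one, the chain is read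
  backwards.\<close>

lemma wasserstein_triangle:
  assumes prob: "prob_Rn d \<mu>1" "prob_Rn d \<mu>2" "prob_Rn d \<mu>3" and p: "1 \<le> p"
    and fin: "finite_moment d p \<mu>1" "finite_moment d p \<mu>2" "finite_moment d p \<mu>3"
    and x: "\<And>j. j < n \<Longrightarrow> x j \<in> Rn d" "0 < n"
    and e: "\<mu>1 = empirical d n x \<or> \<mu>2 = empirical d n x \<or> \<mu>3 = empirical d n x"
  shows "wasserstein d p \<mu>1 \<mu>3 \<le> wasserstein d p \<mu>1 \<mu>2 + wasserstein d p \<mu>2 \<mu>3"
proof -
  have 1: "wasserstein d p \<alpha> \<beta> \<le> wasserstein d p \<alpha> \<delta> + wasserstein d p \<delta> \<beta>"
    if "prob_Rn d \<alpha>" "prob_Rn d \<beta>" "prob_Rn d \<delta>" "finite_moment d p \<alpha>" "finite_moment d p \<beta>"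
      "finite_moment d p \<delta>" "\<alpha> = empirical d n x" for \<alpha> \<beta> \<delta>
    using that p by (intro wasserstein_triangle_ac wcost_finite) (auto intro!: coupling_empirical_ac x)
  have 2: "wasserstein d p \<alpha> \<beta> \<le> wasserstein d p \<alpha> \<delta> + wasserstein d p \<delta> \<beta>"
    if *: "prob_Rn d \<alpha>" "prob_Rn d \<beta>" "prob_Rn d \<delta>" "finite_moment d p \<alpha>" "finite_moment d p \<beta>"
      "finite_moment d p \<delta>" "\<delta> = empirical d n x" for \<alpha> \<beta> \<delta>
  proof (intro wasserstein_triangle_ac wcost_finite that p)
    fix \<gamma> assume g: "\<gamma> \<in> couplings \<alpha> \<delta>"
    interpret \<alpha>: prob_space \<alpha> using * by (simp add: prob_RnD)
    interpret \<delta>: prob_space \<delta> using * by (simp add: prob_RnD)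
    interpret P: pair_sigma_finite \<alpha> \<delta> ..
    interpret P': pair_sigma_finite \<delta> \<alpha> ..
    have [measurable_cong]: "sets \<gamma> = sets (\<alpha> \<Otimes>\<^sub>M \<delta>)" using g by (simp add: couplings_def)
    let ?\<gamma> = "distr \<gamma> (\<delta> \<Otimes>\<^sub>M \<alpha>) (\<lambda>z. (snd z, fst z))"
    \<comment> \<open>The swapped coupling has the empirical measure in front; null sets are then
      carried back through the swap.\<close>
    have ac: "absolutely_continuous (\<delta> \<Otimes>\<^sub>M \<alpha>) ?\<gamma>"
      using coupling_empirical_ac[where x=x, OF x \<open>prob_Rn d \<alpha>\<close>] couplings_swap[OF g] that by blast
    show "absolutely_continuous (\<alpha> \<Otimes>\<^sub>M \<delta>) \<gamma>"
      unfolding absolutely_continuous_def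
    proof
      fix C assume "C \<in> null_sets (\<alpha> \<Otimes>\<^sub>M \<delta>)"
      then have C[measurable]: "C \<in> sets (\<alpha> \<Otimes>\<^sub>M \<delta>)" and C0: "emeasure (\<alpha> \<Otimes>\<^sub>M \<delta>) C = 0" by auto
      let ?C = "(\<lambda>z. (snd z, fst z)) -` C \<inter> space (\<delta> \<Otimes>\<^sub>M \<alpha>)"
      have s[measurable]: "?C \<in> sets (\<delta> \<Otimes>\<^sub>M \<alpha>)" by measurable
      have "emeasure (\<delta> \<Otimes>\<^sub>M \<alpha>) ?C = 0"
        using C0 arg_cong[OF P.distr_pair_swap, of "\<lambda>M. emeasure M C"]
        by (simp add: emeasure_distr split_beta')
      then have "emeasure ?\<gamma> ?C = 0" using absolutely_continuousD[OF ac s] by simp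
      then have "emeasure \<gamma> ((\<lambda>z. (snd z, fst z)) -` ?C \<inter> space \<gamma>) = 0"
        by (subst (asm) emeasure_distr) auto
      also have "(\<lambda>z. (snd z, fst z)) -` ?C \<inter> space \<gamma> = C"
        using sets.sets_into_space[OF C] sets_eq_imp_space_eq[of \<gamma> "\<alpha> \<Otimes>\<^sub>M \<delta>"] g
        by (auto simp: space_pair_measure couplings_def)
      finally show "C \<in> null_sets \<gamma>" using C g by (auto simp: couplings_def)
    qed
  qed
  note S = prob[THEN prob_RnD(2)]
  show ?thesis using e
  proof (elim disjE)
    assume "\<mu>3 = empirical d n x"
    from 1[OF prob(3,1,2) fin(3,1,2) this] show ?thesis
      using wasserstein_sym[of \<mu>1 d \<mu>3] wasserstein_sym[of \<mu>1 d \<mu>2] wasserstein_sym[of \<mu>2 d \<mu>3] S by simp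
  qed (use 1 2 prob fin in auto)
qed

text \<open>Samples are matched index by index, with the uniform measure on the indices as common
  space. All Lipschitz bounds in the sample come from this matching.\<close>

lemma wasserstein_empirical_le:
  assumes x: "\<And>j. j < n \<Longrightarrow> x j \<in> Rn d" and y: "\<And>j. j < n \<Longrightarrow> y j \<in> Rn d" and n: "0 < n" and p: "1 \<le> p"
  shows "wasserstein d p (empirical d n x) (empirical d n y)
    \<le> ((\<Sum>j<n. norm_Rn d (x j - y j) powr p) / real n) powr (1 / p)"
  using p n
  by (intro wasserstein_leI[OF measurable_empirical_points[OF x] measurable_empirical_points[OF y]])
    (auto simp: empirical_def nn_integral_uniform_count powr_powr sum_nonneg)

section \<open>Concentration from the transport inequality\<close>

text \<open>The easy half of Kantorovich duality: the pointwise bound is integrated against a nearly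
  optimal coupling, whose marginals separate g and h.\<close>

lemma coupling_dual_bound:
  assumes prob: "prob_Rn d \<nu>" "prob_Rn d \<mu>" and fin: "wcost d p \<nu> \<mu> < \<infinity>" and p: "1 \<le> p" and c: "0 \<le> c"
    and g: "integrable \<nu> g" "g \<in> borel_measurable (borel_Rn d)" and h: "integrable \<mu> h" "h \<in> borel_measurable (borel_Rn d)"
    and gh: "\<And>x y. x \<in> Rn d \<Longrightarrow> y \<in> Rn d \<Longrightarrow> g x - h y \<le> c * norm_Rn d (x - y) powr p"
  shows "(\<integral>x. g x \<partial>\<nu>) - (\<integral>x. h x \<partial>\<mu>) \<le> c * wasserstein d p \<nu> \<mu> powr p"
proof (rule field_le_epsilon)
  fix e :: real assume e: "0 < e"
  define e' where "e' = e / (c + 1)"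
  have e': "0 < e'" "c * e' \<le> e" using e c by (auto simp: e'_def field_simps)
  let ?W = "enn2real (wcost d p \<nu> \<mu>)"
  have W: "wcost d p \<nu> \<mu> = ennreal ?W" using fin by simp
  have "wcost d p \<nu> \<mu> < ennreal (?W + e')" using e' by (subst W) (simp add: ennreal_less_iff)
  then obtain \<gamma> where \<gamma>: "\<gamma> \<in> couplings \<nu> \<mu>"
    and cost: "(\<integral>\<^sup>+ z. ennreal (norm_Rn d (fst z - snd z) powr p) \<partial>\<gamma>) < ennreal (?W + e')"
    unfolding wcost_def INF_less_iff by blast
  note G = couplings_borel_Rn[OF \<gamma> prob_RnD(2)[OF prob(1)] prob_RnD(2)[OF prob(2)]]
  have m[measurable]: "(\<lambda>z. norm_Rn d (fst z - snd z)) \<in> borel_measurable \<gamma>"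
    by (rule measurable_norm_Rn[OF measurable_Rn_diff[OF G(2,3)]])
  have ci: "integrable \<gamma> (\<lambda>z. norm_Rn d (fst z - snd z) powr p)"
    using order.strict_trans[OF cost ennreal_less_top] by (intro integrableI_bounded) auto
  have "(\<integral>z. norm_Rn d (fst z - snd z) powr p \<partial>\<gamma>) = enn2real (\<integral>\<^sup>+ z. ennreal (norm_Rn d (fst z - snd z) powr p) \<partial>\<gamma>)"
    by (rule integral_eq_nn_integral) auto
  also have "\<dots> \<le> ?W + e'"
    using cost e' by (intro enn2real_leI) (auto simp: less_imp_le)
  finally have cost': "(\<integral>z. norm_Rn d (fst z - snd z) powr p \<partial>\<gamma>) \<le> ?W + e'" .
  have gi: "integrable \<gamma> (\<lambda>z. g (fst z))" and gI: "(\<integral>x. g x \<partial>\<nu>) = (\<integral>z. g (fst z) \<partial>\<gamma>)"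
    using g integrable_distr_eq[OF G(2) g(2)] integral_distr[OF G(2) g(2)] by (auto simp: G(4))
  have hi: "integrable \<gamma> (\<lambda>z. h (snd z))" and hI: "(\<integral>x. h x \<partial>\<mu>) = (\<integral>z. h (snd z) \<partial>\<gamma>)"
    using h integrable_distr_eq[OF G(3) h(2)] integral_distr[OF G(3) h(2)] by (auto simp: G(5))
  have "(\<integral>x. g x \<partial>\<nu>) - (\<integral>x. h x \<partial>\<mu>) = (\<integral>z. g (fst z) - h (snd z) \<partial>\<gamma>)"
    unfolding gI hI by (rule Bochner_Integration.integral_diff[symmetric, OF gi hi])
  also have "\<dots> \<le> (\<integral>z. c * norm_Rn d (fst z - snd z) powr p \<partial>\<gamma>)"
  proof (rule integral_mono)
    fix z assume "z \<in> space \<gamma>"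
    then show "g (fst z) - h (snd z) \<le> c * norm_Rn d (fst z - snd z) powr p"
      using G(2,3) by (intro gh) (auto dest: measurable_space simp: space_borel_Rn)
  qed (use gi hi ci in auto)
  also have "\<dots> \<le> c * (?W + e')" using cost' c by (simp add: mult_left_mono)
  also have "\<dots> \<le> c * ?W + e" using e' by (simp add: algebra_simps)
  finally show "(\<integral>x. g x \<partial>\<nu>) - (\<integral>x. h x \<partial>\<mu>) \<le> c * wasserstein d p \<nu> \<mu> powr p + e"
    using p by (simp add: wasserstein_powr)
qed

text \<open>The test measure is the Gibbs measure \<nu> with density exp g / Z, for which
  D(\<nu>||\<mu>) is the \<nu>-integral of g minus ln Z. Duality bounds the difference of the
  integrals of g and h by s W^p / (2 \<sigma>^2), hence by (W^2 + \<phi>) / (2 \<sigma>^2), hence by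
  D + \<phi> / (2 \<sigma>^2); the integral of g cancels and ln Z is left. The number \<phi> is the
  price for replacing the p-th power of the cost by the square in the transport inequality.\<close>

lemma transport_inequality_dual:
  assumes T: "transport_inequality d p (\<sigma>\<^sup>2) \<mu>" and p: "1 \<le> p" and \<sigma>: "0 < \<sigma>"
    and s: "0 \<le> s" "\<And>w. 0 \<le> w \<Longrightarrow> s * w powr p \<le> w\<^sup>2 + \<phi>"
    and gm: "g \<in> borel_measurable \<mu>" and hm: "h \<in> borel_measurable \<mu>"
    and bd: "\<And>x. x \<in> Rn d \<Longrightarrow> \<bar>g x\<bar> \<le> K" "\<And>x. x \<in> Rn d \<Longrightarrow> \<bar>h x\<bar> \<le> K"
    and gh: "\<And>x y. x \<in> Rn d \<Longrightarrow> y \<in> Rn d \<Longrightarrow> g x - h y \<le> s / (2 * \<sigma>\<^sup>2) * norm_Rn d (x - y) powr p"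
  shows "(\<integral>x. exp (g x) \<partial>\<mu>) \<le> exp ((\<integral>x. h x \<partial>\<mu>) + \<phi> / (2 * \<sigma>\<^sup>2))"
proof -
  note [measurable] = gm hm
  have prob: "prob_Rn d \<mu>" and mom: "finite_moment d p \<mu>" using T by (auto simp: transport_inequality_def)
  interpret prob_space \<mu> using prob by (rule prob_RnD)
  have sp: "space \<mu> = Rn d" and [measurable_cong]: "sets \<mu> = sets (borel_Rn d)" using prob by (auto simp: prob_RnD)
  have gi: "integrable \<mu> g" and hi: "integrable \<mu> h"
    using bd by (auto intro!: integrable_const_bound[where B=K] AE_I2 simp: sp)
  have ei: "integrable \<mu> (\<lambda>x. exp (g x))"
    using bd by (auto intro!: integrable_const_bound[where B="exp K"] AE_I2 simp: sp abs_le_iff)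
  define Z where "Z = (\<integral>x. exp (g x) \<partial>\<mu>)"
  have "exp (- K) \<le> Z"
    unfolding Z_def using bd by (intro integral_ge_const ei AE_I2) (auto simp: sp abs_le_iff minus_le_iff)
  then have Z: "0 < Z" using exp_gt_zero less_le_trans by blast
  define f where "f x = exp (g x) / Z" for x
  have f[measurable]: "f \<in> borel_measurable \<mu>" unfolding f_def by measurable
  have f0: "0 < f x" for x using Z by (simp add: f_def)
  have fK: "f x \<le> exp K / Z" if "x \<in> Rn d" for x
    unfolding f_def using bd(1)[OF that] Z by (intro divide_right_mono) auto
  have lnf: "ln (f x) = g x - ln Z" for x using Z by (simp add: f_def ln_div)
  define \<nu> where "\<nu> = density \<mu> (\<lambda>x. ennreal (f x))"
  have snu[measurable_cong]: "sets \<nu> = sets \<mu>" and spn: "space \<nu> = space \<mu>" by (auto simp: \<nu>_def)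
  have fi: "integrable \<mu> f" unfolding f_def using ei by simp
  have "emeasure \<nu> (space \<nu>) = (\<integral>\<^sup>+ x. ennreal (f x) \<partial>\<mu>)"
    unfolding \<nu>_def by (simp add: emeasure_density)
  also have "\<dots> = ennreal (\<integral>x. f x \<partial>\<mu>)" using fi f0 by (intro nn_integral_eq_integral) (auto simp: less_imp_le)
  also have "(\<integral>x. f x \<partial>\<mu>) = 1" unfolding f_def using Z by (simp add: Z_def[symmetric])
  finally have "prob_space \<nu>" by (intro prob_spaceI) simp
  then have prob\<nu>: "prob_Rn d \<nu>" using snu prob by (simp add: prob_Rn_def)
  interpret \<nu>: prob_space \<nu> by fact
  \<comment> \<open>The density is bounded because g is, so \<nu> inherits the finite p-th moment
    and may be used in the transport inequality.\<close>
  have mom\<nu>: "finite_moment d p \<nu>"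
  proof -
    have [measurable]: "norm_Rn d \<in> borel_measurable \<mu>" using measurable_norm_Rn[of "\<lambda>x. x" \<mu> d] by simp
    have "(\<integral>\<^sup>+ x. ennreal (norm_Rn d x powr p) \<partial>\<nu>) = (\<integral>\<^sup>+ x. ennreal (f x) * ennreal (norm_Rn d x powr p) \<partial>\<mu>)"
      unfolding \<nu>_def by (rule nn_integral_density) measurable
    also have "\<dots> \<le> (\<integral>\<^sup>+ x. ennreal (exp K / Z) * ennreal (norm_Rn d x powr p) \<partial>\<mu>)"
      by (intro nn_integral_mono mult_right_mono ennreal_leI fK) (auto simp: sp)
    also have "\<dots> = ennreal (exp K / Z) * (\<integral>\<^sup>+ x. ennreal (norm_Rn d x powr p) \<partial>\<mu>)"
      by (rule nn_integral_cmult) measurable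
    also have "\<dots> < \<infinity>" using mom by (simp add: finite_moment_def ennreal_mult_less_top)
    finally show ?thesis by (simp add: finite_moment_def)
  qed
  have gi\<nu>: "integrable \<nu> g"
    using bd by (intro \<nu>.integrable_const_bound[where B=K] AE_I2) (auto simp: sp spn)
  have ac: "absolutely_continuous \<mu> \<nu>" unfolding \<nu>_def by (rule absolutely_continuousI_density) measurable
  have "density \<mu> (RN_deriv \<mu> \<nu>) = density \<mu> (\<lambda>x. ennreal (f x))"
    unfolding \<nu>_def by (intro density_RN_deriv_density) auto
  then have "AE x in \<mu>. RN_deriv \<mu> \<nu> x = ennreal (f x)"
    by (intro density_unique) auto
  then have "AE x in \<nu>. RN_deriv \<mu> \<nu> x = ennreal (f x)"
    using absolutely_continuous_AE[OF snu ac] by blast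
  then have ent: "AE x in \<nu>. entropy_density (exp 1) \<mu> \<nu> x = g x - ln Z"
  proof eventually_elim
    case (elim x)
    then show ?case using f0[of x] lnf[of x] by (simp add: entropy_density_def log_ln[symmetric])
  qed
  have [measurable]: "entropy_density (exp 1) \<mu> \<nu> \<in> borel_measurable \<nu>"
    using measurable_entropy_density[of "exp 1" \<mu> \<nu>] by measurable
  have "integrable \<nu> (\<lambda>x. g x - ln Z)" using gi\<nu> by auto
  then have "integrable \<nu> (entropy_density (exp 1) \<mu> \<nu>)"
    using ent by (subst integrable_cong_AE[where g="\<lambda>x. g x - ln Z"]) auto
  moreover have "KL_divergence (exp 1) \<mu> \<nu> = (\<integral>x. g x \<partial>\<nu>) - ln Z"
  proof -
    have "KL_divergence (exp 1) \<mu> \<nu> = (\<integral>x. g x - ln Z \<partial>\<nu>)"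
      unfolding KL_divergence_def using ent by (intro integral_cong_AE) auto
    also have "\<dots> = (\<integral>x. g x \<partial>\<nu>) - ln Z" using gi\<nu> \<nu>.prob_space by simp
    finally show ?thesis .
  qed
  ultimately have KL: "KL_div \<nu> \<mu> = ereal ((\<integral>x. g x \<partial>\<nu>) - ln Z)" using ac by (simp add: KL_div_def)
  let ?W = "wasserstein d p \<nu> \<mu>" and ?r = "2 * \<sigma>\<^sup>2 * ((\<integral>x. g x \<partial>\<nu>) - ln Z)"
  have "?W \<le> sqrt ?r"
    using T prob\<nu> mom\<nu> KL unfolding transport_inequality_def by (auto dest: spec[of _ \<nu>])
  moreover have W0: "0 \<le> ?W" by simp
  \<comment> \<open>\<open>sqrt\<close> is negative at negative arguments, so W \<le> sqrt r also
    says that r \<ge> 0, and squaring is justified.\<close>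
  ultimately have "0 \<le> sqrt ?r" "?W\<^sup>2 \<le> (sqrt ?r)\<^sup>2" by (linarith, intro power_mono)
  then have W2: "?W\<^sup>2 \<le> ?r" by (metis real_sqrt_ge_0_iff real_sqrt_pow2)
  have "(\<integral>x. g x \<partial>\<nu>) - (\<integral>x. h x \<partial>\<mu>) \<le> s / (2 * \<sigma>\<^sup>2) * ?W powr p"
    using s \<sigma> by (intro coupling_dual_bound prob\<nu> prob p gi\<nu> hi gh wcost_finite mom\<nu> mom) measurable
  also have "\<dots> = s * ?W powr p / (2 * \<sigma>\<^sup>2)" by simp
  also have "\<dots> \<le> (?r + \<phi>) / (2 * \<sigma>\<^sup>2)"
    using s(2)[OF W0] W2 \<sigma> by (intro divide_right_mono) auto
  also have "\<dots> = (\<integral>x. g x \<partial>\<nu>) - ln Z + \<phi> / (2 * \<sigma>\<^sup>2)" using \<sigma> by (simp add: field_simps)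
  finally have "ln Z \<le> (\<integral>x. h x \<partial>\<mu>) + \<phi> / (2 * \<sigma>\<^sup>2)" by simp
  then have "exp (ln Z) \<le> exp ((\<integral>x. h x \<partial>\<mu>) + \<phi> / (2 * \<sigma>\<^sup>2))" by simp
  then show ?thesis using Z by (simp add: Z_def[symmetric])
qed

text \<open>The dual form tensorizes by integrating one coordinate at a time: the logarithm of the partial
  integral of \<open>exp g\<close> and the shifted partial integral of \<open>h\<close> satisfy the same inequality.\<close>

lemma transport_inequality_dual_product:
  assumes T: "transport_inequality d p (\<sigma>\<^sup>2) \<mu>" and p: "1 \<le> p" and \<sigma>: "0 < \<sigma>"
    and s: "0 \<le> s" "\<And>w. 0 \<le> w \<Longrightarrow> s * w powr p \<le> w\<^sup>2 + \<phi>" and I: "finite I"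
    and gh: "g \<in> borel_measurable (PiM I (\<lambda>_. \<mu>))" "h \<in> borel_measurable (PiM I (\<lambda>_. \<mu>))"
    and bd: "\<And>x. x \<in> space (PiM I (\<lambda>_. \<mu>)) \<Longrightarrow> \<bar>g x\<bar> \<le> K" "\<And>x. x \<in> space (PiM I (\<lambda>_. \<mu>)) \<Longrightarrow> \<bar>h x\<bar> \<le> K"
    and le: "\<And>x y. x \<in> space (PiM I (\<lambda>_. \<mu>)) \<Longrightarrow> y \<in> space (PiM I (\<lambda>_. \<mu>)) \<Longrightarrow>
      g x - h y \<le> s / (2 * \<sigma>\<^sup>2) * (\<Sum>i\<in>I. norm_Rn d (x i - y i) powr p)"
  shows "(\<integral>x. exp (g x) \<partial>PiM I (\<lambda>_. \<mu>)) \<le> exp ((\<integral>x. h x \<partial>PiM I (\<lambda>_. \<mu>)) + real (card I) * (\<phi> / (2 * \<sigma>\<^sup>2)))"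
  using I gh bd le
proof (induction I arbitrary: g h K rule: finite_induct)
  case empty
  then show ?case
    by (auto simp: PiM_empty lebesgue_integral_count_space_finite)
next
  case (insert i I g h K)
  have prob: "prob_Rn d \<mu>" using T by (auto simp: transport_inequality_def)
  interpret prob_space \<mu> using prob by (rule prob_RnD)
  interpret product_sigma_finite "\<lambda>_. \<mu>" ..
  let ?P = "PiM I (\<lambda>_. \<mu>)" and ?Q = "PiM (insert i I) (\<lambda>_. \<mu>)" and ?c = "s / (2 * \<sigma>\<^sup>2)"
  interpret P: prob_space ?P by (rule prob_space_PiM) unfold_locales
  interpret Q: prob_space ?Q by (rule prob_space_PiM) unfold_locales
  have sp: "space \<mu> = Rn d" using prob by (simp add: prob_RnD)
  note [measurable] = insert.prems(1,2)
  have upd: "x(i := t) \<in> space ?Q" if "x \<in> space ?P" "t \<in> Rn d" for x t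
    using that by (auto simp: space_PiM PiE_def extensional_def sp)
  have mu[measurable]: "(\<lambda>(x, t). x(i := t)) \<in> ?P \<Otimes>\<^sub>M \<mu> \<rightarrow>\<^sub>M ?Q"
    using measurable_add_dim[of i I "\<lambda>_. \<mu>"] by simp
  define G where "G x = ln (\<integral>t. exp (g (x(i := t))) \<partial>\<mu>)" for x
  define H where "H x = (\<integral>t. h (x(i := t)) \<partial>\<mu>) + \<phi> / (2 * \<sigma>\<^sup>2)" for x
  have m1: "(\<lambda>t. x(i := t)) \<in> \<mu> \<rightarrow>\<^sub>M ?Q" if "x \<in> space ?P" for x
    using measurable_compose[OF measurable_Pair1'[OF that] mu] by simp
  have gxm: "(\<lambda>t. g (x(i := t))) \<in> borel_measurable \<mu>" and hxm: "(\<lambda>t. h (x(i := t))) \<in> borel_measurable \<mu>"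
    if "x \<in> space ?P" for x
    by (rule measurable_compose[OF m1[OF that] insert.prems(1)], rule measurable_compose[OF m1[OF that] insert.prems(2)])
  have ebd: "exp (- K) \<le> (\<integral>t. exp (g (x(i := t))) \<partial>\<mu>)" "(\<integral>t. exp (g (x(i := t))) \<partial>\<mu>) \<le> exp K"
    if x: "x \<in> space ?P" for x
  proof -
    have b: "\<bar>g (x(i := t))\<bar> \<le> K" if "t \<in> Rn d" for t using insert.prems(3) upd x that by blast
    have ei: "integrable \<mu> (\<lambda>t. exp (g (x(i := t))))"
      using gxm[OF x] b by (intro integrable_const_bound[where B="exp K"] AE_I2) (auto simp: sp abs_le_iff)
    show "exp (- K) \<le> (\<integral>t. exp (g (x(i := t))) \<partial>\<mu>)" "(\<integral>t. exp (g (x(i := t))) \<partial>\<mu>) \<le> exp K"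
      using b by (auto intro!: integral_ge_const integral_le_const ei AE_I2 simp: sp abs_le_iff minus_le_iff)
  qed
  have epos: "0 < (\<integral>t. exp (g (x(i := t))) \<partial>\<mu>)" if "x \<in> space ?P" for x
    using ebd(1)[OF that] exp_gt_zero less_le_trans by blast
  have expG: "exp (G x) = (\<integral>t. exp (g (x(i := t))) \<partial>\<mu>)" if "x \<in> space ?P" for x
    using epos[OF that] by (simp add: G_def)
  have hi: "integrable \<mu> (\<lambda>t. h (x(i := t)))" if x: "x \<in> space ?P" for x
    using hxm[OF x] insert.prems(4) upd x by (intro integrable_const_bound[where B=K] AE_I2) (auto simp: sp)
  have hbd: "\<bar>\<integral>t. h (x(i := t)) \<partial>\<mu>\<bar> \<le> K" if x: "x \<in> space ?P" for x
  proof -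
    have b: "\<bar>h (x(i := t))\<bar> \<le> K" if "t \<in> Rn d" for t using insert.prems(4) upd x that by blast
    have "- K \<le> (\<integral>t. h (x(i := t)) \<partial>\<mu>)" "(\<integral>t. h (x(i := t)) \<partial>\<mu>) \<le> K"
      using b by (auto intro!: integral_ge_const integral_le_const hi[OF x] AE_I2 simp: sp abs_le_iff minus_le_iff)
    then show ?thesis by (simp add: abs_le_iff)
  qed
  have "(\<integral>x. exp (G x) \<partial>?P) \<le> exp ((\<integral>x. H x \<partial>?P) + real (card I) * (\<phi> / (2 * \<sigma>\<^sup>2)))"
  proof (rule insert.IH[where K = "K + \<bar>\<phi> / (2 * \<sigma>\<^sup>2)\<bar>"])
    show "G \<in> borel_measurable ?P" "H \<in> borel_measurable ?P" unfolding G_def H_def by measurable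
    fix x assume x: "x \<in> space ?P"
    have "exp (- K) \<le> exp (G x)" "exp (G x) \<le> exp K" using ebd[OF x] expG[OF x] by simp_all
    then have "- K \<le> G x" "G x \<le> K" by simp_all
    then show "\<bar>G x\<bar> \<le> K + \<bar>\<phi> / (2 * \<sigma>\<^sup>2)\<bar>" by linarith
    show "\<bar>H x\<bar> \<le> K + \<bar>\<phi> / (2 * \<sigma>\<^sup>2)\<bar>" unfolding H_def using hbd[OF x] by linarith
  next
    fix x y assume x: "x \<in> space ?P" and y: "y \<in> space ?P"
    \<comment> \<open>For fixed x and y the cost of the remaining coordinates is a constant; added
      to h it leaves a problem in the single coordinate t.\<close>
    define S where "S = ?c * (\<Sum>j\<in>I. norm_Rn d (x j - y j) powr p)"
    have "(\<integral>t. exp (g (x(i := t))) \<partial>\<mu>) \<le> exp ((\<integral>t. h (y(i := t)) + S \<partial>\<mu>) + \<phi> / (2 * \<sigma>\<^sup>2))"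
    proof (rule transport_inequality_dual[OF T p \<sigma> s, where K = "K + \<bar>S\<bar>"])
      fix t u assume t: "t \<in> Rn d" and u: "u \<in> Rn d"
      have "g (x(i := t)) - h (y(i := u))
          \<le> ?c * (\<Sum>j\<in>insert i I. norm_Rn d ((x(i := t)) j - (y(i := u)) j) powr p)"
        by (rule insert.prems(5)[OF upd[OF x t] upd[OF y u]])
      also have "(\<Sum>j\<in>insert i I. norm_Rn d ((x(i := t)) j - (y(i := u)) j) powr p)
          = norm_Rn d (t - u) powr p + (\<Sum>j\<in>I. norm_Rn d (x j - y j) powr p)"
        using insert.hyps by (auto intro!: sum.cong)
      finally show "g (x(i := t)) - (h (y(i := u)) + S) \<le> ?c * norm_Rn d (t - u) powr p"
        by (simp add: S_def algebra_simps fun_upd_def)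
    next
      fix t assume t: "t \<in> Rn d"
      show "\<bar>g (x(i := t))\<bar> \<le> K + \<bar>S\<bar>" using insert.prems(3)[OF upd[OF x t]] by linarith
      show "\<bar>h (y(i := t)) + S\<bar> \<le> K + \<bar>S\<bar>" using insert.prems(4)[OF upd[OF y t]] by linarith
    qed (use gxm[OF x] hxm[OF y] in auto)
    also have "(\<integral>t. h (y(i := t)) + S \<partial>\<mu>) = (\<integral>t. h (y(i := t)) \<partial>\<mu>) + S"
      using hi[OF y] by (simp add: prob_space)
    finally have "exp (G x) \<le> exp ((\<integral>t. h (y(i := t)) \<partial>\<mu>) + S + \<phi> / (2 * \<sigma>\<^sup>2))"
      unfolding expG[OF x] by (simp only: fun_upd_def)
    then have "G x \<le> (\<integral>t. h (y(i := t)) \<partial>\<mu>) + S + \<phi> / (2 * \<sigma>\<^sup>2)" by simp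
    then show "G x - H y \<le> ?c * (\<Sum>j\<in>I. norm_Rn d (x j - y j) powr p)"
      by (simp add: H_def S_def)
  qed
  moreover have "(\<integral>x. exp (g x) \<partial>?Q) = (\<integral>x. exp (G x) \<partial>?P)"
  proof -
    have "(\<integral>x. exp (g x) \<partial>?Q) = (\<integral>x. \<integral>t. exp (g (x(i := t))) \<partial>\<mu> \<partial>?P)"
      using insert.prems(3) insert.hyps
      by (intro product_integral_insert Q.integrable_const_bound[where B="exp K"] AE_I2) (auto simp: abs_le_iff)
    also have "\<dots> = (\<integral>x. exp (G x) \<partial>?P)"
      by (intro Bochner_Integration.integral_cong refl) (simp add: expG)
    finally show ?thesis .
  qed
  moreover have "(\<integral>x. H x \<partial>?P) = (\<integral>x. h x \<partial>?Q) + \<phi> / (2 * \<sigma>\<^sup>2)"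
  proof -
    have m: "(\<lambda>x. \<integral>t. h (x(i := t)) \<partial>\<mu>) \<in> borel_measurable ?P" by measurable
    have "(\<integral>x. h x \<partial>?Q) = (\<integral>x. \<integral>t. h (x(i := t)) \<partial>\<mu> \<partial>?P)"
      using insert.prems(4) insert.hyps
      by (intro product_integral_insert Q.integrable_const_bound[where B=K] AE_I2) auto
    moreover have "integrable ?P (\<lambda>x. \<integral>t. h (x(i := t)) \<partial>\<mu>)"
      using hbd m by (intro P.integrable_const_bound[where B=K] AE_I2) auto
    ultimately show ?thesis by (simp add: H_def P.prob_space)
  qed
  ultimately show ?case using insert.hyps by (simp add: algebra_simps add_divide_distrib)
qed

text \<open>The tangent of x^q at 1 lies below the graph. With x rescaled this is the Young
  inequality behind all exchanges between the exponents 1, p and 2 below.\<close>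

lemma Bernoulli_powr:
  assumes "0 \<le> x" "1 \<le> (q::real)" shows "q * x \<le> x powr q + q - 1"
proof (cases "x = 0")
  case False
  define a where "a = q * ln x"
  have "exp ((1 - 1 / q) * 0 + (1 / q) * a) \<le> (1 - 1 / q) * exp 0 + (1 / q) * exp a"
    using assms convex_onD[OF exp_convex, of "1 / q" 0 a] by simp
  moreover have "exp ((1 - 1 / q) * 0 + (1 / q) * a) = x" "exp a = x powr q"
    using False assms by (auto simp: a_def powr_def)
  ultimately have "x \<le> 1 - 1 / q + x powr q / q" by simp
  then have "q * x \<le> q * (1 - 1 / q + x powr q / q)" using assms by (intro mult_left_mono) auto
  also have "\<dots> = x powr q + q - 1" using assms by (simp add: field_simps)
  finally show ?thesis .
qed (use assms in auto)

text \<open>F is Lipschitz for the normalised l^p distance u of samples, while the dual bound asks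
  for a cost that is additive in p-th powers. One Young inequality replaces \<theta> u by a multiple
  of n u^p plus \<delta>; a second one replaces that p-th power by the square in the transport
  inequality, at the price \<phi> for each coordinate.\<close>

lemma transport_inequality_Laplace:
  assumes T: "transport_inequality d p (\<sigma>\<^sup>2) \<mu>" and p: "1 \<le> p" "p \<le> 2" and \<sigma>: "0 < \<sigma>" and n: "0 < n"
    and F: "integrable (PiM {..<n} (\<lambda>_. \<mu>)) F"
    and lip: "\<And>x y. x \<in> space (PiM {..<n} (\<lambda>_. \<mu>)) \<Longrightarrow> y \<in> space (PiM {..<n} (\<lambda>_. \<mu>)) \<Longrightarrow>
      F x - F y \<le> ((\<Sum>j<n. norm_Rn d (x j - y j) powr p) / real n) powr (1 / p)"
    and \<theta>: "0 < \<theta>"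
  shows "(\<integral>\<^sup>+x. ennreal (exp (\<theta> * F x)) \<partial>PiM {..<n} (\<lambda>_. \<mu>))
    \<le> ennreal (exp (\<theta> * (\<integral>x. F x \<partial>PiM {..<n} (\<lambda>_. \<mu>)) + \<theta>\<^sup>2 * \<sigma>\<^sup>2 / (2 * real n)))"
proof -
  let ?P = "PiM {..<n} (\<lambda>_. \<mu>)"
  have prob: "prob_Rn d \<mu>" using T by (auto simp: transport_inequality_def)
  interpret prob_space \<mu> using prob by (rule prob_RnD)
  interpret P: prob_space ?P by (rule prob_space_PiM) unfold_locales
  have [measurable]: "F \<in> borel_measurable ?P" using F by auto
  \<comment> \<open>v maximises \<open>\<theta> * u - n * u^2 / (2 * \<sigma>^2)\<close> over u.
    Both Young inequalities are tangent at v, so neither loses anything there.\<close>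
  define v where "v = \<theta> * \<sigma>\<^sup>2 / real n"
  have v: "0 < v" using \<theta> \<sigma> n by (simp add: v_def)
  define s where "s = 2 / p * v powr (2 - p)"
  define \<phi> where "\<phi> = (2 / p - 1) * v\<^sup>2"
  define \<delta> where "\<delta> = \<theta> * v * (1 - 1 / p)"
  have s0: "0 \<le> s" using p by (simp add: s_def)
  have s: "s * w powr p \<le> w\<^sup>2 + \<phi>" if w: "0 \<le> w" for w
  proof -
    have "2 / p * (w / v) powr p \<le> ((w / v) powr p) powr (2 / p) + 2 / p - 1"
      using p by (intro Bernoulli_powr) (auto simp: field_simps)
    also have "((w / v) powr p) powr (2 / p) = (w / v)\<^sup>2"
      using w v p by (simp add: powr_powr)
    finally have "v\<^sup>2 * (2 / p * (w / v) powr p) \<le> v\<^sup>2 * ((w / v)\<^sup>2 + 2 / p - 1)"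
      by (intro mult_left_mono) auto
    moreover have "v\<^sup>2 * (2 / p * (w / v) powr p) = s * w powr p"
      using v w by (simp add: s_def powr_divide powr_diff)
    moreover have "v\<^sup>2 * ((w / v)\<^sup>2 + 2 / p - 1) = w\<^sup>2 + \<phi>"
      using v by (simp add: \<phi>_def power_divide algebra_simps)
    ultimately show ?thesis by simp
  qed
  have young: "\<theta> * u \<le> s / (2 * \<sigma>\<^sup>2) * (real n * u powr p) + \<delta>" if u: "0 \<le> u" for u
  proof -
    have "p * (u / v) \<le> (u / v) powr p + p - 1" using u v p by (intro Bernoulli_powr) auto
    then have "\<theta> * v / p * (p * (u / v)) \<le> \<theta> * v / p * ((u / v) powr p + p - 1)"
      using \<theta> v p by (intro mult_left_mono) auto
    moreover have "\<theta> * v / p * (p * (u / v)) = \<theta> * u" using v p by simp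
    moreover have "\<theta> * v / p * ((u / v) powr p + p - 1) = \<theta> * v / p * (u / v) powr p + \<delta>"
      using p by (simp add: \<delta>_def field_simps)
    moreover have "\<theta> * v / p * (u / v) powr p = s / (2 * \<sigma>\<^sup>2) * (real n * u powr p)"
    proof -
      have "\<theta> = v * real n / \<sigma>\<^sup>2" using \<sigma> n by (simp add: v_def)
      then show ?thesis using v u by (simp add: s_def powr_divide powr_diff power2_eq_square mult_ac)
    qed
    ultimately show ?thesis by simp
  qed
  \<comment> \<open>The dependence on p cancels, and the total error is the value of the maximum
    attained at v.\<close>
  have tot: "\<delta> + real n * (\<phi> / (2 * \<sigma>\<^sup>2)) = \<theta>\<^sup>2 * \<sigma>\<^sup>2 / (2 * real n)"
    using \<sigma> n p by (simp add: \<delta>_def \<phi>_def v_def field_simps power2_eq_square)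
  \<comment> \<open>The dual bound is for bounded functions. Clamping F to [-k, k] keeps the
    Lipschitz bound; Fatou's lemma on the left and dominated convergence on the right remove the
    clamp.\<close>
  define C where "C k x = max (- real k) (min (real k) (F x))" for k :: nat and x
  have [measurable]: "C k \<in> borel_measurable ?P" for k unfolding C_def by measurable
  have Cb: "\<bar>C k x\<bar> \<le> real k" for k x by (auto simp: C_def)
  have Ci: "integrable ?P (C k)" for k using Cb by (intro P.integrable_const_bound[where B="real k"]) auto
  have CF: "(\<lambda>k. C k x) \<longlonglongrightarrow> F x" for x
  proof (rule tendsto_eventually)
    obtain k0 :: nat where "\<bar>F x\<bar> \<le> real k0" using real_arch_simple by blast
    then have "C k x = F x" if "k \<ge> k0" for k using that by (auto simp: C_def min_def max_def abs_le_iff)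
    then show "\<forall>\<^sub>F k in sequentially. C k x = F x" by (rule eventually_sequentiallyI)
  qed
  have step: "(\<integral>\<^sup>+x. ennreal (exp (\<theta> * C k x)) \<partial>?P)
      \<le> ennreal (exp (\<theta> * (\<integral>x. C k x \<partial>?P) + \<theta>\<^sup>2 * \<sigma>\<^sup>2 / (2 * real n)))" for k
  proof -
    have "(\<integral>x. exp (\<theta> * C k x - \<delta>) \<partial>?P)
        \<le> exp ((\<integral>x. \<theta> * C k x \<partial>?P) + real (card {..<n}) * (\<phi> / (2 * \<sigma>\<^sup>2)))"
    proof (rule transport_inequality_dual_product[OF T p(1) \<sigma> s0 s, where K="\<theta> * real k + \<bar>\<delta>\<bar>"])
      fix x
      have a: "\<bar>\<theta> * C k x\<bar> \<le> \<theta> * real k" using Cb[of k x] \<theta> by (simp add: abs_mult)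
      then show "\<bar>\<theta> * C k x - \<delta>\<bar> \<le> \<theta> * real k + \<bar>\<delta>\<bar>" "\<bar>\<theta> * C k x\<bar> \<le> \<theta> * real k + \<bar>\<delta>\<bar>" by linarith+
    next
      fix x y assume xy: "x \<in> space ?P" "y \<in> space ?P"
      define u where "u = ((\<Sum>j<n. norm_Rn d (x j - y j) powr p) / real n) powr (1 / p)"
      have "F x - F y \<le> u" using lip[OF xy] by (simp add: u_def)
      moreover have u0: "0 \<le> u" by (simp add: u_def)
      ultimately have "C k x - C k y \<le> u" by (auto simp: C_def)
      then have "\<theta> * (C k x - C k y) \<le> \<theta> * u" using \<theta> by simp
      also have "\<dots> \<le> s / (2 * \<sigma>\<^sup>2) * (real n * u powr p) + \<delta>" by (rule young[OF u0])
      also have "real n * u powr p = (\<Sum>j<n. norm_Rn d (x j - y j) powr p)"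
        using n p by (simp add: u_def powr_powr sum_nonneg)
      finally show "\<theta> * C k x - \<delta> - \<theta> * C k y \<le> s / (2 * \<sigma>\<^sup>2) * (\<Sum>j<n. norm_Rn d (x j - y j) powr p)"
        by (simp add: algebra_simps)
    qed auto
    then have "exp \<delta> * (\<integral>x. exp (\<theta> * C k x - \<delta>) \<partial>?P) \<le> exp \<delta> * exp (\<theta> * (\<integral>x. C k x \<partial>?P) + real n * (\<phi> / (2 * \<sigma>\<^sup>2)))"
      using Ci by (intro mult_left_mono) auto
    also have "\<dots> = exp (\<theta> * (\<integral>x. C k x \<partial>?P) + \<theta>\<^sup>2 * \<sigma>\<^sup>2 / (2 * real n))"
      unfolding tot[symmetric] by (simp add: exp_add mult_ac)
    finally have "(\<integral>x. exp (\<theta> * C k x) \<partial>?P) \<le> exp (\<theta> * (\<integral>x. C k x \<partial>?P) + \<theta>\<^sup>2 * \<sigma>\<^sup>2 / (2 * real n))"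
      by (simp add: exp_diff)
    moreover have "integrable ?P (\<lambda>x. exp (\<theta> * C k x))"
      using Cb \<theta> by (intro P.integrable_const_bound[where B="exp (\<theta> * real k)"]) (auto simp: abs_le_iff)
    ultimately show ?thesis by (subst nn_integral_eq_integral) (auto intro: ennreal_leI)
  qed
  have lim: "(\<lambda>k. \<integral>x. C k x \<partial>?P) \<longlonglongrightarrow> (\<integral>x. F x \<partial>?P)"
  proof (rule integral_dominated_convergence[where w="\<lambda>x. \<bar>F x\<bar>"])
    show "AE x in ?P. norm (C k x) \<le> \<bar>F x\<bar>" for k by (auto simp: C_def)
  qed (use F CF in auto)
  have "(\<integral>\<^sup>+x. ennreal (exp (\<theta> * F x)) \<partial>?P) = (\<integral>\<^sup>+x. liminf (\<lambda>k. ennreal (exp (\<theta> * C k x))) \<partial>?P)"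
  proof (rule nn_integral_cong)
    fix x
    have "(\<lambda>k. ennreal (exp (\<theta> * C k x))) \<longlonglongrightarrow> ennreal (exp (\<theta> * F x))"
      by (intro tendsto_ennrealI tendsto_exp tendsto_mult tendsto_const CF)
    then show "ennreal (exp (\<theta> * F x)) = liminf (\<lambda>k. ennreal (exp (\<theta> * C k x)))"
      by (rule lim_imp_Liminf[OF sequentially_bot, symmetric])
  qed
  also have "\<dots> \<le> liminf (\<lambda>k. \<integral>\<^sup>+x. ennreal (exp (\<theta> * C k x)) \<partial>?P)"
    by (rule nn_integral_liminf) measurable
  also have "\<dots> \<le> liminf (\<lambda>k. ennreal (exp (\<theta> * (\<integral>x. C k x \<partial>?P) + \<theta>\<^sup>2 * \<sigma>\<^sup>2 / (2 * real n))))"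
    using step by (intro Liminf_mono always_eventually) auto
  also have "\<dots> = ennreal (exp (\<theta> * (\<integral>x. F x \<partial>?P) + \<theta>\<^sup>2 * \<sigma>\<^sup>2 / (2 * real n)))"
    by (intro lim_imp_Liminf tendsto_ennrealI tendsto_exp tendsto_add tendsto_mult tendsto_const lim) simp
  finally show ?thesis .
qed

section \<open>Moments implied by the transport inequality\<close>

definition mean_Rn :: "nat \<Rightarrow> rvec measure \<Rightarrow> rvec"
  where "mean_Rn d \<mu> = (\<lambda>i. if i < d then (\<integral>x. x i \<partial>\<mu>) else 0)"

lemma mean_Rn_in: "mean_Rn d \<mu> \<in> Rn d"
  by (simp add: mean_Rn_def Rn_def)

lemma inner_Rn_diff: "inner_Rn d u (x - y) = inner_Rn d u x - inner_Rn d u y"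
  by (simp add: inner_Rn_def right_diff_distrib sum_subtractf)

lemma abs_coord_le_norm_Rn: "i < d \<Longrightarrow> \<bar>x i\<bar> \<le> norm_Rn d x"
  using member_le_L2_set[of "{..<d}" i "\<lambda>i. \<bar>x i\<bar>"] by (simp add: norm_Rn_def L2_set_def)

lemma measurable_id_Rn: "sets \<mu> = sets (borel_Rn d) \<Longrightarrow> (\<lambda>x. x) \<in> \<mu> \<rightarrow>\<^sub>M borel_Rn d"
  by (simp cong: measurable_cong_sets)

lemma integrable_norm_Rn:
  assumes prob: "prob_Rn d \<mu>" and mom: "finite_moment d p \<mu>" and p: "1 \<le> p"
  shows "integrable \<mu> (norm_Rn d)"
proof (rule integrableI_bounded)
  interpret prob_space \<mu> using prob by (rule prob_RnD)
  have [measurable]: "norm_Rn d \<in> borel_measurable \<mu>"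
    using measurable_norm_Rn[OF measurable_id_Rn[OF prob_RnD(2)[OF prob]]] by simp
  show "norm_Rn d \<in> borel_measurable \<mu>" by measurable
  have "r \<le> 1 + r powr p" if "0 \<le> r" for r :: real
  proof (cases "r \<le> 1")
    case False
    then have "r powr 1 \<le> r powr p" using p by (intro powr_mono) auto
    then show ?thesis using False by simp
  qed (simp add: add_increasing2)
  then have "(\<integral>\<^sup>+ x. ennreal (norm (norm_Rn d x)) \<partial>\<mu>) \<le> (\<integral>\<^sup>+ x. 1 + ennreal (norm_Rn d x powr p) \<partial>\<mu>)"
    by (intro nn_integral_mono) (simp flip: ennreal_1 ennreal_plus add: ennreal_leI)
  also have "\<dots> = 1 + (\<integral>\<^sup>+ x. ennreal (norm_Rn d x powr p) \<partial>\<mu>)"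
    by (subst nn_integral_add) (auto simp: emeasure_space_1)
  also have "\<dots> < \<infinity>" using mom by (simp add: finite_moment_def)
  finally show "(\<integral>\<^sup>+ x. ennreal (norm (norm_Rn d x)) \<partial>\<mu>) < \<infinity>" .
qed

text \<open>The case n = 1, which gives information on \<mu> itself; the product over one index is
  identified with \<mu>.\<close>

lemma transport_inequality_Laplace_1:
  assumes T: "transport_inequality d p (\<sigma>\<^sup>2) \<mu>" and p: "1 \<le> p" "p \<le> 2" and \<sigma>: "0 < \<sigma>"
    and F: "integrable \<mu> F"
    and lip: "\<And>x y. x \<in> Rn d \<Longrightarrow> y \<in> Rn d \<Longrightarrow> F x - F y \<le> norm_Rn d (x - y)"
    and \<theta>: "0 < \<theta>"
  shows "(\<integral>\<^sup>+x. ennreal (exp (\<theta> * F x)) \<partial>\<mu>) \<le> ennreal (exp (\<theta> * (\<integral>x. F x \<partial>\<mu>) + \<theta>\<^sup>2 * \<sigma>\<^sup>2 / 2))"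
proof -
  have prob: "prob_Rn d \<mu>" using T by (auto simp: transport_inequality_def)
  interpret prob_space \<mu> using prob by (rule prob_RnD)
  interpret product_sigma_finite "\<lambda>_. \<mu>" ..
  have sp: "space \<mu> = Rn d" using prob by (simp add: prob_RnD)
  have [measurable]: "F \<in> borel_measurable \<mu>" using F by auto
  have one: "{..<1} = {0::nat}" by auto
  let ?P = "PiM {..<1} (\<lambda>_. \<mu>) :: (nat \<Rightarrow> rvec) measure"
  have ex: "(\<integral>\<^sup>+x. ennreal (exp (\<theta> * F (x 0))) \<partial>?P) = (\<integral>\<^sup>+x. ennreal (exp (\<theta> * F x)) \<partial>\<mu>)"
    unfolding one by (rule product_nn_integral_singleton) measurable
  have nI: "(\<integral>\<^sup>+x. ennreal (norm (F (x 0))) \<partial>?P) = (\<integral>\<^sup>+x. ennreal (norm (F x)) \<partial>\<mu>)"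
    unfolding one by (rule product_nn_integral_singleton) measurable
  have Fi: "integrable ?P (\<lambda>x. F (x 0))"
  proof (rule integrableI_bounded)
    show "(\<integral>\<^sup>+x. ennreal (norm (F (x 0))) \<partial>?P) < \<infinity>"
      unfolding nI using F by (simp add: integrable_iff_bounded)
    have [measurable]: "(\<lambda>x. x 0) \<in> ?P \<rightarrow>\<^sub>M \<mu>" by (rule measurable_component_singleton) simp
    show "(\<lambda>x. F (x 0)) \<in> borel_measurable ?P" by measurable
  qed
  have I: "(\<integral>x. F (x 0) \<partial>?P) = (\<integral>x. F x \<partial>\<mu>)"
    unfolding one by (rule product_integral_singleton) measurable
  have "(\<integral>\<^sup>+x. ennreal (exp (\<theta> * F (x 0))) \<partial>?P)
      \<le> ennreal (exp (\<theta> * (\<integral>x. F (x 0) \<partial>?P) + \<theta>\<^sup>2 * \<sigma>\<^sup>2 / (2 * real 1)))"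
  proof (rule transport_inequality_Laplace[OF T p \<sigma> _ Fi _ \<theta>])
    fix x y assume "x \<in> space ?P" "y \<in> space ?P"
    then have "x 0 \<in> Rn d" "y 0 \<in> Rn d" by (auto simp: space_PiM PiE_def sp)
    then have "F (x 0) - F (y 0) \<le> norm_Rn d (x 0 - y 0)" by (rule lip)
    also have "\<dots> = ((\<Sum>j<1. norm_Rn d (x j - y j) powr p) / real 1) powr (1 / p)"
      using p by (simp add: powr_powr)
    finally show "F (x 0) - F (y 0) \<le> ((\<Sum>j<1. norm_Rn d (x j - y j) powr p) / real 1) powr (1 / p)" .
  qed simp
  then show ?thesis unfolding ex I by simp
qed

text \<open>The Laplace bound at \<theta> = 1 / \<sigma> for the centred linear functional and for
  its negative: each contributes at most exp (1 / 2) \<le> 2. The bound is free of d, p and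
  \<sigma>; it is all that the rate uses about the tails of a projection.\<close>

lemma transport_inequality_exp_moment:
  assumes T: "transport_inequality d p (\<sigma>\<^sup>2) \<mu>" and p: "1 \<le> p" "p \<le> 2" and \<sigma>: "0 < \<sigma>"
    and u: "norm_Rn d u \<le> 1"
  shows "(\<integral>\<^sup>+x. ennreal (exp (\<bar>inner_Rn d u (x - mean_Rn d \<mu>)\<bar> / \<sigma>)) \<partial>\<mu>) \<le> 4"
proof -
  have prob: "prob_Rn d \<mu>" and mom: "finite_moment d p \<mu>" using T by (auto simp: transport_inequality_def)
  interpret prob_space \<mu> using prob by (rule prob_RnD)
  note id = measurable_id_Rn[OF prob_RnD(2)[OF prob]]
  let ?m = "mean_Rn d \<mu>"
  have coord: "integrable \<mu> (\<lambda>x. x i)" if "i < d" for i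
    using abs_coord_le_norm_Rn[OF that] measurable_Rn_coord[OF id]
    by (intro Bochner_Integration.integrable_bound[OF integrable_norm_Rn[OF prob mom p(1)]]) auto
  define F where "F c x = c * inner_Rn d u (x - ?m)" for c :: real and x
  have half: "(\<integral>\<^sup>+x. ennreal (exp (1 / \<sigma> * F c x)) \<partial>\<mu>) \<le> 2" if c: "\<bar>c\<bar> = 1" for c
  proof -
    have iu: "integrable \<mu> (\<lambda>x. inner_Rn d u x)"
      unfolding inner_Rn_def using coord by (intro Bochner_Integration.integrable_sum) auto
    have Fi: "integrable \<mu> (F c)"
      unfolding F_def inner_Rn_diff using iu by auto
    have "(\<integral>x. inner_Rn d u x \<partial>\<mu>) = (\<Sum>i<d. u i * (\<integral>x. x i \<partial>\<mu>))"
      unfolding inner_Rn_def using coord by (subst Bochner_Integration.integral_sum) auto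
    also have "\<dots> = inner_Rn d u ?m" by (simp add: inner_Rn_def mean_Rn_def)
    finally have I0: "(\<integral>x. F c x \<partial>\<mu>) = 0"
      unfolding F_def inner_Rn_diff using iu by (simp add: prob_space)
    have "(\<integral>\<^sup>+x. ennreal (exp (1 / \<sigma> * F c x)) \<partial>\<mu>)
        \<le> ennreal (exp (1 / \<sigma> * (\<integral>x. F c x \<partial>\<mu>) + (1 / \<sigma>)\<^sup>2 * \<sigma>\<^sup>2 / 2))"
    proof (rule transport_inequality_Laplace_1[OF T p \<sigma> Fi])
      fix x y :: rvec
      have "F c x - F c y = c * inner_Rn d u (x - y)"
        by (simp add: F_def inner_Rn_diff algebra_simps)
      also have "\<dots> \<le> \<bar>c * inner_Rn d u (x - y)\<bar>" by simp
      also have "\<dots> \<le> norm_Rn d u * norm_Rn d (x - y)"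
        using inner_Rn_Cauchy_Schwarz by (simp add: abs_mult c)
      also have "\<dots> \<le> norm_Rn d (x - y)" using u by (simp add: mult_left_le_one_le)
      finally show "F c x - F c y \<le> norm_Rn d (x - y)" .
    qed (use \<sigma> in auto)
    also have "\<dots> = ennreal (exp (1 / 2))" using I0 \<sigma> by (simp add: power_divide)
    also have "\<dots> \<le> ennreal 2"
    proof (rule ennreal_leI)
      have "(exp (1 / 2) :: real)\<^sup>2 \<le> 2\<^sup>2" using exp_le by (simp add: power2_eq_square flip: exp_add)
      then show "exp (1 / 2) \<le> (2::real)" by (rule power2_le_imp_le) simp
    qed
    finally show ?thesis by simp
  qed
  have [measurable]: "F c \<in> borel_measurable \<mu>" for c
    unfolding F_def inner_Rn_diff using measurable_inner_Rn[OF id] by measurable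
  have "(\<integral>\<^sup>+x. ennreal (exp (\<bar>inner_Rn d u (x - ?m)\<bar> / \<sigma>)) \<partial>\<mu>)
      \<le> (\<integral>\<^sup>+x. ennreal (exp (1 / \<sigma> * F 1 x)) + ennreal (exp (1 / \<sigma> * F (- 1) x)) \<partial>\<mu>)"
    by (intro nn_integral_mono) (auto simp: F_def abs_if simp flip: ennreal_plus intro!: ennreal_leI)
  also have "\<dots> = (\<integral>\<^sup>+x. ennreal (exp (1 / \<sigma> * F 1 x)) \<partial>\<mu>) + (\<integral>\<^sup>+x. ennreal (exp (1 / \<sigma> * F (- 1) x)) \<partial>\<mu>)"
    by (rule nn_integral_add) measurable
  also have "\<dots> \<le> 2 + 2" by (intro add_mono half) auto
  finally show ?thesis by simp
qed

text \<open>From t^2 \<le> 2 exp |t| each centred coordinate has second moment at most 2 \<sigma>^2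
  times 4, which gives 8 d \<sigma>^2 in total; the p-th moment follows as in Jensen's
  inequality.\<close>

lemma transport_inequality_moment:
  assumes T: "transport_inequality d p (\<sigma>\<^sup>2) \<mu>" and p: "1 \<le> p" "p \<le> 2" and \<sigma>: "0 < \<sigma>" and d: "0 < d"
  shows "(\<integral>\<^sup>+x. ennreal (norm_Rn d (x - mean_Rn d \<mu>) powr p) \<partial>\<mu>) \<le> ennreal ((sqrt (8 * real d) * \<sigma>) powr p)"
proof -
  have prob: "prob_Rn d \<mu>" using T by (auto simp: transport_inequality_def)
  interpret prob_space \<mu> using prob by (rule prob_RnD)
  note id = measurable_id_Rn[OF prob_RnD(2)[OF prob]]
  let ?m = "mean_Rn d \<mu>"
  define a where "a = sqrt (8 * real d) * \<sigma>"
  have a: "0 < a" using d \<sigma> by (simp add: a_def)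
  have cm[measurable]: "(\<lambda>x. x i) \<in> borel_measurable \<mu>" for i by (rule measurable_Rn_coord[OF id])
  have co: "(\<integral>\<^sup>+x. ennreal (((x - ?m) i)\<^sup>2) \<partial>\<mu>) \<le> ennreal (8 * \<sigma>\<^sup>2)" if i: "i < d" for i
  proof -
    define u :: rvec where "u = (\<lambda>j. if j = i then 1 else 0)"
    have u1: "norm_Rn d u = 1" using i by (simp add: norm_Rn_def L2_set_def u_def if_distrib[of "\<lambda>x. x\<^sup>2"] cong: if_cong)
    have iu: "inner_Rn d u x = x i" for x
      using i by (simp add: inner_Rn_def u_def if_distrib[of "\<lambda>z. z * _"] cong: if_cong)
    have sq: "t\<^sup>2 \<le> 2 * exp \<bar>t\<bar>" for t :: real
      using exp_lower_Taylor_quadratic[of "\<bar>t\<bar>"] by simp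
    have le: "((x - ?m) i)\<^sup>2 \<le> 2 * \<sigma>\<^sup>2 * exp (\<bar>inner_Rn d u (x - ?m)\<bar> / \<sigma>)" for x
    proof -
      have "((x - ?m) i)\<^sup>2 = \<sigma>\<^sup>2 * ((x - ?m) i / \<sigma>)\<^sup>2" using \<sigma> by (simp add: power_divide)
      also have "\<dots> \<le> \<sigma>\<^sup>2 * (2 * exp \<bar>(x - ?m) i / \<sigma>\<bar>)" by (intro mult_left_mono sq) auto
      finally show ?thesis using \<sigma> by (simp add: iu abs_divide mult_ac)
    qed
    have "(\<integral>\<^sup>+x. ennreal (((x - ?m) i)\<^sup>2) \<partial>\<mu>)
       \<le> (\<integral>\<^sup>+x. ennreal (2 * \<sigma>\<^sup>2) * ennreal (exp (\<bar>inner_Rn d u (x - ?m)\<bar> / \<sigma>)) \<partial>\<mu>)"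
      using le by (intro nn_integral_mono) (simp add: ennreal_leI flip: ennreal_mult)
    also have "\<dots> = ennreal (2 * \<sigma>\<^sup>2) * (\<integral>\<^sup>+x. ennreal (exp (\<bar>inner_Rn d u (x - ?m)\<bar> / \<sigma>)) \<partial>\<mu>)"
      by (rule nn_integral_cmult) (simp add: iu)
    also have "\<dots> \<le> ennreal (2 * \<sigma>\<^sup>2) * 4"
      using u1 by (intro mult_left_mono transport_inequality_exp_moment[OF T p \<sigma>]) auto
    also have "\<dots> = ennreal (8 * \<sigma>\<^sup>2)" using ennreal_mult[of "2 * \<sigma>\<^sup>2" 4] by (simp add: mult_ac)
    finally show ?thesis .
  qed
  have "(\<integral>\<^sup>+x. ennreal ((norm_Rn d (x - ?m))\<^sup>2) \<partial>\<mu>) = (\<integral>\<^sup>+x. (\<Sum>i<d. ennreal (((x - ?m) i)\<^sup>2)) \<partial>\<mu>)"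
    unfolding norm_Rn_sq by (subst sum_ennreal) auto
  also have "\<dots> = (\<Sum>i<d. \<integral>\<^sup>+x. ennreal (((x - ?m) i)\<^sup>2) \<partial>\<mu>)"
    by (rule nn_integral_sum) simp
  also have "\<dots> \<le> (\<Sum>i<d. ennreal (8 * \<sigma>\<^sup>2))" by (intro sum_mono co) auto
  also have "\<dots> = ennreal (a\<^sup>2)"
    by (simp add: a_def power_mult_distrib ennreal_of_nat_eq_real_of_nat flip: ennreal_mult)
  finally have m2: "(\<integral>\<^sup>+x. ennreal ((norm_Rn d (x - ?m))\<^sup>2) \<partial>\<mu>) \<le> ennreal (a\<^sup>2)" .
  \<comment> \<open>r^p is a concave function of r^2 since p \<le> 2; this is its tangent at r =
    a.\<close>
  have le: "r powr p \<le> a powr p * (p / 2) / a\<^sup>2 * r\<^sup>2 + a powr p * (1 - p / 2)" if r: "0 \<le> r" for r :: real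
  proof -
    have "2 / p * (r / a) powr p \<le> ((r / a) powr p) powr (2 / p) + 2 / p - 1"
      using p by (intro Bernoulli_powr) (auto simp: field_simps)
    also have "((r / a) powr p) powr (2 / p) = (r / a)\<^sup>2" using r a p by (simp add: powr_powr)
    finally have "a powr p * (p / 2) * (2 / p * (r / a) powr p) \<le> a powr p * (p / 2) * ((r / a)\<^sup>2 + 2 / p - 1)"
      using p by (intro mult_left_mono) auto
    also have "a powr p * (p / 2) * (2 / p * (r / a) powr p) = r powr p" using a r p by (simp add: powr_divide)
    also have "a powr p * (p / 2) * ((r / a)\<^sup>2 + 2 / p - 1) = a powr p * (p / 2) / a\<^sup>2 * r\<^sup>2 + a powr p * (1 - p / 2)"
      using p by (simp add: power_divide algebra_simps)
    finally show ?thesis .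
  qed
  have nm[measurable]: "(\<lambda>x. norm_Rn d (x - ?m)) \<in> borel_measurable \<mu>"
    using mean_Rn_in by (intro measurable_norm_Rn measurable_Rn_diff id) (simp add: space_borel_Rn)
  have "(\<integral>\<^sup>+x. ennreal (norm_Rn d (x - ?m) powr p) \<partial>\<mu>)
     \<le> (\<integral>\<^sup>+x. ennreal (a powr p * (p / 2) / a\<^sup>2) * ennreal ((norm_Rn d (x - ?m))\<^sup>2) + ennreal (a powr p * (1 - p / 2)) \<partial>\<mu>)"
  proof (rule nn_integral_mono)
    fix x
    let ?r = "norm_Rn d (x - ?m)"
    have nn: "0 \<le> a powr p * (p / 2) / a\<^sup>2" "0 \<le> a powr p * (1 - p / 2)" using p by auto
    have "ennreal (?r powr p) \<le> ennreal (a powr p * (p / 2) / a\<^sup>2 * ?r\<^sup>2 + a powr p * (1 - p / 2))"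
      by (intro ennreal_leI le norm_Rn_nonneg)
    also have "\<dots> = ennreal (a powr p * (p / 2) / a\<^sup>2 * ?r\<^sup>2) + ennreal (a powr p * (1 - p / 2))"
      by (rule ennreal_plus[OF mult_nonneg_nonneg[OF nn(1) zero_le_power2] nn(2)])
    also have "ennreal (a powr p * (p / 2) / a\<^sup>2 * ?r\<^sup>2) = ennreal (a powr p * (p / 2) / a\<^sup>2) * ennreal (?r\<^sup>2)"
      by (rule ennreal_mult[OF nn(1) zero_le_power2])
    finally show "ennreal (?r powr p) \<le> ennreal (a powr p * (p / 2) / a\<^sup>2) * ennreal (?r\<^sup>2) + ennreal (a powr p * (1 - p / 2))" .
  qed
  also have "\<dots> = ennreal (a powr p * (p / 2) / a\<^sup>2) * (\<integral>\<^sup>+x. ennreal ((norm_Rn d (x - ?m))\<^sup>2) \<partial>\<mu>) + ennreal (a powr p * (1 - p / 2))"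
    by (simp add: nn_integral_add nn_integral_cmult emeasure_space_1)
  also have "\<dots> \<le> ennreal (a powr p * (p / 2) / a\<^sup>2) * ennreal (a\<^sup>2) + ennreal (a powr p * (1 - p / 2))"
    by (intro add_mono mult_left_mono m2) auto
  also have "\<dots> = ennreal (a powr p * (p / 2) / a\<^sup>2 * a\<^sup>2 + a powr p * (1 - p / 2))"
    using p by (simp flip: ennreal_mult ennreal_plus)
  also have "a powr p * (p / 2) / a\<^sup>2 * a\<^sup>2 + a powr p * (1 - p / 2) = a powr p" using a by (simp add: algebra_simps)
  finally show ?thesis unfolding a_def .
qed

section \<open>Multiscale couplings\<close>

text \<open>A partial coupling of \<open>\<mu>\<close> and \<open>\<nu>\<close> is given by its density \<open>g\<close> with respect to \<open>\<mu> \<Otimes> \<nu>\<close>;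
  \<open>u\<close> and \<open>v\<close> are the densities of the mass that is still unmatched.\<close>

definition partial_coupling ::
    "'a measure \<Rightarrow> 'a measure \<Rightarrow> ('a \<Rightarrow> 'a \<Rightarrow> real) \<Rightarrow> ('a \<Rightarrow> real) \<Rightarrow> ('a \<Rightarrow> real) \<Rightarrow> bool"
  where "partial_coupling \<mu> \<nu> g u v \<longleftrightarrow>
    (\<lambda>(x, y). g x y) \<in> borel_measurable (\<mu> \<Otimes>\<^sub>M \<nu>) \<and> u \<in> borel_measurable \<mu> \<and> v \<in> borel_measurable \<nu> \<and>
    (\<forall>x y. 0 \<le> g x y) \<and> (\<forall>x. 0 \<le> u x \<and> u x \<le> 1) \<and> (\<forall>y. 0 \<le> v y \<and> v y \<le> 1) \<and>
    (\<forall>x\<in>space \<mu>. (\<integral>\<^sup>+ y. ennreal (g x y) \<partial>\<nu>) = ennreal (1 - u x)) \<and>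
    (\<forall>y\<in>space \<nu>. (\<integral>\<^sup>+ x. ennreal (g x y) \<partial>\<mu>) = ennreal (1 - v y))"

text \<open>Inside a cell with unmatched masses a and b, the leftovers are paired independently with
  the factor min(a, b) / (a b), which uses up the lighter side completely. Mass matched earlier
  never left its cell, so a - b is still \<mu>(q) - \<nu>(q), and what survives is the positive part
  of this difference. The cost of the new pairs is charged through c \<le> D x + D y to the mass
  that was unmatched before.\<close>

lemma partial_coupling_step:
  fixes C :: "'a \<Rightarrow> 'c :: countable"
  assumes prob: "prob_space \<mu>" "prob_space \<nu>" and S: "sets \<nu> = sets \<mu>"
    and pc: "partial_coupling \<mu> \<nu> g u v"
    and C: "C \<in> \<mu> \<rightarrow>\<^sub>M count_space UNIV"
    and supp: "\<And>x y. x \<in> space \<mu> \<Longrightarrow> y \<in> space \<mu> \<Longrightarrow> g x y \<noteq> 0 \<Longrightarrow> C x = C y"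
    and D: "D \<in> borel_measurable \<mu>" "\<And>x. 0 \<le> D x" and c: "(\<lambda>(x, y). c x y) \<in> borel_measurable (\<mu> \<Otimes>\<^sub>M \<nu>)"
    and cD: "\<And>x y. x \<in> space \<mu> \<Longrightarrow> y \<in> space \<mu> \<Longrightarrow> C x = C y \<Longrightarrow> c x y \<le> D x + D y" and c0: "\<And>x y. 0 \<le> c x y"
  shows "\<exists>g' u' v'. partial_coupling \<mu> \<nu> g' u' v' \<and>
    (\<forall>x\<in>space \<mu>. \<forall>y\<in>space \<mu>. g' x y \<noteq> 0 \<longrightarrow> C x = C y) \<and>
    (\<forall>q. (\<integral>x. u' x * indicator {q} (C x) \<partial>\<mu>) = max 0 (measure \<mu> (C -` {q} \<inter> space \<mu>) - measure \<nu> (C -` {q} \<inter> space \<mu>))) \<and>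
    (\<forall>q. (\<integral>x. v' x * indicator {q} (C x) \<partial>\<nu>) = max 0 (measure \<nu> (C -` {q} \<inter> space \<mu>) - measure \<mu> (C -` {q} \<inter> space \<mu>))) \<and>
    (\<integral>\<^sup>+ x. \<integral>\<^sup>+ y. ennreal (g' x y * c x y) \<partial>\<nu> \<partial>\<mu>) \<le> (\<integral>\<^sup>+ x. \<integral>\<^sup>+ y. ennreal (g x y * c x y) \<partial>\<nu> \<partial>\<mu>)
      + ((\<integral>\<^sup>+ x. ennreal (u x * D x) \<partial>\<mu>) + (\<integral>\<^sup>+ y. ennreal (v y * D y) \<partial>\<nu>))"
proof -
  interpret \<mu>: prob_space \<mu> by fact
  interpret \<nu>: prob_space \<nu> by fact
  interpret P: pair_prob_space \<mu> \<nu> ..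
  have sp: "space \<nu> = space \<mu>" using S by (rule sets_eq_imp_space_eq)
  note [measurable_cong] = S
  have g[measurable]: "(\<lambda>(x, y). g x y) \<in> borel_measurable (\<mu> \<Otimes>\<^sub>M \<mu>)"
    and [measurable]: "u \<in> borel_measurable \<mu>" "v \<in> borel_measurable \<mu>"
    and [simp]: "\<And>x y. 0 \<le> g x y" "\<And>x. 0 \<le> u x" "\<And>x. u x \<le> 1" "\<And>x. 0 \<le> v x" "\<And>x. v x \<le> 1"
    and gI: "\<And>x. x \<in> space \<mu> \<Longrightarrow> (\<integral>\<^sup>+ y. ennreal (g x y) \<partial>\<nu>) = ennreal (1 - u x)"
      "\<And>y. y \<in> space \<mu> \<Longrightarrow> (\<integral>\<^sup>+ x. ennreal (g x y) \<partial>\<mu>) = ennreal (1 - v y)"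
    using pc S unfolding partial_coupling_def sp
    by (auto cong: measurable_cong_sets sets_pair_measure_cong)
  have [measurable]: "(\<lambda>(x, y). c x y) \<in> borel_measurable (\<mu> \<Otimes>\<^sub>M \<mu>)"
    using c S by (auto cong: measurable_cong_sets sets_pair_measure_cong)
  note [measurable] = C D(1)
  note [simp] = D(2) c0
  have C\<nu>: "C \<in> \<nu> \<rightarrow>\<^sub>M count_space UNIV" using C S by (simp cong: measurable_cong_sets)
  define a where "a q = (\<integral>x. u x * indicator {q} (C x) \<partial>\<mu>)" for q
  define b where "b q = (\<integral>x. v x * indicator {q} (C x) \<partial>\<nu>)" for q
  have a0[simp]: "0 \<le> a q" and b0[simp]: "0 \<le> b q" for q by (auto simp: a_def b_def)
  have ui: "integrable \<mu> (\<lambda>x. u x * indicator {q} (C x))" for q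
    by (intro \<mu>.integrable_const_bound[where B=1]) (auto simp: indicator_def)
  have vi: "integrable \<nu> (\<lambda>x. v x * indicator {q} (C x))" for q
    by (intro \<nu>.integrable_const_bound[where B=1]) (auto simp: indicator_def)
  have an: "(\<integral>\<^sup>+x. ennreal (u x * indicator {q} (C x)) \<partial>\<mu>) = ennreal (a q)" for q
    unfolding a_def by (intro nn_integral_eq_integral ui) auto
  have bn: "(\<integral>\<^sup>+x. ennreal (v x * indicator {q} (C x)) \<partial>\<nu>) = ennreal (b q)" for q
    unfolding b_def by (intro nn_integral_eq_integral vi) auto
  \<comment> \<open>If one of the masses is 0, division by zero gives the factor 0: nothing is
    matched in that cell.\<close>
  define r where "r q = min (a q) (b q) / (a q * b q)" for q
  define \<alpha> where "\<alpha> q = min (a q) (b q) / a q" for q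
  define \<beta> where "\<beta> q = min (a q) (b q) / b q" for q
  have r: "0 \<le> r q" "r q * b q = \<alpha> q" "r q * a q = \<beta> q" for q
  proof -
    show "0 \<le> r q" by (simp add: r_def)
    show "r q * b q = \<alpha> q" using a0[of q] by (cases "b q = 0") (auto simp: r_def \<alpha>_def)
    show "r q * a q = \<beta> q" using b0[of q] by (cases "a q = 0") (auto simp: r_def \<beta>_def)
  qed
  have \<alpha>1: "0 \<le> \<alpha> q" "\<alpha> q \<le> 1" and \<beta>1: "0 \<le> \<beta> q" "\<beta> q \<le> 1" for q
    unfolding \<alpha>_def \<beta>_def by (cases "a q = 0"; cases "b q = 0"; simp add: divide_le_eq less_le)+
  define g1 where "g1 x y = (if C x = C y then u x * v y * r (C x) else 0)" for x y
  define u' where "u' x = u x * (1 - \<alpha> (C x))" for x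
  define v' where "v' y = v y * (1 - \<beta> (C y))" for y
  have g10[simp]: "0 \<le> g1 x y" for x y using r(1) by (simp add: g1_def)
  have m: "(\<lambda>x. h (C x)) \<in> borel_measurable \<mu>" for h :: "'c \<Rightarrow> real"
    by (rule measurable_compose[OF C]) simp
  have rm[measurable]: "(\<lambda>x. r (C x)) \<in> borel_measurable \<mu>" "(\<lambda>x. \<alpha> (C x)) \<in> borel_measurable \<mu>" "(\<lambda>x. \<beta> (C x)) \<in> borel_measurable \<mu>"
    by (rule m)+
  have g1m[measurable]: "(\<lambda>(x, y). g1 x y) \<in> borel_measurable (\<mu> \<Otimes>\<^sub>M \<mu>)"
  proof -
    have "{z \<in> space (\<mu> \<Otimes>\<^sub>M \<mu>). C (fst z) = C (snd z)} \<in> sets (\<mu> \<Otimes>\<^sub>M \<mu>)" by measurable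
    then show ?thesis unfolding g1_def split_beta' by measurable
  qed
  have g1x: "(\<integral>\<^sup>+ y. ennreal (g1 x y) \<partial>\<nu>) = ennreal (u x * \<alpha> (C x))" for x
  proof -
    have "(\<integral>\<^sup>+ y. ennreal (g1 x y) \<partial>\<nu>) = (\<integral>\<^sup>+ y. ennreal (u x * r (C x)) * ennreal (v y * indicator {C x} (C y)) \<partial>\<nu>)"
      using r(1) by (intro nn_integral_cong) (auto simp: g1_def indicator_def mult_ac simp flip: ennreal_mult)
    also have "\<dots> = ennreal (u x * r (C x)) * ennreal (b (C x))"
      unfolding bn[symmetric] by (rule nn_integral_cmult) measurable
    also have "\<dots> = ennreal (u x * \<alpha> (C x))" using r[of "C x"] by (simp add: mult.assoc flip: ennreal_mult)
    finally show ?thesis .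
  qed
  have g1y: "(\<integral>\<^sup>+ x. ennreal (g1 x y) \<partial>\<mu>) = ennreal (v y * \<beta> (C y))" for y
  proof -
    have "(\<integral>\<^sup>+ x. ennreal (g1 x y) \<partial>\<mu>) = (\<integral>\<^sup>+ x. ennreal (v y * r (C y)) * ennreal (u x * indicator {C y} (C x)) \<partial>\<mu>)"
      using r(1) by (intro nn_integral_cong) (auto simp: g1_def indicator_def mult_ac simp flip: ennreal_mult)
    also have "\<dots> = ennreal (v y * r (C y)) * ennreal (a (C y))"
      unfolding an[symmetric] by (rule nn_integral_cmult) measurable
    also have "\<dots> = ennreal (v y * \<beta> (C y))" using r[of "C y"] by (simp add: mult.assoc flip: ennreal_mult)
    finally show ?thesis .
  qed
  have pc': "partial_coupling \<mu> \<nu> (\<lambda>x y. g x y + g1 x y) u' v'"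
    unfolding partial_coupling_def
  proof (intro conjI allI ballI)
    show "(\<lambda>(x, y). g x y + g1 x y) \<in> borel_measurable (\<mu> \<Otimes>\<^sub>M \<nu>)" by measurable
    show "u' \<in> borel_measurable \<mu>" "v' \<in> borel_measurable \<nu>" unfolding u'_def v'_def by measurable
    show "0 \<le> u' x" "u' x \<le> 1" "0 \<le> v' x" "v' x \<le> 1" for x
      using \<alpha>1[of "C x"] \<beta>1[of "C x"] by (auto simp: u'_def v'_def intro!: mult_le_one)
    fix x assume x: "x \<in> space \<mu>"
    then have "(\<integral>\<^sup>+ y. ennreal (g x y + g1 x y) \<partial>\<nu>) = (\<integral>\<^sup>+ y. ennreal (g x y) \<partial>\<nu>) + (\<integral>\<^sup>+ y. ennreal (g1 x y) \<partial>\<nu>)"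
      by (simp add: nn_integral_add)
    also have "\<dots> = ennreal (1 - u' x)"
      using gI(1)[OF x] \<alpha>1[of "C x"] by (simp add: g1x u'_def algebra_simps flip: ennreal_plus)
    finally show "(\<integral>\<^sup>+ y. ennreal (g x y + g1 x y) \<partial>\<nu>) = ennreal (1 - u' x)" .
  next
    fix y assume "y \<in> space \<nu>"
    then have y: "y \<in> space \<mu>" by (simp add: sp)
    then have "(\<integral>\<^sup>+ x. ennreal (g x y + g1 x y) \<partial>\<mu>) = (\<integral>\<^sup>+ x. ennreal (g x y) \<partial>\<mu>) + (\<integral>\<^sup>+ x. ennreal (g1 x y) \<partial>\<mu>)"
      by (simp add: nn_integral_add)
    also have "\<dots> = ennreal (1 - v' y)"
      using gI(2)[OF y] \<beta>1[of "C y"] by (simp add: g1y v'_def algebra_simps flip: ennreal_plus)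
    finally show "(\<integral>\<^sup>+ x. ennreal (g x y + g1 x y) \<partial>\<mu>) = ennreal (1 - v' y)" .
  qed auto
  \<comment> \<open>The density g moves mass only within cells, so it removes the same amount from
    \<mu> and from \<nu> in each cell.\<close>
  have diff: "a q - b q = measure \<mu> (C -` {q} \<inter> space \<mu>) - measure \<nu> (C -` {q} \<inter> space \<mu>)" for q
  proof -
    let ?I = "\<lambda>x. indicator {q} (C x) :: real"
    have "(\<integral>\<^sup>+ x. ennreal ((1 - u x) * ?I x) \<partial>\<mu>) = (\<integral>\<^sup>+ x. \<integral>\<^sup>+ y. ennreal (g x y * ?I x) \<partial>\<nu> \<partial>\<mu>)"
    proof (rule nn_integral_cong)
      fix x assume x: "x \<in> space \<mu>"
      then have "(\<integral>\<^sup>+ y. ennreal (g x y * ?I x) \<partial>\<nu>) = (\<integral>\<^sup>+ y. ennreal (g x y) \<partial>\<nu>) * ennreal (?I x)"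
        by (subst nn_integral_multc[symmetric]) (auto simp: ennreal_mult)
      then show "ennreal ((1 - u x) * ?I x) = (\<integral>\<^sup>+ y. ennreal (g x y * ?I x) \<partial>\<nu>)"
        by (simp add: gI(1)[OF x] ennreal_mult)
    qed
    also have "\<dots> = (\<integral>\<^sup>+ x. \<integral>\<^sup>+ y. ennreal (g x y * ?I y) \<partial>\<nu> \<partial>\<mu>)"
    proof (intro nn_integral_cong)
      fix x y assume "x \<in> space \<mu>" "y \<in> space \<nu>"
      then show "ennreal (g x y * ?I x) = ennreal (g x y * ?I y)"
        using supp[of x y] by (cases "g x y = 0") (auto simp: sp)
    qed
    also have "\<dots> = (\<integral>\<^sup>+ y. \<integral>\<^sup>+ x. ennreal (g x y * ?I y) \<partial>\<mu> \<partial>\<nu>)"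
      by (rule P.Fubini'[symmetric]) measurable
    also have "\<dots> = (\<integral>\<^sup>+ y. ennreal ((1 - v y) * ?I y) \<partial>\<nu>)"
    proof (rule nn_integral_cong)
      fix y assume "y \<in> space \<nu>"
      then have y: "y \<in> space \<mu>" by (simp add: sp)
      then have "(\<integral>\<^sup>+ x. ennreal (g x y * ?I y) \<partial>\<mu>) = (\<integral>\<^sup>+ x. ennreal (g x y) \<partial>\<mu>) * ennreal (?I y)"
        by (subst nn_integral_multc[symmetric]) (auto simp: ennreal_mult)
      then show "(\<integral>\<^sup>+ x. ennreal (g x y * ?I y) \<partial>\<mu>) = ennreal ((1 - v y) * ?I y)"
        by (simp add: gI(2)[OF y] ennreal_mult)
    qed
    finally have eq: "(\<integral>\<^sup>+ x. ennreal ((1 - u x) * ?I x) \<partial>\<mu>) = (\<integral>\<^sup>+ y. ennreal ((1 - v y) * ?I y) \<partial>\<nu>)" .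
    have Im: "integrable \<mu> ?I" "integrable \<nu> ?I"
      by (intro \<mu>.integrable_const_bound[where B=1] \<nu>.integrable_const_bound[where B=1]; auto)+
    have e1: "(\<lambda>x. (1 - u x) * ?I x) = (\<lambda>x. ?I x - u x * ?I x)" "(\<lambda>x. (1 - v x) * ?I x) = (\<lambda>x. ?I x - v x * ?I x)"
      by (auto simp: algebra_simps)
    have "(\<integral>x. (1 - u x) * ?I x \<partial>\<mu>) = (\<integral>x. (1 - v x) * ?I x \<partial>\<nu>)"
      using eq by (subst (1 2) integral_eq_nn_integral) auto
    then have "(\<integral>x. ?I x \<partial>\<mu>) - a q = (\<integral>x. ?I x \<partial>\<nu>) - b q"
      unfolding e1 a_def b_def using ui vi Im by simp
    moreover have "(\<integral>x. ?I x \<partial>\<mu>) = measure \<mu> (C -` {q} \<inter> space \<mu>)"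
      by (subst Bochner_Integration.integral_cong[OF refl, where g="indicator (C -` {q} \<inter> space \<mu>)"])
        (auto simp: indicator_def)
    moreover have "(\<integral>x. ?I x \<partial>\<nu>) = measure \<nu> (C -` {q} \<inter> space \<mu>)"
      by (subst Bochner_Integration.integral_cong[OF refl, where g="indicator (C -` {q} \<inter> space \<mu>)"])
        (auto simp: indicator_def sp)
    ultimately show ?thesis by linarith
  qed
  have leftu: "(\<integral>x. u' x * indicator {q} (C x) \<partial>\<mu>) = max 0 (a q - b q)" for q
  proof -
    have "(\<integral>x. u' x * indicator {q} (C x) \<partial>\<mu>) = (\<integral>x. (1 - \<alpha> q) * (u x * indicator {q} (C x)) \<partial>\<mu>)"
      by (intro Bochner_Integration.integral_cong) (auto simp: u'_def indicator_def)
    also have "\<dots> = (1 - \<alpha> q) * a q" by (simp add: a_def)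
    also have "\<dots> = max 0 (a q - b q)"
      using a0[of q] b0[of q] by (cases "a q = 0") (auto simp: \<alpha>_def algebra_simps)
    finally show ?thesis .
  qed
  have leftv: "(\<integral>x. v' x * indicator {q} (C x) \<partial>\<nu>) = max 0 (b q - a q)" for q
  proof -
    have "(\<integral>x. v' x * indicator {q} (C x) \<partial>\<nu>) = (\<integral>x. (1 - \<beta> q) * (v x * indicator {q} (C x)) \<partial>\<nu>)"
      by (intro Bochner_Integration.integral_cong) (auto simp: v'_def indicator_def)
    also have "\<dots> = (1 - \<beta> q) * b q" by (simp add: b_def)
    also have "\<dots> = max 0 (b q - a q)"
      using a0[of q] b0[of q] by (cases "b q = 0") (auto simp: \<beta>_def algebra_simps)
    finally show ?thesis .
  qed
  have cost: "(\<integral>\<^sup>+ x. \<integral>\<^sup>+ y. ennreal (g1 x y * c x y) \<partial>\<nu> \<partial>\<mu>)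
      \<le> (\<integral>\<^sup>+ x. ennreal (u x * D x) \<partial>\<mu>) + (\<integral>\<^sup>+ y. ennreal (v y * D y) \<partial>\<nu>)"
  proof -
    have "(\<integral>\<^sup>+ x. \<integral>\<^sup>+ y. ennreal (g1 x y * c x y) \<partial>\<nu> \<partial>\<mu>)
        \<le> (\<integral>\<^sup>+ x. \<integral>\<^sup>+ y. ennreal (g1 x y * D x) + ennreal (g1 x y * D y) \<partial>\<nu> \<partial>\<mu>)"
    proof (intro nn_integral_mono)
      fix x y assume "x \<in> space \<mu>" "y \<in> space \<nu>"
      then have "g1 x y * c x y \<le> g1 x y * (D x + D y)"
      proof (cases "C x = C y")
        case True
        with cD[of x y] \<open>x \<in> space \<mu>\<close> \<open>y \<in> space \<nu>\<close> show ?thesis by (intro mult_left_mono) (auto simp: sp)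
      qed (simp add: g1_def)
      then show "ennreal (g1 x y * c x y) \<le> ennreal (g1 x y * D x) + ennreal (g1 x y * D y)"
        by (simp add: distrib_left flip: ennreal_plus)
    qed
    also have "\<dots> = (\<integral>\<^sup>+ x. (\<integral>\<^sup>+ y. ennreal (g1 x y * D x) \<partial>\<nu>) + (\<integral>\<^sup>+ y. ennreal (g1 x y * D y) \<partial>\<nu>) \<partial>\<mu>)"
      by (intro nn_integral_cong nn_integral_add) measurable
    also have "\<dots> = (\<integral>\<^sup>+ x. \<integral>\<^sup>+ y. ennreal (g1 x y * D x) \<partial>\<nu> \<partial>\<mu>) + (\<integral>\<^sup>+ x. \<integral>\<^sup>+ y. ennreal (g1 x y * D y) \<partial>\<nu> \<partial>\<mu>)"
      by (rule nn_integral_add) measurable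
    also have "(\<integral>\<^sup>+ x. \<integral>\<^sup>+ y. ennreal (g1 x y * D y) \<partial>\<nu> \<partial>\<mu>) = (\<integral>\<^sup>+ y. \<integral>\<^sup>+ x. ennreal (g1 x y * D y) \<partial>\<mu> \<partial>\<nu>)"
      by (rule P.Fubini'[symmetric]) measurable
    also have "(\<integral>\<^sup>+ x. \<integral>\<^sup>+ y. ennreal (g1 x y * D x) \<partial>\<nu> \<partial>\<mu>) \<le> (\<integral>\<^sup>+ x. ennreal (u x * D x) \<partial>\<mu>)"
    proof (intro nn_integral_mono)
      fix x assume x: "x \<in> space \<mu>"
      then have "(\<integral>\<^sup>+ y. ennreal (g1 x y * D x) \<partial>\<nu>) = (\<integral>\<^sup>+ y. ennreal (g1 x y) \<partial>\<nu>) * ennreal (D x)"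
        by (subst nn_integral_multc[symmetric]) (auto simp: ennreal_mult)
      also have "\<dots> \<le> ennreal (u x * D x)"
        using \<alpha>1[of "C x"] unfolding g1x
        by (subst ennreal_mult[symmetric]) (auto intro!: ennreal_leI mult_right_mono mult_left_le)
      finally show "(\<integral>\<^sup>+ y. ennreal (g1 x y * D x) \<partial>\<nu>) \<le> ennreal (u x * D x)" .
    qed
    also have "(\<integral>\<^sup>+ y. \<integral>\<^sup>+ x. ennreal (g1 x y * D y) \<partial>\<mu> \<partial>\<nu>) \<le> (\<integral>\<^sup>+ y. ennreal (v y * D y) \<partial>\<nu>)"
    proof (intro nn_integral_mono)
      fix y assume "y \<in> space \<nu>"
      then have y: "y \<in> space \<mu>" by (simp add: sp)
      then have "(\<integral>\<^sup>+ x. ennreal (g1 x y * D y) \<partial>\<mu>) = (\<integral>\<^sup>+ x. ennreal (g1 x y) \<partial>\<mu>) * ennreal (D y)"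
        by (subst nn_integral_multc[symmetric]) (auto simp: ennreal_mult)
      also have "\<dots> \<le> ennreal (v y * D y)"
        using \<beta>1[of "C y"] unfolding g1y
        by (subst ennreal_mult[symmetric]) (auto intro!: ennreal_leI mult_right_mono mult_left_le)
      finally show "(\<integral>\<^sup>+ x. ennreal (g1 x y * D y) \<partial>\<mu>) \<le> ennreal (v y * D y)" .
    qed
    finally show ?thesis by (simp add: add_mono)
  qed
  have "(\<integral>\<^sup>+ x. \<integral>\<^sup>+ y. ennreal ((g x y + g1 x y) * c x y) \<partial>\<nu> \<partial>\<mu>)
      = (\<integral>\<^sup>+ x. (\<integral>\<^sup>+ y. ennreal (g x y * c x y) \<partial>\<nu>) + (\<integral>\<^sup>+ y. ennreal (g1 x y * c x y) \<partial>\<nu>) \<partial>\<mu>)"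
    by (intro nn_integral_cong, subst nn_integral_add[symmetric]) (auto simp: distrib_right)
  also have "\<dots> = (\<integral>\<^sup>+ x. \<integral>\<^sup>+ y. ennreal (g x y * c x y) \<partial>\<nu> \<partial>\<mu>) + (\<integral>\<^sup>+ x. \<integral>\<^sup>+ y. ennreal (g1 x y * c x y) \<partial>\<nu> \<partial>\<mu>)"
    by (rule nn_integral_add) measurable
  also have "\<dots> \<le> (\<integral>\<^sup>+ x. \<integral>\<^sup>+ y. ennreal (g x y * c x y) \<partial>\<nu> \<partial>\<mu>)
      + ((\<integral>\<^sup>+ x. ennreal (u x * D x) \<partial>\<mu>) + (\<integral>\<^sup>+ y. ennreal (v y * D y) \<partial>\<nu>))"
    by (intro add_left_mono cost)
  finally have total: "(\<integral>\<^sup>+ x. \<integral>\<^sup>+ y. ennreal ((g x y + g1 x y) * c x y) \<partial>\<nu> \<partial>\<mu>)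
      \<le> (\<integral>\<^sup>+ x. \<integral>\<^sup>+ y. ennreal (g x y * c x y) \<partial>\<nu> \<partial>\<mu>)
      + ((\<integral>\<^sup>+ x. ennreal (u x * D x) \<partial>\<mu>) + (\<integral>\<^sup>+ y. ennreal (v y * D y) \<partial>\<nu>))" .
  have "b q - a q = measure \<nu> (C -` {q} \<inter> space \<mu>) - measure \<mu> (C -` {q} \<inter> space \<mu>)" for q
    using diff[of q] by linarith
  then show ?thesis
    using leftu leftv diff pc' total supp
    by (intro exI[of _ "\<lambda>x y. g x y + g1 x y"] exI[of _ u'] exI[of _ v']) (auto simp: g1_def)
qed

text \<open>D depends on x only through its cell, and there are countably many cells. This turns the
  charge of a matching step into a sum over cells of leftover masses; with u = 1 it is the image
  measure formula for C.\<close>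

lemma nn_integral_leftover:
  fixes C :: "'a \<Rightarrow> 'c :: countable"
  assumes "prob_space \<mu>" and C[measurable]: "C \<in> \<mu> \<rightarrow>\<^sub>M count_space UNIV" and u[measurable]: "u \<in> borel_measurable \<mu>"
    and ub: "\<And>x. 0 \<le> u x" "\<And>x. u x \<le> 1" and D: "\<And>q. 0 \<le> D q"
  shows "(\<integral>\<^sup>+ x. ennreal (u x * D (C x)) \<partial>\<mu>)
    = (\<integral>\<^sup>+ q. ennreal (D q * (\<integral>x. u x * indicator {q} (C x) \<partial>\<mu>)) \<partial>count_space UNIV)"
proof -
  interpret prob_space \<mu> by fact
  have "(\<integral>\<^sup>+ x. ennreal (u x * D (C x)) \<partial>\<mu>)
      = (\<integral>\<^sup>+ x. \<integral>\<^sup>+ q. ennreal (D q * (u x * indicator {q} (C x))) \<partial>count_space UNIV \<partial>\<mu>)"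
  proof (rule nn_integral_cong)
    fix x
    have "(\<integral>\<^sup>+ q. ennreal (D q * (u x * indicator {q} (C x))) \<partial>count_space UNIV)
        = (\<integral>\<^sup>+ q. ennreal (D q * u x) * indicator {C x} q \<partial>count_space UNIV)"
      by (intro nn_integral_cong) (auto simp: indicator_def)
    also have "\<dots> = ennreal (D (C x) * u x)"
      by (subst nn_integral_indicator_singleton) auto
    finally show "ennreal (u x * D (C x)) = (\<integral>\<^sup>+ q. ennreal (D q * (u x * indicator {q} (C x))) \<partial>count_space UNIV)"
      by (simp add: mult.commute)
  qed
  also have "\<dots> = (\<integral>\<^sup>+ q. \<integral>\<^sup>+ x. ennreal (D q * (u x * indicator {q} (C x))) \<partial>\<mu> \<partial>count_space UNIV)"
    by (rule nn_integral_count_space_nn_integral) auto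
  also have "\<dots> = (\<integral>\<^sup>+ q. ennreal (D q * (\<integral>x. u x * indicator {q} (C x) \<partial>\<mu>)) \<partial>count_space UNIV)"
  proof (rule nn_integral_cong)
    fix q
    have "integrable \<mu> (\<lambda>x. u x * indicator {q} (C x))"
      using ub by (intro integrable_const_bound[where B=1]) (auto simp: indicator_def)
    then have "integrable \<mu> (\<lambda>x. D q * (u x * indicator {q} (C x)))" by simp
    then show "(\<integral>\<^sup>+ x. ennreal (D q * (u x * indicator {q} (C x))) \<partial>\<mu>) = ennreal (D q * (\<integral>x. u x * indicator {q} (C x) \<partial>\<mu>))"
      using ub D by (subst nn_integral_eq_integral) auto
  qed
  finally show ?thesis .
qed

lemma partial_coupling_complete:
  assumes prob: "prob_space \<mu>" "prob_space \<nu>" and pc: "partial_coupling \<mu> \<nu> g u v"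
    and u: "AE x in \<mu>. u x = 0" and v: "AE y in \<nu>. v y = 0"
  shows "density (\<mu> \<Otimes>\<^sub>M \<nu>) (\<lambda>(x, y). ennreal (g x y)) \<in> couplings \<mu> \<nu>"
proof -
  interpret \<mu>: prob_space \<mu> by fact
  interpret \<nu>: prob_space \<nu> by fact
  interpret P: pair_prob_space \<mu> \<nu> ..
  have [measurable]: "(\<lambda>(x, y). g x y) \<in> borel_measurable (\<mu> \<Otimes>\<^sub>M \<nu>)"
    and gI: "\<And>x. x \<in> space \<mu> \<Longrightarrow> (\<integral>\<^sup>+ y. ennreal (g x y) \<partial>\<nu>) = ennreal (1 - u x)"
      "\<And>y. y \<in> space \<nu> \<Longrightarrow> (\<integral>\<^sup>+ x. ennreal (g x y) \<partial>\<mu>) = ennreal (1 - v y)"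
    using pc by (auto simp: partial_coupling_def)
  let ?\<gamma> = "density (\<mu> \<Otimes>\<^sub>M \<nu>) (\<lambda>(x, y). ennreal (g x y))"
  have "distr ?\<gamma> \<mu> fst = \<mu>"
  proof (rule measure_eqI)
    fix B assume "B \<in> sets (distr ?\<gamma> \<mu> fst)"
    then have [measurable]: "B \<in> sets \<mu>" by simp
    have "emeasure (distr ?\<gamma> \<mu> fst) B = (\<integral>\<^sup>+ z. indicator B z \<partial>distr ?\<gamma> \<mu> fst)" by simp
    also have "\<dots> = (\<integral>\<^sup>+ z. indicator B (fst z) \<partial>?\<gamma>)"
      by (rule nn_integral_distr) measurable
    also have "\<dots> = (\<integral>\<^sup>+ (x, y). ennreal (g x y) * indicator B x \<partial>(\<mu> \<Otimes>\<^sub>M \<nu>))"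
      by (subst nn_integral_density) (auto simp: split_beta')
    also have "\<dots> = (\<integral>\<^sup>+ x. \<integral>\<^sup>+ y. ennreal (g x y) * indicator B x \<partial>\<nu> \<partial>\<mu>)"
      by (subst \<nu>.nn_integral_fst[symmetric]) auto
    also have "\<dots> = (\<integral>\<^sup>+ x. indicator B x \<partial>\<mu>)"
    proof (rule nn_integral_cong_AE)
      show "AE x in \<mu>. (\<integral>\<^sup>+ y. ennreal (g x y) * indicator B x \<partial>\<nu>) = indicator B x"
        using u AE_space
      proof eventually_elim
        case (elim x)
        then show ?case using gI(1)[of x] by (subst nn_integral_multc) auto
      qed
    qed
    finally show "emeasure (distr ?\<gamma> \<mu> fst) B = emeasure \<mu> B" by simp
  qed simp
  moreover have "distr ?\<gamma> \<nu> snd = \<nu>"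
  proof (rule measure_eqI)
    fix B assume "B \<in> sets (distr ?\<gamma> \<nu> snd)"
    then have [measurable]: "B \<in> sets \<nu>" by simp
    have "emeasure (distr ?\<gamma> \<nu> snd) B = (\<integral>\<^sup>+ z. indicator B z \<partial>distr ?\<gamma> \<nu> snd)" by simp
    also have "\<dots> = (\<integral>\<^sup>+ z. indicator B (snd z) \<partial>?\<gamma>)"
      by (rule nn_integral_distr) measurable
    also have "\<dots> = (\<integral>\<^sup>+ (x, y). ennreal (g x y) * indicator B y \<partial>(\<mu> \<Otimes>\<^sub>M \<nu>))"
      by (subst nn_integral_density) (auto simp: split_beta')
    also have "\<dots> = (\<integral>\<^sup>+ y. \<integral>\<^sup>+ x. ennreal (g x y) * indicator B y \<partial>\<mu> \<partial>\<nu>)"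
      by (subst P.nn_integral_snd[symmetric]) auto
    also have "\<dots> = (\<integral>\<^sup>+ y. indicator B y \<partial>\<nu>)"
    proof (rule nn_integral_cong_AE)
      show "AE y in \<nu>. (\<integral>\<^sup>+ x. ennreal (g x y) * indicator B y \<partial>\<mu>) = indicator B y"
        using v AE_space
      proof eventually_elim
        case (elim y)
        then show ?case using gI(2)[of y] by (subst nn_integral_multc) auto
      qed
    qed
    finally show "emeasure (distr ?\<gamma> \<nu> snd) B = emeasure \<nu> B" by simp
  qed simp
  ultimately show ?thesis by (simp add: couplings_def)
qed

text \<open>Greedy matching from the finest partition \<open>C 0\<close> to the trivial partition \<open>C m\<close>.  What is left
  over in a cell \<open>q\<close> after its own step is exactly \<open>\<mu>(q) - \<nu>(q)\<close> (or \<open>\<nu>(q) - \<mu>(q)\<close>), so the next step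
  pays only for these differences.\<close>

lemma multiscale_coupling:
  fixes C :: "nat \<Rightarrow> 'a \<Rightarrow> 'c :: countable"
  assumes prob: "prob_space \<mu>" "prob_space \<nu>" and S: "sets \<nu> = sets \<mu>"
    and C: "\<And>j. j \<le> m \<Longrightarrow> C j \<in> \<mu> \<rightarrow>\<^sub>M count_space UNIV"
    and nest: "\<And>j x y. j < m \<Longrightarrow> C j x = C j y \<Longrightarrow> C (Suc j) x = C (Suc j) y"
    and D: "0 \<le> D0" "\<And>j q. 0 \<le> D j q" and c: "(\<lambda>(x, y). c x y) \<in> borel_measurable (\<mu> \<Otimes>\<^sub>M \<nu>)"
    and c0: "\<And>x y. 0 \<le> c x y"
    and cost0: "\<And>x y. x \<in> space \<mu> \<Longrightarrow> y \<in> space \<mu> \<Longrightarrow> C 0 x = C 0 y \<Longrightarrow> c x y \<le> D0 + D0"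
    and cost: "\<And>j x y. j < m \<Longrightarrow> x \<in> space \<mu> \<Longrightarrow> y \<in> space \<mu> \<Longrightarrow> C (Suc j) x = C (Suc j) y \<Longrightarrow>
      c x y \<le> D j (C j x) + D j (C j y)"
    and const: "\<And>x y. C m x = C m y"
  shows "\<exists>\<gamma>\<in>couplings \<mu> \<nu>. (\<integral>\<^sup>+ z. ennreal (c (fst z) (snd z)) \<partial>\<gamma>) \<le> ennreal (2 * D0)
    + (\<Sum>j<m. \<integral>\<^sup>+ q. ennreal (D j q * \<bar>measure \<mu> (C j -` {q} \<inter> space \<mu>) - measure \<nu> (C j -` {q} \<inter> space \<mu>)\<bar>) \<partial>count_space UNIV)"
proof -
  interpret \<mu>: prob_space \<mu> by fact
  interpret \<nu>: prob_space \<nu> by fact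
  interpret P: pair_prob_space \<mu> \<nu> ..
  have sp: "space \<nu> = space \<mu>" using S by (rule sets_eq_imp_space_eq)
  define E where "E j q = measure \<mu> (C j -` {q} \<inter> space \<mu>) - measure \<nu> (C j -` {q} \<inter> space \<mu>)" for j q
  define B where "B j = ennreal (2 * D0) + (\<Sum>i<j. \<integral>\<^sup>+ q. ennreal (D i q * \<bar>E i q\<bar>) \<partial>count_space UNIV)" for j
  have "\<exists>g u v. partial_coupling \<mu> \<nu> g u v \<and>
    (\<forall>x\<in>space \<mu>. \<forall>y\<in>space \<mu>. g x y \<noteq> 0 \<longrightarrow> C j x = C j y) \<and>
    (\<forall>q. (\<integral>x. u x * indicator {q} (C j x) \<partial>\<mu>) = max 0 (E j q)) \<and>
    (\<forall>q. (\<integral>x. v x * indicator {q} (C j x) \<partial>\<nu>) = max 0 (- E j q)) \<and>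
    (\<integral>\<^sup>+ x. \<integral>\<^sup>+ y. ennreal (g x y * c x y) \<partial>\<nu> \<partial>\<mu>) \<le> B j" if "j \<le> m" for j
    using that
  proof (induction j)
    case 0
    \<comment> \<open>Initially nothing is matched. The first step charges at most D0 for each unit
      of mass on both sides, which is the term 2 * D0.\<close>
    have pc: "partial_coupling \<mu> \<nu> (\<lambda>_ _. 0) (\<lambda>_. 1) (\<lambda>_. 1)"
      by (simp add: partial_coupling_def)
    obtain g u v where G: "partial_coupling \<mu> \<nu> g u v"
      "\<forall>x\<in>space \<mu>. \<forall>y\<in>space \<mu>. g x y \<noteq> 0 \<longrightarrow> C 0 x = C 0 y"
      "\<forall>q. (\<integral>x. u x * indicator {q} (C 0 x) \<partial>\<mu>) = max 0 (measure \<mu> (C 0 -` {q} \<inter> space \<mu>) - measure \<nu> (C 0 -` {q} \<inter> space \<mu>))"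
      "\<forall>q. (\<integral>x. v x * indicator {q} (C 0 x) \<partial>\<nu>) = max 0 (measure \<nu> (C 0 -` {q} \<inter> space \<mu>) - measure \<mu> (C 0 -` {q} \<inter> space \<mu>))"
      "(\<integral>\<^sup>+ x. \<integral>\<^sup>+ y. ennreal (g x y * c x y) \<partial>\<nu> \<partial>\<mu>) \<le> (\<integral>\<^sup>+ x. \<integral>\<^sup>+ y. ennreal (0 * c x y) \<partial>\<nu> \<partial>\<mu>)
      + ((\<integral>\<^sup>+ x. ennreal (1 * D0) \<partial>\<mu>) + (\<integral>\<^sup>+ y. ennreal (1 * D0) \<partial>\<nu>))"
      using partial_coupling_step[OF prob S pc C[of 0], where D="\<lambda>_. D0" and c=c] c c0 D cost0 by auto
    have "(\<integral>\<^sup>+ x. \<integral>\<^sup>+ y. ennreal (0 * c x y) \<partial>\<nu> \<partial>\<mu>) + ((\<integral>\<^sup>+ x. ennreal (1 * D0) \<partial>\<mu>) + (\<integral>\<^sup>+ y. ennreal (1 * D0) \<partial>\<nu>)) = B 0"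
      using D by (simp add: B_def \<mu>.emeasure_space_1 \<nu>.emeasure_space_1 flip: ennreal_plus)
    then show ?case using G by (intro exI[of _ g] exI[of _ u] exI[of _ v]) (auto simp: E_def)
  next
    case (Suc j)
    then have j: "j < m" by simp
    obtain g u v where G: "partial_coupling \<mu> \<nu> g u v"
      "\<forall>x\<in>space \<mu>. \<forall>y\<in>space \<mu>. g x y \<noteq> 0 \<longrightarrow> C j x = C j y"
      and U: "\<And>q. (\<integral>x. u x * indicator {q} (C j x) \<partial>\<mu>) = max 0 (E j q)"
      and V: "\<And>q. (\<integral>x. v x * indicator {q} (C j x) \<partial>\<nu>) = max 0 (- E j q)"
      and cj: "(\<integral>\<^sup>+ x. \<integral>\<^sup>+ y. ennreal (g x y * c x y) \<partial>\<nu> \<partial>\<mu>) \<le> B j"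
      using Suc by auto
    have Cj: "C j \<in> \<mu> \<rightarrow>\<^sub>M count_space UNIV" "C j \<in> \<nu> \<rightarrow>\<^sub>M count_space UNIV"
      using C[of j] j S by (auto cong: measurable_cong_sets)
    have Dm: "(\<lambda>x. D j (C j x)) \<in> borel_measurable \<mu>" by (rule measurable_compose[OF Cj(1)]) simp
    obtain g' u' v' where G': "partial_coupling \<mu> \<nu> g' u' v'"
      "\<forall>x\<in>space \<mu>. \<forall>y\<in>space \<mu>. g' x y \<noteq> 0 \<longrightarrow> C (Suc j) x = C (Suc j) y"
      "\<forall>q. (\<integral>x. u' x * indicator {q} (C (Suc j) x) \<partial>\<mu>) = max 0 (measure \<mu> (C (Suc j) -` {q} \<inter> space \<mu>) - measure \<nu> (C (Suc j) -` {q} \<inter> space \<mu>))"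
      "\<forall>q. (\<integral>x. v' x * indicator {q} (C (Suc j) x) \<partial>\<nu>) = max 0 (measure \<nu> (C (Suc j) -` {q} \<inter> space \<mu>) - measure \<mu> (C (Suc j) -` {q} \<inter> space \<mu>))"
      and c': "(\<integral>\<^sup>+ x. \<integral>\<^sup>+ y. ennreal (g' x y * c x y) \<partial>\<nu> \<partial>\<mu>) \<le> (\<integral>\<^sup>+ x. \<integral>\<^sup>+ y. ennreal (g x y * c x y) \<partial>\<nu> \<partial>\<mu>)
      + ((\<integral>\<^sup>+ x. ennreal (u x * D j (C j x)) \<partial>\<mu>) + (\<integral>\<^sup>+ y. ennreal (v y * D j (C j y)) \<partial>\<nu>))"
      using partial_coupling_step[OF prob S G(1) C[OF Suc.prems] _ Dm _ c _ c0] nest[OF j] G(2) D(2) cost[OF j] by blast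
    have uv: "u \<in> borel_measurable \<mu>" "v \<in> borel_measurable \<nu>" "\<And>x. 0 \<le> u x" "\<And>x. u x \<le> 1" "\<And>x. 0 \<le> v x" "\<And>x. v x \<le> 1"
      using G(1) by (auto simp: partial_coupling_def)
    have "(\<integral>\<^sup>+ x. ennreal (u x * D j (C j x)) \<partial>\<mu>) + (\<integral>\<^sup>+ y. ennreal (v y * D j (C j y)) \<partial>\<nu>)
      = (\<integral>\<^sup>+ q. ennreal (D j q * max 0 (E j q)) \<partial>count_space UNIV) + (\<integral>\<^sup>+ q. ennreal (D j q * max 0 (- E j q)) \<partial>count_space UNIV)"
      by (subst (1 2) nn_integral_leftover) (auto simp: prob Cj uv D U V)
    also have "\<dots> = (\<integral>\<^sup>+ q. ennreal (D j q * max 0 (E j q)) + ennreal (D j q * max 0 (- E j q)) \<partial>count_space UNIV)"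
      by (rule nn_integral_add[symmetric]) auto
    also have "\<dots> = (\<integral>\<^sup>+ q. ennreal (D j q * \<bar>E j q\<bar>) \<partial>count_space UNIV)"
      using D by (intro nn_integral_cong) (auto simp: max_def abs_if)
    finally have "(\<integral>\<^sup>+ x. \<integral>\<^sup>+ y. ennreal (g' x y * c x y) \<partial>\<nu> \<partial>\<mu>) \<le> B (Suc j)"
      using c' cj by (auto simp: B_def add.assoc[symmetric] intro: order_trans add_right_mono)
    then show ?case using G' by (intro exI[of _ g'] exI[of _ u'] exI[of _ v']) (auto simp: E_def)
  qed
  from this[of m] obtain g u v where G: "partial_coupling \<mu> \<nu> g u v"
      and U: "\<And>q. (\<integral>x. u x * indicator {q} (C m x) \<partial>\<mu>) = max 0 (E m q)"
      and V: "\<And>q. (\<integral>x. v x * indicator {q} (C m x) \<partial>\<nu>) = max 0 (- E m q)"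
      and cm: "(\<integral>\<^sup>+ x. \<integral>\<^sup>+ y. ennreal (g x y * c x y) \<partial>\<nu> \<partial>\<mu>) \<le> B m"
    by blast
  have uv[measurable]: "u \<in> borel_measurable \<mu>" "v \<in> borel_measurable \<nu>" and gm[measurable]: "(\<lambda>(x, y). g x y) \<in> borel_measurable (\<mu> \<Otimes>\<^sub>M \<nu>)"
    and uvb: "\<And>x. 0 \<le> u x" "\<And>x. u x \<le> 1" "\<And>x. 0 \<le> v x" "\<And>x. v x \<le> 1" and g0: "\<And>x y. 0 \<le> g x y"
    using G by (auto simp: partial_coupling_def)
  obtain q where q: "\<And>x. C m x = q" using const by blast
  \<comment> \<open>The last partition has a single cell, of mass 1 under both measures, so its
    leftovers vanish and the coupling is complete.\<close>
  have "E m q = 0" using \<mu>.prob_space \<nu>.prob_space by (simp add: E_def q vimage_def sp)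
  then have "(\<integral>x. u x \<partial>\<mu>) = 0" "(\<integral>x. v x \<partial>\<nu>) = 0" using U[of q] V[of q] by (simp_all add: q)
  moreover have "integrable \<mu> u" "integrable \<nu> v"
    using uvb by (auto intro!: \<mu>.integrable_const_bound[where B=1] \<nu>.integrable_const_bound[where B=1])
  ultimately have "AE x in \<mu>. u x = 0" "AE x in \<nu>. v x = 0"
    using uvb by (auto simp: integral_nonneg_eq_0_iff_AE)
  note coup = partial_coupling_complete[OF prob G this]
  have cm'[measurable]: "(\<lambda>(x, y). c x y) \<in> borel_measurable (\<mu> \<Otimes>\<^sub>M \<nu>)" by fact
  have "(\<integral>\<^sup>+ z. ennreal (c (fst z) (snd z)) \<partial>density (\<mu> \<Otimes>\<^sub>M \<nu>) (\<lambda>(x, y). ennreal (g x y)))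
      = (\<integral>\<^sup>+ (x, y). ennreal (g x y * c x y) \<partial>(\<mu> \<Otimes>\<^sub>M \<nu>))"
    using c0 g0 by (subst nn_integral_density) (auto simp: split_beta' ennreal_mult)
  also have "\<dots> = (\<integral>\<^sup>+ x. \<integral>\<^sup>+ y. ennreal (g x y * c x y) \<partial>\<nu> \<partial>\<mu>)"
    by (subst \<nu>.nn_integral_fst[symmetric]) auto
  also have "\<dots> \<le> B m" by fact
  finally show ?thesis using coup unfolding B_def E_def by blast
qed

section \<open>Empirical measures\<close>

lemma nn_integral_exp_int:
  assumes "0 < \<delta>"
  shows "(\<integral>\<^sup>+ z. ennreal (exp (- \<delta> * \<bar>real_of_int z\<bar>)) \<partial>count_space UNIV) \<le> ennreal (2 / (1 - exp (- \<delta>)))"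
proof -
  let ?f = "\<lambda>z :: int. ennreal (exp (- \<delta> * \<bar>real_of_int z\<bar>))"
  have half: "(\<integral>\<^sup>+ z. ?f z * indicator (range g) z \<partial>count_space UNIV) = ennreal (1 / (1 - exp (- \<delta>)))"
    if g: "inj g" "\<And>n. \<bar>g n\<bar> = int n" for g :: "nat \<Rightarrow> int"
  proof -
    have "bij_betw g UNIV (range g)" using g(1) by (simp add: bij_betw_def)
    then have "(\<integral>\<^sup>+ n. ?f (g n) \<partial>count_space UNIV) = (\<integral>\<^sup>+ z. ?f z \<partial>count_space (range g))"
      by (rule nn_integral_bij_count_space)
    then have "(\<integral>\<^sup>+ z. ?f z * indicator (range g) z \<partial>count_space UNIV) = (\<integral>\<^sup>+ n. ?f (g n) \<partial>count_space UNIV)"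
      by (subst (asm) nn_integral_count_space_indicator[where X="range g"]) simp_all
    also have "\<dots> = (\<Sum>n. ?f (g n))" by (rule nn_integral_count_space_nat)
    also have "\<dots> = (\<Sum>n. ennreal (exp (- \<delta>) ^ n))"
    proof (rule arg_cong[where f=suminf], rule ext)
      fix n
      have "\<bar>real_of_int (g n)\<bar> = real n" using g(2)[of n] by (metis of_int_abs of_int_of_nat_eq)
      then show "?f (g n) = ennreal (exp (- \<delta>) ^ n)" by (simp flip: exp_of_nat_mult add: mult.commute)
    qed
    also have "\<dots> = ennreal (1 / (1 - exp (- \<delta>)))"
      using assms by (intro suminf_ennreal_eq geometric_sums) auto
    finally show ?thesis .
  qed
  \<comment> \<open>The two half-lines overlap in 0, which is counted twice; this is why only an
    upper bound results.\<close>
  have cover: "z \<in> range int \<or> z \<in> range (\<lambda>n. - int n)" for z :: int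
    by (cases z rule: int_cases2) auto
  have "(\<integral>\<^sup>+ z. ?f z \<partial>count_space UNIV)
    \<le> (\<integral>\<^sup>+ z. ?f z * indicator (range int) z + ?f z * indicator (range (\<lambda>n. - int n)) z \<partial>count_space UNIV)"
  proof (rule nn_integral_mono)
    fix z :: int
    show "?f z \<le> ?f z * indicator (range int) z + ?f z * indicator (range (\<lambda>n. - int n)) z"
      using cover[of z] by (cases "z \<in> range int") (auto simp del: rangeI)
  qed
  also have "\<dots> = (\<integral>\<^sup>+ z. ?f z * indicator (range int) z \<partial>count_space UNIV) + (\<integral>\<^sup>+ z. ?f z * indicator (range (\<lambda>n. - int n)) z \<partial>count_space UNIV)"
    by (rule nn_integral_add) auto
  also have "\<dots> = ennreal (1 / (1 - exp (- \<delta>))) + ennreal (1 / (1 - exp (- \<delta>)))"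
    by (subst (1 2) half) (auto simp: inj_def)
  also have "\<dots> = ennreal (2 / (1 - exp (- \<delta>)))" using assms by (simp flip: ennreal_plus)
  finally show ?thesis .
qed

text \<open>Lattice points, and with them dyadic cells and rounded matrices, are integer lists: one
  countable index type that serves every dimension and every level.\<close>

definition list_l1 :: "int list \<Rightarrow> real"
  where "list_l1 xs = (\<Sum>z\<leftarrow>xs. \<bar>real_of_int z\<bar>)"

lemma list_l1_nonneg [simp]: "0 \<le> list_l1 xs"
  unfolding list_l1_def by (rule sum_list_nonneg) auto

text \<open>The weight of an l^1 norm factorises over the coordinates; an l^1 norm is used
  throughout for this reason.\<close>

lemma nn_integral_exp_lattice:
  assumes "0 < \<delta>"
  shows "(\<integral>\<^sup>+ xs. ennreal (exp (- \<delta> * list_l1 xs)) \<partial>count_space {xs. length xs = k})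
    \<le> ennreal ((2 / (1 - exp (- \<delta>))) ^ k)"
proof (induction k)
  case 0
  have "{xs :: int list. length xs = 0} = {[]}" by auto
  then show ?case by (simp add: nn_integral_count_space_finite list_l1_def)
next
  case (Suc k)
  let ?A = "{xs :: int list. length xs = k}" and ?e = "2 / (1 - exp (- \<delta>))"
  have e0: "0 \<le> ?e" using assms by simp
  have bij: "bij_betw (\<lambda>(z, xs). z # xs) (UNIV \<times> ?A) {xs :: int list. length xs = Suc k}"
    by (auto simp: bij_betw_def inj_on_def length_Suc_conv image_def)
  interpret A: sigma_finite_measure "count_space ?A"
    by (rule sigma_finite_measure_count_space_countable) auto
  have "(\<integral>\<^sup>+ xs. ennreal (exp (- \<delta> * list_l1 xs)) \<partial>count_space {xs. length xs = Suc k})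
     = (\<integral>\<^sup>+ w. ennreal (exp (- \<delta> * list_l1 (case w of (z, xs) \<Rightarrow> z # xs))) \<partial>count_space (UNIV \<times> ?A))"
    by (rule nn_integral_bij_count_space[OF bij, symmetric])
  also have "count_space (UNIV \<times> ?A) = count_space (UNIV :: int set) \<Otimes>\<^sub>M count_space ?A"
    by (rule pair_measure_countable[symmetric]) auto
  also have "(\<integral>\<^sup>+ w. ennreal (exp (- \<delta> * list_l1 (case w of (z, xs) \<Rightarrow> z # xs))) \<partial>(count_space UNIV \<Otimes>\<^sub>M count_space ?A))
     = (\<integral>\<^sup>+ z. \<integral>\<^sup>+ xs. ennreal (exp (- \<delta> * list_l1 (z # xs))) \<partial>count_space ?A \<partial>count_space UNIV)"
    by (subst A.nn_integral_fst[symmetric]) (auto simp: pair_measure_countable)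
  also have "\<dots> = (\<integral>\<^sup>+ z. ennreal (exp (- \<delta> * \<bar>real_of_int z\<bar>)) * (\<integral>\<^sup>+ xs. ennreal (exp (- \<delta> * list_l1 xs)) \<partial>count_space ?A) \<partial>count_space UNIV)"
  proof (intro nn_integral_cong)
    fix z :: int
    have "exp (- \<delta> * list_l1 (z # xs)) = exp (- \<delta> * \<bar>real_of_int z\<bar>) * exp (- \<delta> * list_l1 xs)" for xs
      unfolding exp_add[symmetric] distrib_left[symmetric] by (simp add: list_l1_def)
    then show "(\<integral>\<^sup>+ xs. ennreal (exp (- \<delta> * list_l1 (z # xs))) \<partial>count_space ?A)
      = ennreal (exp (- \<delta> * \<bar>real_of_int z\<bar>)) * (\<integral>\<^sup>+ xs. ennreal (exp (- \<delta> * list_l1 xs)) \<partial>count_space ?A)"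
      by (simp only: ennreal_mult[OF exp_ge_zero exp_ge_zero]) (rule nn_integral_cmult, simp)
  qed
  also have "\<dots> \<le> (\<integral>\<^sup>+ z. ennreal (exp (- \<delta> * \<bar>real_of_int z\<bar>)) * ennreal (?e ^ k) \<partial>count_space UNIV)"
    by (intro nn_integral_mono mult_left_mono Suc) auto
  also have "\<dots> = (\<integral>\<^sup>+ z. ennreal (exp (- \<delta> * \<bar>real_of_int z\<bar>)) \<partial>count_space UNIV) * ennreal (?e ^ k)"
    by (rule nn_integral_multc) auto
  also have "\<dots> \<le> ennreal ?e * ennreal (?e ^ k)"
    by (intro mult_right_mono nn_integral_exp_int assms) auto
  also have "\<dots> = ennreal (?e ^ Suc k)" using e0 by (simp flip: ennreal_mult del: divide_nonneg_nonneg)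
  finally show ?case .
qed

text \<open>Uses 1 - exp (-\<delta>) \<ge> \<delta> / 2 on (0, 1]. For \<delta> of order 2^(-l) the
  bound grows like 2^(l k), the number of cells of level l in a bounded region.\<close>

lemma nn_integral_exp_lattice_le:
  assumes "0 < \<delta>" "\<delta> \<le> 1"
  shows "(\<integral>\<^sup>+ xs. ennreal (exp (- \<delta> * list_l1 xs)) \<partial>count_space {xs. length xs = k}) \<le> ennreal ((4 / \<delta>) ^ k)"
proof -
  have "exp (- \<delta>) \<le> 1 - \<delta> / 2"
  proof -
    have "1 + \<delta> \<le> exp \<delta>" by simp
    then have "exp (- \<delta>) \<le> 1 / (1 + \<delta>)"
      using assms by (simp add: exp_minus inverse_eq_divide frac_le)
    also have "\<dots> \<le> 1 - \<delta> / 2" using assms mult_right_mono[of \<delta> 1 \<delta>] by (simp add: field_simps)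
    finally show ?thesis .
  qed
  then have "2 / (1 - exp (- \<delta>)) \<le> 2 / (\<delta> / 2)"
    using assms by (intro divide_left_mono) auto
  then have "(2 / (1 - exp (- \<delta>))) ^ k \<le> (4 / \<delta>) ^ k"
    using assms by (intro power_mono) auto
  then show ?thesis using nn_integral_exp_lattice[OF assms(1), of k] by (auto intro: order_trans ennreal_leI)
qed

section \<open>Fluctuations of empirical frequencies\<close>

lemma square_sum_product:
  assumes "prob_space \<mu>" and f[measurable]: "f \<in> borel_measurable \<mu>" and b: "\<And>x. \<bar>f x\<bar> \<le> (B::real)"
    and mean: "(\<integral>x. f x \<partial>\<mu>) = 0" and "finite I"
  shows "(\<integral>x. (\<Sum>i\<in>I. f (x i))\<^sup>2 \<partial>PiM I (\<lambda>_. \<mu>)) = real (card I) * (\<integral>x. (f x)\<^sup>2 \<partial>\<mu>)"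
  using \<open>finite I\<close>
proof (induction I rule: finite_induct)
  case empty
  interpret prob_space \<mu> by fact
  show ?case by (simp add: PiM_empty)
next
  case (insert i I)
  interpret prob_space \<mu> by fact
  interpret product_sigma_finite "\<lambda>_. \<mu>" ..
  let ?P = "PiM I (\<lambda>_. \<mu>)" and ?Q = "PiM (insert i I) (\<lambda>_. \<mu>)"
  interpret P: prob_space ?P by (rule prob_space_PiM) unfold_locales
  interpret Q: prob_space ?Q by (rule prob_space_PiM) unfold_locales
  define S where "S x = (\<Sum>j\<in>I. f (x j))" for x :: "'b \<Rightarrow> 'a"
  have Sb: "\<bar>S x\<bar> \<le> real (card I) * B" for x
    unfolding S_def using sum_mono[of I "\<lambda>j. \<bar>f (x j)\<bar>" "\<lambda>_. B"] b
    by (intro order_trans[OF sum_abs]) auto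
  have Sm[measurable]: "S \<in> borel_measurable ?P" unfolding S_def by measurable
  have fi: "integrable \<mu> f" using b by (intro integrable_const_bound[where B=B]) auto
  have f2: "integrable \<mu> (\<lambda>x. (f x)\<^sup>2)"
    using b by (intro integrable_const_bound[where B="B\<^sup>2"]) (auto simp: abs_le_square_iff[symmetric] intro: order_trans[OF b abs_ge_self])
  have S2: "integrable ?P (\<lambda>x. (S x)\<^sup>2)"
    using Sb by (intro P.integrable_const_bound[where B="(real (card I) * B)\<^sup>2"]) (auto simp: abs_le_square_iff[symmetric] intro: order_trans[OF Sb abs_ge_self])
  have Qm: "(\<lambda>x. (\<Sum>j\<in>insert i I. f (x j))\<^sup>2) \<in> borel_measurable ?Q" by measurable
  have Qb: "\<bar>\<Sum>j\<in>insert i I. f (x j)\<bar> \<le> real (card (insert i I)) * B" for x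
    using sum_mono[of "insert i I" "\<lambda>j. \<bar>f (x j)\<bar>" "\<lambda>_. B"] b
    by (intro order_trans[OF sum_abs]) auto
  have "(\<integral>x. (\<Sum>j\<in>insert i I. f (x j))\<^sup>2 \<partial>?Q) = (\<integral>x. \<integral>t. (\<Sum>j\<in>insert i I. f ((x(i := t)) j))\<^sup>2 \<partial>\<mu> \<partial>?P)"
    using insert.hyps Qm Qb
    by (intro product_integral_insert Q.integrable_const_bound[where B="(real (card (insert i I)) * B)\<^sup>2"])
      (auto simp: abs_le_square_iff[symmetric] intro: order_trans[OF Qb abs_ge_self] simp del: card_insert_disjoint sum.insert)
  also have "\<dots> = (\<integral>x. (S x)\<^sup>2 + (\<integral>t. (f t)\<^sup>2 \<partial>\<mu>) \<partial>?P)"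
  proof (rule Bochner_Integration.integral_cong[OF refl])
    fix x
    have "(\<Sum>j\<in>insert i I. f ((x(i := t)) j)) = f t + S x" for t
      using insert.hyps by (auto simp: S_def intro!: sum.cong)
    then have "(\<integral>t. (\<Sum>j\<in>insert i I. f ((x(i := t)) j))\<^sup>2 \<partial>\<mu>) = (\<integral>t. (f t)\<^sup>2 + 2 * S x * f t + (S x)\<^sup>2 \<partial>\<mu>)"
      by (simp add: power2_sum algebra_simps)
    \<comment> \<open>The cross term 2 * S x * f t vanishes because f has mean 0; this is where
      independence acts.\<close>
    also have "\<dots> = (\<integral>t. (f t)\<^sup>2 \<partial>\<mu>) + (S x)\<^sup>2"
      using fi f2 mean by (simp add: prob_space)
    finally show "(\<integral>t. (\<Sum>j\<in>insert i I. f ((x(i := t)) j))\<^sup>2 \<partial>\<mu>) = (S x)\<^sup>2 + (\<integral>t. (f t)\<^sup>2 \<partial>\<mu>)" by simp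
  qed
  also have "\<dots> = (\<integral>x. (S x)\<^sup>2 \<partial>?P) + (\<integral>t. (f t)\<^sup>2 \<partial>\<mu>)"
    using S2 by (simp add: P.prob_space)
  finally show ?case using insert by (simp add: S_def algebra_simps)
qed

lemma measure_empirical:
  assumes "\<And>j. j < n \<Longrightarrow> x j \<in> Rn d" "A \<in> sets (borel_Rn d)"
  shows "measure (empirical d n x) A = (\<Sum>j<n. indicator A (x j)) / real n"
  using emeasure_empirical[OF assms] by (simp add: measure_def sum_nonneg)

text \<open>The variance of an indicator is at most its mean, and the first absolute moment is at
  most the root of the second. The factor sqrt (\<mu>(A)) is kept because it will be summed over
  infinitely many cells.\<close>

lemma expected_deviation:
  assumes prob: "prob_space \<mu>" and A[measurable]: "A \<in> sets \<mu>" and n: "0 < n"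
  shows "(\<integral>\<^sup>+ x. ennreal \<bar>measure \<mu> A - (\<Sum>j<n. indicator A (x j)) / real n\<bar> \<partial>PiM {..<n} (\<lambda>_. \<mu>))
    \<le> ennreal (sqrt (measure \<mu> A) / sqrt (real n))"
proof -
  interpret prob_space \<mu> by fact
  let ?P = "PiM {..<n} (\<lambda>_. \<mu>)"
  interpret P: prob_space ?P by (rule prob_space_PiM) unfold_locales
  define f where "f x = indicator A x - measure \<mu> A" for x
  have [measurable]: "f \<in> borel_measurable \<mu>" unfolding f_def by measurable
  have fb: "\<bar>f x\<bar> \<le> 1" for x unfolding f_def by (auto simp: indicator_def)
  have f0: "(\<integral>x. f x \<partial>\<mu>) = 0" 
    unfolding f_def using sets.sets_into_space[OF A]
    by (subst Bochner_Integration.integral_diff) (auto simp: prob_space Int_absorb2 less_top[symmetric])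
  define Y where "Y x = (\<Sum>j<n. f (x j))" for x :: "nat \<Rightarrow> 'a"
  have [measurable]: "Y \<in> borel_measurable ?P" unfolding Y_def by measurable
  have Yb: "\<bar>Y x\<bar> \<le> real n" for x
    unfolding Y_def using sum_mono[of "{..<n}" "\<lambda>j. \<bar>f (x j)\<bar>" "\<lambda>_. 1"] fb
    by (intro order_trans[OF sum_abs]) auto
  have "(\<integral>x. (Y x)\<^sup>2 \<partial>?P) = real n * (\<integral>x. (f x)\<^sup>2 \<partial>\<mu>)"
    unfolding Y_def using square_sum_product[of \<mu> f 1 "{..<n}"] prob fb f0 by simp
  also have "(\<integral>x. (f x)\<^sup>2 \<partial>\<mu>) = (\<integral>x. (1 - 2 * measure \<mu> A) * indicator A x + (measure \<mu> A)\<^sup>2 \<partial>\<mu>)"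
    by (intro Bochner_Integration.integral_cong) (auto simp: f_def indicator_def power2_eq_square algebra_simps)
  also have "\<dots> = (1 - 2 * measure \<mu> A) * measure \<mu> A + (measure \<mu> A)\<^sup>2"
    using sets.sets_into_space[OF A]
    by (subst Bochner_Integration.integral_add) (auto simp: prob_space Int_absorb2 less_top[symmetric])
  also have "\<dots> \<le> measure \<mu> A" by (simp add: power2_eq_square algebra_simps)
  finally have Y2: "(\<integral>x. (Y x)\<^sup>2 \<partial>?P) \<le> real n * measure \<mu> A" using n by simp
  have Yi: "integrable ?P (\<lambda>x. \<bar>Y x\<bar>)" using Yb by (intro P.integrable_const_bound[where B="real n"]) auto
  have Yi2: "integrable ?P (\<lambda>x. \<bar>Y x\<bar>\<^sup>2)"
    using Yb by (intro P.integrable_const_bound[where B="(real n)\<^sup>2"]) (auto simp: abs_le_square_iff[symmetric])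
  have "(P.expectation (\<lambda>x. \<bar>Y x\<bar>))\<^sup>2 \<le> P.expectation (\<lambda>x. \<bar>Y x\<bar>\<^sup>2)"
    using P.variance_eq[OF Yi Yi2] P.variance_positive[of "\<lambda>x. \<bar>Y x\<bar>"] by linarith
  also have "\<dots> \<le> real n * measure \<mu> A" using Y2 by simp
  finally have EY: "P.expectation (\<lambda>x. \<bar>Y x\<bar>) \<le> sqrt (real n * measure \<mu> A)"
    by (rule real_le_rsqrt)
  have "(\<integral>\<^sup>+ x. ennreal \<bar>measure \<mu> A - (\<Sum>j<n. indicator A (x j)) / real n\<bar> \<partial>?P)
      = (\<integral>\<^sup>+ x. ennreal (\<bar>Y x\<bar> / real n) \<partial>?P)"
  proof (rule nn_integral_cong)
    fix x :: "nat \<Rightarrow> 'a"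
    have "measure \<mu> A - (\<Sum>j<n. indicator A (x j)) / real n = - Y x / real n"
      using n by (simp add: Y_def f_def sum_subtractf field_simps)
    then show "ennreal \<bar>measure \<mu> A - (\<Sum>j<n. indicator A (x j)) / real n\<bar> = ennreal (\<bar>Y x\<bar> / real n)"
      by simp
  qed
  also have "\<dots> = ennreal (P.expectation (\<lambda>x. \<bar>Y x\<bar>) / real n)"
    using Yi by (subst nn_integral_eq_integral) auto
  also have "\<dots> \<le> ennreal (sqrt (real n * measure \<mu> A) / real n)"
    using EY by (intro ennreal_leI divide_right_mono) auto
  also have "sqrt (real n * measure \<mu> A) / real n = sqrt (measure \<mu> A) / sqrt (real n)"
    using n by (simp add: real_sqrt_mult field_simps)
  finally show ?thesis .
qed

section \<open>Dyadic cells and weighted sums over them\<close>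

definition cell :: "nat \<Rightarrow> nat \<Rightarrow> rvec \<Rightarrow> int list"
  where "cell k l x = map (\<lambda>i. \<lfloor>2 ^ l * x i\<rfloor>) [0..<k]"

lemma length_cell [simp]: "length (cell k l x) = k"
  by (simp add: cell_def)

lemma cell_eq_iff: "cell k l x = cell k l y \<longleftrightarrow> (\<forall>i<k. \<lfloor>2 ^ l * x i\<rfloor> = \<lfloor>2 ^ l * y i\<rfloor>)"
  by (auto simp: cell_def map_eq_conv)

lemma cell_nested:
  assumes "cell k (Suc l) x = cell k (Suc l) y" shows "cell k l x = cell k l y"
proof -
  have "\<lfloor>2 ^ l * z\<rfloor> = \<lfloor>2 ^ Suc l * z\<rfloor> div 2" for z :: real
    using floor_divide_real_eq_div[of 2 "2 ^ Suc l * z"] by simp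
  then show ?thesis using assms by (simp add: cell_eq_iff)
qed

lemma measurable_cell: "cell k l \<in> borel_Rn k \<rightarrow>\<^sub>M count_space UNIV"
proof (subst measurable_count_space_eq2_countable)
  have [measurable]: "(\<lambda>x. x i) \<in> borel_measurable (borel_Rn k)" for i
    using measurable_Rn_coord[of "\<lambda>x. x" "borel_Rn k" k] by simp
  have "cell k l -` {q} \<inter> space (borel_Rn k) \<in> sets (borel_Rn k)" for q
  proof (cases "length q = k")
    case True
    have "cell k l -` {q} \<inter> space (borel_Rn k) = {x \<in> space (borel_Rn k). \<forall>i\<in>{..<k}. \<lfloor>2 ^ l * x i\<rfloor> = q ! i}"
    proof -
      have "cell k l x = q \<longleftrightarrow> (\<forall>i\<in>{..<k}. \<lfloor>2 ^ l * x i\<rfloor> = q ! i)" for x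
        using True by (simp add: cell_def list_eq_iff_nth_eq Ball_def)
      then show ?thesis by auto
    qed
    also have "\<dots> \<in> sets (borel_Rn k)" by measurable
    finally show ?thesis .
  next
    case False
    then have "cell k l -` {q} = {}" by (auto simp: cell_def)
    then show ?thesis by simp
  qed
  then show "cell k l \<in> space (borel_Rn k) \<rightarrow> UNIV \<and> (\<forall>a\<in>UNIV. cell k l -` {a} \<inter> space (borel_Rn k) \<in> sets (borel_Rn k))"
    by auto
qed

lemma list_l1_cell_le: "list_l1 (cell k l x) \<le> (\<Sum>i<k. 2 ^ l * \<bar>x i\<bar> + 1)"
proof -
  have "list_l1 (cell k l x) = (\<Sum>i<k. \<bar>real_of_int \<lfloor>2 ^ l * x i\<rfloor>\<bar>)"
    by (simp add: list_l1_def cell_def comp_def interv_sum_list_conv_sum_set_nat atLeast0LessThan)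
  also have "\<dots> \<le> (\<Sum>i<k. 2 ^ l * \<bar>x i\<bar> + 1)"
  proof (rule sum_mono)
    fix i
    have "\<bar>real_of_int \<lfloor>z\<rfloor>\<bar> \<le> \<bar>z\<bar> + 1" for z :: real by linarith
    from this[of "2 ^ l * x i"] show "\<bar>real_of_int \<lfloor>2 ^ l * x i\<rfloor>\<bar> \<le> 2 ^ l * \<bar>x i\<bar> + 1"
      by (simp add: abs_mult)
  qed
  finally show ?thesis .
qed

lemma sum_abs_le_list_l1_cell: "(\<Sum>i<k. \<bar>x i\<bar>) \<le> list_l1 (cell k 0 x) + real k"
proof -
  have "(\<Sum>i<k. \<bar>x i\<bar>) \<le> (\<Sum>i<k. \<bar>real_of_int \<lfloor>x i\<rfloor>\<bar> + 1)"
  proof (rule sum_mono)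
    fix i show "\<bar>x i\<bar> \<le> \<bar>real_of_int \<lfloor>x i\<rfloor>\<bar> + 1" by linarith
  qed
  also have "\<dots> = list_l1 (cell k 0 x) + real k"
    by (simp add: list_l1_def cell_def comp_def interv_sum_list_conv_sum_set_nat atLeast0LessThan sum.distrib)
  finally show ?thesis .
qed

lemma norm_Rn_cell_le:
  assumes "cell k l x = cell k l y" shows "norm_Rn k (x - y) \<le> sqrt (real k) / 2 ^ l"
proof -
  have "\<bar>x i - y i\<bar> \<le> 1 / 2 ^ l" if "i < k" for i
  proof -
    have "\<lfloor>2 ^ l * x i\<rfloor> = \<lfloor>2 ^ l * y i\<rfloor>" using assms that by (simp add: cell_eq_iff)
    then have "\<bar>2 ^ l * x i - 2 ^ l * y i\<bar> \<le> 1" by linarith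
    moreover have "\<bar>2 ^ l * x i - 2 ^ l * y i\<bar> = 2 ^ l * \<bar>x i - y i\<bar>"
      by (simp add: abs_mult flip: right_diff_distrib)
    ultimately have "2 ^ l * \<bar>x i - y i\<bar> \<le> 1" by simp
    then show ?thesis by (subst pos_le_divide_eq) (simp_all add: mult.commute)
  qed
  then have "L2_set (\<lambda>i. \<bar>x i - y i\<bar>) {..<k} \<le> L2_set (\<lambda>i. 1 / 2 ^ l) {..<k}"
    by (intro L2_set_mono) auto
  moreover have "norm_Rn k (x - y) = L2_set (\<lambda>i. \<bar>x i - y i\<bar>) {..<k}"
    by (simp add: norm_Rn_def L2_set_def)
  ultimately have "norm_Rn k (x - y) \<le> L2_set (\<lambda>i. 1 / 2 ^ l) {..<k}" by simp
  also have "\<dots> = sqrt (real k) / 2 ^ l" by (simp add: L2_set_constant)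
  finally show ?thesis .
qed

text \<open>The scale 1 / (2^l k) turns the l^1 norm of the cell into at most the average of the |x
  i| plus 1. Some coordinate is at least the average, so the exponential is at most e \<le> 3 times
  the sum of the exp |x i|, and 3 * 4 * k = 12 k.\<close>

lemma nn_integral_exp_cell:
  assumes \<rho>: "prob_Rn k \<rho>" and k: "1 \<le> k"
    and ex: "\<And>i. i < k \<Longrightarrow> (\<integral>\<^sup>+ x. ennreal (exp \<bar>x i\<bar>) \<partial>\<rho>) \<le> 4"
  shows "(\<integral>\<^sup>+ x. ennreal (exp (1 / (2 ^ l * real k) * list_l1 (cell k l x))) \<partial>\<rho>) \<le> ennreal (12 * real k)"
proof -
  have cm: "(\<lambda>x. x i) \<in> borel_measurable \<rho>" for i
    by (rule measurable_Rn_coord[OF measurable_id_Rn[OF prob_RnD(2)[OF \<rho>]]])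
  have le: "exp (1 / (2 ^ l * real k) * list_l1 (cell k l x)) \<le> (\<Sum>i<k. 3 * exp \<bar>x i\<bar>)" for x
  proof -
    define b where "b = (\<Sum>i<k. \<bar>x i\<bar>) / real k"
    have "1 / (2 ^ l * real k) * list_l1 (cell k l x) \<le> 1 / (2 ^ l * real k) * (\<Sum>i<k. 2 ^ l * \<bar>x i\<bar> + 1)"
      by (intro mult_left_mono list_l1_cell_le) auto
    also have "(\<Sum>i<k. 2 ^ l * \<bar>x i\<bar> + 1) = 2 ^ l * (\<Sum>i<k. \<bar>x i\<bar>) + real k"
      by (simp add: sum.distrib sum_distrib_left)
    also have "1 / (2 ^ l * real k) * (2 ^ l * (\<Sum>i<k. \<bar>x i\<bar>) + real k) = b + 1 / 2 ^ l"
      using k by (simp add: b_def field_simps)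
    also have "\<dots> \<le> b + 1" by (simp add: divide_le_eq)
    finally have "exp (1 / (2 ^ l * real k) * list_l1 (cell k l x)) \<le> exp (b + 1)" by simp
    also have "\<dots> = exp 1 * exp b" by (simp add: exp_add)
    also have "\<dots> \<le> 3 * exp b" using exp_le by (intro mult_right_mono) auto
    also have "exp b \<le> (\<Sum>i<k. exp \<bar>x i\<bar>)"
    proof -
      have "\<exists>i<k. b \<le> \<bar>x i\<bar>"
      proof (rule ccontr)
        assume "\<not> ?thesis"
        then have "(\<Sum>i<k. \<bar>x i\<bar>) < (\<Sum>i<k. b)" using k by (intro sum_strict_mono) (auto simp: lessThan_empty_iff)
        also have "\<dots> = (\<Sum>i<k. \<bar>x i\<bar>)" using k by (simp add: b_def)
        finally show False by simp
      qed
      then obtain i where i: "i < k" "b \<le> \<bar>x i\<bar>" by blast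
      then have "exp b \<le> exp \<bar>x i\<bar>" by simp
      also have "\<dots> \<le> (\<Sum>i<k. exp \<bar>x i\<bar>)" using i by (intro member_le_sum) auto
      finally show ?thesis .
    qed
    finally show ?thesis by (simp add: sum_distrib_left)
  qed
  have "(\<integral>\<^sup>+ x. ennreal (exp (1 / (2 ^ l * real k) * list_l1 (cell k l x))) \<partial>\<rho>)
      \<le> (\<integral>\<^sup>+ x. (\<Sum>i<k. ennreal 3 * ennreal (exp \<bar>x i\<bar>)) \<partial>\<rho>)"
  proof (rule nn_integral_mono)
    fix x
    have "ennreal (exp (1 / (2 ^ l * real k) * list_l1 (cell k l x))) \<le> ennreal (\<Sum>i<k. 3 * exp \<bar>x i\<bar>)"
      by (rule ennreal_leI[OF le])
    also have "\<dots> = (\<Sum>i<k. ennreal (3 * exp \<bar>x i\<bar>))" by (rule sum_ennreal[symmetric]) auto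
    also have "\<dots> = (\<Sum>i<k. ennreal 3 * ennreal (exp \<bar>x i\<bar>))" by (subst ennreal_mult) auto
    finally show "ennreal (exp (1 / (2 ^ l * real k) * list_l1 (cell k l x))) \<le> (\<Sum>i<k. ennreal 3 * ennreal (exp \<bar>x i\<bar>))" .
  qed
  also have "\<dots> = (\<Sum>i<k. ennreal 3 * (\<integral>\<^sup>+ x. ennreal (exp \<bar>x i\<bar>) \<partial>\<rho>))"
    using cm by (subst nn_integral_sum) (auto intro!: sum.cong nn_integral_cmult)
  also have "\<dots> \<le> (\<Sum>i<k. ennreal 3 * 4)"
    by (intro sum_mono mult_left_mono ex) auto
  also have "\<dots> = ennreal (12 * real k)"
    using ennreal_mult[of "real k" 12] by (simp add: ennreal_of_nat_eq_real_of_nat mult.commute)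
  finally show ?thesis .
qed

text \<open>Square roots of the cell masses need not be summable without control of the tails. A
  Cauchy-Schwarz inequality with the weight exp (\<delta> |q|) repairs this: one factor becomes a
  lattice sum, the other the exponential moment of the cell. It is written as an
  arithmetic-geometric mean with a free parameter \<tau>, so that no product of two infinite sums
  arises.\<close>

lemma cell_sum:
  assumes \<rho>: "prob_Rn k \<rho>" and k: "1 \<le> k"
    and ex: "\<And>i. i < k \<Longrightarrow> (\<integral>\<^sup>+ x. ennreal (exp \<bar>x i\<bar>) \<partial>\<rho>) \<le> 4"
    and w: "\<And>q. 0 \<le> w q"
    and A: "(\<integral>\<^sup>+ q. ennreal ((w q)\<^sup>2 * exp (- (1 / (2 ^ l * real k)) * list_l1 q)) \<partial>count_space {q. length q = k}) \<le> ennreal A" "0 \<le> A"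
    and \<tau>: "0 < \<tau>"
  shows "(\<integral>\<^sup>+ q. ennreal (w q * sqrt (measure \<rho> (cell k l -` {q} \<inter> space \<rho>))) \<partial>count_space UNIV)
    \<le> ennreal ((A / \<tau> + 12 * real k * \<tau>) / 2)"
proof -
  interpret prob_space \<rho> using \<rho> by (rule prob_RnD)
  define \<delta> where "\<delta> = 1 / (2 ^ l * real k)"
  define R where "R q = measure \<rho> (cell k l -` {q} \<inter> space \<rho>)" for q
  let ?s = "\<lambda>q. exp (- \<delta> * list_l1 q)"
  have Cm: "cell k l \<in> \<rho> \<rightarrow>\<^sub>M count_space UNIV"
    using measurable_cell prob_RnD(2)[OF \<rho>] by (simp cong: measurable_cong_sets)
  have "(\<integral>\<^sup>+ q. ennreal (exp (\<delta> * list_l1 q) * R q) \<partial>count_space UNIV)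
      = (\<integral>\<^sup>+ x. ennreal (1 * exp (\<delta> * list_l1 (cell k l x))) \<partial>\<rho>)"
  proof -
    have "(\<integral>x. 1 * indicator {q} (cell k l x) \<partial>\<rho>) = R q" for q
      unfolding R_def
      by (subst Bochner_Integration.integral_cong[OF refl, where g="indicator (cell k l -` {q} \<inter> space \<rho>)"])
        (auto simp: indicator_def)
    then show ?thesis
      by (subst nn_integral_leftover[OF prob_space_axioms Cm]) auto
  qed
  also have "\<dots> \<le> ennreal (12 * real k)"
    using nn_integral_exp_cell[OF \<rho> k ex, of l] by (simp add: \<delta>_def)
  finally have E: "(\<integral>\<^sup>+ q. ennreal (exp (\<delta> * list_l1 q) * R q) \<partial>count_space UNIV) \<le> ennreal (12 * real k)" .
  have le: "w q * sqrt (R q) \<le> 1 / (2 * \<tau>) * ((w q)\<^sup>2 * ?s q) + \<tau> / 2 * (exp (\<delta> * list_l1 q) * R q)" for q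
  proof -
    define e where "e = exp (\<delta> * list_l1 q / 2)"
    have e: "0 < e" "?s q = 1 / e\<^sup>2" "exp (\<delta> * list_l1 q) = e\<^sup>2"
      by (simp_all add: e_def exp_minus inverse_eq_divide flip: exp_double)
    define a where "a = w q / e" define b where "b = \<tau> * e * sqrt (R q)"
    have "2 * a * b \<le> a\<^sup>2 + b\<^sup>2" by (rule sum_squares_bound)
    then have "1 / (2 * \<tau>) * (2 * a * b) \<le> 1 / (2 * \<tau>) * (a\<^sup>2 + b\<^sup>2)"
      using \<tau> by (intro mult_left_mono) auto
    moreover have "1 / (2 * \<tau>) * (2 * a * b) = w q * sqrt (R q)" using e \<tau> by (simp add: a_def b_def)
    moreover have "1 / (2 * \<tau>) * (a\<^sup>2 + b\<^sup>2) = 1 / (2 * \<tau>) * ((w q)\<^sup>2 * ?s q) + \<tau> / 2 * (exp (\<delta> * list_l1 q) * R q)"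
    proof -
      have "a\<^sup>2 = (w q)\<^sup>2 * ?s q" unfolding a_def e(2) by (simp add: power_divide)
      moreover have "b\<^sup>2 = \<tau>\<^sup>2 * (e\<^sup>2 * R q)" by (simp add: b_def power_mult_distrib R_def)
      ultimately show ?thesis using \<tau> by (simp add: e(3) power2_eq_square field_simps)
    qed
    ultimately show ?thesis by simp
  qed
  have pt: "ennreal (w q * sqrt (R q)) \<le> ennreal (1 / (2 * \<tau>)) * (ennreal ((w q)\<^sup>2 * ?s q) * indicator {q. length q = k} q)
      + ennreal (\<tau> / 2) * ennreal (exp (\<delta> * list_l1 q) * R q)" for q
  \<comment> \<open>A list of another length is no cell and has empty preimage, so the lattice sum
    runs over length k only.\<close>
  proof (cases "length q = k")
    case True
    have nn: "0 \<le> 1 / (2 * \<tau>)" "0 \<le> (w q)\<^sup>2 * ?s q" "0 \<le> \<tau> / 2" "0 \<le> exp (\<delta> * list_l1 q) * R q"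
      using \<tau> by (auto simp: R_def)
    have "ennreal (w q * sqrt (R q)) \<le> ennreal (1 / (2 * \<tau>) * ((w q)\<^sup>2 * ?s q) + \<tau> / 2 * (exp (\<delta> * list_l1 q) * R q))"
      by (rule ennreal_leI[OF le])
    also have "\<dots> = ennreal (1 / (2 * \<tau>)) * ennreal ((w q)\<^sup>2 * ?s q) + ennreal (\<tau> / 2) * ennreal (exp (\<delta> * list_l1 q) * R q)"
      by (simp only: ennreal_plus[OF mult_nonneg_nonneg[OF nn(1,2)] mult_nonneg_nonneg[OF nn(3,4)]]
        ennreal_mult[OF nn(1,2)] ennreal_mult[OF nn(3,4)])
    finally show ?thesis using True by simp
  next
    case False
    then have "cell k l -` {q} = {}" by auto
    then show ?thesis by (simp add: R_def)
  qed
  have "(\<integral>\<^sup>+ q. ennreal (w q * sqrt (R q)) \<partial>count_space UNIV)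
      \<le> (\<integral>\<^sup>+ q. ennreal (1 / (2 * \<tau>)) * (ennreal ((w q)\<^sup>2 * ?s q) * indicator {q. length q = k} q)
      + ennreal (\<tau> / 2) * ennreal (exp (\<delta> * list_l1 q) * R q) \<partial>count_space UNIV)"
    by (intro nn_integral_mono pt)
  also have "\<dots> = ennreal (1 / (2 * \<tau>)) * (\<integral>\<^sup>+ q. ennreal ((w q)\<^sup>2 * ?s q) * indicator {q. length q = k} q \<partial>count_space UNIV)
      + ennreal (\<tau> / 2) * (\<integral>\<^sup>+ q. ennreal (exp (\<delta> * list_l1 q) * R q) \<partial>count_space UNIV)"
    by (subst nn_integral_add) (auto simp: nn_integral_cmult)
  also have "(\<integral>\<^sup>+ q. ennreal ((w q)\<^sup>2 * ?s q) * indicator {q. length q = k} q \<partial>count_space UNIV)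
      = (\<integral>\<^sup>+ q. ennreal ((w q)\<^sup>2 * ?s q) \<partial>count_space {q. length q = k})"
  proof -
    have "replicate (Suc k) 0 \<notin> {q :: int list. length q = k}" by simp
    then have "{q :: int list. length q = k} \<noteq> UNIV" by blast
    then show ?thesis
      by (subst nn_integral_count_space_indicator[where X="{q. length q = k}"]) (auto simp: NO_MATCH_def)
  qed
  also have "ennreal (1 / (2 * \<tau>)) * (\<integral>\<^sup>+ q. ennreal ((w q)\<^sup>2 * ?s q) \<partial>count_space {q. length q = k})
      + ennreal (\<tau> / 2) * (\<integral>\<^sup>+ q. ennreal (exp (\<delta> * list_l1 q) * R q) \<partial>count_space UNIV)
      \<le> ennreal (1 / (2 * \<tau>)) * ennreal A + ennreal (\<tau> / 2) * ennreal (12 * real k)"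
    using A(1) E by (intro add_mono mult_left_mono) (auto simp: \<delta>_def)
  also have "\<dots> = ennreal (1 / (2 * \<tau>) * A + \<tau> / 2 * (12 * real k))"
    using \<tau> A(2) by (simp flip: ennreal_mult ennreal_plus)
  also have "1 / (2 * \<tau>) * A + \<tau> / 2 * (12 * real k) = (A / \<tau> + 12 * real k * \<tau>) / 2"
    using \<tau> by (simp add: field_simps)
  finally show ?thesis unfolding R_def .
qed

text \<open>The value of \<open>cell_sum\<close> at \<tau> = 1: 16 * 3072 * k^4 is what absorbing a
  fourth power costs, with 3072 = 16 * 64 * 3, and (8 k)^k is the lattice sum at \<delta> = 1 / (2
  k).\<close>

definition tail_const :: "nat \<Rightarrow> real"
  where "tail_const k = (16 * (3072 * real k ^ 4) * (8 * real k) ^ k + 12 * real k) / 2"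

text \<open>At the coarsest dyadic level arbitrarily distant unit cells are merged, so the weight
  grows quadratically. Its square is a fourth power, absorbed by half of the exponential
  weight.\<close>

lemma cell_sum_tail:
  assumes \<rho>: "prob_Rn k \<rho>" and k: "1 \<le> k"
    and ex: "\<And>i. i < k \<Longrightarrow> (\<integral>\<^sup>+ x. ennreal (exp \<bar>x i\<bar>) \<partial>\<rho>) \<le> 4"
  shows "(\<integral>\<^sup>+ q. ennreal (4 * (1 + real k + list_l1 q)\<^sup>2 * sqrt (measure \<rho> (cell k 0 -` {q} \<inter> space \<rho>))) \<partial>count_space UNIV)
    \<le> ennreal (tail_const k)"
proof -
  let ?B = "16 * (3072 * real k ^ 4)"
  have "(4 * (1 + real k + t)\<^sup>2)\<^sup>2 * exp (- (1 / (2 ^ 0 * real k)) * t) \<le> ?B * exp (- (1 / (2 * real k)) * t)" if t: "0 \<le> t" for t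
  proof -
    \<comment> \<open>Normalised so that y^4 \<le> 64 exp y costs only half of the weight: (1 + k) /
      (2 k) \<le> 1 leaves exp (1 + t / (2 k)).\<close>
    define y where "y = (1 + real k + t) / (2 * real k)"
    have y: "0 \<le> y" using t by (simp add: y_def)
    have "(y / 2)\<^sup>2 / 2 \<le> exp (y / 2)" using exp_lower_Taylor_quadratic[of "y / 2"] y by simp
    then have "((y / 2)\<^sup>2 / 2)\<^sup>2 \<le> (exp (y / 2))\<^sup>2" by (intro power_mono) auto
    then have "y ^ 4 \<le> 64 * exp y" by (simp add: power_divide flip: exp_double) 
    also have "exp y \<le> exp (1 + t / (2 * real k))"
      using k by (simp add: y_def add_divide_distrib) (simp add: field_simps)
    also have "\<dots> \<le> 3 * exp (t / (2 * real k))" using exp_le by (simp add: exp_add)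
    finally have y4: "y ^ 4 \<le> 64 * (3 * exp (t / (2 * real k)))" by simp
    have "(4 * (1 + real k + t)\<^sup>2)\<^sup>2 = 16 * (2 * real k) ^ 4 * y ^ 4"
      using k by (simp add: y_def power_divide power_mult_distrib)
    also have "\<dots> \<le> 16 * (2 * real k) ^ 4 * (64 * (3 * exp (t / (2 * real k))))"
      by (intro mult_left_mono y4) auto
    also have "\<dots> = ?B * exp (t / (2 * real k))" by (simp add: power_mult_distrib)
    finally have "(4 * (1 + real k + t)\<^sup>2)\<^sup>2 * exp (- (1 / (2 ^ 0 * real k)) * t)
        \<le> ?B * exp (t / (2 * real k)) * exp (- (1 / (2 ^ 0 * real k)) * t)"
      by (intro mult_right_mono) auto
    also have "\<dots> = ?B * exp (t / (2 * real k) + - (1 / (2 ^ 0 * real k)) * t)" by (simp only: mult.assoc exp_add)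
    also have "t / (2 * real k) + - (1 / (2 ^ 0 * real k)) * t = - (1 / (2 * real k)) * t"
      using k by (simp add: field_simps)
    finally show ?thesis .
  qed
  then have "(\<integral>\<^sup>+ q. ennreal ((4 * (1 + real k + list_l1 q)\<^sup>2)\<^sup>2 * exp (- (1 / (2 ^ 0 * real k)) * list_l1 q)) \<partial>count_space {q. length q = k})
      \<le> (\<integral>\<^sup>+ q. ennreal ?B * ennreal (exp (- (1 / (2 * real k)) * list_l1 q)) \<partial>count_space {q. length q = k})"
    by (intro nn_integral_mono) (simp only: ennreal_mult[symmetric] ennreal_leI list_l1_nonneg exp_ge_zero mult_nonneg_nonneg zero_le_numeral zero_le_power of_nat_0_le_iff)
  also have "\<dots> = ennreal ?B * (\<integral>\<^sup>+ q. ennreal (exp (- (1 / (2 * real k)) * list_l1 q)) \<partial>count_space {q. length q = k})"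
    by (rule nn_integral_cmult) auto
  also have "\<dots> \<le> ennreal ?B * ennreal ((4 / (1 / (2 * real k))) ^ k)"
    using k by (intro mult_left_mono nn_integral_exp_lattice_le) auto
  also have "\<dots> = ennreal (?B * (8 * real k) ^ k)" by (simp flip: ennreal_mult)
  finally have "(\<integral>\<^sup>+ q. ennreal ((4 * (1 + real k + list_l1 q)\<^sup>2)\<^sup>2 * exp (- (1 / (2 ^ 0 * real k)) * list_l1 q)) \<partial>count_space {q. length q = k})
     \<le> ennreal (?B * (8 * real k) ^ k)" .
  from cell_sum[OF \<rho> k ex _ this, of 1] show ?thesis by (simp add: tail_const_def)
qed

text \<open>The choice \<tau> = \<kappa> 2^(k l / 2) balances the two halves of
  \<open>cell_sum\<close>: the lattice sum is of order 2^(k l), and its square root is the growth of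
  the bound.\<close>

lemma cell_sum_const:
  assumes \<rho>: "prob_Rn k \<rho>" and k: "1 \<le> k"
    and ex: "\<And>i. i < k \<Longrightarrow> (\<integral>\<^sup>+ x. ennreal (exp \<bar>x i\<bar>) \<partial>\<rho>) \<le> 4"
    and \<kappa>: "0 < \<kappa>"
  shows "(\<integral>\<^sup>+ q. ennreal (\<kappa> * sqrt (measure \<rho> (cell k l -` {q} \<inter> space \<rho>))) \<partial>count_space UNIV)
    \<le> ennreal (((4 * real k) ^ k + 12 * real k) / 2 * (\<kappa> * 2 powr (real k * real l / 2)))"
proof -
  let ?\<delta> = "1 / (2 ^ l * real k)" and ?P = "2 powr (real k * real l / 2)"
  have P2: "?P * ?P = (2 ^ l) ^ k"
    by (simp flip: powr_add powr_realpow power_mult add: powr_powr mult.commute)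
  have "1 \<le> (2::real) ^ l * real k" using k mult_mono[of 1 "(2::real) ^ l" 1 "real k"] by simp
  then have \<delta>: "0 < ?\<delta>" "?\<delta> \<le> 1" using k by auto
  have "(\<integral>\<^sup>+ q. ennreal (\<kappa>\<^sup>2 * exp (- ?\<delta> * list_l1 q)) \<partial>count_space {q. length q = k})
      = ennreal (\<kappa>\<^sup>2) * (\<integral>\<^sup>+ q. ennreal (exp (- ?\<delta> * list_l1 q)) \<partial>count_space {q. length q = k})"
    by (simp only: ennreal_mult[OF zero_le_power2 exp_ge_zero]) (rule nn_integral_cmult, simp)
  also have "\<dots> \<le> ennreal (\<kappa>\<^sup>2) * ennreal ((4 / ?\<delta>) ^ k)"
    by (intro mult_left_mono nn_integral_exp_lattice_le \<delta>) auto
  also have "\<dots> = ennreal (\<kappa>\<^sup>2 * (4 * real k) ^ k * (?P * ?P))"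
    unfolding P2 by (simp add: power_mult_distrib mult_ac flip: ennreal_mult)
  finally have "(\<integral>\<^sup>+ q. ennreal (\<kappa>\<^sup>2 * exp (- ?\<delta> * list_l1 q)) \<partial>count_space {q. length q = k})
      \<le> ennreal (\<kappa>\<^sup>2 * (4 * real k) ^ k * (?P * ?P))" .
  from cell_sum[OF \<rho> k ex _ this, of "\<kappa> * ?P"] \<kappa>
  have "(\<integral>\<^sup>+ q. ennreal (\<kappa> * sqrt (measure \<rho> (cell k l -` {q} \<inter> space \<rho>))) \<partial>count_space UNIV)
    \<le> ennreal ((\<kappa>\<^sup>2 * (4 * real k) ^ k * (?P * ?P) / (\<kappa> * ?P) + 12 * real k * (\<kappa> * ?P)) / 2)" by simp
  also have "(\<kappa>\<^sup>2 * (4 * real k) ^ k * (?P * ?P) / (\<kappa> * ?P) + 12 * real k * (\<kappa> * ?P)) / 2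
      = ((4 * real k) ^ k + 12 * real k) / 2 * (\<kappa> * ?P)"
    using \<kappa> by (simp add: power2_eq_square field_simps)
  finally show ?thesis .
qed

text \<open>One summand for each source of cost: the levels 1 to L (4 k times the bracket of
  \<open>cell_sum_const\<close>, halved), the merging of unit cells, and the matching inside the
  finest cells.\<close>

definition emp_const :: "nat \<Rightarrow> real"
  where "emp_const k = 2 * real k * ((4 * real k) ^ k + 12 * real k) + tail_const k + 2 * real k"

lemma emp_const_pos: "1 \<le> k \<Longrightarrow> 0 < emp_const k"
  by (auto simp: emp_const_def tail_const_def intro!: add_nonneg_pos add_nonneg_nonneg)

text \<open>A cell of level l has diameter at most sqrt k / 2^l, and p \<le> 2 bounds the p-th power
  by k 2^(-p l). Leftovers of level l are matched in the parent cell, which costs a further factor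
  2^p \<le> 4. Leftovers of unit cells are matched globally, at a price bounded through their
  distance from the origin.\<close>

lemma wasserstein_multiscale:
  assumes \<rho>: "prob_Rn k \<rho>" and \<nu>: "prob_Rn k \<nu>" and k: "1 \<le> k" and p: "1 \<le> p" "p \<le> 2"
  shows "ennreal (wasserstein k p \<rho> \<nu> powr p) \<le> ennreal (2 * (real k * 2 powr (- p * real L)))
    + (\<Sum>j<Suc L. \<integral>\<^sup>+ q. ennreal ((if j < L then 4 * real k * 2 powr (- p * real (L - j)) else 4 * (1 + real k + list_l1 q)\<^sup>2)
        * \<bar>measure \<rho> (cell k (L - j) -` {q} \<inter> Rn k) - measure \<nu> (cell k (L - j) -` {q} \<inter> Rn k)\<bar>) \<partial>count_space UNIV)"
proof -
  note S = prob_RnD(2)[OF \<rho>] prob_RnD(2)[OF \<nu>]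
  have sp: "space \<rho> = Rn k" using \<rho> by (rule prob_RnD)
  \<comment> \<open>The index j counts from fine to coarse, so it stands for level L - j; the index
    Suc L is the trivial partition, represented by the empty list.\<close>
  define C where "C j x = (if j < Suc L then cell k (L - j) x else [])" for j x
  define D where "D j q = (if j < L then 4 * real k * 2 powr (- p * real (L - j)) else 4 * (1 + real k + list_l1 q)\<^sup>2)" for j q
  have D0: "0 \<le> D j q" for j q by (simp add: D_def)
  define c where "c x y = norm_Rn k (x - y) powr p" for x y
  have cm: "(\<lambda>(x, y). c x y) \<in> borel_measurable (\<rho> \<Otimes>\<^sub>M \<nu>)"
  proof -
    have s: "sets (\<rho> \<Otimes>\<^sub>M \<nu>) = sets (borel_Rn k \<Otimes>\<^sub>M borel_Rn k)" using S by (intro sets_pair_measure_cong) auto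
    have "(\<lambda>z. norm_Rn k (fst z - snd z)) \<in> borel_measurable (borel_Rn k \<Otimes>\<^sub>M borel_Rn k)"
      by (intro measurable_norm_Rn measurable_Rn_diff) measurable
    then have [measurable]: "(\<lambda>z. norm_Rn k (fst z - snd z)) \<in> borel_measurable (\<rho> \<Otimes>\<^sub>M \<nu>)"
      using measurable_cong_sets[OF s refl] by blast
    show ?thesis unfolding c_def split_beta' by measurable
  qed
  have Cm: "C j \<in> \<rho> \<rightarrow>\<^sub>M count_space UNIV" for j
    using measurable_cell S(1) unfolding C_def by (cases "j < Suc L") (simp_all cong: measurable_cong_sets)
  have cell_cost: "norm_Rn k (x - y) powr p \<le> real k * 2 powr (- p * real l)" if "cell k l x = cell k l y" for l x y
  proof -
    have "norm_Rn k (x - y) powr p \<le> (sqrt (real k) / 2 ^ l) powr p"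
      using norm_Rn_cell_le[OF that] p by (intro powr_mono2) auto
    also have "\<dots> = sqrt (real k) powr p * 2 powr (- p * real l)"
      by (simp add: powr_divide powr_minus_divide powr_powr mult.commute flip: powr_realpow)
    also have "\<dots> \<le> real k * 2 powr (- p * real l)"
    proof (intro mult_right_mono)
      have "sqrt (real k) powr p \<le> sqrt (real k) powr 2" using p k by (intro powr_mono) auto
      then show "sqrt (real k) powr p \<le> real k" using k by simp
    qed auto
    finally show ?thesis .
  qed
  have "\<exists>\<gamma>\<in>couplings \<rho> \<nu>. (\<integral>\<^sup>+ z. ennreal (c (fst z) (snd z)) \<partial>\<gamma>) \<le> ennreal (2 * (real k * 2 powr (- p * real L)))
    + (\<Sum>j<Suc L. \<integral>\<^sup>+ q. ennreal (D j q * \<bar>measure \<rho> (C j -` {q} \<inter> space \<rho>) - measure \<nu> (C j -` {q} \<inter> space \<rho>)\<bar>) \<partial>count_space UNIV)"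
  proof (rule multiscale_coupling)
    show "prob_space \<rho>" "prob_space \<nu>" using \<rho> \<nu> by (auto dest: prob_RnD)
    show "sets \<nu> = sets \<rho>" using S by simp
    show "C j \<in> \<rho> \<rightarrow>\<^sub>M count_space UNIV" for j by (rule Cm)
    show "C (Suc j) x = C (Suc j) y" if "j < Suc L" "C j x = C j y" for j x y
    proof (cases "j < L")
      case True
      then have "L - j = Suc (L - Suc j)" by simp
      with that True show ?thesis using cell_nested[of k "L - Suc j" x y] by (simp add: C_def)
    qed (simp add: C_def)
    show "c x y \<le> real k * 2 powr (- p * real L) + real k * 2 powr (- p * real L)" if "C 0 x = C 0 y" for x y
    proof -
      have "c x y \<le> real k * 2 powr (- p * real L)" using cell_cost[of L x y] that by (simp add: C_def c_def)
      moreover have "0 \<le> real k * 2 powr (- p * real L)" by simp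
      ultimately show ?thesis by linarith
    qed
    show "c x y \<le> D j (C j x) + D j (C j y)" if j: "j < Suc L" and xy: "C (Suc j) x = C (Suc j) y" for j x y
    proof (cases "j < L")
      case True
      then have "c x y \<le> real k * 2 powr (- p * real (L - Suc j))"
        using cell_cost[of "L - Suc j" x y] xy by (simp add: C_def c_def)
      \<comment> \<open>Passing to the parent cell costs 2^p \<le> 4. The whole cost is charged to
        the cell of x alone.\<close>
      also have "- p * real (L - Suc j) = p + - p * real (L - j)" using True by (simp add: of_nat_diff algebra_simps)
      also have "real k * 2 powr (p + - p * real (L - j)) = real k * (2 powr p * 2 powr (- p * real (L - j)))"
        by (simp only: powr_add)
      also have "\<dots> \<le> real k * (4 * 2 powr (- p * real (L - j)))"
        using powr_mono[OF p(2), of 2] by (intro mult_left_mono mult_right_mono) auto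
      finally have "c x y \<le> D j (C j x)" using True by (simp add: D_def)
      with D0[of j "C j y"] show ?thesis by linarith
    next
      case False
      then have jL: "j = L" using j by simp
      let ?X = "list_l1 (cell k 0 x)" and ?Y = "list_l1 (cell k 0 y)" and ?r = "norm_Rn k (x - y)"
      have "?r \<le> (\<Sum>i<k. \<bar>x i\<bar>) + (\<Sum>i<k. \<bar>y i\<bar>)"
        using norm_Rn_diff_le[of k x y] norm_Rn_le_sum[of k x] norm_Rn_le_sum[of k y] by linarith
      then have r: "?r \<le> (1 + real k + ?X) + (1 + real k + ?Y)"
        using sum_abs_le_list_l1_cell[of x k] sum_abs_le_list_l1_cell[of y k] by linarith
      have "?r powr p \<le> ((1 + real k + ?X) + (1 + real k + ?Y)) powr p"
        using r p by (intro powr_mono2) auto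
      \<comment> \<open>The base is at least 1, so p \<le> 2 allows the exponent 2.\<close>
      also have "\<dots> \<le> ((1 + real k + ?X) + (1 + real k + ?Y)) powr 2"
        using p by (intro powr_mono) (auto intro!: add_increasing2)
      also have "\<dots> = ((1 + real k + ?X) + (1 + real k + ?Y))\<^sup>2" by (simp add: powr_numeral add_pos_nonneg)
      also have "\<dots> \<le> 2 * (1 + real k + ?X)\<^sup>2 + 2 * (1 + real k + ?Y)\<^sup>2"
      proof -
        have "(a + b)\<^sup>2 \<le> 2 * a\<^sup>2 + 2 * b\<^sup>2" for a b :: real
          using sum_squares_bound[of a b] by (simp add: power2_sum)
        then show ?thesis .
      qed
      also have "\<dots> \<le> 4 * (1 + real k + ?X)\<^sup>2 + 4 * (1 + real k + ?Y)\<^sup>2" by (intro add_mono mult_right_mono) auto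
      finally show ?thesis by (simp add: D_def C_def c_def jL)
    qed
    show "C (Suc L) x = C (Suc L) y" for x y by (simp add: C_def)
  qed (use cm D0 in \<open>auto simp: c_def\<close>)
  then obtain \<gamma> where \<gamma>: "\<gamma> \<in> couplings \<rho> \<nu>" and cost: "(\<integral>\<^sup>+ z. ennreal (c (fst z) (snd z)) \<partial>\<gamma>) \<le> ennreal (2 * (real k * 2 powr (- p * real L)))
    + (\<Sum>j<Suc L. \<integral>\<^sup>+ q. ennreal (D j q * \<bar>measure \<rho> (C j -` {q} \<inter> space \<rho>) - measure \<nu> (C j -` {q} \<inter> space \<rho>)\<bar>) \<partial>count_space UNIV)" ..
  have "ennreal (wasserstein k p \<rho> \<nu> powr p) \<le> wcost k p \<rho> \<nu>"
    using p by (simp add: wasserstein_powr) (cases "wcost k p \<rho> \<nu>"; simp)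
  also have "\<dots> \<le> (\<integral>\<^sup>+ z. ennreal (c (fst z) (snd z)) \<partial>\<gamma>)"
    unfolding wcost_def c_def using \<gamma> by (rule INF_lower)
  also note cost
  also have "(\<Sum>j<Suc L. \<integral>\<^sup>+ q. ennreal (D j q * \<bar>measure \<rho> (C j -` {q} \<inter> space \<rho>) - measure \<nu> (C j -` {q} \<inter> space \<rho>)\<bar>) \<partial>count_space UNIV)
    = (\<Sum>j<Suc L. \<integral>\<^sup>+ q. ennreal ((if j < L then 4 * real k * 2 powr (- p * real (L - j)) else 4 * (1 + real k + list_l1 q)\<^sup>2)
        * \<bar>measure \<rho> (cell k (L - j) -` {q} \<inter> Rn k) - measure \<nu> (cell k (L - j) -` {q} \<inter> Rn k)\<bar>) \<partial>count_space UNIV)"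
  proof (rule sum.cong[OF refl])
    fix j assume "j \<in> {..<Suc L}"
    then have "C j = cell k (L - j)" by (simp add: C_def fun_eq_iff)
    then show "(\<integral>\<^sup>+ q. ennreal (D j q * \<bar>measure \<rho> (C j -` {q} \<inter> space \<rho>) - measure \<nu> (C j -` {q} \<inter> space \<rho>)\<bar>) \<partial>count_space UNIV)
    = (\<integral>\<^sup>+ q. ennreal ((if j < L then 4 * real k * 2 powr (- p * real (L - j)) else 4 * (1 + real k + list_l1 q)\<^sup>2)
        * \<bar>measure \<rho> (cell k (L - j) -` {q} \<inter> Rn k) - measure \<nu> (cell k (L - j) -` {q} \<inter> Rn k)\<bar>) \<partial>count_space UNIV)"
      by (simp only: D_def sp)
  qed
  finally show ?thesis .
qed

text \<open>Tonelli exchanges expectation and the sum over cells; each cell then contributes sqrt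
  (\<rho>(q) / n), and \<open>cell_sum_const\<close> makes level l contribute 2^(l (k / 2 - p)) /
  sqrt n up to constants.\<close>

lemma expected_wasserstein_empirical:
  assumes \<rho>: "prob_Rn k \<rho>" and k: "1 \<le> k" and p: "1 \<le> p" "p \<le> 2" and n: "0 < n"
    and ex: "\<And>i. i < k \<Longrightarrow> (\<integral>\<^sup>+ x. ennreal (exp \<bar>x i\<bar>) \<partial>\<rho>) \<le> 4"
  shows "(\<integral>\<^sup>+ x. ennreal (wasserstein k p \<rho> (empirical k n x) powr p) \<partial>PiM {..<n} (\<lambda>_. \<rho>))
    \<le> ennreal (emp_const k * (2 powr (- p * real L) + (\<Sum>l\<le>L. 2 powr (real l * (real k / 2 - p))) / sqrt (real n)))"
proof -
  interpret prob_space \<rho> using \<rho> by (rule prob_RnD)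
  let ?P = "PiM {..<n} (\<lambda>_. \<rho>)"
  interpret P: prob_space ?P by (rule prob_space_PiM) unfold_locales
  note S = prob_RnD(2)[OF \<rho>]
  have sp: "space \<rho> = Rn k" using \<rho> by (rule prob_RnD)
  define Q where "Q j q = cell k (L - j) -` {q} \<inter> Rn k" for j q
  have Qm[measurable]: "Q j q \<in> sets \<rho>" for j q
  proof -
    have "cell k (L - j) -` {q} \<inter> space (borel_Rn k) \<in> sets (borel_Rn k)"
      by (rule measurable_sets[OF measurable_cell]) simp
    then show ?thesis by (simp add: Q_def S space_borel_Rn)
  qed
  define w where "w j q = (if j < L then 4 * real k * 2 powr (- p * real (L - j)) else 4 * (1 + real k + list_l1 q)\<^sup>2)" for j q
  have w0: "0 \<le> w j q" for j q by (simp add: w_def)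
  define dev where "dev j q x = \<bar>measure \<rho> (Q j q) - (\<Sum>i<n. indicator (Q j q) (x i)) / real n\<bar>" for j q and x :: "nat \<Rightarrow> rvec"
  have dm[measurable]: "dev j q \<in> borel_measurable ?P" for j q unfolding dev_def by measurable
  have Ed: "(\<integral>\<^sup>+ x. ennreal (dev j q x) \<partial>?P) \<le> ennreal (sqrt (measure \<rho> (Q j q)) / sqrt (real n))" for j q
    unfolding dev_def by (intro expected_deviation prob_space_axioms Qm n)
  let ?D0 = "2 * (real k * 2 powr (- p * real L))"
  have "(\<integral>\<^sup>+ x. ennreal (wasserstein k p \<rho> (empirical k n x) powr p) \<partial>?P)
    \<le> (\<integral>\<^sup>+ x. ennreal ?D0 + (\<Sum>j<Suc L. \<integral>\<^sup>+ q. ennreal (w j q) * ennreal (dev j q x) \<partial>count_space UNIV) \<partial>?P)"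
  proof (rule nn_integral_mono)
    fix x assume "x \<in> space ?P"
    then have x: "x j \<in> Rn k" if "j < n" for j using that by (auto simp: space_PiM PiE_def Pi_def sp)
    have \<nu>: "prob_Rn k (empirical k n x)" using x n by (rule prob_Rn_empirical)
    have m: "measure (empirical k n x) (Q j q) = (\<Sum>i<n. indicator (Q j q) (x i)) / real n" for j q
      using x Qm by (intro measure_empirical) (auto simp: S)
    show "ennreal (wasserstein k p \<rho> (empirical k n x) powr p)
      \<le> ennreal ?D0 + (\<Sum>j<Suc L. \<integral>\<^sup>+ q. ennreal (w j q) * ennreal (dev j q x) \<partial>count_space UNIV)"
      using wasserstein_multiscale[OF \<rho> \<nu> k p, of L]
      unfolding Q_def[symmetric] m w_def[symmetric] dev_def[symmetric]
      by (simp only: ennreal_mult[OF w0, symmetric] dev_def abs_ge_zero)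
  qed
  also have "\<dots> = ennreal ?D0 + (\<Sum>j<Suc L. \<integral>\<^sup>+ x. \<integral>\<^sup>+ q. ennreal (w j q) * ennreal (dev j q x) \<partial>count_space UNIV \<partial>?P)"
  proof -
    have m: "(\<lambda>x. \<integral>\<^sup>+ q. ennreal (w j q) * ennreal (dev j q x) \<partial>count_space UNIV) \<in> borel_measurable ?P" for j
    proof -
      interpret c: sigma_finite_measure "count_space (UNIV :: int list set)"
        by (rule sigma_finite_measure_count_space_countable) auto
      have "(\<lambda>(q, x). ennreal (w j q) * ennreal (dev j q x)) \<in> borel_measurable (count_space UNIV \<Otimes>\<^sub>M ?P)"
        by (rule measurable_pair_measure_countable1) auto
      from measurable_compose[OF measurable_pair_swap' this]
      have "(\<lambda>(x, q). ennreal (w j q) * ennreal (dev j q x)) \<in> borel_measurable (?P \<Otimes>\<^sub>M count_space UNIV)"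
        by (simp add: split_beta')
      then show ?thesis by (rule c.borel_measurable_nn_integral)
    qed
    then show ?thesis
      by (subst nn_integral_add) (auto simp: P.emeasure_space_1 nn_integral_sum simp del: sum.lessThan_Suc)
  qed
  also have "\<dots> \<le> ennreal ?D0 + (\<Sum>j<Suc L. ennreal (1 / sqrt (real n)) * (\<integral>\<^sup>+ q. ennreal (w j q * sqrt (measure \<rho> (Q j q))) \<partial>count_space UNIV))"
  proof (intro add_left_mono sum_mono)
    fix j
    have "(\<integral>\<^sup>+ x. \<integral>\<^sup>+ q. ennreal (w j q) * ennreal (dev j q x) \<partial>count_space UNIV \<partial>?P)
        = (\<integral>\<^sup>+ q. \<integral>\<^sup>+ x. ennreal (w j q) * ennreal (dev j q x) \<partial>?P \<partial>count_space UNIV)"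
      by (rule nn_integral_count_space_nn_integral) auto
    also have "\<dots> = (\<integral>\<^sup>+ q. ennreal (w j q) * (\<integral>\<^sup>+ x. ennreal (dev j q x) \<partial>?P) \<partial>count_space UNIV)"
      by (intro nn_integral_cong nn_integral_cmult) auto
    also have "\<dots> \<le> (\<integral>\<^sup>+ q. ennreal (w j q) * ennreal (sqrt (measure \<rho> (Q j q)) / sqrt (real n)) \<partial>count_space UNIV)"
      by (intro nn_integral_mono mult_left_mono Ed) auto
    also have "\<dots> = (\<integral>\<^sup>+ q. ennreal (1 / sqrt (real n)) * ennreal (w j q * sqrt (measure \<rho> (Q j q))) \<partial>count_space UNIV)"
      using w0 by (intro nn_integral_cong) (simp add: mult_ac flip: ennreal_mult)
    also have "\<dots> = ennreal (1 / sqrt (real n)) * (\<integral>\<^sup>+ q. ennreal (w j q * sqrt (measure \<rho> (Q j q))) \<partial>count_space UNIV)"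
      by (rule nn_integral_cmult) auto
    finally show "(\<integral>\<^sup>+ x. \<integral>\<^sup>+ q. ennreal (w j q) * ennreal (dev j q x) \<partial>count_space UNIV \<partial>?P)
      \<le> ennreal (1 / sqrt (real n)) * (\<integral>\<^sup>+ q. ennreal (w j q * sqrt (measure \<rho> (Q j q))) \<partial>count_space UNIV)" .
  qed
  also have "\<dots> \<le> ennreal ?D0 + (\<Sum>j<Suc L. ennreal (1 / sqrt (real n)) * ennreal (if j < L then 2 * real k * ((4 * real k) ^ k + 12 * real k) * 2 powr (real (L - j) * (real k / 2 - p)) else tail_const k))"
  proof (intro add_left_mono sum_mono mult_left_mono)
    fix j assume "j \<in> {..<Suc L}"
    show "(\<integral>\<^sup>+ q. ennreal (w j q * sqrt (measure \<rho> (Q j q))) \<partial>count_space UNIV)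
      \<le> ennreal (if j < L then 2 * real k * ((4 * real k) ^ k + 12 * real k) * 2 powr (real (L - j) * (real k / 2 - p)) else tail_const k)"
    proof (cases "j < L")
      case True
      let ?\<kappa> = "4 * real k * 2 powr (- p * real (L - j))"
      have "(\<integral>\<^sup>+ q. ennreal (w j q * sqrt (measure \<rho> (Q j q))) \<partial>count_space UNIV)
        \<le> ennreal (((4 * real k) ^ k + 12 * real k) / 2 * (?\<kappa> * 2 powr (real k * real (L - j) / 2)))"
        using cell_sum_const[OF \<rho> k ex, of ?\<kappa> "L - j"] k True by (simp add: w_def Q_def sp)
      also have "?\<kappa> * 2 powr (real k * real (L - j) / 2) = 4 * real k * (2 powr (- p * real (L - j) + real k * real (L - j) / 2))"
        by (simp only: powr_add mult.assoc)
      also have "- p * real (L - j) + real k * real (L - j) / 2 = real (L - j) * (real k / 2 - p)"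
        by (simp add: algebra_simps)
      finally have "(\<integral>\<^sup>+ q. ennreal (w j q * sqrt (measure \<rho> (Q j q))) \<partial>count_space UNIV)
        \<le> ennreal (((4 * real k) ^ k + 12 * real k) / 2 * (4 * real k * 2 powr (real (L - j) * (real k / 2 - p))))" .
      also have "((4 * real k) ^ k + 12 * real k) / 2 * (4 * real k * 2 powr (real (L - j) * (real k / 2 - p)))
        = 2 * real k * ((4 * real k) ^ k + 12 * real k) * 2 powr (real (L - j) * (real k / 2 - p))"
        by simp
      finally show ?thesis using True by (simp only: if_True)
    next
      case False
      with \<open>j \<in> {..<Suc L}\<close> have "j = L" by simp
      then show ?thesis using cell_sum_tail[OF \<rho> k ex] by (simp add: w_def Q_def sp)
    qed
  qed auto
  also have "\<dots> = ennreal (?D0 + (\<Sum>j<Suc L. 1 / sqrt (real n) * (if j < L then 2 * real k * ((4 * real k) ^ k + 12 * real k) * 2 powr (real (L - j) * (real k / 2 - p)) else tail_const k)))"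
  proof -
    have nn: "0 \<le> (if j < L then 2 * real k * ((4 * real k) ^ k + 12 * real k) * 2 powr (real (L - j) * (real k / 2 - p)) else tail_const k)" for j
      by (simp add: tail_const_def)
    show ?thesis
      using nn by (simp only: ennreal_mult[symmetric] sum_ennreal ennreal_plus[symmetric] sum_nonneg mult_nonneg_nonneg
          zero_le_divide_1_iff real_sqrt_ge_zero of_nat_0_le_iff powr_ge_zero zero_le_numeral)
  qed
  also have "\<dots> \<le> ennreal (emp_const k * (2 powr (- p * real L) + (\<Sum>l\<le>L. 2 powr (real l * (real k / 2 - p))) / sqrt (real n)))"
  proof (rule ennreal_leI)
    define a where "a l = 2 powr (real l * (real k / 2 - p))" for l
    define c where "c = 2 * real k * ((4 * real k) ^ k + 12 * real k)"
    define T where "T = (\<Sum>j<L. a (Suc j))"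
    have T0: "0 \<le> T" by (auto simp: T_def a_def intro: sum_nonneg)
    have c0: "0 \<le> c" "0 \<le> tail_const k" by (auto simp: c_def tail_const_def)
    have "(\<Sum>j<Suc L. 1 / sqrt (real n) * (if j < L then c * a (L - j) else tail_const k))
       = 1 / sqrt (real n) * ((\<Sum>j<L. c * a (L - j)) + tail_const k)"
      by (simp add: sum_distrib_left distrib_left)
    also have "(\<Sum>j<L. c * a (L - j)) = c * (\<Sum>j<L. a (Suc (L - Suc j)))"
      by (simp add: sum_distrib_left Suc_diff_Suc)
    also have "(\<Sum>j<L. a (Suc (L - Suc j))) = T"
      unfolding T_def by (rule sum.nat_diff_reindex)
    finally have 1: "(\<Sum>j<Suc L. 1 / sqrt (real n) * (if j < L then c * a (L - j) else tail_const k)) = (c * T + tail_const k) / sqrt (real n)"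
      by simp
    \<comment> \<open>The summand for l = 0 equals 1 and makes room for the constant of the unit
      cells.\<close>
    have 2: "(\<Sum>l\<le>L. a l) = 1 + T"
      unfolding T_def by (subst sum.atMost_shift) (simp add: a_def)
    have "c * T + tail_const k \<le> emp_const k * (1 + T)"
    proof -
      have "emp_const k = c + tail_const k + 2 * real k" by (simp add: emp_const_def c_def)
      then have "c \<le> emp_const k" "tail_const k \<le> emp_const k" using c0 by auto
      then show ?thesis using mult_right_mono[of c "emp_const k" T] T0 by (simp add: distrib_left)
    qed
    then have "(c * T + tail_const k) / sqrt (real n) \<le> emp_const k * ((1 + T) / sqrt (real n))"
      by (simp add: divide_right_mono)
    moreover have "?D0 \<le> emp_const k * 2 powr (- p * real L)"
      using c0 by (simp add: emp_const_def c_def[symmetric] algebra_simps)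
    ultimately show "?D0 + (\<Sum>j<Suc L. 1 / sqrt (real n) * (if j < L then 2 * real k * ((4 * real k) ^ k + 12 * real k) * 2 powr (real (L - j) * (real k / 2 - p)) else tail_const k))
      \<le> emp_const k * (2 powr (- p * real L) + (\<Sum>l\<le>L. 2 powr (real l * (real k / 2 - p))) / sqrt (real n))"
      unfolding a_def[symmetric] c_def[symmetric] 1 2 distrib_left[of "emp_const k"] by (rule add_mono[rotated])
  qed
  finally show ?thesis .
qed

section \<open>Depth of the multiscale coupling and the rate\<close>

definition geo_const :: "real \<Rightarrow> nat \<Rightarrow> real"
  where "geo_const p k = 1 / (1 - 2 powr (- \<bar>real k / 2 - p\<bar>))"

text \<open>At k = 2 p the geometric ratio is 1 and the value is 1 / 0 = 0; there
  \<open>level_choice\<close> bounds the sum over levels by its length.\<close>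

lemma geo_const_nonneg: "0 \<le> geo_const p k"
proof -
  have "2 powr (- \<bar>real k / 2 - p\<bar>) \<le> 2 powr 0" by (intro powr_mono) auto
  then show ?thesis by (simp add: geo_const_def)
qed

text \<open>For \<open>p \<le> 2\<close> the geometric constants are at most \<open>4\<close> when \<open>k \<ge> 5\<close>, which makes the constant
  uniform in \<open>k\<close>.\<close>

definition rate_const :: "real \<Rightarrow> real"
  where "rate_const p = 16 + (\<Sum>k\<le>4. geo_const p k)"

lemma rate_const_pos: "0 < rate_const p"
  by (auto simp: rate_const_def intro!: add_pos_nonneg sum_nonneg geo_const_nonneg)

text \<open>The 8 is what the critical case k = 2 p of \<open>level_choice\<close> asks for. For k
  \<ge> 5 the exponent is at least 1 / 2 away from 0, and 1 / (1 - 1 / sqrt 2) \<le> 4.\<close>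

lemma geo_const_le:
  assumes "p \<le> 2" shows "8 + geo_const p k \<le> rate_const p"
proof (cases "k \<le> 4")
  case True
  then have "geo_const p k \<le> (\<Sum>k\<le>4. geo_const p k)"
    by (intro member_le_sum geo_const_nonneg) auto
  then show ?thesis by (simp add: rate_const_def)
next
  case False
  then have "1 / 2 \<le> \<bar>real k / 2 - p\<bar>" using assms by auto
  then have "2 powr (- \<bar>real k / 2 - p\<bar>) \<le> 2 powr (- (1 / 2))" by (intro powr_mono) auto
  also have "\<dots> = 1 / sqrt 2" by (simp add: powr_minus_divide powr_half_sqrt)
  also have "\<dots> \<le> 3 / 4"
  proof -
    have "4 / 3 \<le> sqrt 2" by (rule real_le_rsqrt) (simp add: power2_eq_square)
    then show ?thesis by (simp add: field_simps)
  qed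
  finally have "geo_const p k \<le> 1 / (1 / 4)" unfolding geo_const_def by (intro divide_left_mono) auto
  moreover have "0 \<le> (\<Sum>k\<le>4. geo_const p k)" by (intro sum_nonneg geo_const_nonneg)
  ultimately show ?thesis by (simp add: rate_const_def)
qed

lemma sum_powr_geometric:
  "(\<Sum>l\<le>L. 2 powr (real l * a)) = (\<Sum>l\<le>L. (2 powr a) ^ l)"
  by (intro sum.cong refl) (simp add: powr_powr mult.commute flip: powr_realpow)

text \<open>The p-th power of the rate is, up to the factor in k, n^(-1/2), n^(-1/2) log n or
  n^(-p/k). These are the sizes of the level sum when it is dominated by its coarse levels, spread
  evenly, or dominated by its fine levels.\<close>

lemma level_choice:
  assumes p: "1 \<le> p" "p \<le> 2" and k: "1 \<le> k" and n: "2 \<le> n"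
  shows "\<exists>L. 2 powr (- p * real L) + (\<Sum>l\<le>L. 2 powr (real l * (real k / 2 - p))) / sqrt (real n)
    \<le> rate_const p * (rate 1 p k n powr p / sqrt (real k) powr p)"
proof -
  let ?a = "real k / 2 - p" and ?g = "geo_const p k"
  have n1: "0 < real n" using n by simp
  have g0: "0 \<le> ?g" and gr: "8 + ?g \<le> rate_const p" using geo_const_nonneg geo_const_le[OF p(2)] by auto
  have sk: "0 < sqrt (real k)" using k by simp
  consider "real k < 2 * p" | "real k = 2 * p" | "2 * p < real k" by linarith
  then show ?thesis
  proof cases
    case 1
    \<comment> \<open>The series over levels converges, so depth is free: L = n is far more than
      needed to make the first term small.\<close>
    have "2 powr (- p * real n) \<le> 2 powr (- real n)"
      using p mult_right_mono[of 1 p "real n"] by (intro powr_mono) auto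
    also have "\<dots> = 1 / 2 ^ n" by (simp add: powr_minus_divide powr_realpow)
    also have "\<dots> \<le> 1 / real n"
      using n1 of_nat_less_two_power[of n, where 'a=real] by (intro divide_left_mono) auto
    also have "\<dots> \<le> 1 / sqrt (real n)"
      using n sqrt_le_D[of "real n"] by (intro divide_left_mono real_le_lsqrt) (auto simp: power2_eq_square)
    finally have A: "2 powr (- p * real n) \<le> 1 / sqrt (real n)" .
    let ?q = "2 powr ?a"
    have q: "0 < ?q" "?q < 1" using 1 powr_less_mono[of ?a 0 2] by auto
    have "(\<Sum>l\<le>n. 2 powr (real l * ?a)) = (1 - ?q ^ Suc n) / (1 - ?q)"
      unfolding sum_powr_geometric using q 1 sum_gp_basic[of ?q n] by (simp add: eq_divide_eq mult.commute)
    also have "\<dots> \<le> 1 / (1 - ?q)" using q by (intro divide_right_mono) auto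
    also have "\<dots> = ?g" using 1 by (simp add: geo_const_def)
    finally have B: "(\<Sum>l\<le>n. 2 powr (real l * ?a)) / sqrt (real n) \<le> ?g / sqrt (real n)" by (intro divide_right_mono) auto
    have E: "rate 1 p k n powr p / sqrt (real k) powr p = 1 / sqrt (real n)"
      using 1 p n sk by (simp add: rate_def powr_mult powr_divide powr_powr powr_minus_divide powr_half_sqrt)
    moreover have "2 powr (- p * real n) + (\<Sum>l\<le>n. 2 powr (real l * ?a)) / sqrt (real n) \<le> (1 + ?g) * (1 / sqrt (real n))"
      using A B by (simp add: add_divide_distrib)
    moreover have "(1 + ?g) * (1 / sqrt (real n)) \<le> rate_const p * (1 / sqrt (real n))"
      using gr by (intro mult_right_mono) auto
    ultimately show ?thesis unfolding E by (intro exI[of _ n]) linarith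
  next
    case 2
    \<comment> \<open>All levels contribute equally. About log 2 n of them make the first term small
      enough, and their number is the logarithm in the rate.\<close>
    define L where "L = nat \<lceil>log 2 (real n)\<rceil>"
    have lg: "1 \<le> log 2 (real n)" using n by (simp add: le_log_iff)
    have L: "log 2 (real n) \<le> real L" "real L \<le> log 2 (real n) + 1" using lg unfolding L_def by linarith+
    have ln2: "1 / 2 \<le> ln (2::real)" using ln2_ge_two_thirds by simp
    have "2 powr (- p * real L) \<le> 2 powr (- log 2 (real n))"
      using L(1) p lg mult_mono[of 1 p "log 2 (real n)" "real L"] by (intro powr_mono) auto
    also have "\<dots> = 1 / real n" using n by (simp add: powr_minus_divide)
    also have "\<dots> \<le> 1 / sqrt (real n)"
      using n by (intro divide_left_mono real_le_lsqrt) (auto simp: power2_eq_square)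
    finally have A: "2 powr (- p * real L) \<le> 1 / sqrt (real n)" .
    have "(\<Sum>l\<le>L. 2 powr (real l * ?a)) = real L + 1" using 2 by simp
    then have B: "2 powr (- p * real L) + (\<Sum>l\<le>L. 2 powr (real l * ?a)) / sqrt (real n) \<le> (real L + 2) / sqrt (real n)"
      using A by (simp add: add_divide_distrib)
    have "real L + 2 \<le> 4 * log 2 (real n)" using L lg by linarith
    also have "\<dots> = 4 * ln (real n) / ln 2" by (simp add: log_def)
    also have "\<dots> \<le> 4 * ln (real n) / (1 / 2)" using ln2 n by (intro divide_left_mono) auto
    finally have C: "(real L + 2) / sqrt (real n) \<le> 8 * (ln (real n) / sqrt (real n))"
      by (simp add: divide_right_mono)
    have ln0: "0 < ln (real n)" using n by simp
    have E: "rate 1 p k n powr p / sqrt (real k) powr p = ln (real n) / sqrt (real n)"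
      using 2 p n sk ln0 by (simp add: rate_def powr_mult powr_divide powr_powr powr_minus_divide powr_half_sqrt)
    moreover have "8 * (ln (real n) / sqrt (real n)) \<le> rate_const p * (ln (real n) / sqrt (real n))"
      using gr g0 ln0 by (intro mult_right_mono) auto
    ultimately show ?thesis unfolding E using B C by (intro exI[of _ L]) linarith
  next
    case 3
    \<comment> \<open>At this real depth 2^(-p z) and 2^(z (k / 2 - p)) / sqrt n coincide, both
      being n^(-p/k). Rounding down costs 2^p \<le> 4 in the first term.\<close>
    define z where "z = log 2 (real n) / real k"
    define L where "L = nat \<lfloor>z\<rfloor>"
    have z0: "0 \<le> z" using n by (simp add: z_def)
    have L: "real L \<le> z" "z \<le> real L + 1" using z0 unfolding L_def by linarith+
    have nz: "2 powr (z * t) = real n powr (t / real k)" for t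
    proof -
      have "2 powr (z * t) = (2 powr log 2 (real n)) powr (t / real k)" by (simp add: powr_powr z_def)
      then show ?thesis using n by simp
    qed
    let ?R = "real n powr (- p / real k)"
    have "2 powr (- p * real L) \<le> 2 powr (p + z * (- p))"
    proof (intro powr_mono)
      have "p * (z - real L) \<le> p * 1" using L p by (intro mult_left_mono) auto
      then show "- p * real L \<le> p + z * (- p)" by (simp add: algebra_simps)
    qed auto
    also have "\<dots> = 2 powr p * ?R" unfolding powr_add nz by simp
    also have "\<dots> \<le> 4 * ?R" using powr_mono[OF p(2), of 2] by (intro mult_right_mono) auto
    finally have A: "2 powr (- p * real L) \<le> 4 * ?R" .
    let ?q = "2 powr ?a"
    have q: "1 < ?q" using 3 powr_less_mono[of 0 ?a 2] by auto
    have "(\<Sum>l\<le>L. 2 powr (real l * ?a)) = (?q ^ Suc L - 1) / (?q - 1)"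
      unfolding sum_powr_geometric using q 3 geometric_sum[of ?q "Suc L"] by (simp add: lessThan_Suc_atMost)
    also have "\<dots> \<le> ?q ^ Suc L / (?q - 1)" using q by (intro divide_right_mono) auto
    also have "\<dots> = ?q ^ L * ?g"
      using q 3 by (simp add: geo_const_def powr_minus_divide field_simps)
    also have "?q ^ L = 2 powr (real L * ?a)" by (simp add: powr_powr mult.commute flip: powr_realpow)
    also have "\<dots> \<le> 2 powr (z * ?a)" using L 3 by (intro powr_mono mult_right_mono) auto
    also have "\<dots> = sqrt (real n) * ?R"
    proof -
      have "2 powr (z * ?a) = real n powr (1 / 2 + - p / real k)"
        unfolding nz using k by (simp add: field_simps)
      then show ?thesis using n by (simp only: powr_add) (simp add: powr_half_sqrt)
    qed
    finally have "(\<Sum>l\<le>L. 2 powr (real l * ?a)) \<le> sqrt (real n) * ?R * ?g" using g0 by (simp add: mult_right_mono)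
    then have B: "(\<Sum>l\<le>L. 2 powr (real l * ?a)) / sqrt (real n) \<le> ?g * ?R"
      using n by (simp add: divide_le_eq mult_ac)
    have E: "rate 1 p k n powr p / sqrt (real k) powr p = ?R"
      using 3 p n sk by (simp add: rate_def powr_mult powr_divide powr_powr)
    moreover have "(4 + ?g) * ?R \<le> rate_const p * ?R"
      using gr by (intro mult_right_mono) auto
    moreover have "(4 + ?g) * ?R = 4 * ?R + ?g * ?R" by (rule distrib_right)
    ultimately show ?thesis unfolding E using A B by (intro exI[of _ L]) linarith
  qed
qed

lemma emp_const_ge_1: "1 \<le> k \<Longrightarrow> 1 \<le> emp_const k"
proof -
  assume k: "1 \<le> k"
  have "0 \<le> 2 * real k * ((4 * real k) ^ k + 12 * real k) + tail_const k" by (simp add: tail_const_def)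
  then show ?thesis using k by (simp add: emp_const_def)
qed

lemma rate_nonneg: "1 \<le> n \<Longrightarrow> 0 \<le> c \<Longrightarrow> 0 \<le> rate c p k n"
  by (simp add: rate_def)

lemma rate_mult: "rate c p k n = c * rate 1 p k n"
  by (simp add: rate_def)

text \<open>Constants that are at least 1 may be raised to the power p, so the whole bound becomes a
  p-th power and a p-th root can be taken later.\<close>

lemma expected_wasserstein_rate:
  assumes \<rho>: "prob_Rn k \<rho>" and k: "1 \<le> k" and p: "1 \<le> p" "p \<le> 2" and n: "2 \<le> n"
    and ex: "\<And>i. i < k \<Longrightarrow> (\<integral>\<^sup>+ x. ennreal (exp \<bar>x i\<bar>) \<partial>\<rho>) \<le> 4"
  shows "(\<integral>\<^sup>+ x. ennreal (wasserstein k p \<rho> (empirical k n x) powr p) \<partial>PiM {..<n} (\<lambda>_. \<rho>))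
    \<le> ennreal ((emp_const k * rate (rate_const p) p k n) powr p)"
proof -
  obtain L where L: "2 powr (- p * real L) + (\<Sum>l\<le>L. 2 powr (real l * (real k / 2 - p))) / sqrt (real n)
    \<le> rate_const p * (rate 1 p k n powr p / sqrt (real k) powr p)"
    using level_choice[OF p k n] by blast
  have e1: "1 \<le> emp_const k" using emp_const_ge_1[OF k] .
  have c1: "1 \<le> rate_const p"
    using geo_const_le[OF p(2), of 0] geo_const_nonneg[of p 0] by linarith
  have pw: "c \<le> c powr p" if "1 \<le> c" for c :: real using powr_mono[of 1 p c] that p by simp
  have r0: "0 \<le> rate 1 p k n" using n by (intro rate_nonneg) auto
  have s1: "1 \<le> sqrt (real k) powr p" using k p by (simp add: ge_one_powr_ge_zero)
  have "emp_const k * (2 powr (- p * real L) + (\<Sum>l\<le>L. 2 powr (real l * (real k / 2 - p))) / sqrt (real n))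
    \<le> emp_const k * (rate_const p * (rate 1 p k n powr p / sqrt (real k) powr p))"
    using L e1 by (intro mult_left_mono) auto
  also have "\<dots> \<le> emp_const k * (rate_const p * (rate 1 p k n powr p / 1))"
    using s1 e1 c1 k by (intro mult_left_mono divide_left_mono) auto
  also have "\<dots> \<le> emp_const k powr p * (rate_const p powr p * rate 1 p k n powr p)"
    using pw[OF e1] pw[OF c1] e1 c1 by (simp add: mult_mono mult_right_mono)
  also have "\<dots> = (emp_const k * rate (rate_const p) p k n) powr p"
    using e1 c1 r0 by (subst (2) rate_mult) (simp add: powr_mult)
  finally show ?thesis
    using expected_wasserstein_empirical[OF \<rho> k p _ ex, of n L] n by (auto intro: order_trans ennreal_leI)
qed

text \<open>A Lipschitz function of finitely many vectors is continuous, hence Borel. This yields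
  measurability of Wasserstein distances and of their supremum over an uncountable set of
  projections, without any countable reduction.\<close>

lemma lipschitz_sample_measurable:
  fixes N :: nat and X :: "nat \<Rightarrow> 'a \<Rightarrow> rvec"
  assumes X: "\<And>j. j < N \<Longrightarrow> X j \<in> M \<rightarrow>\<^sub>M borel_Rn d" and p: "1 \<le> p"
    and lip: "\<And>x y. (\<And>j. j < N \<Longrightarrow> x j \<in> Rn d) \<Longrightarrow> (\<And>j. j < N \<Longrightarrow> y j \<in> Rn d) \<Longrightarrow>
      \<bar>G x - G y\<bar> \<le> K * (\<Sum>j<N. norm_Rn d (x j - y j) powr p) powr (1 / p)"
  shows "(\<lambda>\<omega>. G (\<lambda>j. X j \<omega>)) \<in> borel_measurable M"
proof -
  define tr :: "(nat \<Rightarrow> rvec) \<Rightarrow> nat \<Rightarrow> rvec" where "tr x = (\<lambda>j i. if i < d then x j i else 0)" for x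
  have tr: "tr x j \<in> Rn d" for x j by (simp add: tr_def Rn_def)
  have ntr: "norm_Rn d (tr x j - tr y j) = norm_Rn d (x j - y j)" for x y j
    by (simp add: norm_Rn_def L2_set_def tr_def)
  define H where "H x y = K * (\<Sum>j<N. norm_Rn d (y j - x j) powr p) powr (1 / p)" for x y :: "nat \<Rightarrow> rvec"
  have Hc: "continuous_on UNIV (H x)" for x
  proof -
    have c: "continuous_on UNIV (\<lambda>y :: nat \<Rightarrow> rvec. y j i)" for j i
    proof -
      have 1: "continuous_on UNIV (\<lambda>z :: rvec. z i)" and 2: "continuous_on UNIV (\<lambda>y :: nat \<Rightarrow> rvec. y j)" by simp_all
      show ?thesis by (rule continuous_on_compose2[OF 1 2]) simp
    qed
    have "continuous_on UNIV (\<lambda>y. norm_Rn d (y j - x j))" for j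
      unfolding norm_Rn_def L2_set_def minus_apply by (intro continuous_intros c)
    then have "continuous_on UNIV (\<lambda>y. \<Sum>j<N. norm_Rn d (y j - x j) powr p)"
      using p by (intro continuous_on_sum continuous_on_powr' continuous_on_const) auto
    then show ?thesis
      unfolding H_def using p by (intro continuous_on_mult continuous_on_powr' continuous_on_const) (auto intro: sum_nonneg)
  qed
  have "continuous_on UNIV (\<lambda>x. G (tr x))"
    unfolding continuous_on_def
  proof
    fix x :: "nat \<Rightarrow> rvec"
    have "(H x \<longlongrightarrow> H x x) (at x)" using Hc[of x] by (simp add: continuous_on_def)
    moreover have "H x x = 0" by (simp add: H_def)
    ultimately have H0: "(H x \<longlongrightarrow> 0) (at x)" by simp
    have "((\<lambda>y. G (tr y) - G (tr x)) \<longlongrightarrow> 0) (at x)"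
    proof (rule Lim_null_comparison[OF always_eventually H0], rule allI)
      fix y show "norm (G (tr y) - G (tr x)) \<le> H x y"
        using lip[of "tr y" "tr x"] tr by (simp add: H_def ntr)
    qed
    then show "((\<lambda>x. G (tr x)) \<longlongrightarrow> G (tr x)) (at x)" by (simp add: LIM_zero_iff)
  qed
  then have m: "(\<lambda>x. G (tr x)) \<in> borel_measurable borel" by (rule borel_measurable_continuous_onI)
  define Y where "Y \<omega> = (\<lambda>j. if j < N then X j \<omega> else 0)" for \<omega>
  have "Y \<in> borel_measurable M"
  proof (rule measurable_coordinatewise_then_product)
    fix j
    show "(\<lambda>\<omega>. Y \<omega> j) \<in> borel_measurable M"
    proof (cases "j < N")
      case True
      have "(\<lambda>x. x) \<in> borel_Rn d \<rightarrow>\<^sub>M borel" unfolding borel_Rn_def by (rule measurable_restrict_space1) simp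
      from measurable_compose[OF X[OF True] this] show ?thesis using True by (simp add: Y_def)
    qed (simp add: Y_def)
  qed
  from measurable_compose[OF this m] have "(\<lambda>\<omega>. G (tr (Y \<omega>))) \<in> borel_measurable M" .
  moreover have "G (tr (Y \<omega>)) = G (\<lambda>j. X j \<omega>)" if "\<omega> \<in> space M" for \<omega>
  proof -
    have XR: "X j \<omega> \<in> Rn d" if "j < N" for j
      using measurable_space[OF X[OF that] \<open>\<omega> \<in> space M\<close>] by (simp add: space_borel_Rn)
    \<comment> \<open>The sample and its truncation are at distance 0, so the Lipschitz bound alone
      identifies the two values of G.\<close>
    have "norm_Rn d (tr (Y \<omega>) j - X j \<omega>) = 0" if "j < N" for j
      using that by (simp add: tr_def Y_def norm_Rn_def L2_set_def)
    then have "(\<Sum>j<N. norm_Rn d (tr (Y \<omega>) j - X j \<omega>) powr p) = 0" by simp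
    then show ?thesis using lip[of "tr (Y \<omega>)" "\<lambda>j. X j \<omega>"] tr XR by simp
  qed
  ultimately show ?thesis by (simp cong: measurable_cong)
qed

section \<open>Projections\<close>

lemma mat_vec_in_Rn: "mat_vec k d U x \<in> Rn k"
  by (simp add: mat_vec_def Rn_def)

lemma mat_vec_nth: "i < k \<Longrightarrow> mat_vec k d U x i = inner_Rn d (U i) x"
  by (simp add: mat_vec_def inner_Rn_def)

lemma mat_vec_diff: "mat_vec k d U (x - y) = mat_vec k d U x - mat_vec k d U y"
  by (auto simp: mat_vec_def fun_eq_iff right_diff_distrib sum_subtractf)

lemma mat_vec_add: "mat_vec k d U (x + y) = mat_vec k d U x + mat_vec k d U y"
  by (auto simp: mat_vec_def fun_eq_iff distrib_left sum.distrib)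

lemma stiefel_norm: "U \<in> stiefel k d \<Longrightarrow> i < k \<Longrightarrow> norm_Rn d (U i) = 1"
  using inner_Rn_self[of d "U i"] by (simp add: stiefel_def power2_eq_1_iff) (metis norm_Rn_nonneg not_one_le_zero neg_0_le_iff_le zero_neq_one order.antisym le_minus_one_simps(3))

lemma inner_Rn_sum: "inner_Rn d (\<lambda>j. \<Sum>i\<in>I. c i * u i j) x = (\<Sum>i\<in>I. c i * inner_Rn d (u i) x)"
  unfolding inner_Rn_def sum_distrib_left sum_distrib_right
  by (subst sum.swap) (simp add: mult_ac)

lemma inner_Rn_commute: "inner_Rn d x y = inner_Rn d y x"
  by (simp add: inner_Rn_def mult.commute)

lemma norm_Rn_orthonormal_sum:
  fixes k :: nat
  assumes "\<And>i l. i < k \<Longrightarrow> l < k \<Longrightarrow> inner_Rn d (u i) (u l) = (if i = l then 1 else 0)"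
  shows "(norm_Rn d (\<lambda>j. \<Sum>i<k. c i * u i j))\<^sup>2 = (\<Sum>i<k. (c i)\<^sup>2)"
proof -
  have "inner_Rn d (u i) (\<lambda>j. \<Sum>i<k. c i * u i j) = c i" if i: "i < k" for i
  proof -
    have "inner_Rn d (u i) (\<lambda>j. \<Sum>i<k. c i * u i j) = (\<Sum>l<k. c l * inner_Rn d (u l) (u i))"
      by (subst inner_Rn_commute) (rule inner_Rn_sum)
    also have "\<dots> = (\<Sum>l<k. c l * (if l = i then 1 else 0))" using assms i by (intro sum.cong) auto
    also have "\<dots> = (\<Sum>l\<in>{i}. c l)" by (rule sum.mono_neutral_cong_right) (use i in auto)
    finally show ?thesis by simp
  qed
  then show ?thesis
    unfolding inner_Rn_self[symmetric] inner_Rn_sum by (intro sum.cong refl) (simp add: power2_eq_square)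
qed

text \<open>Bessel's inequality: the combination y of the rows with coefficients U x satisfies |U
  x|^2 = |y|^2 = <y, x>, and Cauchy-Schwarz cancels one factor |y|.\<close>

lemma norm_mat_vec_le:
  assumes U: "U \<in> stiefel k d" shows "norm_Rn k (mat_vec k d U x) \<le> norm_Rn d x"
proof -
  define c where "c i = inner_Rn d (U i) x" for i
  define y where "y = (\<lambda>j. \<Sum>i<k. c i * U i j)"
  have yy: "(norm_Rn d y)\<^sup>2 = (\<Sum>i<k. (c i)\<^sup>2)"
    unfolding y_def using U by (intro norm_Rn_orthonormal_sum) (auto simp: stiefel_def)
  have yx: "inner_Rn d y x = (\<Sum>i<k. (c i)\<^sup>2)"
    unfolding y_def inner_Rn_sum by (simp add: c_def power2_eq_square)
  have "(norm_Rn k (mat_vec k d U x))\<^sup>2 = (\<Sum>i<k. (c i)\<^sup>2)"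
    unfolding norm_Rn_sq by (intro sum.cong refl) (simp add: mat_vec_nth c_def)
  then have "(norm_Rn k (mat_vec k d U x))\<^sup>2 = (norm_Rn d y)\<^sup>2" using yy by simp
  moreover have "(norm_Rn d y)\<^sup>2 \<le> norm_Rn d y * norm_Rn d x"
    using inner_Rn_Cauchy_Schwarz[of d y x] yx yy by simp
  ultimately have eq: "norm_Rn k (mat_vec k d U x) = norm_Rn d y" and le: "norm_Rn d y * norm_Rn d y \<le> norm_Rn d y * norm_Rn d x"
    by (auto simp: power2_eq_square intro: power2_eq_imp_eq)
  show ?thesis
  proof (cases "norm_Rn d y = 0")
    case False
    then have "0 < norm_Rn d y" using norm_Rn_nonneg[of d y] by linarith
    with le show ?thesis by (simp add: eq)
  qed (simp add: eq)
qed

lemma mat_vec_contraction: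
  assumes U: "U \<in> stiefel k d"
  shows "norm_Rn k (mat_vec k d U x - mat_vec k d U y) \<le> norm_Rn d (x - y)"
  using norm_mat_vec_le[OF U, of "x - y"] by (simp add: mat_vec_diff)

text \<open>Entrywise closeness \<epsilon> / sqrt d makes each row \<epsilon>-close in Euclidean
  norm, and the k rows together give the factor sqrt k.\<close>

lemma mat_vec_perturb:
  assumes "\<And>i j. i < k \<Longrightarrow> j < d \<Longrightarrow> \<bar>U i j - V i j\<bar> \<le> \<epsilon> / sqrt (real d)" "0 \<le> \<epsilon>" "0 < d"
  shows "norm_Rn k (mat_vec k d U x - mat_vec k d V x) \<le> \<epsilon> * sqrt (real k) * norm_Rn d x"
proof -
  have row: "\<bar>(mat_vec k d U x - mat_vec k d V x) i\<bar> \<le> \<epsilon> * norm_Rn d x" if i: "i < k" for i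
  proof -
    have "(mat_vec k d U x - mat_vec k d V x) i = inner_Rn d (U i - V i) x"
      using i by (simp add: mat_vec_nth) (simp add: inner_Rn_def left_diff_distrib sum_subtractf)
    also have "\<bar>\<dots>\<bar> \<le> norm_Rn d (U i - V i) * norm_Rn d x" by (rule inner_Rn_Cauchy_Schwarz)
    also have "norm_Rn d (U i - V i) \<le> \<epsilon>"
    proof -
      have "norm_Rn d (U i - V i) = L2_set (\<lambda>j. \<bar>U i j - V i j\<bar>) {..<d}" by (simp add: norm_Rn_def L2_set_def)
      also have "\<dots> \<le> L2_set (\<lambda>j. \<epsilon> / sqrt (real d)) {..<d}" using assms i by (intro L2_set_mono) auto
      also have "\<dots> = \<epsilon>" using assms by (simp add: L2_set_constant)
      finally show ?thesis .
    qed
    finally show ?thesis by (simp add: mult_right_mono)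
  qed
  have "norm_Rn k (mat_vec k d U x - mat_vec k d V x) = L2_set (\<lambda>i. \<bar>(mat_vec k d U x - mat_vec k d V x) i\<bar>) {..<k}"
    by (simp add: norm_Rn_def L2_set_def)
  also have "\<dots> \<le> L2_set (\<lambda>i. \<epsilon> * norm_Rn d x) {..<k}" using row by (intro L2_set_mono) auto
  also have "\<dots> = \<epsilon> * sqrt (real k) * norm_Rn d x" using assms by (simp add: L2_set_constant)
  finally show ?thesis .
qed

section \<open>Entropy of the Stiefel manifold\<close>

lemma card_lattice_ball:
  assumes "0 < \<delta>" "\<delta> \<le> 1"
  shows "finite {q. length q = N \<and> list_l1 q \<le> R}" "real (card {q. length q = N \<and> list_l1 q \<le> R}) \<le> exp (\<delta> * R) * (4 / \<delta>) ^ N"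
proof -
  let ?S = "{q. length q = N \<and> list_l1 q \<le> R}"
  have "emeasure (count_space {q. length q = N}) ?S = (\<integral>\<^sup>+ q. indicator ?S q \<partial>count_space {q. length q = N})"
    by (subst nn_integral_indicator) auto
  \<comment> \<open>A Chernoff bound for counting: on the ball, exp (\<delta> (R - |q|)) is at least
    1.\<close>
  also have "\<dots> \<le> (\<integral>\<^sup>+ q. ennreal (exp (\<delta> * R)) * ennreal (exp (- \<delta> * list_l1 q)) \<partial>count_space {q. length q = N})"
  proof (rule nn_integral_mono)
    fix q :: "int list"
    have "1 \<le> exp (\<delta> * R) * exp (- \<delta> * list_l1 q)" if "q \<in> ?S"
      using that assms by (simp flip: exp_add)
    then show "indicator ?S q \<le> ennreal (exp (\<delta> * R)) * ennreal (exp (- \<delta> * list_l1 q))"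
      by (auto simp: indicator_def simp flip: ennreal_mult ennreal_1 intro!: ennreal_leI)
  qed
  also have "\<dots> = ennreal (exp (\<delta> * R)) * (\<integral>\<^sup>+ q. ennreal (exp (- \<delta> * list_l1 q)) \<partial>count_space {q. length q = N})"
    by (rule nn_integral_cmult) auto
  also have "\<dots> \<le> ennreal (exp (\<delta> * R)) * ennreal ((4 / \<delta>) ^ N)"
    by (intro mult_left_mono nn_integral_exp_lattice_le assms) auto
  also have "\<dots> = ennreal (exp (\<delta> * R) * (4 / \<delta>) ^ N)" using assms by (simp flip: ennreal_mult)
  finally have le: "emeasure (count_space {q. length q = N}) ?S \<le> ennreal (exp (\<delta> * R) * (4 / \<delta>) ^ N)" .
  show fin: "finite ?S"
  proof (rule ccontr)
    assume "\<not> ?thesis"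
    then have "emeasure (count_space {q. length q = N}) ?S = \<infinity>" by (intro emeasure_count_space_infinite) auto
    with le show False by (simp add: top_unique)
  qed
  then have "emeasure (count_space {q. length q = N}) ?S = ennreal (real (card ?S))"
    by (subst emeasure_count_space_finite) (auto simp: ennreal_of_nat_eq_real_of_nat)
  with le show "real (card ?S) \<le> exp (\<delta> * R) * (4 / \<delta>) ^ N" using assms by (simp add: ennreal_le_iff)
qed

text \<open>Rounding to the grid of width \<open>\<epsilon> / \<surd>d\<close>.  Rows have Euclidean norm \<open>1\<close>, hence \<open>\<ell>\<^sup>1\<close>-norm at most
  \<open>\<surd>d\<close>, and counting lattice points in an \<open>\<ell>\<^sup>1\<close>-ball avoids a factor \<open>log d\<close> in the entropy.\<close>

lemma stiefel_net:
  assumes k: "1 \<le> k" "1 \<le> d" and \<epsilon>: "0 < \<epsilon>" "\<epsilon> \<le> 1"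
  shows "\<exists>S\<subseteq>stiefel k d. finite S \<and> real (card S) \<le> (36 / \<epsilon>) ^ (k * d) \<and>
    (\<forall>U\<in>stiefel k d. \<exists>V\<in>S. \<forall>i<k. \<forall>j<d. \<bar>U i j - V i j\<bar> \<le> \<epsilon> / sqrt (real d))"
proof -
  define h where "h = \<epsilon> / sqrt (real d)"
  have h: "0 < h" using \<epsilon> k by (simp add: h_def)
  define r where "r U = map (\<lambda>t. \<lfloor>U (t div d) (t mod d) / h\<rfloor>) [0..<k * d]" for U :: "nat \<Rightarrow> nat \<Rightarrow> real"
  let ?N = "k * d" let ?R = "real ?N * (1 / \<epsilon> + 1)"
  have rb: "list_l1 (r U) \<le> ?R" if U: "U \<in> stiefel k d" for U
  proof -
    have "list_l1 (r U) = (\<Sum>t<k * d. \<bar>real_of_int \<lfloor>U (t div d) (t mod d) / h\<rfloor>\<bar>)"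
      by (simp add: list_l1_def r_def comp_def interv_sum_list_conv_sum_set_nat atLeast0LessThan)
    also have "\<dots> \<le> (\<Sum>t<k * d. \<bar>U (t div d) (t mod d)\<bar> / h + 1)"
    proof (rule sum_mono)
      fix t
      have "\<bar>real_of_int \<lfloor>z\<rfloor>\<bar> \<le> \<bar>z\<bar> + 1" for z :: real by linarith
      from this[of "U (t div d) (t mod d) / h"] show "\<bar>real_of_int \<lfloor>U (t div d) (t mod d) / h\<rfloor>\<bar> \<le> \<bar>U (t div d) (t mod d)\<bar> / h + 1"
        using h by (simp add: abs_divide)
    qed
    also have "\<dots> = (\<Sum>t<k * d. \<bar>U (t div d) (t mod d)\<bar>) / h + real ?N"
      by (simp add: sum.distrib sum_divide_distrib)
    also have "(\<Sum>t<k * d. \<bar>U (t div d) (t mod d)\<bar>) = (\<Sum>i<k. \<Sum>j<d. \<bar>U i j\<bar>)"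
    proof -
      have "(\<Sum>i<k. \<Sum>j<d. \<bar>U i j\<bar>) = (\<Sum>i<k. \<Sum>j<d. \<bar>U ((j + i * d) div d) ((j + i * d) mod d)\<bar>)"
        by (intro sum.cong refl) auto
      also have "\<dots> = (\<Sum>t<k * d. \<bar>U (t div d) (t mod d)\<bar>)"
      proof -
        have sh: "(\<Sum>j<d. f (j + i * d)) = sum f {i * d..<i * d + d}" for i and f :: "nat \<Rightarrow> real"
          using sum.shift_bounds_nat_ivl[of f 0 "i * d" d] by (simp add: atLeast0LessThan add.commute)
        show ?thesis
          by (simp only: sh[where f="\<lambda>t. \<bar>U (t div d) (t mod d)\<bar>"] sum.nat_group)
      qed
      finally show ?thesis by simp
    qed
    also have "\<dots> \<le> (\<Sum>i<k. sqrt (real d))"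
    proof (rule sum_mono)
      fix i assume "i \<in> {..<k}"
      then have n1: "norm_Rn d (U i) = 1" using stiefel_norm[OF U] by simp
      have "(\<Sum>j<d. \<bar>U i j\<bar>) = (\<Sum>j<d. \<bar>1\<bar> * \<bar>U i j\<bar>)" by simp
      also have "\<dots> \<le> L2_set (\<lambda>_. 1) {..<d} * L2_set (U i) {..<d}" by (rule L2_set_mult_ineq)
      also have "\<dots> = sqrt (real d)" using n1 by (simp add: L2_set_constant norm_Rn_def)
      finally show "(\<Sum>j<d. \<bar>U i j\<bar>) \<le> sqrt (real d)" .
    qed
    also have "(\<Sum>i<k. sqrt (real d)) = real k * sqrt (real d)" by simp
    finally have "list_l1 (r U) \<le> real k * sqrt (real d) / h + real ?N" using h by (simp add: divide_right_mono)
    also have "real k * sqrt (real d) / h = real ?N / \<epsilon>" using k \<epsilon> by (simp add: h_def)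
    finally show ?thesis by (simp add: distrib_left)
  qed
  let ?T = "{q. length q = ?N \<and> list_l1 q \<le> ?R}"
  have sub: "r ` stiefel k d \<subseteq> ?T" using rb by (auto simp: r_def)
  have finT: "finite ?T" and cardT: "real (card ?T) \<le> exp (\<epsilon> * ?R) * (4 / \<epsilon>) ^ ?N"
    using card_lattice_ball[of \<epsilon> ?N ?R] \<epsilon> by auto
  \<comment> \<open>With \<delta> = \<epsilon> the exponent \<epsilon> R is at most 2 k d, so the
    exponential costs e^2 \<le> 9 per entry and 9 * 4 gives the 36.\<close>
  have "exp (\<epsilon> * ?R) \<le> exp (real ?N * 2)" using \<epsilon> mult_right_mono[of \<epsilon> 1 "real k * real d"]
    by (simp add: distrib_left mult_ac)
  also have "\<dots> = (exp 2) ^ ?N" by (rule exp_of_nat_mult)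
  also have "\<dots> \<le> 9 ^ ?N"
  proof (rule power_mono)
    have "exp 2 = (exp 1 :: real)\<^sup>2" by (simp flip: exp_double)
    also have "\<dots> \<le> 3\<^sup>2" using exp_le by (intro power_mono) auto
    finally show "exp 2 \<le> (9 :: real)" by simp
  qed simp
  finally have "exp (\<epsilon> * ?R) * (4 / \<epsilon>) ^ ?N \<le> 9 ^ ?N * (4 / \<epsilon>) ^ ?N" using \<epsilon> by (intro mult_right_mono) auto
  also have "\<dots> = (36 / \<epsilon>) ^ ?N" by (simp flip: power_mult_distrib)
  finally have cT: "real (card ?T) \<le> (36 / \<epsilon>) ^ ?N" using cardT by linarith
  \<comment> \<open>One matrix is picked from the manifold for every occupied grid cell. The net
    thus consists of genuine projections, to which the bounds for a fixed U apply.\<close>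
  define S where "S = inv_into (stiefel k d) r ` (r ` stiefel k d)"
  have finr: "finite (r ` stiefel k d)" using sub finT by (rule finite_subset)
  have "card S \<le> card (r ` stiefel k d)" unfolding S_def by (rule card_image_le[OF finr])
  also have "\<dots> \<le> card ?T" by (rule card_mono[OF finT sub])
  finally have cS: "real (card S) \<le> (36 / \<epsilon>) ^ ?N" using cT by linarith
  have "S \<subseteq> stiefel k d" unfolding S_def by (auto intro: inv_into_into)
  moreover have "\<exists>V\<in>S. \<forall>i<k. \<forall>j<d. \<bar>U i j - V i j\<bar> \<le> h" if U: "U \<in> stiefel k d" for U
  proof -
    define V where "V = inv_into (stiefel k d) r (r U)"
    have rV: "r V = r U" unfolding V_def using U by (intro f_inv_into_f[of "r U" r "stiefel k d"] imageI)
    have "\<bar>U i j - V i j\<bar> \<le> h" if ij: "i < k" "j < d" for i j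
    proof -
      let ?t = "i * d + j"
      have "Suc i * d \<le> k * d" using ij by (intro mult_le_mono1) auto
      then have t: "?t < k * d" using ij by simp
      have "r V ! ?t = r U ! ?t" using rV by simp
      then have "\<lfloor>V i j / h\<rfloor> = \<lfloor>U i j / h\<rfloor>" using t ij by (simp add: r_def)
      then have "\<bar>U i j / h - V i j / h\<bar> \<le> 1" by linarith
      then have "\<bar>U i j - V i j\<bar> / h \<le> 1" using h by (simp add: abs_divide flip: diff_divide_distrib)
      then show ?thesis using h by (simp add: divide_le_eq)
    qed
    then show ?thesis using U by (auto simp: S_def V_def)
  qed
  ultimately show ?thesis using cS finr unfolding h_def S_def by blast
qed

text \<open>Jensen's inequality through the tangent of x^p at Y: it bounds X by a constant plus a
  multiple of X^p, which yields integrability along with the estimate.\<close>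

lemma integral_le_of_powr:
  assumes "prob_space M" and [measurable]: "X \<in> borel_measurable M" and X: "\<And>x. 0 \<le> X x" and p: "1 \<le> (p::real)" and Y: "0 < Y"
    and le: "(\<integral>\<^sup>+ x. ennreal (X x powr p) \<partial>M) \<le> ennreal (Y powr p)"
  shows "integrable M X" "(\<integral>x. X x \<partial>M) \<le> Y"
proof -
  interpret prob_space M by fact
  have pt: "X x \<le> Y * (1 - 1 / p) + Y / p / Y powr p * X x powr p" for x
  proof -
    have "p * (X x / Y) \<le> (X x / Y) powr p + p - 1" using X Y p by (intro Bernoulli_powr) auto
    then have "Y / p * (p * (X x / Y)) \<le> Y / p * ((X x / Y) powr p + p - 1)" using Y p by (intro mult_left_mono) auto
    moreover have "Y / p * (p * (X x / Y)) = X x" using Y p by simp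
    moreover have "Y / p * ((X x / Y) powr p + p - 1) = Y * (1 - 1 / p) + Y / p / Y powr p * X x powr p"
      using Y p X by (simp add: powr_divide field_simps)
    ultimately show ?thesis by simp
  qed
  have ip: "integrable M (\<lambda>x. X x powr p)"
    using order.strict_trans1[OF le ennreal_less_top] by (intro integrableI_bounded) auto
  have "(\<integral>x. X x powr p \<partial>M) = enn2real (\<integral>\<^sup>+ x. ennreal (X x powr p) \<partial>M)"
    by (rule integral_eq_nn_integral) auto
  also have "\<dots> \<le> Y powr p" using le by (intro enn2real_leI) auto
  finally have Ip: "(\<integral>x. X x powr p \<partial>M) \<le> Y powr p" .
  have ib: "integrable M (\<lambda>x. Y * (1 - 1 / p) + Y / p / Y powr p * X x powr p)" using ip by auto
  show i: "integrable M X"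
    by (rule Bochner_Integration.integrable_bound[OF ib]) (use pt X in \<open>auto intro: order_trans[OF _ abs_ge_self]\<close>)
  have "(\<integral>x. X x \<partial>M) \<le> (\<integral>x. Y * (1 - 1 / p) + Y / p / Y powr p * X x powr p \<partial>M)"
    by (intro integral_mono i ib pt)
  also have "\<dots> = Y * (1 - 1 / p) + Y / p / Y powr p * (\<integral>x. X x powr p \<partial>M)"
    using ip by (simp add: prob_space)
  also have "\<dots> \<le> Y * (1 - 1 / p) + Y / p / Y powr p * Y powr p"
    using Y p by (intro add_left_mono mult_left_mono Ip) auto
  also have "\<dots> = Y" using Y p by (simp add: field_simps)
  finally show "(\<integral>x. X x \<partial>M) \<le> Y" .
qed

lemma empirical_distr:
  assumes x: "\<forall>j<n. x j \<in> Rn d" and f: "f \<in> borel_Rn d \<rightarrow>\<^sub>M borel_Rn k"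
  shows "distr (empirical d n x) (borel_Rn k) f = empirical k n (\<lambda>j. f (x j))"
  unfolding empirical_def using f x measurable_empirical_points[of n x d]
  by (subst distr_distr) (auto simp: comp_def)

lemma measurable_affine_proj:
  "(\<lambda>y. c *\<^sub>R mat_vec k d U (y - m)) \<in> borel_Rn d \<rightarrow>\<^sub>M borel_Rn k" if "m \<in> Rn d"
  using that by (intro measurable_Rn_scaleR measurable_compose[OF _ measurable_mat_vec] measurable_Rn_diff)
    (auto simp: space_borel_Rn)

section \<open>Projected distances for a sample from one measure\<close>

locale transport_sample =
  fixes d k n :: nat and p \<sigma> :: real and \<mu> :: "rvec measure"
  assumes T: "transport_inequality d p (\<sigma>\<^sup>2) \<mu>" and p: "1 \<le> p" "p \<le> 2" and \<sigma>: "0 < \<sigma>"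
    and k: "1 \<le> k" and d: "1 \<le> d" and n: "2 \<le> n"
begin

abbreviation "P \<equiv> PiM {..<n} (\<lambda>_. \<mu>)"
abbreviation "m \<equiv> mean_Rn d \<mu>"

lemma prob: "prob_Rn d \<mu>" and mom: "finite_moment d p \<mu>"
  using T by (auto simp: transport_inequality_def)

sublocale \<mu>: prob_space \<mu>
  using prob by (rule prob_RnD)

sublocale P: prob_space P
  by (rule prob_space_PiM) unfold_locales

lemma sets_\<mu>: "sets \<mu> = sets (borel_Rn d)" and space_\<mu>: "space \<mu> = Rn d"
  using prob by (auto simp: prob_RnD)

lemma n0: "0 < n" using n by simp

lemma space_P: "x \<in> space P \<Longrightarrow> j < n \<Longrightarrow> x j \<in> Rn d"
  by (auto simp: space_PiM PiE_def Pi_def space_\<mu>)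

lemma measurable_component: "j < n \<Longrightarrow> (\<lambda>x. x j) \<in> P \<rightarrow>\<^sub>M borel_Rn d"
  using measurable_component_singleton[of j "{..<n}" "\<lambda>_. \<mu>"]
  by (simp add: measurable_cong_sets[OF refl sets_\<mu>])

definition F :: "(nat \<Rightarrow> nat \<Rightarrow> real) \<Rightarrow> (nat \<Rightarrow> rvec) \<Rightarrow> real"
  where "F U x = wasserstein k p (proj_measure k d U \<mu>) (proj_measure k d U (empirical d n x))"

lemma F_nonneg [simp]: "0 \<le> F U x"
  by (simp add: F_def)

lemma m_in: "m \<in> Rn d" by (rule mean_Rn_in)

lemma prob_finite_distr:
  assumes f: "f \<in> borel_Rn d \<rightarrow>\<^sub>M borel_Rn k" and L: "0 \<le> L"
    and fb: "\<And>y. y \<in> Rn d \<Longrightarrow> norm_Rn k (f y) \<le> L * norm_Rn d (y - c)" and c: "c \<in> Rn d"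
    and \<nu>: "prob_Rn d \<nu>" "finite_moment d p \<nu>"
  shows "prob_Rn k (distr \<nu> (borel_Rn k) f)" "finite_moment k p (distr \<nu> (borel_Rn k) f)"
proof -
  interpret \<nu>: prob_space \<nu> using \<nu>(1) by (rule prob_RnD)
  have id: "(\<lambda>y. y) \<in> \<nu> \<rightarrow>\<^sub>M borel_Rn d" by (rule measurable_id_Rn[OF prob_RnD(2)[OF \<nu>(1)]])
  have f': "f \<in> \<nu> \<rightarrow>\<^sub>M borel_Rn k" using f prob_RnD(2)[OF \<nu>(1)] by (simp cong: measurable_cong_sets)
  show "prob_Rn k (distr \<nu> (borel_Rn k) f)" by (rule prob_Rn_distr[OF \<nu>.prob_space_axioms f'])
  have "(\<integral>\<^sup>+ y. ennreal (norm_Rn k (f y) powr p) \<partial>\<nu>) \<le> (\<integral>\<^sup>+ y. ennreal ((L * norm_Rn d y + L * norm_Rn d c) powr p) \<partial>\<nu>)"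
  proof (rule nn_integral_mono)
    fix y assume "y \<in> space \<nu>"
    then have "norm_Rn k (f y) \<le> L * norm_Rn d (y - c)" using fb prob_RnD(3)[OF \<nu>(1)] by auto
    also have "\<dots> \<le> L * (norm_Rn d y + norm_Rn d c)" using L by (intro mult_left_mono norm_Rn_diff_le)
    finally have "norm_Rn k (f y) \<le> L * norm_Rn d y + L * norm_Rn d c" by (simp add: distrib_left)
    then show "ennreal (norm_Rn k (f y) powr p) \<le> ennreal ((L * norm_Rn d y + L * norm_Rn d c) powr p)"
      using p by (intro ennreal_leI powr_mono2) auto
  qed
  also have "\<dots> < \<infinity>"
  proof (rule nn_integral_powr_add_finite)
    show "(\<lambda>y. L * norm_Rn d y) \<in> borel_measurable \<nu>" "(\<lambda>_. L * norm_Rn d c) \<in> borel_measurable \<nu>"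
      using measurable_norm_Rn[OF id] by auto
    have "(\<integral>\<^sup>+ y. ennreal ((L * norm_Rn d y) powr p) \<partial>\<nu>) = (\<integral>\<^sup>+ y. ennreal (L powr p) * ennreal (norm_Rn d y powr p) \<partial>\<nu>)"
      using L by (intro nn_integral_cong) (simp add: powr_mult ennreal_mult)
    also have "\<dots> = ennreal (L powr p) * (\<integral>\<^sup>+ y. ennreal (norm_Rn d y powr p) \<partial>\<nu>)"
      using measurable_norm_Rn[OF id] by (intro nn_integral_cmult) simp
    also have "\<dots> < \<infinity>" using \<nu>(2) by (simp add: finite_moment_def ennreal_mult_less_top)
    finally show "(\<integral>\<^sup>+ y. ennreal ((L * norm_Rn d y) powr p) \<partial>\<nu>) < \<infinity>" .
    show "(\<integral>\<^sup>+ y. ennreal ((L * norm_Rn d c) powr p) \<partial>\<nu>) < \<infinity>" by (simp add: \<nu>.emeasure_space_1)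
  qed (use L p in auto)
  finally show "finite_moment k p (distr \<nu> (borel_Rn k) f)" by (simp add: finite_moment_distr[OF f'])
qed

lemma proj_ok:
  assumes U: "U \<in> stiefel k d" and \<nu>: "prob_Rn d \<nu>" "finite_moment d p \<nu>"
  shows "prob_Rn k (proj_measure k d U \<nu>)" "finite_moment k p (proj_measure k d U \<nu>)"
  unfolding proj_measure_def
  using prob_finite_distr[OF measurable_mat_vec _ _ Rn_zero \<nu>, of 1 U] norm_mat_vec_le[OF U] by auto

lemma emp_ok:
  assumes x: "\<forall>j<n. x j \<in> Rn d"
  shows "prob_Rn d (empirical d n x)" "finite_moment d p (empirical d n x)"
  using x n0 by (auto intro: prob_Rn_empirical finite_moment_empirical)

lemma proj_empirical:
  assumes x: "\<forall>j<n. x j \<in> Rn d"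
  shows "proj_measure k d U (empirical d n x) = empirical k n (\<lambda>j. mat_vec k d U (x j))"
  unfolding proj_measure_def by (rule empirical_distr[OF x measurable_mat_vec])

text \<open>The triangle inequality through the sample y, then matching by index. Projections
  contract, so the bound is the same for all U.\<close>

lemma F_lipschitz:
  assumes U: "U \<in> stiefel k d" and x: "\<forall>j<n. x j \<in> Rn d" and y: "\<forall>j<n. y j \<in> Rn d"
  shows "F U x - F U y \<le> ((\<Sum>j<n. norm_Rn d (x j - y j) powr p) / real n) powr (1 / p)"
proof -
  let ?e = "\<lambda>x. empirical k n (\<lambda>j. mat_vec k d U (x j))"
  have "F U x \<le> F U y + wasserstein k p (?e y) (?e x)"
    unfolding F_def proj_empirical[OF x] proj_empirical[OF y]
    using p n0 proj_ok[OF U prob mom]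
    by (intro wasserstein_triangle[where n=n and x="\<lambda>j. mat_vec k d U (x j)"] prob_Rn_empirical finite_moment_empirical mat_vec_in_Rn) auto
  also have "wasserstein k p (?e y) (?e x) \<le> ((\<Sum>j<n. norm_Rn k (mat_vec k d U (y j) - mat_vec k d U (x j)) powr p) / real n) powr (1 / p)"
    using p n0 by (intro wasserstein_empirical_le mat_vec_in_Rn) auto
  also have "\<dots> \<le> ((\<Sum>j<n. norm_Rn d (x j - y j) powr p) / real n) powr (1 / p)"
    using p mat_vec_contraction[OF U, of "y _" "x _"]
    by (intro powr_mono2 divide_right_mono sum_mono) (auto simp: norm_Rn_minus_commute[of d] intro!: sum_nonneg divide_nonneg_nonneg)
  finally show ?thesis by simp
qed

lemma F_measurable: assumes U: "U \<in> stiefel k d" shows "F U \<in> borel_measurable P"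
proof -
  have "(\<lambda>\<omega>. F U (\<lambda>j. \<omega> j)) \<in> borel_measurable P"
  proof (rule lipschitz_sample_measurable[where G="F U" and X="\<lambda>j \<omega>. \<omega> j" and d=d and p=p and N=n and K="(1 / real n) powr (1 / p)"])
    fix x y :: "nat \<Rightarrow> rvec" assume "\<And>j. j < n \<Longrightarrow> x j \<in> Rn d" "\<And>j. j < n \<Longrightarrow> y j \<in> Rn d"
    then have x: "\<forall>j<n. x j \<in> Rn d" and y: "\<forall>j<n. y j \<in> Rn d" by auto
    have s: "(\<Sum>j<n. norm_Rn d (y j - x j) powr p) = (\<Sum>j<n. norm_Rn d (x j - y j) powr p)"
      by (simp add: norm_Rn_minus_commute)
    have "((\<Sum>j<n. norm_Rn d (x j - y j) powr p) / real n) powr (1 / p)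
        = (1 / real n) powr (1 / p) * (\<Sum>j<n. norm_Rn d (x j - y j) powr p) powr (1 / p)"
      by (simp add: powr_divide sum_nonneg)
    then show "\<bar>F U x - F U y\<bar> \<le> (1 / real n) powr (1 / p) * (\<Sum>j<n. norm_Rn d (x j - y j) powr p) powr (1 / p)"
      using F_lipschitz[OF U x y] F_lipschitz[OF U y x] unfolding s by (simp add: abs_le_iff)
  qed (use p measurable_component in auto)
  then show ?thesis by simp
qed

lemma wasserstein_translate_le:
  assumes "prob_Rn k \<alpha>" "prob_Rn k \<beta>" "finite_moment k p \<alpha>" "finite_moment k p \<beta>" "c \<in> Rn k"
  shows "wasserstein k p (distr \<alpha> (borel_Rn k) (\<lambda>z. L *\<^sub>R z + c)) (distr \<beta> (borel_Rn k) (\<lambda>z. L *\<^sub>R z + c)) \<le> \<bar>L\<bar> * wasserstein k p \<alpha> \<beta>"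
proof (rule wasserstein_distr_lipschitz)
  show "(\<lambda>z. L *\<^sub>R z + c) \<in> borel_Rn k \<rightarrow>\<^sub>M borel_Rn k"
    using assms by (intro measurable_Rn_add measurable_Rn_scaleR) (auto simp: space_borel_Rn)
  fix x y
  have "norm_Rn k (L *\<^sub>R x + c - (L *\<^sub>R y + c)) = \<bar>L\<bar> * norm_Rn k (x - y)"
    by (simp add: norm_Rn_def L2_set_def scaleR_fun_def real_sqrt_mult power_mult_distrib sum_distrib_left[symmetric] flip: right_diff_distrib)
  then show "norm_Rn k (L *\<^sub>R x + c - (L *\<^sub>R y + c)) \<le> \<bar>L\<bar> * norm_Rn k (x - y)" by simp
  show "wcost k p \<alpha> \<beta> < \<infinity>" using assms p by (intro wcost_finite)
qed (use assms p in auto)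

text \<open>\<open>F U\<close> does not change under translations, so the projections may be centred at the mean \<open>m\<close>; the
  size of \<open>m\<close> then does not enter the moment bounds.\<close>

definition cproj :: "real \<Rightarrow> (nat \<Rightarrow> nat \<Rightarrow> real) \<Rightarrow> rvec \<Rightarrow> rvec"
  where "cproj c U y = c *\<^sub>R mat_vec k d U (y - m)"

lemma measurable_cproj: "cproj c U \<in> borel_Rn d \<rightarrow>\<^sub>M borel_Rn k"
  unfolding cproj_def using m_in by (rule measurable_affine_proj)

lemma cproj_in: "cproj c U y \<in> Rn k"
  unfolding cproj_def by (intro Rn_scaleR mat_vec_in_Rn)

lemma norm_cproj_le: assumes U: "U \<in> stiefel k d" shows "norm_Rn k (cproj c U y) \<le> \<bar>c\<bar> * norm_Rn d (y - m)"
proof -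
  have "norm_Rn k (cproj c U y) = \<bar>c\<bar> * norm_Rn k (mat_vec k d U (y - m))"
    by (simp add: cproj_def norm_Rn_def L2_set_def scaleR_fun_def real_sqrt_mult power_mult_distrib sum_distrib_left[symmetric])
  then show ?thesis using norm_mat_vec_le[OF U, of "y - m"] by (simp add: mult_left_mono)
qed

lemma cproj_ok:
  assumes U: "U \<in> stiefel k d" and \<nu>: "prob_Rn d \<nu>" "finite_moment d p \<nu>"
  shows "prob_Rn k (distr \<nu> (borel_Rn k) (cproj c U))" "finite_moment k p (distr \<nu> (borel_Rn k) (cproj c U))"
  using prob_finite_distr[OF measurable_cproj _ _ m_in \<nu>, of "\<bar>c\<bar>"] norm_cproj_le[OF U] by auto

lemma distr_cproj_affine:
  assumes c: "c \<noteq> 0" and s: "sets \<nu> = sets (borel_Rn d)"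
  shows "distr (distr \<nu> (borel_Rn k) (cproj c U)) (borel_Rn k) (\<lambda>z. (1 / c) *\<^sub>R z + mat_vec k d U m) = proj_measure k d U \<nu>"
    "distr (proj_measure k d U \<nu>) (borel_Rn k) (\<lambda>z. c *\<^sub>R z + (- c) *\<^sub>R mat_vec k d U m) = distr \<nu> (borel_Rn k) (cproj c U)"
proof -
  have m1: "cproj c U \<in> \<nu> \<rightarrow>\<^sub>M borel_Rn k" "mat_vec k d U \<in> \<nu> \<rightarrow>\<^sub>M borel_Rn k"
    using measurable_cproj measurable_mat_vec s by (auto cong: measurable_cong_sets)
  have m2: "(\<lambda>z. L *\<^sub>R z + b) \<in> borel_Rn k \<rightarrow>\<^sub>M borel_Rn k" if "b \<in> Rn k" for L b
    using that by (intro measurable_Rn_add measurable_Rn_scaleR) (auto simp: space_borel_Rn)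
  have e1: "(1 / c) *\<^sub>R cproj c U y + mat_vec k d U m = mat_vec k d U y" for y
    using c by (simp add: cproj_def mat_vec_diff)
  have e2: "c *\<^sub>R mat_vec k d U y + (- c) *\<^sub>R mat_vec k d U m = cproj c U y" for y
    by (simp add: cproj_def mat_vec_diff scaleR_right_diff_distrib)
  show "distr (distr \<nu> (borel_Rn k) (cproj c U)) (borel_Rn k) (\<lambda>z. (1 / c) *\<^sub>R z + mat_vec k d U m) = proj_measure k d U \<nu>"
    unfolding proj_measure_def
    by (subst distr_distr[OF m2[OF mat_vec_in_Rn] m1(1)]) (simp add: comp_def e1)
  show "distr (proj_measure k d U \<nu>) (borel_Rn k) (\<lambda>z. c *\<^sub>R z + (- c) *\<^sub>R mat_vec k d U m) = distr \<nu> (borel_Rn k) (cproj c U)"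
    unfolding proj_measure_def
    by (subst distr_distr[OF m2 m1(2)]) (simp_all add: comp_def e2 Rn_scaleR mat_vec_in_Rn del: scaleR_minus_left)
qed

text \<open>The centred and scaled projection differs from the plain one by an invertible affine map
  of \<open>Rn k\<close>; its Lipschitz bound and that of its inverse give the two
  estimates.\<close>

lemma F_le_scaled:
  assumes U: "U \<in> stiefel k d" and x: "\<forall>j<n. x j \<in> Rn d" and c: "0 < c"
  shows "F U x \<le> 1 / c * wasserstein k p (distr \<mu> (borel_Rn k) (cproj c U)) (empirical k n (\<lambda>j. cproj c U (x j)))"
    "wasserstein k p (distr \<mu> (borel_Rn k) (cproj c U)) (empirical k n (\<lambda>j. cproj c U (x j))) \<le> c * F U x"
proof -
  let ?\<nu> = "empirical d n x"
  note S = sets_\<mu> prob_RnD(2)[OF emp_ok(1)[OF x]]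
  have e: "empirical k n (\<lambda>j. cproj c U (x j)) = distr ?\<nu> (borel_Rn k) (cproj c U)"
    by (rule empirical_distr[OF x measurable_cproj, symmetric])
  show "F U x \<le> 1 / c * wasserstein k p (distr \<mu> (borel_Rn k) (cproj c U)) (empirical k n (\<lambda>j. cproj c U (x j)))"
    using wasserstein_translate_le[OF cproj_ok(1)[OF U prob mom, of c] cproj_ok(1)[OF U emp_ok[OF x], of c]
      cproj_ok(2)[OF U prob mom] cproj_ok(2)[OF U emp_ok[OF x]] mat_vec_in_Rn[of k d U m], where L="1 / c"] c
    unfolding F_def e by (simp add: distr_cproj_affine S)
  show "wasserstein k p (distr \<mu> (borel_Rn k) (cproj c U)) (empirical k n (\<lambda>j. cproj c U (x j))) \<le> c * F U x"
    using wasserstein_translate_le[OF proj_ok(1)[OF U prob mom] proj_ok(1)[OF U emp_ok[OF x]]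
      proj_ok(2)[OF U prob mom] proj_ok(2)[OF U emp_ok[OF x]], where c="(- c) *\<^sub>R mat_vec k d U m" and L=c] c
    unfolding F_def e by (simp add: distr_cproj_affine S Rn_scaleR mat_vec_in_Rn del: scaleR_minus_left)
qed

end

lemma empirical_cong: "(\<And>j. j < n \<Longrightarrow> x j = y j) \<Longrightarrow> empirical k n x = empirical k n y"
  unfolding empirical_def by (rule distr_cong) (auto simp: space_uniform_count_measure)

context transport_sample
begin

definition R where "R = \<sigma> * (emp_const k * rate (rate_const p) p k n)"

lemma R_pos: "0 < R"
proof -
  have "0 < rate (rate_const p) p k n"
    using rate_const_pos[of p] k n by (auto simp: rate_def intro!: mult_pos_pos)
  then show ?thesis using \<sigma> emp_const_pos[OF k] by (simp add: R_def)
qed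

text \<open>Centring and dividing by \<sigma> brings every projection into the normalised situation
  where each coordinate satisfies the absolute exponential bound 4; the factor \<sigma> returns by
  homogeneity.\<close>

lemma expected_F:
  assumes U: "U \<in> stiefel k d" shows "integrable P (F U)" "P.expectation (F U) \<le> R"
proof -
  define f where "f = cproj (1 / \<sigma>) U"
  define \<rho> where "\<rho> = distr \<mu> (borel_Rn k) f"
  have fm: "f \<in> \<mu> \<rightarrow>\<^sub>M borel_Rn k"
    using measurable_cproj by (simp add: f_def measurable_cong_sets[OF sets_\<mu> refl])
  have \<rho>: "prob_Rn k \<rho>" "finite_moment k p \<rho>" unfolding \<rho>_def f_def using cproj_ok[OF U prob mom] by auto
  interpret \<rho>: prob_space \<rho> using \<rho>(1) by (rule prob_RnD)
  have fm\<rho>: "f \<in> \<mu> \<rightarrow>\<^sub>M \<rho>" using fm by (simp add: measurable_cong_sets[OF refl prob_RnD(2)[OF \<rho>(1)]])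
  have d\<rho>: "distr \<mu> \<rho> f = \<rho>"
    unfolding \<rho>_def by (rule distr_cong) auto
  have ex: "(\<integral>\<^sup>+ z. ennreal (exp \<bar>z i\<bar>) \<partial>\<rho>) \<le> 4" if i: "i < k" for i
  proof -
    have "(\<lambda>z. z i) \<in> borel_measurable (borel_Rn k)" by (rule measurable_Rn_coord[of _ _ k]) simp
    then have "(\<integral>\<^sup>+ z. ennreal (exp \<bar>z i\<bar>) \<partial>\<rho>) = (\<integral>\<^sup>+ y. ennreal (exp \<bar>f y i\<bar>) \<partial>\<mu>)"
      unfolding \<rho>_def by (intro nn_integral_distr fm) simp
    also have "\<dots> = (\<integral>\<^sup>+ y. ennreal (exp (\<bar>inner_Rn d (U i) (y - m)\<bar> / \<sigma>)) \<partial>\<mu>)"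
      using i \<sigma> by (intro nn_integral_cong) (simp add: f_def cproj_def scaleR_fun_def mat_vec_nth abs_mult)
    also have "\<dots> \<le> 4"
      using stiefel_norm[OF U i] by (intro transport_inequality_exp_moment[OF T p \<sigma>]) simp
    finally show ?thesis .
  qed
  let ?W = "\<lambda>x. wasserstein k p \<rho> (empirical k n x)"
  have Wm: "?W \<in> borel_measurable (PiM {..<n} (\<lambda>_. \<rho>))"
  proof -
    have W1: "?W x - ?W y \<le> (1 / real n) powr (1 / p) * (\<Sum>j<n. norm_Rn k (x j - y j) powr p) powr (1 / p)"
      if x: "\<And>j. j < n \<Longrightarrow> x j \<in> Rn k" and y: "\<And>j. j < n \<Longrightarrow> y j \<in> Rn k" for x y
    proof -
      have "?W x \<le> ?W y + wasserstein k p (empirical k n y) (empirical k n x)"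
        using p n0 \<rho> x y
        by (intro wasserstein_triangle[where n=n and x=x] prob_Rn_empirical finite_moment_empirical) auto
      also have "wasserstein k p (empirical k n y) (empirical k n x) \<le> ((\<Sum>j<n. norm_Rn k (y j - x j) powr p) / real n) powr (1 / p)"
        using p n0 x y by (intro wasserstein_empirical_le) auto
      also have "\<dots> = (1 / real n) powr (1 / p) * (\<Sum>j<n. norm_Rn k (x j - y j) powr p) powr (1 / p)"
        by (simp add: powr_divide sum_nonneg norm_Rn_minus_commute)
      finally show ?thesis by simp
    qed
    have "(\<lambda>\<omega>. ?W (\<lambda>j. \<omega> j)) \<in> borel_measurable (PiM {..<n} (\<lambda>_. \<rho>))"
    proof (rule lipschitz_sample_measurable[where G="?W" and X="\<lambda>j \<omega>. \<omega> j" and d=k and p=p and N=n and K="(1 / real n) powr (1 / p)"])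
      fix j assume "j < n"
      then have "(\<lambda>x. x j) \<in> PiM {..<n} (\<lambda>_. \<rho>) \<rightarrow>\<^sub>M \<rho>" by (intro measurable_component_singleton) simp
      then show "(\<lambda>x. x j) \<in> PiM {..<n} (\<lambda>_. \<rho>) \<rightarrow>\<^sub>M borel_Rn k"
        by (simp add: measurable_cong_sets[OF refl prob_RnD(2)[OF \<rho>(1)]])
    next
      fix x y :: "nat \<Rightarrow> rvec" assume x: "\<And>j. j < n \<Longrightarrow> x j \<in> Rn k" and y: "\<And>j. j < n \<Longrightarrow> y j \<in> Rn k"
      have s: "(\<Sum>j<n. norm_Rn k (y j - x j) powr p) = (\<Sum>j<n. norm_Rn k (x j - y j) powr p)"
        by (simp add: norm_Rn_minus_commute)
      from W1[of x y] W1[of y x] x y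
      show "\<bar>?W x - ?W y\<bar> \<le> (1 / real n) powr (1 / p) * (\<Sum>j<n. norm_Rn k (x j - y j) powr p) powr (1 / p)"
        unfolding s by (simp add: abs_le_iff)
    qed (use p in auto)
    then show ?thesis by simp
  qed
  \<comment> \<open>The coordinatewise image of the product measure is the product of the image
    measures, so the projected sample is again i.i.d.\<close>
  have D: "distr P (PiM {..<n} (\<lambda>_. \<rho>)) (compose {..<n} f) = PiM {..<n} (\<lambda>_. \<rho>)"
    using distr_PiM_finite_prob_space'[of "{..<n}" "\<lambda>_. \<mu>" "\<lambda>_. \<rho>" f] fm\<rho> \<mu>.prob_space_axioms \<rho>.prob_space_axioms
    by (simp add: d\<rho>)
  have cm: "compose {..<n} f \<in> P \<rightarrow>\<^sub>M PiM {..<n} (\<lambda>_. \<rho>)"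
    unfolding compose_def using fm\<rho>
    by (intro measurable_restrict measurable_compose[OF measurable_component_singleton]) auto
  have "(\<integral>\<^sup>+ x. ennreal (F U x powr p) \<partial>P) \<le> (\<integral>\<^sup>+ x. ennreal (\<sigma> powr p) * ennreal (?W (compose {..<n} f x) powr p) \<partial>P)"
  proof (rule nn_integral_mono)
    fix x assume "x \<in> space P"
    then have x: "\<forall>j<n. x j \<in> Rn d" by (auto intro: space_P)
    have e: "empirical k n (compose {..<n} f x) = empirical k n (\<lambda>j. f (x j))"
      by (rule empirical_cong) (simp add: compose_def)
    have "F U x \<le> \<sigma> * ?W (compose {..<n} f x)"
      using F_le_scaled(1)[OF U x, of "1 / \<sigma>"] \<sigma> unfolding e by (simp add: f_def \<rho>_def)
    then have "F U x powr p \<le> (\<sigma> * ?W (compose {..<n} f x)) powr p" using p by (intro powr_mono2) auto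
    then show "ennreal (F U x powr p) \<le> ennreal (\<sigma> powr p) * ennreal (?W (compose {..<n} f x) powr p)"
      using \<sigma> by (simp add: powr_mult ennreal_leI flip: ennreal_mult)
  qed
  also have "\<dots> = ennreal (\<sigma> powr p) * (\<integral>\<^sup>+ x. ennreal (?W (compose {..<n} f x) powr p) \<partial>P)"
    using measurable_compose[OF cm Wm] by (intro nn_integral_cmult) simp
  also have "(\<integral>\<^sup>+ x. ennreal (?W (compose {..<n} f x) powr p) \<partial>P) = (\<integral>\<^sup>+ x. ennreal (?W x powr p) \<partial>PiM {..<n} (\<lambda>_. \<rho>))"
    using nn_integral_distr[OF cm, of "\<lambda>x. ennreal (?W x powr p)"] Wm unfolding D by simp
  also have "ennreal (\<sigma> powr p) * \<dots> \<le> ennreal (\<sigma> powr p) * ennreal ((emp_const k * rate (rate_const p) p k n) powr p)"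
    by (intro mult_left_mono expected_wasserstein_rate[OF \<rho>(1) k p n ex]) auto
  also have "\<dots> = ennreal (R powr p)"
    using \<sigma> emp_const_pos[OF k] n rate_const_pos[of p]
    by (simp add: R_def powr_mult rate_nonneg less_imp_le flip: ennreal_mult)
  finally have "(\<integral>\<^sup>+ x. ennreal (F U x powr p) \<partial>P) \<le> ennreal (R powr p)" .
  from integral_le_of_powr[OF P.prob_space_axioms F_measurable[OF U] F_nonneg p(1) R_pos this]
  show "integrable P (F U)" "P.expectation (F U) \<le> R" .
qed

definition A where "A = sqrt (8 * real d) * \<sigma>"

lemma A_pos: "0 < A" using d \<sigma> by (simp add: A_def)

text \<open>The empirical counterpart of \<open>A\<close>: both measure the L^p size of the centred
  data, which limits how much a change of U can matter.\<close>

definition Q where "Q x = ((\<Sum>j<n. norm_Rn d (x j - m) powr p) / real n) powr (1 / p)"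

lemma expected_Q: "integrable P Q" "P.expectation Q \<le> A"
proof -
  have nm: "(\<lambda>y. norm_Rn d (y - m)) \<in> borel_measurable \<mu>"
    using m_in by (intro measurable_norm_Rn measurable_Rn_diff measurable_id_Rn sets_\<mu>) (simp add: space_borel_Rn)
  have comp: "(\<lambda>x. x j) \<in> P \<rightarrow>\<^sub>M \<mu>" if "j < n" for j
    using that by (intro measurable_component_singleton) simp
  have njm: "(\<lambda>x. norm_Rn d (x j - m)) \<in> borel_measurable P" if "j < n" for j
    by (rule measurable_compose[OF comp[OF that] nm])
  have Qm: "Q \<in> borel_measurable P"
  proof -
    have "(\<lambda>x. \<Sum>j<n. norm_Rn d (x j - m) powr p) \<in> borel_measurable P"
      using njm by (intro borel_measurable_sum) simp
    then show ?thesis unfolding Q_def by simp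
  qed
  have "(\<integral>\<^sup>+ x. ennreal (Q x powr p) \<partial>P) = (\<integral>\<^sup>+ x. (\<Sum>j<n. ennreal (1 / real n) * ennreal (norm_Rn d (x j - m) powr p)) \<partial>P)"
  proof (rule nn_integral_cong)
    fix x
    have "Q x powr p = (\<Sum>j<n. norm_Rn d (x j - m) powr p) / real n"
      using p by (simp add: Q_def powr_powr sum_nonneg)
    also have "\<dots> = (\<Sum>j<n. 1 / real n * norm_Rn d (x j - m) powr p)" by (simp add: sum_divide_distrib)
    finally show "ennreal (Q x powr p) = (\<Sum>j<n. ennreal (1 / real n) * ennreal (norm_Rn d (x j - m) powr p))"
      by (simp add: sum_ennreal flip: ennreal_mult)
  qed
  also have "\<dots> = (\<Sum>j<n. ennreal (1 / real n) * (\<integral>\<^sup>+ x. ennreal (norm_Rn d (x j - m) powr p) \<partial>P))"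
    using njm by (subst nn_integral_sum) (auto intro!: sum.cong nn_integral_cmult)
  also have "\<dots> \<le> (\<Sum>j<n. ennreal (1 / real n) * ennreal (A powr p))"
  proof (intro sum_mono mult_left_mono)
    fix j assume j: "j \<in> {..<n}"
    have dj: "distr P \<mu> (\<lambda>x. x j) = \<mu>"
      using distr_PiM_component[of "{..<n}" "\<lambda>_. \<mu>" j] j \<mu>.prob_space_axioms by simp
    have "(\<integral>\<^sup>+ x. ennreal (norm_Rn d (x j - m) powr p) \<partial>P) = (\<integral>\<^sup>+ y. ennreal (norm_Rn d (y - m) powr p) \<partial>distr P \<mu> (\<lambda>x. x j))"
      using nm j by (intro nn_integral_distr[symmetric] comp) auto
    also have "\<dots> \<le> ennreal (A powr p)"
      unfolding dj A_def using d by (intro transport_inequality_moment[OF T p \<sigma>]) simp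
    finally show "(\<integral>\<^sup>+ x. ennreal (norm_Rn d (x j - m) powr p) \<partial>P) \<le> ennreal (A powr p)" .
  qed auto
  also have "\<dots> = ennreal (A powr p)"
  proof -
    have "(\<Sum>j<n. ennreal (1 / real n) * ennreal (A powr p)) = (\<Sum>j<n. ennreal (1 / real n * A powr p))"
      by (intro sum.cong refl, subst ennreal_mult) auto
    also have "\<dots> = ennreal (\<Sum>j<n. 1 / real n * A powr p)" by (rule sum_ennreal) simp
    finally show ?thesis using n0 by simp
  qed
  finally have "(\<integral>\<^sup>+ x. ennreal (Q x powr p) \<partial>P) \<le> ennreal (A powr p)" .
  moreover have "\<And>x. 0 \<le> Q x" by (simp add: Q_def)
  ultimately show "integrable P Q" "P.expectation Q \<le> A"
    using integral_le_of_powr[OF P.prob_space_axioms Qm _ p(1) A_pos] by auto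
qed

text \<open>U is exchanged for V in the population measure and in the empirical measure separately;
  each exchange moves a centred point y by at most \<epsilon> sqrt k |y - m|. Both triangles in the
  chain contain an empirical measure.\<close>

lemma F_perturb:
  assumes U: "U \<in> stiefel k d" and V: "V \<in> stiefel k d" and x: "\<forall>j<n. x j \<in> Rn d" and \<epsilon>: "0 \<le> \<epsilon>"
    and UV: "\<And>i j. i < k \<Longrightarrow> j < d \<Longrightarrow> \<bar>U i j - V i j\<bar> \<le> \<epsilon> / sqrt (real d)"
  shows "F U x \<le> F V x + \<epsilon> * sqrt (real k) * (A + Q x)"
proof -
  define \<alpha> where "\<alpha> W = distr \<mu> (borel_Rn k) (cproj 1 W)" for W
  define \<beta> where "\<beta> W = empirical k n (\<lambda>j. cproj 1 W (x j))" for W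
  let ?L = "\<epsilon> * sqrt (real k)"
  have L: "0 \<le> ?L" using \<epsilon> by simp
  have close: "norm_Rn k (cproj 1 U y - cproj 1 V y) \<le> ?L * norm_Rn d (y - m)"
    "norm_Rn k (cproj 1 V y - cproj 1 U y) \<le> ?L * norm_Rn d (y - m)" for y
  proof -
    have "norm_Rn k (mat_vec k d U (y - m) - mat_vec k d V (y - m)) \<le> ?L * norm_Rn d (y - m)"
      by (rule mat_vec_perturb) (use UV \<epsilon> d in auto)
    then show "norm_Rn k (cproj 1 U y - cproj 1 V y) \<le> ?L * norm_Rn d (y - m)"
      "norm_Rn k (cproj 1 V y - cproj 1 U y) \<le> ?L * norm_Rn d (y - m)"
      by (simp_all add: cproj_def norm_Rn_minus_commute[of k "mat_vec k d V _"])
  qed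
  have ok: "prob_Rn k (\<alpha> U)" "prob_Rn k (\<alpha> V)" "finite_moment k p (\<alpha> U)" "finite_moment k p (\<alpha> V)"
    "prob_Rn k (\<beta> U)" "prob_Rn k (\<beta> V)" "finite_moment k p (\<beta> U)" "finite_moment k p (\<beta> V)"
    unfolding \<alpha>_def \<beta>_def using cproj_ok[OF U prob mom] cproj_ok[OF V prob mom] n0
    by (auto intro!: prob_Rn_empirical finite_moment_empirical cproj_in)
  have "F U x \<le> wasserstein k p (\<alpha> U) (\<beta> U)"
    using F_le_scaled(1)[OF U x, of 1] by (simp add: \<alpha>_def \<beta>_def)
  also have "\<dots> \<le> wasserstein k p (\<alpha> U) (\<beta> V) + wasserstein k p (\<beta> V) (\<beta> U)"
    using ok n0 p by (intro wasserstein_triangle[where n=n and x="\<lambda>j. cproj 1 U (x j)"] cproj_in) (auto simp: \<beta>_def)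
  also have "wasserstein k p (\<alpha> U) (\<beta> V) \<le> wasserstein k p (\<alpha> U) (\<alpha> V) + wasserstein k p (\<alpha> V) (\<beta> V)"
    using ok n0 p by (intro wasserstein_triangle[where n=n and x="\<lambda>j. cproj 1 V (x j)"] cproj_in) (auto simp: \<beta>_def)
  also have "wasserstein k p (\<alpha> V) (\<beta> V) \<le> F V x"
    using F_le_scaled(2)[OF V x, of 1] by (simp add: \<alpha>_def \<beta>_def)
  also have "wasserstein k p (\<alpha> U) (\<alpha> V) \<le> ?L * A"
  proof (rule wasserstein_leI)
    show "cproj 1 U \<in> \<mu> \<rightarrow>\<^sub>M borel_Rn k" "cproj 1 V \<in> \<mu> \<rightarrow>\<^sub>M borel_Rn k"
      using measurable_cproj by (auto simp: measurable_cong_sets[OF sets_\<mu> refl])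
    have nm: "(\<lambda>y. norm_Rn d (y - m)) \<in> borel_measurable \<mu>"
      using m_in by (intro measurable_norm_Rn measurable_Rn_diff measurable_id_Rn sets_\<mu>) (simp add: space_borel_Rn)
    have "(\<integral>\<^sup>+ y. ennreal (norm_Rn k (cproj 1 U y - cproj 1 V y) powr p) \<partial>\<mu>)
      \<le> (\<integral>\<^sup>+ y. ennreal (?L powr p) * ennreal (norm_Rn d (y - m) powr p) \<partial>\<mu>)"
    proof (rule nn_integral_mono)
      fix y
      have "norm_Rn k (cproj 1 U y - cproj 1 V y) powr p \<le> (?L * norm_Rn d (y - m)) powr p"
        using p by (intro powr_mono2 close) auto
      then show "ennreal (norm_Rn k (cproj 1 U y - cproj 1 V y) powr p) \<le> ennreal (?L powr p) * ennreal (norm_Rn d (y - m) powr p)"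
        unfolding powr_mult[of ?L] by (simp add: ennreal_leI flip: ennreal_mult)
    qed
    also have "\<dots> = ennreal (?L powr p) * (\<integral>\<^sup>+ y. ennreal (norm_Rn d (y - m) powr p) \<partial>\<mu>)"
      using nm by (intro nn_integral_cmult) simp
    also have "\<dots> \<le> ennreal (?L powr p) * ennreal (A powr p)"
      unfolding A_def using d by (intro mult_left_mono transport_inequality_moment[OF T p \<sigma>]) auto
    also have "\<dots> = ennreal ((?L * A) powr p)"
      using L A_pos by (simp add: powr_mult[of ?L A] less_imp_le flip: ennreal_mult)
    finally show "(\<integral>\<^sup>+ y. ennreal (norm_Rn k (cproj 1 U y - cproj 1 V y) powr p) \<partial>\<mu>) \<le> ennreal ((?L * A) powr p)" .
  qed (use L A_pos p in \<open>auto simp: \<alpha>_def\<close>)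
  also have "wasserstein k p (\<beta> V) (\<beta> U) \<le> ((\<Sum>j<n. norm_Rn k (cproj 1 V (x j) - cproj 1 U (x j)) powr p) / real n) powr (1 / p)"
    unfolding \<beta>_def using n0 p by (intro wasserstein_empirical_le cproj_in) auto
  also have "\<dots> \<le> ((\<Sum>j<n. ?L powr p * norm_Rn d (x j - m) powr p) / real n) powr (1 / p)"
  proof (intro powr_mono2 divide_right_mono sum_mono)
    fix j
    have "norm_Rn k (cproj 1 V (x j) - cproj 1 U (x j)) powr p \<le> (?L * norm_Rn d (x j - m)) powr p"
      using p by (intro powr_mono2 close) auto
    then show "norm_Rn k (cproj 1 V (x j) - cproj 1 U (x j)) powr p \<le> ?L powr p * norm_Rn d (x j - m) powr p"
      unfolding powr_mult[of ?L] .
  qed (use p in \<open>auto intro!: divide_nonneg_nonneg sum_nonneg\<close>)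
  also have "\<dots> = ?L * Q x"
  proof -
    have "(\<Sum>j<n. ?L powr p * norm_Rn d (x j - m) powr p) / real n = ?L powr p * ((\<Sum>j<n. norm_Rn d (x j - m) powr p) / real n)"
      by (simp add: sum_distrib_left)
    moreover have "0 \<le> (\<Sum>j<n. norm_Rn d (x j - m) powr p) / real n" by (auto intro!: divide_nonneg_nonneg sum_nonneg)
    ultimately have "((\<Sum>j<n. ?L powr p * norm_Rn d (x j - m) powr p) / real n) powr (1 / p) = (?L powr p) powr (1 / p) * Q x"
      unfolding Q_def by (simp only: powr_mult[of "?L powr p"])
    then show ?thesis using L p by (simp add: powr_powr)
  qed
  finally show ?thesis by (simp add: distrib_left)
qed

lemma expected_exp_F:
  assumes U: "U \<in> stiefel k d" and \<theta>: "0 < \<theta>"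
  shows "integrable P (\<lambda>x. exp (\<theta> * (F U x - P.expectation (F U))))"
    "P.expectation (\<lambda>x. exp (\<theta> * (F U x - P.expectation (F U)))) \<le> exp (\<theta>\<^sup>2 * \<sigma>\<^sup>2 / (2 * real n))"
proof -
  let ?E = "P.expectation (F U)" let ?v = "\<theta>\<^sup>2 * \<sigma>\<^sup>2 / (2 * real n)"
  have L: "(\<integral>\<^sup>+ x. ennreal (exp (\<theta> * F U x)) \<partial>P) \<le> ennreal (exp (\<theta> * ?E + ?v))"
    using space_P by (intro transport_inequality_Laplace[OF T p \<sigma> n0 expected_F(1)[OF U] F_lipschitz[OF U] \<theta>]) auto
  have [measurable]: "F U \<in> borel_measurable P" by (rule F_measurable[OF U])
  have i: "integrable P (\<lambda>x. exp (\<theta> * F U x))"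
    using order.strict_trans1[OF L ennreal_less_top] by (intro integrableI_bounded) auto
  have "P.expectation (\<lambda>x. exp (\<theta> * F U x)) = enn2real (\<integral>\<^sup>+ x. ennreal (exp (\<theta> * F U x)) \<partial>P)"
    by (rule integral_eq_nn_integral) auto
  also have "\<dots> \<le> exp (\<theta> * ?E + ?v)" using L by (intro enn2real_leI) auto
  finally have I: "P.expectation (\<lambda>x. exp (\<theta> * F U x)) \<le> exp (\<theta> * ?E + ?v)" .
  have e: "exp (\<theta> * (F U x - ?E)) = exp (\<theta> * F U x) / exp (\<theta> * ?E)" for x
    by (simp add: right_diff_distrib exp_diff)
  show "integrable P (\<lambda>x. exp (\<theta> * (F U x - ?E)))" unfolding e using i by simp
  have "P.expectation (\<lambda>x. exp (\<theta> * (F U x - ?E))) = P.expectation (\<lambda>x. exp (\<theta> * F U x)) / exp (\<theta> * ?E)"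
    unfolding e by simp
  also have "\<dots> \<le> exp (\<theta> * ?E + ?v) / exp (\<theta> * ?E)" using I by (intro divide_right_mono) auto
  also have "\<dots> = exp ?v" by (simp add: exp_add)
  finally show "P.expectation (\<lambda>x. exp (\<theta> * (F U x - ?E))) \<le> exp ?v" .
qed

text \<open>The maximum over the net is bounded through \<open>t \<le> e\<^sup>t / a + ln a - 1\<close>, which plays the role of
  Jensen's inequality for the logarithm.\<close>

lemma sup_bound:
  "\<exists>B. integrable P B \<and> (\<forall>x\<in>space P. \<forall>U\<in>stiefel k d. F U x \<le> B x) \<and>
    P.expectation B \<le> R + (18 * real k + 1) * \<sigma> * sqrt (real d * ln (real n) / real n)"
proof -
  \<comment> \<open>The error of the net is of order \<epsilon> sqrt k A with A of order \<sigma>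
    sqrt d, so mesh 1 / sqrt n brings it down to order \<sigma> sqrt (k d / n).\<close>
  define \<epsilon> where "\<epsilon> = 1 / sqrt (real n)"
  have \<epsilon>: "0 < \<epsilon>" "\<epsilon> \<le> 1" using n by (auto simp: \<epsilon>_def)
  obtain S where S: "S \<subseteq> stiefel k d" "finite S" "real (card S) \<le> (36 / \<epsilon>) ^ (k * d)"
    and net: "\<And>U. U \<in> stiefel k d \<Longrightarrow> \<exists>V\<in>S. \<forall>i<k. \<forall>j<d. \<bar>U i j - V i j\<bar> \<le> \<epsilon> / sqrt (real d)"
    using stiefel_net[OF k d \<epsilon>] by blast
  define l where "l = ln (real n)"
  have ln2: "1 / 2 \<le> ln (2::real)" using ln2_ge_two_thirds by simp
  have "ln 2 \<le> l" unfolding l_def using n by simp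
  then have l: "1 / 2 \<le> l" using ln2 by linarith
  \<comment> \<open>This makes the variance term \<theta>^2 \<sigma>^2 / (2 n) equal to d log n / 2,
    of the same order in d log n as the entropy of the net; dividing by \<theta> leaves the square
    root.\<close>
  define \<theta> where "\<theta> = sqrt (real n * real d * l) / \<sigma>"
  have \<theta>: "0 < \<theta>" using n d l \<sigma> by (simp add: \<theta>_def)
  \<comment> \<open>An upper bound for the expectation of Y below, so that Y / a - 1 contributes
    nothing positive on average and only ln a remains.\<close>
  define a where "a = (36 / \<epsilon>) ^ (k * d) * exp (\<theta>\<^sup>2 * \<sigma>\<^sup>2 / (2 * real n))"
  have a: "0 < a" using \<epsilon> by (simp add: a_def)
  define Y where "Y x = (\<Sum>V\<in>S. exp (\<theta> * (F V x - P.expectation (F V))))" for x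
  \<comment> \<open>A finite sum over the net together with \<open>Q\<close> dominates all
    projections at once, so no measurability of the supremum is involved.\<close>
  define B where "B x = R + 1 / \<theta> * (Y x / a + ln a - 1) + \<epsilon> * sqrt (real k) * (A + Q x)" for x
  have Yi: "integrable P Y" unfolding Y_def using S(1) by (intro Bochner_Integration.integrable_sum expected_exp_F(1) \<theta>) auto
  have "P.expectation Y = (\<Sum>V\<in>S. P.expectation (\<lambda>x. exp (\<theta> * (F V x - P.expectation (F V)))))"
    unfolding Y_def using S(1) by (intro Bochner_Integration.integral_sum expected_exp_F(1) \<theta>) auto
  also have "\<dots> \<le> (\<Sum>V\<in>S. exp (\<theta>\<^sup>2 * \<sigma>\<^sup>2 / (2 * real n)))"
    using S(1) by (intro sum_mono expected_exp_F(2) \<theta>) auto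
  also have "\<dots> = real (card S) * exp (\<theta>\<^sup>2 * \<sigma>\<^sup>2 / (2 * real n))" by simp
  also have "\<dots> \<le> a" unfolding a_def using S(3) by (intro mult_right_mono) auto
  finally have EY: "P.expectation Y \<le> a" .
  have Bi: "integrable P B" unfolding B_def using Yi expected_Q(1) by auto
  have le: "F U x \<le> B x" if x: "x \<in> space P" and U: "U \<in> stiefel k d" for x U
  proof -
    obtain V where V: "V \<in> S" "\<And>i j. i < k \<Longrightarrow> j < d \<Longrightarrow> \<bar>U i j - V i j\<bar> \<le> \<epsilon> / sqrt (real d)"
      using net[OF U] by blast
    then have Vs: "V \<in> stiefel k d" using S by auto
    have xR: "\<forall>j<n. x j \<in> Rn d" using x space_P by auto
    define t where "t = \<theta> * (F V x - P.expectation (F V))"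
    have "t - ln a + 1 \<le> exp (t - ln a)" using exp_ge_add_one_self[of "t - ln a"] by linarith
    also have "\<dots> = exp t / a" using a by (simp add: exp_diff)
    also have "\<dots> \<le> Y x / a"
    proof (intro divide_right_mono)
      show "exp t \<le> Y x" unfolding t_def Y_def using V(1) S(2) by (intro member_le_sum) auto
    qed (use a in auto)
    finally have "t \<le> Y x / a + ln a - 1" by simp
    then have "1 / \<theta> * t \<le> 1 / \<theta> * (Y x / a + ln a - 1)" using \<theta> by (intro mult_left_mono) auto
    moreover have "1 / \<theta> * t = F V x - P.expectation (F V)" using \<theta> by (simp add: t_def)
    ultimately have "F V x \<le> R + 1 / \<theta> * (Y x / a + ln a - 1)" using expected_F(2)[OF Vs] by linarith
    moreover have "F U x \<le> F V x + \<epsilon> * sqrt (real k) * (A + Q x)"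
      using \<epsilon> V by (intro F_perturb[OF U Vs xR]) auto
    ultimately show ?thesis unfolding B_def by linarith
  qed
  define s where "s = sqrt (real d * l / real n)"
  have s0: "0 < s" using d l n by (simp add: s_def)
  have "P.expectation B = R + 1 / \<theta> * (P.expectation Y / a + ln a - 1) + \<epsilon> * sqrt (real k) * (A + P.expectation Q)"
    unfolding B_def using Yi expected_Q(1) by (simp add: P.prob_space)
  also have "\<dots> \<le> R + 1 / \<theta> * ln a + \<epsilon> * sqrt (real k) * (A + A)"
  proof (intro add_mono mult_left_mono)
    have "P.expectation Y / a \<le> 1" using EY a by simp
    then show "P.expectation Y / a + ln a - 1 \<le> ln a" by simp
  qed (use \<theta> \<epsilon> expected_Q(2) in auto)
  also have "1 / \<theta> * ln a \<le> (9 * real k + 1) * \<sigma> * s"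
  proof -
    have "ln 36 \<le> 8 * l"
    proof -
      have "ln (36::real) \<le> ln (64::real)" by simp
      also have "ln (64::real) = 6 * ln 2" using ln_realpow[of "2::real" 6] by simp
      also have "\<dots> \<le> 8 * l" using \<open>ln 2 \<le> l\<close> l by linarith
      finally show ?thesis .
    qed
    moreover have "ln (36 / \<epsilon>) = ln 36 + l / 2"
      using n by (simp add: \<epsilon>_def ln_mult ln_sqrt l_def)
    ultimately have "ln (36 / \<epsilon>) \<le> 9 * l" using l by linarith
    then have "real (k * d) * ln (36 / \<epsilon>) \<le> real (k * d) * (9 * l)" by (intro mult_left_mono) auto
    moreover have "ln a = real (k * d) * ln (36 / \<epsilon>) + \<theta>\<^sup>2 * \<sigma>\<^sup>2 / (2 * real n)"
      using \<epsilon> by (simp add: a_def ln_mult ln_realpow)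
    moreover have "\<theta>\<^sup>2 * \<sigma>\<^sup>2 / (2 * real n) = real d * l / 2"
      using \<sigma> n l by (simp add: \<theta>_def power_divide)
    moreover have "(9 * real k + 1) * (real d * l) = real (k * d) * (9 * l) + real d * l"
      by (simp add: algebra_simps)
    moreover have "0 \<le> real d * l" using l by simp
    ultimately have "ln a \<le> (9 * real k + 1) * (real d * l)" by linarith
    then have "1 / \<theta> * ln a \<le> 1 / \<theta> * ((9 * real k + 1) * (real d * l))"
      using \<theta> by (intro mult_left_mono) auto
    also have "\<dots> = (9 * real k + 1) * \<sigma> * (real d * l / sqrt (real n * real d * l))"
      by (simp add: \<theta>_def)
    also have "real d * l / sqrt (real n * real d * l) = s"
    proof -
      have "sqrt (real n * real d * l) * s = sqrt ((real d * l)\<^sup>2)"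
        unfolding s_def real_sqrt_mult[symmetric] using n by (simp add: power2_eq_square mult_ac)
      also have "\<dots> = real d * l" using l by simp
      finally show ?thesis using n d l by (simp add: field_simps)
    qed
    finally show ?thesis .
  qed
  \<comment> \<open>\<epsilon> A \<le> 4 \<sigma> s since sqrt 8 * sqrt 2 = 4, where l \<ge> 1 / 2
    puts the logarithm under the root. The two copies of A give 8 k, rounded up to 9 k; with 9 k + 1
    from ln a the total is 18 k + 1.\<close>
  also have "\<epsilon> * sqrt (real k) * (A + A) \<le> 9 * real k * \<sigma> * s"
  proof -
    have "\<epsilon> * A = \<sigma> * (sqrt 8 * sqrt (real d / real n))"
      by (simp add: \<epsilon>_def A_def real_sqrt_mult real_sqrt_divide)
    also have "sqrt (real d / real n) \<le> sqrt (2 * (real d * l / real n))"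
    proof (rule real_sqrt_le_mono)
      have "real d / real n * 1 \<le> real d / real n * (2 * l)" using l by (intro mult_left_mono) auto
      then show "real d / real n \<le> 2 * (real d * l / real n)" by (simp add: mult_ac)
    qed
    also have "\<dots> = sqrt 2 * s" unfolding s_def real_sqrt_mult by simp
    finally have "\<epsilon> * A \<le> \<sigma> * (sqrt 8 * (sqrt 2 * s))" using \<sigma> by (simp add: mult_left_mono)
    also have "sqrt 8 * (sqrt 2 * s) = 4 * s"
      by (simp flip: mult.assoc real_sqrt_mult)
    finally have eA: "\<epsilon> * A \<le> 4 * \<sigma> * s" by simp
    have "sqrt (real k) \<le> real k" using k by (intro real_le_lsqrt) (auto simp: power2_eq_square)
    then have "sqrt (real k) * (\<epsilon> * A) \<le> real k * (4 * \<sigma> * s)"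
      by (rule mult_mono[OF _ eA]) (use \<epsilon> A_pos in auto)
    moreover have "\<epsilon> * sqrt (real k) * (A + A) = 2 * (sqrt (real k) * (\<epsilon> * A))" by simp
    ultimately have "\<epsilon> * sqrt (real k) * (A + A) \<le> 2 * (real k * (4 * \<sigma> * s))" by linarith
    also have "\<dots> = 8 * (real k * \<sigma> * s)" by simp
    also have "\<dots> \<le> 9 * (real k * \<sigma> * s)" using \<sigma> s0 by (intro mult_right_mono) auto
    finally show ?thesis by (simp add: mult_ac)
  qed
  finally have "P.expectation B \<le> R + (18 * real k + 1) * \<sigma> * s"
    by (simp add: algebra_simps)
  then show ?thesis using Bi le unfolding s_def l_def by blast
qed

end

section \<open>The spiked transport model\<close>

lemma sum_fun_apply: "(\<Sum>x\<in>A. f x) (j :: 'b) = (\<Sum>x\<in>A. f x j :: real)"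
  by (induction A rule: infinite_finite_induct) auto

definition orthonormal_Rn :: "nat \<Rightarrow> rvec set \<Rightarrow> nat \<Rightarrow> (nat \<Rightarrow> rvec) \<Rightarrow> bool"
  where "orthonormal_Rn d U r e \<longleftrightarrow> (\<forall>i<r. e i \<in> U) \<and>
    (\<forall>i<r. \<forall>l<r. inner_Rn d (e i) (e l) = (if i = l then 1 else 0))"

lemma orthonormal_independent:
  assumes "orthonormal_Rn d U r e"
  shows "independent (e ` {..<r})" "card (e ` {..<r}) = r"
proof -
  have ort: "\<And>i l. i < r \<Longrightarrow> l < r \<Longrightarrow> inner_Rn d (e i) (e l) = (if i = l then 1 else 0)"
    using assms by (auto simp: orthonormal_Rn_def)
  have inj: "inj_on e {..<r}"
  proof (rule inj_onI)
    fix i l assume il: "i \<in> {..<r}" "l \<in> {..<r}" "e i = e l"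
    then have "inner_Rn d (e i) (e l) = 1" using ort[of i i] by auto
    then show "i = l" using ort[of i l] il by (auto split: if_splits)
  qed
  show "card (e ` {..<r}) = r" using card_image[OF inj] by simp
  show "independent (e ` {..<r})"
  proof (rule independent_if_scalars_zero)
    fix f :: "rvec \<Rightarrow> real" and x assume sum0: "(\<Sum>x\<in>e ` {..<r}. f x *\<^sub>R x) = 0" and x: "x \<in> e ` {..<r}"
    then obtain l where l: "l < r" "x = e l" by auto
    have "(\<Sum>x\<in>e ` {..<r}. f x *\<^sub>R x) = (\<Sum>i<r. f (e i) *\<^sub>R e i)" by (rule sum.reindex[OF inj, unfolded comp_def])
    then have z: "(\<Sum>i<r. f (e i) * e i j) = 0" for j
      using fun_cong[OF sum0, of j] by (simp add: sum_fun_apply scaleR_fun_def)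
    have "0 = inner_Rn d (\<lambda>j. \<Sum>i<r. f (e i) * e i j) (e l)" by (simp add: z inner_Rn_def)
    also have "\<dots> = (\<Sum>i<r. f (e i) * inner_Rn d (e i) (e l))" by (rule inner_Rn_sum)
    also have "\<dots> = (\<Sum>i\<in>{l}. f (e i))" by (rule sum.mono_neutral_cong_right) (use l ort in auto)
    finally show "f x = 0" using l by simp
  qed simp
qed

lemma Rn_dim_bound:
  assumes "independent B" "B \<subseteq> Rn d" shows "finite B" "card B \<le> d"
proof -
  define u :: "nat \<Rightarrow> rvec" where "u j = (\<lambda>i. if i = j then 1 else 0)" for j
  have "Rn d \<subseteq> span (u ` {..<d})"
  proof
    fix x assume x: "x \<in> Rn d"
    have "x = (\<Sum>j<d. x j *\<^sub>R u j)"
    proof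
      fix i
      have "(\<Sum>j<d. x j *\<^sub>R u j) i = (\<Sum>j<d. if j = i then x j else 0)"
        unfolding sum_fun_apply by (intro sum.cong) (auto simp: scaleR_fun_def u_def)
      also have "\<dots> = x i" using x by (cases "i < d") (auto simp: Rn_def)
      finally show "x i = (\<Sum>j<d. x j *\<^sub>R u j) i" by simp
    qed
    moreover have "(\<Sum>j<d. x j *\<^sub>R u j) \<in> span (u ` {..<d})"
      by (intro span_sum span_scale span_base) auto
    ultimately show "x \<in> span (u ` {..<d})" by simp
  qed
  then have "finite B \<and> card B \<le> card (u ` {..<d})"
    using assms by (intro independent_span_bound) auto
  moreover have "card (u ` {..<d}) \<le> d" using card_image_le[of "{..<d}" u] by simp
  ultimately show "finite B" "card B \<le> d" by auto
qed

lemma norm_Rn_eq_0: "x \<in> Rn d \<Longrightarrow> norm_Rn d x = 0 \<Longrightarrow> x = 0"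
  by (auto simp: norm_Rn_def L2_set_eq_0_iff Rn_def fun_eq_iff) (metis lessThan_iff not_less)

text \<open>Maximality takes the place of the Gram-Schmidt recursion: a longest orthonormal family
  in U spans U, because the normalised residual of an unspanned vector would extend it. Its length
  is then k by dimension.\<close>

lemma orthonormal_basis_Rn:
  assumes U: "U \<subseteq> Rn d" "subspace U" and k: "dim U = k"
  shows "\<exists>V\<in>stiefel k d. (\<forall>i<k. V i \<in> U) \<and> (\<forall>x\<in>U. x = (\<lambda>j. \<Sum>i<k. inner_Rn d (V i) x * V i j))"
proof -
  \<comment> \<open>A longest family exists, since d + 1 orthonormal vectors would form too large an
    independent set in \<open>Rn d\<close>.\<close>
  have "\<exists>r. (\<exists>e. orthonormal_Rn d U r e) \<and> \<not> (\<exists>e. orthonormal_Rn d U (Suc r) e)"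
  proof (rule ccontr)
    assume "\<not> ?thesis"
    then have step: "(\<exists>e. orthonormal_Rn d U r e) \<Longrightarrow> (\<exists>e. orthonormal_Rn d U (Suc r) e)" for r by blast
    have "\<exists>e. orthonormal_Rn d U r e" for r
      by (induction r) (auto simp: step, simp add: orthonormal_Rn_def)
    then obtain e where e: "orthonormal_Rn d U (Suc d) e" by blast
    then have "e ` {..<Suc d} \<subseteq> Rn d" using U by (auto simp: orthonormal_Rn_def)
    from Rn_dim_bound(2)[OF orthonormal_independent(1)[OF e] this] show False
      using orthonormal_independent(2)[OF e] by simp
  qed
  then obtain r e where e: "orthonormal_Rn d U r e" and max: "\<And>e. \<not> orthonormal_Rn d U (Suc r) e" by blast
  have eU: "\<And>i. i < r \<Longrightarrow> e i \<in> U"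
    and ort: "\<And>i l. i < r \<Longrightarrow> l < r \<Longrightarrow> inner_Rn d (e i) (e l) = (if i = l then 1 else 0)"
    using e by (auto simp: orthonormal_Rn_def)
  have exp: "x = (\<Sum>i<r. inner_Rn d (e i) x *\<^sub>R e i)" if x: "x \<in> U" for x
  proof (rule ccontr)
    assume ne: "x \<noteq> (\<Sum>i<r. inner_Rn d (e i) x *\<^sub>R e i)"
    \<comment> \<open>The residual of x: nonzero by assumption and orthogonal to the family.\<close>
    define w where "w = x - (\<Sum>i<r. inner_Rn d (e i) x *\<^sub>R e i)"
    have wU: "w \<in> U" unfolding w_def using x eU U(2)
      by (intro subspace_diff subspace_sum subspace_scale) auto
    have "w \<noteq> 0" using ne by (simp add: w_def)
    then have nw: "norm_Rn d w \<noteq> 0" using norm_Rn_eq_0 wU U(1) by blast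
    have we: "inner_Rn d (e l) w = 0" if l: "l < r" for l
    proof -
      have "(\<Sum>i<r. inner_Rn d (e i) x *\<^sub>R e i) = (\<lambda>j. \<Sum>i<r. inner_Rn d (e i) x * e i j)"
        by (rule ext) (simp add: sum_fun_apply scaleR_fun_def)
      then have "inner_Rn d (e l) w = inner_Rn d (e l) x - inner_Rn d (\<lambda>j. \<Sum>i<r. inner_Rn d (e i) x * e i j) (e l)"
        unfolding w_def inner_Rn_diff by (simp add: inner_Rn_commute)
      also have "inner_Rn d (\<lambda>j. \<Sum>i<r. inner_Rn d (e i) x * e i j) (e l) = (\<Sum>i<r. inner_Rn d (e i) x * inner_Rn d (e i) (e l))"
        by (rule inner_Rn_sum)
      also have "\<dots> = (\<Sum>i\<in>{l}. inner_Rn d (e i) x)" by (rule sum.mono_neutral_cong_right) (use l ort in auto)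
      finally show ?thesis by simp
    qed
    define e' where "e' = e(r := (1 / norm_Rn d w) *\<^sub>R w)"
    have sc: "inner_Rn d y (c *\<^sub>R z) = c * inner_Rn d y z" for c y z
      by (simp add: inner_Rn_def scaleR_fun_def sum_distrib_left mult_ac)
    have ww: "inner_Rn d ((1 / norm_Rn d w) *\<^sub>R w) ((1 / norm_Rn d w) *\<^sub>R w) = 1"
      using nw by (subst sc, subst inner_Rn_commute, subst sc) (simp add: inner_Rn_self power2_eq_square)
    have "orthonormal_Rn d U (Suc r) e'"
      unfolding orthonormal_Rn_def
    proof (intro conjI allI impI)
      fix i assume "i < Suc r"
      then show "e' i \<in> U" using eU wU U(2) by (auto simp: e'_def less_Suc_eq intro: subspace_scale)
    next
      fix i l assume "i < Suc r" "l < Suc r"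
      moreover have "inner_Rn d ((1 / norm_Rn d w) *\<^sub>R w) (e l) = 0" "inner_Rn d (e l) ((1 / norm_Rn d w) *\<^sub>R w) = 0" if "l < r" for l
        using we[OF that] by (simp_all add: inner_Rn_commute[of d "_ *\<^sub>R w"] sc)
      ultimately show "inner_Rn d (e' i) (e' l) = (if i = l then 1 else 0)"
        using ort ww by (auto simp: e'_def less_Suc_eq)
    qed
    then show False using max by blast
  qed
  have "span (e ` {..<r}) = U"
  proof
    show "span (e ` {..<r}) \<subseteq> U" using eU U(2) by (intro span_minimal) auto
    show "U \<subseteq> span (e ` {..<r})"
    proof
      fix x assume "x \<in> U"
      have "(\<Sum>i<r. inner_Rn d (e i) x *\<^sub>R e i) \<in> span (e ` {..<r})"
        by (intro span_sum span_scale span_base) auto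
      then show "x \<in> span (e ` {..<r})" using exp[OF \<open>x \<in> U\<close>] by simp
    qed
  qed
  then have rk: "r = k"
    using dim_span_eq_card_independent[OF orthonormal_independent(1)[OF e]] orthonormal_independent(2)[OF e] k by simp
  define V where "V = (\<lambda>i. if i < k then e i else 0)"
  have "V \<in> stiefel k d"
    unfolding stiefel_def
  proof (intro CollectI conjI allI impI)
    fix i j assume "\<not> (i < k \<and> j < d)"
    then show "V i j = 0" using eU[of i] U(1) rk by (auto simp: V_def Rn_def)
  next
    fix i l assume "i < k" "l < k"
    then show "inner_Rn d (V i) (V l) = (if i = l then 1 else 0)" using ort rk by (simp add: V_def)
  qed
  moreover have "\<forall>i<k. V i \<in> U" using eU rk by (simp add: V_def)
  moreover have "x = (\<lambda>j. \<Sum>i<k. inner_Rn d (V i) x * V i j)" if "x \<in> U" for x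
  proof
    fix j
    have "x j = (\<Sum>i<r. inner_Rn d (e i) x *\<^sub>R e i) j" using exp[OF that] by simp
    also have "\<dots> = (\<Sum>i<k. inner_Rn d (V i) x * V i j)"
      unfolding sum_fun_apply rk by (intro sum.cong) (auto simp: scaleR_fun_def V_def)
    finally show "x j = (\<Sum>i<k. inner_Rn d (V i) x * V i j)" .
  qed
  ultimately show ?thesis by blast
qed

section \<open>Lifting couplings of the projections back to the ambient space\<close>

definition mat_transpose_vec :: "nat \<Rightarrow> (nat \<Rightarrow> nat \<Rightarrow> real) \<Rightarrow> rvec \<Rightarrow> rvec"
  where "mat_transpose_vec k V a = (\<lambda>j. \<Sum>i<k. a i * V i j)"

lemma mat_transpose_vec_in_Rn: "V \<in> stiefel k d \<Longrightarrow> mat_transpose_vec k V a \<in> Rn d"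
  by (simp add: Rn_def mat_transpose_vec_def stiefel_def)

lemma measurable_mat_transpose_vec:
  assumes V: "V \<in> stiefel k d" and f: "f \<in> M \<rightarrow>\<^sub>M borel_Rn k"
  shows "(\<lambda>\<omega>. mat_transpose_vec k V (f \<omega>)) \<in> M \<rightarrow>\<^sub>M borel_Rn d"
proof (rule measurable_borel_RnI)
  fix i
  show "(\<lambda>\<omega>. mat_transpose_vec k V (f \<omega>) i) \<in> borel_measurable M"
    unfolding mat_transpose_vec_def
    by (intro borel_measurable_sum borel_measurable_times measurable_Rn_coord[OF f] borel_measurable_const)
qed (rule mat_transpose_vec_in_Rn[OF V])

lemma norm_mat_transpose_vec_diff:
  assumes V: "V \<in> stiefel k d"
  shows "norm_Rn d (mat_transpose_vec k V a - mat_transpose_vec k V b) = norm_Rn k (a - b)"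
proof -
  have "mat_transpose_vec k V a - mat_transpose_vec k V b = (\<lambda>j. \<Sum>i<k. (a - b) i * V i j)"
    by (auto simp: mat_transpose_vec_def fun_eq_iff left_diff_distrib sum_subtractf)
  moreover have "(norm_Rn d (\<lambda>j. \<Sum>i<k. (a - b) i * V i j))\<^sup>2 = (norm_Rn k (a - b))\<^sup>2"
    unfolding norm_Rn_sq[of k] using V by (intro norm_Rn_orthonormal_sum) (auto simp: stiefel_def)
  ultimately show ?thesis by (metis norm_Rn_nonneg power2_eq_iff_nonneg)
qed

text \<open>V (X + Z) = V X because V annihilates Z, so the projected measure is the law of V X, and
  X is recovered from it by the transpose. The law of X + Z depends only on the laws of V X and Z,
  as these are independent; f on \<gamma> replaces V X and an independent factor M supplies Z. The
  pair Y with X = g Y serves both measures of the model, since independence is given for the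
  pair.\<close>

lemma spiked_marginal:
  assumes M: "prob_space M" and X: "X \<in> M \<rightarrow>\<^sub>M borel_Rn d" and Z: "Z \<in> M \<rightarrow>\<^sub>M borel_Rn d"
    and ind: "prob_space.indep_set M (sets (vimage_algebra (space M) Y N)) (sets (vimage_algebra (space M) Z (borel_Rn d)))"
    and Y: "Y \<in> M \<rightarrow>\<^sub>M N" and Xg: "\<And>\<omega>. X \<omega> = g (Y \<omega>)" and g: "g \<in> N \<rightarrow>\<^sub>M borel_Rn d"
    and V: "V \<in> stiefel k d"
    and XV: "\<And>\<omega>. \<omega> \<in> space M \<Longrightarrow> mat_transpose_vec k V (mat_vec k d V (X \<omega>)) = X \<omega>"
    and ZV: "\<And>\<omega>. \<omega> \<in> space M \<Longrightarrow> mat_vec k d V (Z \<omega>) = 0"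
    and \<mu>: "\<mu> = distr M (borel_Rn d) (\<lambda>\<omega>. X \<omega> + Z \<omega>)"
    and \<gamma>: "prob_space \<gamma>" "f \<in> \<gamma> \<rightarrow>\<^sub>M borel_Rn k" "distr \<gamma> (borel_Rn k) f = proj_measure k d V \<mu>"
  shows "distr (\<gamma> \<Otimes>\<^sub>M M) (borel_Rn d) (\<lambda>z. mat_transpose_vec k V (f (fst z)) + Z (snd z)) = \<mu>"
proof -
  interpret M: prob_space M by fact
  interpret \<gamma>: prob_space \<gamma> by fact
  interpret G: pair_prob_space \<gamma> M ..
  let ?VX = "\<lambda>\<omega>. mat_vec k d V (X \<omega>)"
  let ?h = "\<lambda>z. mat_transpose_vec k V (fst z) + snd z"
  have VX: "?VX \<in> M \<rightarrow>\<^sub>M borel_Rn k" by (rule measurable_compose[OF X measurable_mat_vec])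
  have hm: "?h \<in> borel_Rn k \<Otimes>\<^sub>M borel_Rn d \<rightarrow>\<^sub>M borel_Rn d"
    by (intro measurable_Rn_add measurable_mat_transpose_vec[OF V]) auto
  have pm: "proj_measure k d V \<mu> = distr M (borel_Rn k) ?VX"
  proof -
    have "proj_measure k d V \<mu> = distr M (borel_Rn k) (mat_vec k d V \<circ> (\<lambda>\<omega>. X \<omega> + Z \<omega>))"
      unfolding proj_measure_def \<mu> using X Z by (intro distr_distr measurable_mat_vec measurable_Rn_add)
    also have "\<dots> = distr M (borel_Rn k) ?VX"
      by (rule distr_cong) (auto simp: mat_vec_add ZV)
    finally show ?thesis .
  qed
  have iv: "M.indep_var (borel_Rn k) ?VX (borel_Rn d) Z"
  proof -
    have "M.indep_set (sigma_sets (space M) {?VX -` A \<inter> space M |A. A \<in> sets (borel_Rn k)})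
        (sigma_sets (space M) {Z -` A \<inter> space M |A. A \<in> sets (borel_Rn d)})"
    proof -
      \<comment> \<open>V X is a function of Y, so its events lie in the sigma-algebra for which
        independence from Z is known.\<close>
      have sub: "{?VX -` A \<inter> space M |A. A \<in> sets (borel_Rn k)} \<subseteq> sets (vimage_algebra (space M) Y N)"
      proof safe
        fix A assume A: "A \<in> sets (borel_Rn k)"
        have "(\<lambda>y. mat_vec k d V (g y)) \<in> N \<rightarrow>\<^sub>M borel_Rn k" by (rule measurable_compose[OF g measurable_mat_vec])
        then have "(\<lambda>y. mat_vec k d V (g y)) -` A \<inter> space N \<in> sets N" using A by (rule measurable_sets)
        moreover have "?VX -` A \<inter> space M = Y -` ((\<lambda>y. mat_vec k d V (g y)) -` A \<inter> space N) \<inter> space M"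
          using measurable_space[OF Y] by (auto simp: Xg)
        ultimately show "?VX -` A \<inter> space M \<in> sets (vimage_algebra (space M) Y N)"
          using in_vimage_algebra by metis
      qed
      have 1: "sigma_sets (space M) {?VX -` A \<inter> space M |A. A \<in> sets (borel_Rn k)} \<subseteq> sets (vimage_algebra (space M) Y N)"
        using sets.sigma_sets_subset[OF sub] by simp
      have sub2: "{Z -` A \<inter> space M |A. A \<in> sets (borel_Rn d)} \<subseteq> sets (vimage_algebra (space M) Z (borel_Rn d))"
        by (auto intro: in_vimage_algebra)
      have 2: "sigma_sets (space M) {Z -` A \<inter> space M |A. A \<in> sets (borel_Rn d)} \<subseteq> sets (vimage_algebra (space M) Z (borel_Rn d))"
        using sets.sigma_sets_subset[OF sub2] by simp
      show ?thesis
        using 1 2 M.indep_setD_ev1[OF ind] M.indep_setD_ev2[OF ind] M.indep_setD[OF ind]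
        by (intro M.indep_setI) blast+
    qed
    then show ?thesis unfolding M.indep_var_eq using VX Z by simp
  qed
  then have prod: "distr M (borel_Rn k) ?VX \<Otimes>\<^sub>M distr M (borel_Rn d) Z = distr M (borel_Rn k \<Otimes>\<^sub>M borel_Rn d) (\<lambda>\<omega>. (?VX \<omega>, Z \<omega>))"
    unfolding M.indep_var_distribution_eq by simp
  have "\<mu> = distr M (borel_Rn d) (\<lambda>\<omega>. ?h (?VX \<omega>, Z \<omega>))"
    unfolding \<mu> by (rule distr_cong) (auto simp: XV)
  also have "\<dots> = distr (distr M (borel_Rn k \<Otimes>\<^sub>M borel_Rn d) (\<lambda>\<omega>. (?VX \<omega>, Z \<omega>))) (borel_Rn d) ?h"
    using VX Z hm by (subst distr_distr) (auto simp: comp_def)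
  also have "\<dots> = distr (distr \<gamma> (borel_Rn k) f \<Otimes>\<^sub>M distr M (borel_Rn d) Z) (borel_Rn d) ?h"
    unfolding prod[symmetric] \<gamma>(3) pm ..
  also have "distr \<gamma> (borel_Rn k) f \<Otimes>\<^sub>M distr M (borel_Rn d) Z = distr (\<gamma> \<Otimes>\<^sub>M M) (borel_Rn k \<Otimes>\<^sub>M borel_Rn d) (\<lambda>(x, y). (f x, Z y))"
    using \<gamma>(2) Z M.prob_space_distr[OF Z] by (intro pair_measure_distr) (auto simp: prob_space_imp_sigma_finite)
  also have "distr \<dots> (borel_Rn d) ?h = distr (\<gamma> \<Otimes>\<^sub>M M) (borel_Rn d) (\<lambda>z. mat_transpose_vec k V (f (fst z)) + Z (snd z))"
  proof -
    have "(\<lambda>(x, y). (f x, Z y)) \<in> \<gamma> \<Otimes>\<^sub>M M \<rightarrow>\<^sub>M borel_Rn k \<Otimes>\<^sub>M borel_Rn d" using \<gamma>(2) Z by measurable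
    then show ?thesis using hm by (subst distr_distr) (auto simp: comp_def split_beta')
  qed
  finally show ?thesis by simp
qed

text \<open>A nearly optimal coupling of the projections is lifted by the transpose of V, which is
  isometric, so adding noise of the right law preserves its cost as long as the noise is common to
  both sides.\<close>

lemma spiked_wasserstein_le:
  assumes sp: "spiked_transport_model d U \<mu>1 \<mu>2" and V: "V \<in> stiefel k d" "\<And>i. i < k \<Longrightarrow> V i \<in> U"
    and VU: "\<And>x. x \<in> U \<Longrightarrow> x = (\<lambda>j. \<Sum>i<k. inner_Rn d (V i) x * V i j)"
    and fin: "wcost k p (proj_measure k d V \<mu>1) (proj_measure k d V \<mu>2) < \<infinity>" and p: "1 \<le> p"
    and prob: "prob_Rn k (proj_measure k d V \<mu>1)" "prob_Rn k (proj_measure k d V \<mu>2)"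
  shows "wasserstein d p \<mu>1 \<mu>2 \<le> wasserstein k p (proj_measure k d V \<mu>1) (proj_measure k d V \<mu>2)"
proof (rule dense_le)
  fix w assume "w < wasserstein d p \<mu>1 \<mu>2"
  show "w \<le> wasserstein k p (proj_measure k d V \<mu>1) (proj_measure k d V \<mu>2)"
  proof (rule ccontr)
    assume "\<not> ?thesis"
    then have lt: "wasserstein k p (proj_measure k d V \<mu>1) (proj_measure k d V \<mu>2) < w" by simp
    have w0: "0 \<le> w" using lt wasserstein_nonneg[of k p] by (meson less_le_trans not_less order.strict_trans1 order_less_imp_le)
    from wasserstein_lessE[OF fin lt p] obtain \<gamma> where \<gamma>: "\<gamma> \<in> couplings (proj_measure k d V \<mu>1) (proj_measure k d V \<mu>2)"
      and cost: "(\<integral>\<^sup>+ z. ennreal (norm_Rn k (fst z - snd z) powr p) \<partial>\<gamma>) < ennreal (w powr p)" .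
    note G = couplings_borel_Rn[OF \<gamma> prob_RnD(2)[OF prob(1)] prob_RnD(2)[OF prob(2)]]
    have p\<gamma>: "prob_space \<gamma>" by (rule coupling_prob_space[OF \<gamma> prob_RnD(1)[OF prob(1)]])
    obtain M :: "outcome measure" and X1 X2 Z where M: "prob_space M"
      and m: "X1 \<in> M \<rightarrow>\<^sub>M borel_Rn d" "X2 \<in> M \<rightarrow>\<^sub>M borel_Rn d" "Z \<in> M \<rightarrow>\<^sub>M borel_Rn d"
      and v: "\<forall>\<omega>\<in>space M. X1 \<omega> \<in> U \<and> X2 \<omega> \<in> U \<and> Z \<omega> \<in> orth_compl d U"
      and ind: "prob_space.indep_set M
         (sets (vimage_algebra (space M) (\<lambda>\<omega>. (X1 \<omega>, X2 \<omega>)) (borel_Rn d \<Otimes>\<^sub>M borel_Rn d)))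
         (sets (vimage_algebra (space M) Z (borel_Rn d)))"
      and \<mu>: "\<mu>1 = distr M (borel_Rn d) (\<lambda>\<omega>. X1 \<omega> + Z \<omega>)" "\<mu>2 = distr M (borel_Rn d) (\<lambda>\<omega>. X2 \<omega> + Z \<omega>)"
      using sp unfolding spiked_transport_model_def by blast
    interpret M: prob_space M by fact
    interpret \<gamma>: prob_space \<gamma> by fact
    have XV: "mat_transpose_vec k V (mat_vec k d V x) = x" if "x \<in> U" for x
      using VU[OF that] by (simp add: mat_transpose_vec_def mat_vec_nth)
    have ZV: "mat_vec k d V z = 0" if "z \<in> orth_compl d U" for z
    proof
      fix i
      show "mat_vec k d V z i = 0 i"
        using that V mat_vec_nth[of i k d V z] by (cases "i < k") (auto simp: orth_compl_def mat_vec_def)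
    qed
    let ?A = "\<gamma> \<Otimes>\<^sub>M M"
    \<comment> \<open>Both choices of f use the same \<open>Z (snd z)\<close>, which cancels in the
      difference.\<close>
    let ?f = "\<lambda>f z. mat_transpose_vec k V (f (fst z)) + Z (snd z)"
    have fm: "?f f \<in> ?A \<rightarrow>\<^sub>M borel_Rn d" if "f \<in> \<gamma> \<rightarrow>\<^sub>M borel_Rn k" for f
      using that m(3) by (intro measurable_Rn_add measurable_mat_transpose_vec[OF V(1)])
        (auto intro: measurable_compose[OF measurable_fst] measurable_compose[OF measurable_snd])
    have YM: "(\<lambda>\<omega>. (X1 \<omega>, X2 \<omega>)) \<in> M \<rightarrow>\<^sub>M borel_Rn d \<Otimes>\<^sub>M borel_Rn d" using m by simp
    have d1: "distr ?A (borel_Rn d) (?f fst) = \<mu>1"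
      by (rule spiked_marginal[OF M m(1,3) ind YM, where g=fst]) (use V v XV ZV \<mu> p\<gamma> G in auto)
    have d2: "distr ?A (borel_Rn d) (?f snd) = \<mu>2"
      by (rule spiked_marginal[OF M m(2,3) ind YM, where g=snd]) (use V v XV ZV \<mu> p\<gamma> G in auto)
    have "wasserstein d p \<mu>1 \<mu>2 \<le> w"
    proof (rule wasserstein_leI[OF fm[OF G(2)] fm[OF G(3)] d1 d2])
      have nm: "(\<lambda>z. norm_Rn k (fst z - snd z)) \<in> borel_measurable \<gamma>"
        by (rule measurable_norm_Rn[OF measurable_Rn_diff[OF G(2,3)]])
      have "(\<integral>\<^sup>+ z. ennreal (norm_Rn d (?f fst z - ?f snd z) powr p) \<partial>?A)
        = (\<integral>\<^sup>+ z. ennreal (norm_Rn k (fst (fst z) - snd (fst z)) powr p) \<partial>?A)"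
        by (simp add: norm_mat_transpose_vec_diff[OF V(1)])
      also have "\<dots> = (\<integral>\<^sup>+ z. ennreal (norm_Rn k (fst z - snd z) powr p) \<partial>distr ?A \<gamma> fst)"
        using nm by (intro nn_integral_distr[symmetric]) auto
      also have "distr ?A \<gamma> fst = \<gamma>" by (rule M.distr_pair_fst)
      also have "(\<integral>\<^sup>+ z. ennreal (norm_Rn k (fst z - snd z) powr p) \<partial>\<gamma>) \<le> ennreal (w powr p)"
        using cost by (rule less_imp_le)
      finally show "(\<integral>\<^sup>+ z. ennreal (norm_Rn d (?f fst z - ?f snd z) powr p) \<partial>?A) \<le> ennreal (w powr p)" .
    qed (use w0 p in auto)
    with \<open>w < wasserstein d p \<mu>1 \<mu>2\<close> show False by simp
  qed
qed

section \<open>The supremum over projections\<close>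

lemma proj_measure_ok:
  assumes U: "U \<in> stiefel k d" and \<nu>: "prob_Rn d \<nu>" "finite_moment d p \<nu>" and p: "1 \<le> p"
  shows "prob_Rn k (proj_measure k d U \<nu>)" "finite_moment k p (proj_measure k d U \<nu>)"
proof -
  interpret \<nu>: prob_space \<nu> using \<nu>(1) by (rule prob_RnD)
  have f: "mat_vec k d U \<in> \<nu> \<rightarrow>\<^sub>M borel_Rn k"
    using measurable_mat_vec by (simp add: measurable_cong_sets[OF prob_RnD(2)[OF \<nu>(1)] refl])
  show "prob_Rn k (proj_measure k d U \<nu>)" unfolding proj_measure_def by (rule prob_Rn_distr[OF \<nu>.prob_space_axioms f])
  have "(\<integral>\<^sup>+ x. ennreal (norm_Rn k (mat_vec k d U x) powr p) \<partial>\<nu>) \<le> (\<integral>\<^sup>+ x. ennreal (norm_Rn d x powr p) \<partial>\<nu>)"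
    using p by (intro nn_integral_mono ennreal_leI powr_mono2 norm_mat_vec_le[OF U]) auto
  also have "\<dots> < \<infinity>" using \<nu>(2) by (simp add: finite_moment_def)
  finally show "finite_moment k p (proj_measure k d U \<nu>)"
    unfolding proj_measure_def by (simp add: finite_moment_distr[OF f])
qed

lemma proj_wasserstein_bdd:
  assumes "prob_Rn d \<mu>" "prob_Rn d \<nu>" "finite_moment d p \<mu>" "finite_moment d p \<nu>" "1 \<le> p" and U: "U \<in> stiefel k d"
  shows "wasserstein k p (proj_measure k d U \<mu>) (proj_measure k d U \<nu>) \<le> wasserstein d p \<mu> \<nu>"
proof -
  have "wasserstein k p (proj_measure k d U \<mu>) (proj_measure k d U \<nu>) \<le> 1 * wasserstein d p \<mu> \<nu>"
    unfolding proj_measure_def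
  proof (rule wasserstein_distr_lipschitz)
    show "wcost d p \<mu> \<nu> < \<infinity>" using assms by (intro wcost_finite)
  qed (use assms measurable_mat_vec mat_vec_contraction[OF U] in auto)
  then show ?thesis by simp
qed

lemma proj_wasserstein_bdd_above:
  assumes "prob_Rn d \<mu>" "prob_Rn d \<nu>" "finite_moment d p \<mu>" "finite_moment d p \<nu>" "1 \<le> p"
  shows "bdd_above ((\<lambda>U. wasserstein k p (proj_measure k d U \<mu>) (proj_measure k d U \<nu>)) ` stiefel k d)"
  using proj_wasserstein_bdd[OF assms] by (intro bdd_aboveI2) auto

text \<open>Contraction bounds every projected distance from above, and the basis of the spike
  attains the bound. That basis also shows the Stiefel set nonempty, which the real supremum
  requires.\<close>

lemma spiked_proj_wasserstein:
  assumes sp: "spiked_transport_model d U \<mu>1 \<mu>2" and k: "dim U = k" and p: "1 \<le> p"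
    and ok: "prob_Rn d \<mu>1" "prob_Rn d \<mu>2" "finite_moment d p \<mu>1" "finite_moment d p \<mu>2"
  shows "stiefel k d \<noteq> {}" "proj_wasserstein d p k \<mu>1 \<mu>2 = wasserstein d p \<mu>1 \<mu>2"
proof -
  have "U \<subseteq> Rn d" "subspace U" using sp by (auto simp: spiked_transport_model_def)
  from orthonormal_basis_Rn[OF this k] obtain V where V: "V \<in> stiefel k d" "\<And>i. i < k \<Longrightarrow> V i \<in> U"
    "\<And>x. x \<in> U \<Longrightarrow> x = (\<lambda>j. \<Sum>i<k. inner_Rn d (V i) x * V i j)" by blast
  show ne: "stiefel k d \<noteq> {}" using V by auto
  have "proj_wasserstein d p k \<mu>1 \<mu>2 \<le> wasserstein d p \<mu>1 \<mu>2"
    unfolding proj_wasserstein_def using ne proj_wasserstein_bdd[OF ok p] by (intro cSUP_least) auto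
  moreover have "wasserstein d p \<mu>1 \<mu>2 \<le> wasserstein k p (proj_measure k d V \<mu>1) (proj_measure k d V \<mu>2)"
    using proj_measure_ok[OF V(1) ok(1,3) p] proj_measure_ok[OF V(1) ok(2,4) p] p
    by (intro spiked_wasserstein_le[OF sp V] wcost_finite) auto
  moreover have "\<dots> \<le> proj_wasserstein d p k \<mu>1 \<mu>2"
    unfolding proj_wasserstein_def by (intro cSUP_upper V(1) proj_wasserstein_bdd_above ok p)
  ultimately show "proj_wasserstein d p k \<mu>1 \<mu>2 = wasserstein d p \<mu>1 \<mu>2" by linarith
qed

lemma abs_SUP_diff_le:
  fixes f g :: "'a \<Rightarrow> real"
  assumes "S \<noteq> {}" "bdd_above (f ` S)" "bdd_above (g ` S)" "\<And>x. x \<in> S \<Longrightarrow> \<bar>f x - g x\<bar> \<le> c"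
  shows "\<bar>(SUP x\<in>S. f x) - (SUP x\<in>S. g x)\<bar> \<le> c"
proof -
  have "(SUP x\<in>S. f x) \<le> (SUP x\<in>S. g x) + c"
  proof (rule cSUP_least[OF assms(1)])
    fix x assume x: "x \<in> S"
    have "f x \<le> g x + c" using assms(4)[OF x] by linarith
    also have "g x \<le> (SUP x\<in>S. g x)" by (rule cSUP_upper[OF x assms(3)])
    finally show "f x \<le> (SUP x\<in>S. g x) + c" by simp
  qed
  moreover have "(SUP x\<in>S. g x) \<le> (SUP x\<in>S. f x) + c"
  proof (rule cSUP_least[OF assms(1)])
    fix x assume x: "x \<in> S"
    have "g x \<le> f x + c" using assms(4)[OF x] by linarith
    also have "f x \<le> (SUP x\<in>S. f x)" by (rule cSUP_upper[OF x assms(2)])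
    finally show "g x \<le> (SUP x\<in>S. f x) + c" by simp
  qed
  ultimately show ?thesis by linarith
qed

text \<open>For each fixed U the two distances differ by at most c through triangle inequalities;
  each of them contains one of the two empirical measures. A bound uniform in U passes to the
  suprema.\<close>

lemma proj_wasserstein_diff_le:
  assumes ne: "stiefel k d \<noteq> {}" and p: "1 \<le> p"
    and ok: "prob_Rn d \<alpha>" "prob_Rn d \<beta>" "finite_moment d p \<alpha>" "finite_moment d p \<beta>"
    and x: "\<forall>j<n. x j \<in> Rn d" and y: "\<forall>j<n. y j \<in> Rn d" and n: "0 < n"
    and c: "\<And>U. U \<in> stiefel k d \<Longrightarrow> wasserstein k p (proj_measure k d U \<alpha>) (proj_measure k d U (empirical d n x))
      + wasserstein k p (proj_measure k d U \<beta>) (proj_measure k d U (empirical d n y)) \<le> c"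
  shows "\<bar>proj_wasserstein d p k (empirical d n x) (empirical d n y) - proj_wasserstein d p k \<alpha> \<beta>\<bar> \<le> c"
proof -
  have e: "prob_Rn d (empirical d n x)" "prob_Rn d (empirical d n y)"
    "finite_moment d p (empirical d n x)" "finite_moment d p (empirical d n y)"
    using x y n by (auto intro!: prob_Rn_empirical finite_moment_empirical)
  show ?thesis
    unfolding proj_wasserstein_def
  proof (rule abs_SUP_diff_le[OF ne])
    fix U assume U: "U \<in> stiefel k d"
    let ?W = "\<lambda>\<mu> \<nu>. wasserstein k p (proj_measure k d U \<mu>) (proj_measure k d U \<nu>)"
    let ?x = "empirical d n x" and ?y = "empirical d n y"
    have pe: "proj_measure k d U (empirical d n z) = empirical k n (\<lambda>j. mat_vec k d U (z j))"
      if "\<forall>j<n. z j \<in> Rn d" for z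
      unfolding proj_measure_def by (rule empirical_distr[OF that measurable_mat_vec])
    have tri: "?W \<mu>1 \<mu>3 \<le> ?W \<mu>1 \<mu>2 + ?W \<mu>2 \<mu>3"
      if "prob_Rn d \<mu>1" "prob_Rn d \<mu>2" "prob_Rn d \<mu>3" "finite_moment d p \<mu>1" "finite_moment d p \<mu>2" "finite_moment d p \<mu>3"
        "\<mu>1 = empirical d n z \<or> \<mu>2 = empirical d n z \<or> \<mu>3 = empirical d n z" "\<forall>j<n. z j \<in> Rn d" for \<mu>1 \<mu>2 \<mu>3 z
      using that p n pe[OF that(8)]
      by (intro wasserstein_triangle[where n=n and x="\<lambda>j. mat_vec k d U (z j)"] proj_measure_ok[OF U] mat_vec_in_Rn) auto
    have sym: "?W \<mu> \<nu> = ?W \<nu> \<mu>" for \<mu> \<nu>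
      by (rule wasserstein_sym) (auto simp: proj_measure_def)
    have "?W ?x ?y \<le> ?W ?x \<alpha> + ?W \<alpha> ?y" using ok e x by (intro tri[where z=x]) auto
    moreover have "?W \<alpha> ?y \<le> ?W \<alpha> \<beta> + ?W \<beta> ?y" using ok e y by (intro tri[where z=y]) auto
    moreover have "?W \<alpha> \<beta> \<le> ?W \<alpha> ?x + ?W ?x \<beta>" using ok e x by (intro tri[where z=x]) auto
    moreover have "?W ?x \<beta> \<le> ?W ?x ?y + ?W ?y \<beta>" using ok e y by (intro tri[where z=y]) auto
    ultimately show "\<bar>?W ?x ?y - ?W \<alpha> \<beta>\<bar> \<le> c"
      using c[OF U] sym[of ?x \<alpha>] sym[of ?y \<beta>] by linarith
  qed (use ok e p in \<open>auto intro: proj_wasserstein_bdd_above\<close>)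
qed

text \<open>The two samples are concatenated into one of 2 n vectors, so that a Lipschitz bound in a
  single sample applies. Each half is bounded by the full sum, whence the factor 2 in the Lipschitz
  constant.\<close>

lemma measurable_proj_wasserstein_empirical:
  assumes ne: "stiefel k d \<noteq> {}" and p: "1 \<le> p" and n: "0 < n"
    and X: "\<And>j. j < n \<Longrightarrow> X1 j \<in> M \<rightarrow>\<^sub>M borel_Rn d" "\<And>j. j < n \<Longrightarrow> X2 j \<in> M \<rightarrow>\<^sub>M borel_Rn d"
  shows "(\<lambda>\<omega>. proj_wasserstein d p k (empirical d n (\<lambda>j. X1 j \<omega>)) (empirical d n (\<lambda>j. X2 j \<omega>))) \<in> borel_measurable M"
proof -
  define G where "G z = proj_wasserstein d p k (empirical d n z) (empirical d n (\<lambda>j. z (n + j)))" for z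
  define Y where "Y j = (if j < n then X1 j else X2 (j - n))" for j
  let ?K = "2 * (1 / real n) powr (1 / p)"
  have "(\<lambda>\<omega>. G (\<lambda>j. Y j \<omega>)) \<in> borel_measurable M"
  proof (rule lipschitz_sample_measurable[where G=G and X=Y and N="2 * n" and K="?K" and d=d and p=p])
    show "Y j \<in> M \<rightarrow>\<^sub>M borel_Rn d" if "j < 2 * n" for j using that X by (auto simp: Y_def)
    fix x y :: "nat \<Rightarrow> rvec" assume x: "\<And>j. j < 2 * n \<Longrightarrow> x j \<in> Rn d" and y: "\<And>j. j < 2 * n \<Longrightarrow> y j \<in> Rn d"
    let ?S = "\<Sum>j<2 * n. norm_Rn d (x j - y j) powr p"
    have half: "wasserstein k p (proj_measure k d U (empirical d n (\<lambda>j. y (i + j)))) (proj_measure k d U (empirical d n (\<lambda>j. x (i + j))))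
        \<le> (1 / real n) powr (1 / p) * ?S powr (1 / p)" if U: "U \<in> stiefel k d" and i: "i \<le> n" for U i
    proof -
      have xi: "x (i + j) \<in> Rn d" "y (i + j) \<in> Rn d" if "j < n" for j using x y i that by auto
      have "wasserstein k p (proj_measure k d U (empirical d n (\<lambda>j. y (i + j)))) (proj_measure k d U (empirical d n (\<lambda>j. x (i + j))))
        \<le> wasserstein d p (empirical d n (\<lambda>j. y (i + j))) (empirical d n (\<lambda>j. x (i + j)))"
        using xi n p by (intro proj_wasserstein_bdd prob_Rn_empirical finite_moment_empirical U) auto
      also have "\<dots> \<le> ((\<Sum>j<n. norm_Rn d (y (i + j) - x (i + j)) powr p) / real n) powr (1 / p)"
        using xi n p by (intro wasserstein_empirical_le) auto
      also have "\<dots> \<le> (?S / real n) powr (1 / p)"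
      proof (intro powr_mono2 divide_right_mono)
        have "(\<Sum>j<n. norm_Rn d (y (i + j) - x (i + j)) powr p) = (\<Sum>j\<in>{i..<n + i}. norm_Rn d (x j - y j) powr p)"
          using sum.shift_bounds_nat_ivl[of "\<lambda>j. norm_Rn d (x j - y j) powr p" 0 i n]
          by (simp add: atLeast0LessThan add.commute norm_Rn_minus_commute)
        also have "\<dots> \<le> ?S" using i by (intro sum_mono2) auto
        finally show "(\<Sum>j<n. norm_Rn d (y (i + j) - x (i + j)) powr p) \<le> ?S" .
      qed (use p in \<open>auto intro!: divide_nonneg_nonneg sum_nonneg\<close>)
      also have "\<dots> = (1 / real n) powr (1 / p) * ?S powr (1 / p)" by (simp add: powr_divide sum_nonneg)
      finally show ?thesis .
    qed
    have "\<bar>proj_wasserstein d p k (empirical d n x) (empirical d n (\<lambda>j. x (n + j)))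
       - proj_wasserstein d p k (empirical d n y) (empirical d n (\<lambda>j. y (n + j)))\<bar> \<le> ?K * ?S powr (1 / p)"
    proof (rule proj_wasserstein_diff_le[OF ne p])
      show "prob_Rn d (empirical d n y)" "prob_Rn d (empirical d n (\<lambda>j. y (n + j)))"
        "finite_moment d p (empirical d n y)" "finite_moment d p (empirical d n (\<lambda>j. y (n + j)))"
        using y n by (auto intro!: prob_Rn_empirical finite_moment_empirical)
      fix U assume U: "U \<in> stiefel k d"
      show "wasserstein k p (proj_measure k d U (empirical d n y)) (proj_measure k d U (empirical d n x))
        + wasserstein k p (proj_measure k d U (empirical d n (\<lambda>j. y (n + j)))) (proj_measure k d U (empirical d n (\<lambda>j. x (n + j))))
        \<le> ?K * ?S powr (1 / p)"
        using half[OF U, of 0] half[OF U, of n] by simp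
    qed (use x y n in auto)
    then show "\<bar>G x - G y\<bar> \<le> ?K * ?S powr (1 / p)" by (simp add: G_def)
  qed (rule p)
  moreover have "G (\<lambda>j. Y j \<omega>) = proj_wasserstein d p k (empirical d n (\<lambda>j. X1 j \<omega>)) (empirical d n (\<lambda>j. X2 j \<omega>))" for \<omega>
  proof -
    have "empirical d n (\<lambda>j. Y j \<omega>) = empirical d n (\<lambda>j. X1 j \<omega>)" by (rule empirical_cong) (simp add: Y_def)
    then show ?thesis by (simp add: G_def Y_def)
  qed
  ultimately show ?thesis by simp
qed

section \<open>Transfer to the given probability space and conclusion\<close>

lemma iid_sample_transfer:
  assumes M: "prob_space M" and iid: "iid_sample d M n X \<mu>" and n: "0 < n" and prob: "prob_Rn d \<mu>"
  shows "\<And>j. j < n \<Longrightarrow> X j \<in> M \<rightarrow>\<^sub>M borel_Rn d"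
    "(\<lambda>\<omega>. \<lambda>j\<in>{..<n}. X j \<omega>) \<in> M \<rightarrow>\<^sub>M PiM {..<n} (\<lambda>_. \<mu>)"
    "distr M (PiM {..<n} (\<lambda>_. \<mu>)) (\<lambda>\<omega>. \<lambda>j\<in>{..<n}. X j \<omega>) = PiM {..<n} (\<lambda>_. \<mu>)"
proof -
  interpret prob_space M by fact
  have iv: "indep_vars (\<lambda>_. borel_Rn d) X {..<n}" and dj: "\<And>j. j < n \<Longrightarrow> distr M (borel_Rn d) (X j) = \<mu>"
    using iid by (auto simp: iid_sample_def)
  show rv: "\<And>j. j < n \<Longrightarrow> X j \<in> M \<rightarrow>\<^sub>M borel_Rn d" using iv by (auto simp: indep_vars_def)
  have sP: "sets (PiM {..<n} (\<lambda>_. \<mu>)) = sets (PiM {..<n} (\<lambda>_. borel_Rn d))"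
    using prob_RnD(2)[OF prob] by (intro sets_PiM_cong) auto
  have "(\<lambda>\<omega>. \<lambda>j\<in>{..<n}. X j \<omega>) \<in> M \<rightarrow>\<^sub>M PiM {..<n} (\<lambda>_. borel_Rn d)"
    using rv by (intro measurable_restrict) auto
  then show "(\<lambda>\<omega>. \<lambda>j\<in>{..<n}. X j \<omega>) \<in> M \<rightarrow>\<^sub>M PiM {..<n} (\<lambda>_. \<mu>)"
    by (simp add: measurable_cong_sets[OF refl sP])
  have "distr M (PiM {..<n} (\<lambda>_. \<mu>)) (\<lambda>\<omega>. \<lambda>j\<in>{..<n}. X j \<omega>) = distr M (PiM {..<n} (\<lambda>_. borel_Rn d)) (\<lambda>\<omega>. \<lambda>j\<in>{..<n}. X j \<omega>)"
    using sP by (intro distr_cong) auto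
  also have "\<dots> = PiM {..<n} (\<lambda>j. distr M (borel_Rn d) (X j))"
    using indep_vars_iff_distr_eq_PiM'[where I="{..<n}" and M'="\<lambda>_. borel_Rn d" and X=X] iv rv n by auto
  also have "\<dots> = PiM {..<n} (\<lambda>_. \<mu>)" using dj by (intro PiM_cong) auto
  finally show "distr M (PiM {..<n} (\<lambda>_. \<mu>)) (\<lambda>\<omega>. \<lambda>j\<in>{..<n}. X j \<omega>) = PiM {..<n} (\<lambda>_. \<mu>)" .
qed

text \<open>The majorant is built on the canonical product space and composed with the sample. Only
  expectations of two such majorants are added later, so the two measures can be treated one at a
  time on the common space M.\<close>

lemma sup_bound_iid:
  assumes "transport_sample d k n p \<sigma> \<mu>" and M: "prob_space M" and iid: "iid_sample d M n X \<mu>"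
  shows "\<exists>B. integrable M B \<and>
    (\<forall>\<omega>\<in>space M. \<forall>U\<in>stiefel k d. wasserstein k p (proj_measure k d U \<mu>) (proj_measure k d U (empirical d n (\<lambda>j. X j \<omega>))) \<le> B \<omega>) \<and>
    (\<integral>\<omega>. B \<omega> \<partial>M) \<le> \<sigma> * (emp_const k * rate (rate_const p) p k n) + (18 * real k + 1) * \<sigma> * sqrt (real d * ln (real n) / real n)"
proof -
  interpret transport_sample d k n p \<sigma> \<mu> by fact
  note T = iid_sample_transfer[OF M iid n0 prob]
  obtain B where B: "integrable P B" "\<And>x U. x \<in> space P \<Longrightarrow> U \<in> stiefel k d \<Longrightarrow> F U x \<le> B x"
    "P.expectation B \<le> R + (18 * real k + 1) * \<sigma> * sqrt (real d * ln (real n) / real n)"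
    using sup_bound by blast
  have Bm: "B \<in> borel_measurable P" using B(1) by auto
  let ?r = "\<lambda>\<omega>. \<lambda>j\<in>{..<n}. X j \<omega>"
  have "integrable M (\<lambda>\<omega>. B (?r \<omega>))"
    using B(1) integrable_distr_eq[OF T(2) Bm] unfolding T(3) by simp
  moreover have "(\<integral>\<omega>. B (?r \<omega>) \<partial>M) = P.expectation B"
    using integral_distr[OF T(2) Bm] unfolding T(3) by simp
  moreover have "wasserstein k p (proj_measure k d U \<mu>) (proj_measure k d U (empirical d n (\<lambda>j. X j \<omega>))) \<le> B (?r \<omega>)"
    if "\<omega> \<in> space M" "U \<in> stiefel k d" for \<omega> U
  proof -
    have "empirical d n (\<lambda>j. X j \<omega>) = empirical d n (?r \<omega>)" by (rule empirical_cong) simp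
    then show ?thesis using B(2)[OF measurable_space[OF T(2) that(1)] that(2)] by (simp add: F_def)
  qed
  ultimately show ?thesis using B(3) unfolding R_def by (intro exI[of _ "\<lambda>\<omega>. B (?r \<omega>)"]) auto
qed

theorem theorem1:
  shows "\<exists>(cp :: real \<Rightarrow> real) (ck :: nat \<Rightarrow> real).
    (\<forall>p. 0 < cp p) \<and> (\<forall>k. 0 < ck k) \<and>
    (\<forall>(d :: nat) (k :: nat) (n :: nat) (p :: real) (\<sigma> :: real) (U :: rvec set)
       (\<mu>1 :: rvec measure) (\<mu>2 :: rvec measure) (M :: outcome measure)
       (X1 :: nat \<Rightarrow> outcome \<Rightarrow> rvec) (X2 :: nat \<Rightarrow> outcome \<Rightarrow> rvec).
       2 \<le> n \<longrightarrow> 1 \<le> p \<longrightarrow> p \<le> 2 \<longrightarrow> 0 < \<sigma> \<longrightarrow>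
       spiked_transport_model d U \<mu>1 \<mu>2 \<longrightarrow> dim U = k \<longrightarrow>
       transport_inequality d p (\<sigma>\<^sup>2) \<mu>1 \<longrightarrow> transport_inequality d p (\<sigma>\<^sup>2) \<mu>2 \<longrightarrow>
       prob_space M \<longrightarrow> iid_sample d M n X1 \<mu>1 \<longrightarrow> iid_sample d M n X2 \<mu>2 \<longrightarrow>
       (let err = (\<lambda>\<omega>. \<bar>proj_wasserstein d p k
                          (empirical d n (\<lambda>j. X1 j \<omega>)) (empirical d n (\<lambda>j. X2 j \<omega>))
                        - wasserstein d p \<mu>1 \<mu>2\<bar>)
        in integrable M err \<and>
           prob_space.expectation M err
             \<le> ck k * \<sigma> * (rate (cp p) p k n + sqrt (real d * ln (real n) / real n))))"
proof -
  \<comment> \<open>The factor 2 counts the two samples. The constants of the rate and of the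
    concentration term are added, so that one number can multiply both.\<close>
  define ck where "ck k = (if k = 0 then 1 else 2 * emp_const k + 2 * (18 * real k + 1))" for k
  have ck: "0 < ck k" for k
    using emp_const_pos[of k] by (auto simp: ck_def intro!: add_pos_pos)
  show ?thesis
  proof (intro exI[of _ rate_const] exI[of _ ck] conjI allI impI)
    fix d k n :: nat and p \<sigma> :: real and U :: "rvec set" and \<mu>1 \<mu>2 :: "rvec measure" and M :: "outcome measure"
      and X1 X2 :: "nat \<Rightarrow> outcome \<Rightarrow> rvec"
    assume n: "2 \<le> n" and p: "1 \<le> p" "p \<le> 2" and \<sigma>: "0 < \<sigma>" and sp: "spiked_transport_model d U \<mu>1 \<mu>2"
      and k: "dim U = k" and T: "transport_inequality d p (\<sigma>\<^sup>2) \<mu>1" "transport_inequality d p (\<sigma>\<^sup>2) \<mu>2"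
      and M: "prob_space M" and iid: "iid_sample d M n X1 \<mu>1" "iid_sample d M n X2 \<mu>2"
    interpret M: prob_space M by fact
    have ok: "prob_Rn d \<mu>1" "prob_Rn d \<mu>2" "finite_moment d p \<mu>1" "finite_moment d p \<mu>2"
      using T by (auto simp: transport_inequality_def)
    note spiked = spiked_proj_wasserstein[OF sp k p(1) ok]
    have n0: "0 < n" using n by simp
    define s where "s = sqrt (real d * ln (real n) / real n)"
    have s0: "0 \<le> s" using n by (simp add: s_def)
    have r0: "0 \<le> rate (rate_const p) p k n" using n rate_const_pos[of p] by (intro rate_nonneg) auto
    define err where "err \<omega> = \<bar>proj_wasserstein d p k (empirical d n (\<lambda>j. X1 j \<omega>)) (empirical d n (\<lambda>j. X2 j \<omega>))
        - wasserstein d p \<mu>1 \<mu>2\<bar>" for \<omega>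
    note t1 = iid_sample_transfer[OF M iid(1) n0 ok(1)] and t2 = iid_sample_transfer[OF M iid(2) n0 ok(2)]
    have "integrable M err \<and> M.expectation err \<le> ck k * \<sigma> * (rate (rate_const p) p k n + s)"
    proof (cases "k = 0")
      \<comment> \<open>A trivial spike: projections live in dimension 0, where all distances
        vanish, and W_p of the two measures equals the projected distance. The error is identically
        0.\<close>
      case True
      have "proj_wasserstein d p 0 \<alpha> \<beta> = 0" for \<alpha> \<beta>
        using spiked(1) True by (simp add: proj_wasserstein_def wasserstein_dim_0)
      then have "err = (\<lambda>_. 0)" using spiked(2) True by (simp add: err_def fun_eq_iff)
      then show ?thesis using ck[of k] \<sigma> r0 s0 by simp
    next
      case False
      then have k1: "1 \<le> k" by simp
      \<comment> \<open>A row of a Stiefel matrix is a unit vector, which does not exist in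
        dimension 0.\<close>
      have d1: "1 \<le> d"
      proof (rule ccontr)
        assume "\<not> ?thesis"
        then have "d = 0" by simp
        obtain V where "V \<in> stiefel k d" using spiked(1) by blast
        then have "norm_Rn d (V 0) = 1" using k1 by (intro stiefel_norm) auto
        then show False using \<open>d = 0\<close> by (simp add: norm_Rn_def)
      qed
      have ts: "transport_sample d k n p \<sigma> \<mu>1" "transport_sample d k n p \<sigma> \<mu>2"
        by unfold_locales (use T p \<sigma> k1 d1 n in auto)
      let ?b = "\<sigma> * (emp_const k * rate (rate_const p) p k n) + (18 * real k + 1) * \<sigma> * s"
      obtain B1 where B1: "integrable M B1" "M.expectation B1 \<le> ?b"
        "\<And>\<omega> V. \<omega> \<in> space M \<Longrightarrow> V \<in> stiefel k d \<Longrightarrow>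
          wasserstein k p (proj_measure k d V \<mu>1) (proj_measure k d V (empirical d n (\<lambda>j. X1 j \<omega>))) \<le> B1 \<omega>"
        using sup_bound_iid[OF ts(1) M iid(1)] unfolding s_def by blast
      obtain B2 where B2: "integrable M B2" "M.expectation B2 \<le> ?b"
        "\<And>\<omega> V. \<omega> \<in> space M \<Longrightarrow> V \<in> stiefel k d \<Longrightarrow>
          wasserstein k p (proj_measure k d V \<mu>2) (proj_measure k d V (empirical d n (\<lambda>j. X2 j \<omega>))) \<le> B2 \<omega>"
        using sup_bound_iid[OF ts(2) M iid(2)] unfolding s_def by blast
      have le: "err \<omega> \<le> B1 \<omega> + B2 \<omega>" if \<omega>: "\<omega> \<in> space M" for \<omega>
        unfolding err_def spiked(2)[symmetric]
      proof (rule proj_wasserstein_diff_le[OF spiked(1) p(1) ok _ _ n0])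
        show "\<forall>j<n. X1 j \<omega> \<in> Rn d" "\<forall>j<n. X2 j \<omega> \<in> Rn d"
          using measurable_space[OF t1(1) \<omega>] measurable_space[OF t2(1) \<omega>] by (auto simp: space_borel_Rn)
      qed (intro add_mono B1(3)[OF \<omega>] B2(3)[OF \<omega>])
      have em: "err \<in> borel_measurable M"
        unfolding err_def
        using measurable_proj_wasserstein_empirical[OF spiked(1) p(1) n0 t1(1) t2(1)] by simp
      have Bi: "integrable M (\<lambda>\<omega>. B1 \<omega> + B2 \<omega>)" using B1(1) B2(1) by simp
      have ei: "integrable M err"
        by (rule Bochner_Integration.integrable_bound[OF Bi em])
          (use le in \<open>auto simp: err_def intro!: AE_I2 intro: order_trans[OF _ abs_ge_self]\<close>)
      have "M.expectation err \<le> M.expectation (\<lambda>\<omega>. B1 \<omega> + B2 \<omega>)"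
        by (rule integral_mono[OF ei Bi le])
      also have "\<dots> = M.expectation B1 + M.expectation B2" using B1(1) B2(1) by simp
      also have "\<dots> \<le> 2 * ?b" using B1(2) B2(2) by simp
      also have "\<dots> \<le> ck k * \<sigma> * (rate (rate_const p) p k n + s)"
      proof -
        have "0 \<le> emp_const k" using emp_const_pos[OF k1] by simp
        then have "0 \<le> emp_const k * \<sigma> * s" "0 \<le> (18 * real k + 1) * \<sigma> * rate (rate_const p) p k n"
          using \<sigma> s0 r0 by auto
        \<comment> \<open>Multiplying out produces both wanted terms and two mixed terms, which are
          nonnegative and dropped.\<close>
        moreover have "ck k * \<sigma> * (rate (rate_const p) p k n + s)
          = 2 * ?b + 2 * (emp_const k * \<sigma> * s) + 2 * ((18 * real k + 1) * \<sigma> * rate (rate_const p) p k n)"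
          using False by (simp add: ck_def algebra_simps)
        ultimately show ?thesis by linarith
      qed
      finally show ?thesis using ei by simp
    qed
    then show "let err = (\<lambda>\<omega>. \<bar>proj_wasserstein d p k
                          (empirical d n (\<lambda>j. X1 j \<omega>)) (empirical d n (\<lambda>j. X2 j \<omega>))
                        - wasserstein d p \<mu>1 \<mu>2\<bar>)
        in integrable M err \<and>
           prob_space.expectation M err
             \<le> ck k * \<sigma> * (rate (rate_const p) p k n + sqrt (real d * ln (real n) / real n))"
      unfolding Let_def err_def[abs_def, symmetric] s_def .
  qed (use rate_const_pos ck in auto)
qed

end
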